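(* Let $n\geq1$, let $G=\mathfrak{S}_n$ and let $H=\mathfrak{S}_{n-1}$ be the subgroup of permutations fixing $1$. Then $$\mathbb{C}\Gamma_{\mathfrak{S}_{n-1}}(\mathfrak{S}_n)\cong\prod_{k=1}^nM_{\binom{n-1}{k-1}}(\mathbb{C}[\mathfrak{S}_k\times\mathfrak{S}_{n-k}])$$ as algebras. Moreover, the representations $$V_{(\lambda,\mu)}:=\mathsf{Ind}_{[k]}(V_\lambda\otimes V_\mu)\quad\text{for }1\leq k\leq n,\ \lambda\vdash k,\ \mu\vdash n-k$$ form a complete set of inequivalent irreducible $\mathfrak{S}_{n-1}$-global $\mathfrak{S}_n$-partial representations, and $$\dim_{\mathbb{C}}V_{(\lambda,\mu)}=\binom{n-1}{k-1}f^\lambda f^\mu.$$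
   Context: All vector spaces carrying representations are finite-dimensional over $\mathbb{C}$. For a subgroup $H$ of a finite group $G$, a $G$-partial representation $(V,\pi)$ is a map $\pi\colon G\to\operatorname{End}(V)$ such that for all $g,h\in G$: $\pi(1_G)=\mathrm{Id}_V$; $\pi(g^{-1})\pi(gh)=\pi(g^{-1})\pi(g)\pi(h)$; $\pi(gh)\pi(h^{-1})=\pi(g)\pi(h)\pi(h^{-1})$. It is $H$-global if the restriction of $\pi$ to $H$ is a (usual) representation of $H$. Morphisms are linear maps commuting with the maps $\pi(g)$; irreducible means nonzero with no proper nonzero subspace stable under all $\pi(g)$. $\mathcal{P}_H(G/H):=\{A\subseteq G\mid H\subseteq A\text{ and }A\text{ is a union of left cosets of }H\}$. $\Gamma_H(G):=\{(A,g)\in\mathcal{P}_H(G/H)\times G\mid g^{-1}\in A\}$ is the groupoid with operation $(A,g)\cdot(B,h):=(B,gh)$ if $A=hB$, and undefined otherwise. The groupoid algebra $\mathbb{C}\Gamma_H(G)$ has basis $\Gamma_H(G)$, with undefined products set to $0$. For $A\in\mathcal{P}_H(G/H)$ with stabilizer $K=\{g\in G\mid gA=A\}$ and a representation $W$ of $K$, $\mathsf{Ind}_AW$ is the subspace $\bigoplus_{xK\subseteq A^{-1}}x\otimes W$ of $\mathsf{Ind}_K^GW=\mathbb{C}[G]\otimes_{\mathbb{C}[K]}W$ with $\pi(g)(x\otimes w)=gx\otimes w$ if $gx\in A^{-1}$ and $0$ otherwise ($x\in A^{-1}$). For $G=\mathfrak{S}_n$, $H=\mathfrak{S}_{n-1}=\{\sigma\in\mathfrak{S}_n\mid\sigma(1)=1\}$: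 the left coset $\sigma H$ is identified with $\sigma(1)\in[n]=\{1,\dots,n\}$, so $\mathcal{P}_H(G/H)$ is identified with $\{A\subseteq[n]\mid1\in A\}$. In particular $[k]=\{1,\dots,k\}$ corresponds to $A_k=\{\sigma\in\mathfrak{S}_n\mid\sigma(1)\in[k]\}$, whose stabilizer is $\{\sigma\in\mathfrak{S}_n\mid\sigma([k])=[k]\}\equiv\mathfrak{S}_k\times\mathfrak{S}_{n-k}$; $\mathsf{Ind}_{[k]}$ means $\mathsf{Ind}_{A_k}$. $\{V_\nu\}_{\nu\vdash m}$ is the standard complete set of inequivalent irreducible representations of $\mathfrak{S}_m$ indexed by partitions of $m\geq0$, and $f^\nu$ is the number of standard Young tableaux of shape $\nu$. *)

theory Defs
  imports
    "HOL-Algebra.Sym_Groups"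
    "HOL-Library.Function_Algebras"
    "HOL-Algebra.QuotRing"
    "HOL-Algebra.Left_Coset"
    "HOL-Algebra.Algebraic_Closure_Type"
begin

section \<open>Representations and partial representations\<close>

text \<open>
  A complex vector space is a linear subspace \<open>rspace R\<close> of an ambient space: a type of class
  \<^class>\<open>ab_group_add\<close> together with a scalar multiplication \<open>rscale R\<close>. The values \<open>ract R g\<close>
  matter only on \<open>rspace R\<close>.
\<close>

record ('g, 'v) rep =
  rspace :: "'v set"
  rscale :: "complex \<Rightarrow> 'v \<Rightarrow> 'v"
  ract :: "'g \<Rightarrow> 'v \<Rightarrow> 'v"

definition fin_dim_space :: "(complex \<Rightarrow> 'v \<Rightarrow> 'v::ab_group_add) \<Rightarrow> 'v set \<Rightarrow> bool" where
  "fin_dim_space s V \<longleftrightarrow> vector_space s \<and> (\<exists>B. finite B \<and> V = module.span s B)"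

definition linear_maps ::
  "(complex \<Rightarrow> 'v \<Rightarrow> 'v::ab_group_add) \<Rightarrow> 'v set \<Rightarrow> (complex \<Rightarrow> 'w \<Rightarrow> 'w::ab_group_add) \<Rightarrow> 'w set \<Rightarrow> ('v \<Rightarrow> 'w) set"
where
  "linear_maps s V t W = {f \<in> V \<rightarrow> W.
     (\<forall>x\<in>V. \<forall>y\<in>V. f (x + y) = f x + f y) \<and> (\<forall>c. \<forall>x\<in>V. f (s c x) = t c (f x))}"

definition rdim :: "('g, 'v::ab_group_add) rep \<Rightarrow> nat" where
  "rdim R = vector_space.dim (rscale R) (rspace R)"

definition acts_on :: "('g, 'b) monoid_scheme \<Rightarrow> ('g, 'v::ab_group_add) rep \<Rightarrow> bool" where
  "acts_on G R \<longleftrightarrow> fin_dim_space (rscale R) (rspace R) \<and>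
     (\<forall>g\<in>carrier G. ract R g \<in> linear_maps (rscale R) (rspace R) (rscale R) (rspace R))"

definition representation :: "('g, 'b) monoid_scheme \<Rightarrow> ('g, 'v::ab_group_add) rep \<Rightarrow> bool" where
  "representation G R \<longleftrightarrow> acts_on G R \<and>
     (\<forall>v\<in>rspace R. ract R \<one>\<^bsub>G\<^esub> v = v) \<and>
     (\<forall>g\<in>carrier G. \<forall>h\<in>carrier G. \<forall>v\<in>rspace R. ract R (g \<otimes>\<^bsub>G\<^esub> h) v = ract R g (ract R h v))"

definition partial_representation :: "('g, 'b) monoid_scheme \<Rightarrow> ('g, 'v::ab_group_add) rep \<Rightarrow> bool" where
  "partial_representation G R \<longleftrightarrow> acts_on G R \<and>
     (\<forall>v\<in>rspace R. ract R \<one>\<^bsub>G\<^esub> v = v) \<and>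
     (\<forall>g\<in>carrier G. \<forall>h\<in>carrier G. \<forall>v\<in>rspace R.
        ract R (inv\<^bsub>G\<^esub> g) (ract R (g \<otimes>\<^bsub>G\<^esub> h) v) = ract R (inv\<^bsub>G\<^esub> g) (ract R g (ract R h v))) \<and>
     (\<forall>g\<in>carrier G. \<forall>h\<in>carrier G. \<forall>v\<in>rspace R.
        ract R (g \<otimes>\<^bsub>G\<^esub> h) (ract R (inv\<^bsub>G\<^esub> h) v) = ract R g (ract R h (ract R (inv\<^bsub>G\<^esub> h) v)))"

definition global_partial_representation ::
  "('g, 'b) monoid_scheme \<Rightarrow> 'g set \<Rightarrow> ('g, 'v::ab_group_add) rep \<Rightarrow> bool"
where
  "global_partial_representation G H R \<longleftrightarrow>
     partial_representation G R \<and> representation (G\<lparr>carrier := H\<rparr>) R"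

definition rep_irreducible :: "('g, 'b) monoid_scheme \<Rightarrow> ('g, 'v::ab_group_add) rep \<Rightarrow> bool" where
  "rep_irreducible G R \<longleftrightarrow> rspace R \<noteq> {0} \<and>
     (\<forall>U. module.subspace (rscale R) U \<and> U \<subseteq> rspace R \<and> (\<forall>g\<in>carrier G. ract R g ` U \<subseteq> U) \<longrightarrow>
        U = {0} \<or> U = rspace R)"

definition rep_isomorphic ::
  "('g, 'b) monoid_scheme \<Rightarrow> ('g, 'v::ab_group_add) rep \<Rightarrow> ('g, 'w::ab_group_add) rep \<Rightarrow> bool"
where
  "rep_isomorphic G R S \<longleftrightarrow>
     (\<exists>f \<in> linear_maps (rscale R) (rspace R) (rscale S) (rspace S).
        bij_betw f (rspace R) (rspace S) \<and>
        (\<forall>g\<in>carrier G. \<forall>v\<in>rspace R. f (ract R g v) = ract S g (f v)))"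


section \<open>Algebras\<close>

abbreviation complex_ring :: "complex ring" where
  "complex_ring \<equiv> ring_of_type_algebra"

text \<open>The library locale \<open>algebra\<close> requires a commutative multiplication, hence this definition.\<close>

definition complex_algebra :: "(complex, 'a) module \<Rightarrow> bool" where
  "complex_algebra A \<longleftrightarrow> ring A \<and> Module.module complex_ring A \<and>
     (\<forall>c. \<forall>x\<in>carrier A. \<forall>y\<in>carrier A.
        (c \<odot>\<^bsub>A\<^esub> x) \<otimes>\<^bsub>A\<^esub> y = c \<odot>\<^bsub>A\<^esub> (x \<otimes>\<^bsub>A\<^esub> y) \<and>
        x \<otimes>\<^bsub>A\<^esub> (c \<odot>\<^bsub>A\<^esub> y) = c \<odot>\<^bsub>A\<^esub> (x \<otimes>\<^bsub>A\<^esub> y))"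

definition algebra_isomorphic :: "(complex, 'a) module \<Rightarrow> (complex, 'b) module \<Rightarrow> bool" where
  "algebra_isomorphic A B \<longleftrightarrow> complex_algebra A \<and> complex_algebra B \<and>
     (\<exists>h \<in> ring_iso A B. \<forall>c. \<forall>x\<in>carrier A. h (c \<odot>\<^bsub>A\<^esub> x) = c \<odot>\<^bsub>B\<^esub> h x)"

text \<open>The group algebra of a finite group; an element is its family of coefficients.\<close>

definition group_algebra :: "('g, 'b) monoid_scheme \<Rightarrow> (complex, 'g \<Rightarrow> complex) module" where
  "group_algebra G = \<lparr>
     carrier = {a. \<forall>x. x \<notin> carrier G \<longrightarrow> a x = 0},
     monoid.mult = (\<lambda>a b x. \<Sum>(y, z) \<in> {(y, z) \<in> carrier G \<times> carrier G. y \<otimes>\<^bsub>G\<^esub> z = x}. a y * b z),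
     one = (\<lambda>x. if x = \<one>\<^bsub>G\<^esub> then 1 else 0),
     ring.zero = (\<lambda>x. 0),
     add = (\<lambda>a b x. a x + b x),
     module.smult = (\<lambda>c a x. c * a x)\<rparr>"

definition matrix_algebra :: "nat \<Rightarrow> (complex, 'a) module \<Rightarrow> (complex, nat \<times> nat \<Rightarrow> 'a) module" where
  "matrix_algebra m A = \<lparr>
     carrier = {..<m} \<times> {..<m} \<rightarrow>\<^sub>E carrier A,
     monoid.mult = (\<lambda>M N. \<lambda>(i, j)\<in>{..<m} \<times> {..<m}. \<Oplus>\<^bsub>A\<^esub>l\<in>{..<m}. M (i, l) \<otimes>\<^bsub>A\<^esub> N (l, j)),
     one = (\<lambda>(i, j)\<in>{..<m} \<times> {..<m}. if i = j then \<one>\<^bsub>A\<^esub> else \<zero>\<^bsub>A\<^esub>),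
     ring.zero = (\<lambda>(i, j)\<in>{..<m} \<times> {..<m}. \<zero>\<^bsub>A\<^esub>),
     add = (\<lambda>M N. \<lambda>(i, j)\<in>{..<m} \<times> {..<m}. M (i, j) \<oplus>\<^bsub>A\<^esub> N (i, j)),
     module.smult = (\<lambda>c M. \<lambda>(i, j)\<in>{..<m} \<times> {..<m}. c \<odot>\<^bsub>A\<^esub> M (i, j))\<rparr>"

definition product_algebra :: "'i set \<Rightarrow> ('i \<Rightarrow> (complex, 'a) module) \<Rightarrow> (complex, 'i \<Rightarrow> 'a) module" where
  "product_algebra I A = \<lparr>
     carrier = (\<Pi>\<^sub>E i\<in>I. carrier (A i)),
     monoid.mult = (\<lambda>x y. \<lambda>i\<in>I. x i \<otimes>\<^bsub>A i\<^esub> y i),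
     one = (\<lambda>i\<in>I. \<one>\<^bsub>A i\<^esub>),
     ring.zero = (\<lambda>i\<in>I. \<zero>\<^bsub>A i\<^esub>),
     add = (\<lambda>x y. \<lambda>i\<in>I. x i \<oplus>\<^bsub>A i\<^esub> y i),
     module.smult = (\<lambda>c x. \<lambda>i\<in>I. c \<odot>\<^bsub>A i\<^esub> x i)\<rparr>"


section \<open>The groupoid and its algebra\<close>

definition coset_unions :: "('g, 'b) monoid_scheme \<Rightarrow> 'g set \<Rightarrow> 'g set set" where
  "coset_unions G H = {A. A \<subseteq> carrier G \<and> H \<subseteq> A \<and> (\<exists>C \<subseteq> lcosets\<^bsub>G\<^esub> H. A = \<Union>C)}"

definition Gamma :: "('g, 'b) monoid_scheme \<Rightarrow> 'g set \<Rightarrow> ('g set \<times> 'g) set" where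
  "Gamma G H = {(A, g) \<in> coset_unions G H \<times> carrier G. inv\<^bsub>G\<^esub> g \<in> A}"

fun Gamma_mult :: "('g, 'b) monoid_scheme \<Rightarrow> 'g set \<times> 'g \<Rightarrow> 'g set \<times> 'g \<Rightarrow> ('g set \<times> 'g) option" where
  "Gamma_mult G (A, g) (B, h) = (if A = h <#\<^bsub>G\<^esub> B then Some (B, g \<otimes>\<^bsub>G\<^esub> h) else None)"

text \<open>For finite \<open>G\<close>. The unit is the sum of the units \<open>(A, 1)\<close> of the groupoid.\<close>

definition groupoid_algebra ::
  "('g, 'b) monoid_scheme \<Rightarrow> 'g set \<Rightarrow> (complex, 'g set \<times> 'g \<Rightarrow> complex) module"
where
  "groupoid_algebra G H = \<lparr>
     carrier = {a. \<forall>x. x \<notin> Gamma G H \<longrightarrow> a x = 0},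
     monoid.mult = (\<lambda>a b x. \<Sum>(y, z) \<in> {(y, z) \<in> Gamma G H \<times> Gamma G H. Gamma_mult G y z = Some x}. a y * b z),
     one = (\<lambda>(A, g). if A \<in> coset_unions G H \<and> g = \<one>\<^bsub>G\<^esub> then 1 else 0),
     ring.zero = (\<lambda>x. 0),
     add = (\<lambda>a b x. a x + b x),
     module.smult = (\<lambda>c a x. c * a x)\<rparr>"


section \<open>The partial representations \<open>Ind\<^sub>A W\<close>\<close>

definition stabilizer_of :: "('g, 'b) monoid_scheme \<Rightarrow> 'g set \<Rightarrow> 'g set" where
  "stabilizer_of G A = {g \<in> carrier G. g <#\<^bsub>G\<^esub> A = A}"

text \<open>
  For a finite group \<open>G\<close>, \<open>\<complex>[G] \<otimes>\<^bsub>\<complex>[K]\<^esub> W\<close> is realized by functions from \<open>G\<close> to \<open>W\<close>, with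
  \<open>x \<otimes> w\<close> the function supported on \<open>x K\<close> that maps \<open>x k\<close> to \<open>k\<^sup>-\<^sup>1 w\<close>. The lemmas
  \<open>pure_tensor_balanced\<close> and \<open>tensor_space_universal\<close> below justify this model.
\<close>

definition pure_tensor ::
  "('g, 'b) monoid_scheme \<Rightarrow> 'g set \<Rightarrow> ('g, 'w::ab_group_add) rep \<Rightarrow> 'g \<Rightarrow> 'w \<Rightarrow> ('g \<Rightarrow> 'w)"
where
  "pure_tensor G K R x w =
     (\<lambda>y. if y \<in> carrier G \<and> inv\<^bsub>G\<^esub> y \<otimes>\<^bsub>G\<^esub> x \<in> K then ract R (inv\<^bsub>G\<^esub> y \<otimes>\<^bsub>G\<^esub> x) w else 0)"

definition fun_scale :: "(complex \<Rightarrow> 'w \<Rightarrow> 'w) \<Rightarrow> complex \<Rightarrow> ('x \<Rightarrow> 'w) \<Rightarrow> ('x \<Rightarrow> 'w)" where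
  "fun_scale s c f = (\<lambda>x. s c (f x))"

text \<open>The subspace \<open>\<Oplus>\<^bsub>xK \<subseteq> Y\<^esub> x \<otimes> W\<close>, for \<open>Y\<close> a union of left cosets of \<open>K\<close>.\<close>

definition tensor_space ::
  "('g, 'b) monoid_scheme \<Rightarrow> 'g set \<Rightarrow> ('g, 'w::ab_group_add) rep \<Rightarrow> 'g set \<Rightarrow> ('g \<Rightarrow> 'w) set"
where
  "tensor_space G K R Y =
     module.span (fun_scale (rscale R)) {pure_tensor G K R x w | x w. x \<in> Y \<and> w \<in> rspace R}"

lemma vector_space_fun_scale: "vector_space s \<Longrightarrow> vector_space (fun_scale s)"
  unfolding vector_space_def fun_scale_def by (auto simp: fun_eq_iff)

lemma pure_tensor_balanced:
  assumes G: "group G" and K: "subgroup K G" and R: "representation (G\<lparr>carrier := K\<rparr>) R"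
    and x: "x \<in> carrier G" and k: "k \<in> K" and w: "w \<in> rspace R"
  shows "pure_tensor G K R (x \<otimes>\<^bsub>G\<^esub> k) w = pure_tensor G K R x (ract R k w)"
proof
  fix y
  interpret group G by (rule G)
  interpret K: subgroup K G by (rule K)
  show "pure_tensor G K R (x \<otimes>\<^bsub>G\<^esub> k) w y = pure_tensor G K R x (ract R k w) y"
  proof (cases "y \<in> carrier G")
    case y: True
    have e: "inv\<^bsub>G\<^esub> y \<otimes>\<^bsub>G\<^esub> (x \<otimes>\<^bsub>G\<^esub> k) = (inv\<^bsub>G\<^esub> y \<otimes>\<^bsub>G\<^esub> x) \<otimes>\<^bsub>G\<^esub> k"
      using x y k by (simp add: m_assoc)
    have "(inv\<^bsub>G\<^esub> y \<otimes>\<^bsub>G\<^esub> x) \<otimes>\<^bsub>G\<^esub> k \<in> K \<longleftrightarrow> inv\<^bsub>G\<^esub> y \<otimes>\<^bsub>G\<^esub> x \<in> K"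
    proof
      assume "(inv\<^bsub>G\<^esub> y \<otimes>\<^bsub>G\<^esub> x) \<otimes>\<^bsub>G\<^esub> k \<in> K"
      then have "((inv\<^bsub>G\<^esub> y \<otimes>\<^bsub>G\<^esub> x) \<otimes>\<^bsub>G\<^esub> k) \<otimes>\<^bsub>G\<^esub> inv\<^bsub>G\<^esub> k \<in> K"
        using k by simp
      then show "inv\<^bsub>G\<^esub> y \<otimes>\<^bsub>G\<^esub> x \<in> K"
        using x y k by (simp add: m_assoc)
    qed (use k in simp)
    moreover have "ract R ((inv\<^bsub>G\<^esub> y \<otimes>\<^bsub>G\<^esub> x) \<otimes>\<^bsub>G\<^esub> k) w = ract R (inv\<^bsub>G\<^esub> y \<otimes>\<^bsub>G\<^esub> x) (ract R k w)"
      if "inv\<^bsub>G\<^esub> y \<otimes>\<^bsub>G\<^esub> x \<in> K"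
      using R that k w by (simp add: representation_def)
    ultimately show ?thesis
      by (simp add: pure_tensor_def e)
  qed (simp add: pure_tensor_def)
qed

lemma tensor_space_universal:
  fixes R :: "('g, 'w::ab_group_add) rep" and t :: "complex \<Rightarrow> 'u \<Rightarrow> 'u::ab_group_add"
  assumes G: "group G" "finite (carrier G)" and K: "subgroup K G"
    and R: "representation (G\<lparr>carrier := K\<rparr>) R" and t: "vector_space t"
    and lin: "\<And>x. x \<in> carrier G \<Longrightarrow> \<beta> x \<in> linear_maps (rscale R) (rspace R) t UNIV"
    and bal: "\<And>x k w. x \<in> carrier G \<Longrightarrow> k \<in> K \<Longrightarrow> w \<in> rspace R \<Longrightarrow>
                \<beta> (x \<otimes>\<^bsub>G\<^esub> k) w = \<beta> x (ract R k w)"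
  shows "\<exists>\<Phi> \<in> linear_maps (fun_scale (rscale R)) (tensor_space G K R (carrier G)) t UNIV.
           \<forall>x\<in>carrier G. \<forall>w\<in>rspace R. \<Phi> (pure_tensor G K R x w) = \<beta> x w"
proof -
  interpret group G by (rule G)
  interpret K: subgroup K G by (rule K)
  have vs: "vector_space (rscale R)" and act: "\<And>k. k \<in> K \<Longrightarrow> ract R k ` rspace R \<subseteq> rspace R"
    using R by (auto simp: representation_def acts_on_def fin_dim_space_def linear_maps_def)
  interpret W: vector_space "rscale R" by (rule vs)
  interpret F: vector_space "fun_scale (rscale R) :: complex \<Rightarrow> ('g \<Rightarrow> 'w) \<Rightarrow> ('g \<Rightarrow> 'w)"
    by (rule vector_space_fun_scale[OF vs])
  interpret U: vector_space t by (rule t)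
  have subW: "W.subspace (rspace R)"
    using R by (auto simp: representation_def acts_on_def fin_dim_space_def)
  have val: "f y \<in> rspace R" if "f \<in> tensor_space G K R (carrier G)" for f y
    using that unfolding tensor_space_def
  proof (induction rule: F.span_induct)
    case base
    show ?case
      using subW unfolding F.subspace_def W.subspace_def fun_scale_def by simp
  next
    case (step a)
    then obtain x w where a: "a = pure_tensor G K R x w" "w \<in> rspace R" by blast
    then show ?case
      using act[of "inv\<^bsub>G\<^esub> y \<otimes>\<^bsub>G\<^esub> x"] W.subspace_0[OF subW] by (auto simp: pure_tensor_def)
  qed
  have add: "\<beta> x (v + w) = \<beta> x v + \<beta> x w" if "x \<in> carrier G" "v \<in> rspace R" "w \<in> rspace R" for x v w
    using lin[OF that(1)] that by (simp add: linear_maps_def)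
  have scl: "\<beta> x (rscale R c v) = t c (\<beta> x v)" if "x \<in> carrier G" "v \<in> rspace R" for x v c
    using lin[OF that(1)] that by (simp add: linear_maps_def)
  have z: "\<beta> x 0 = 0" if "x \<in> carrier G" for x
    using scl[OF that W.subspace_0[OF subW], of 0] by simp
  have fK: "finite K" by (rule finite_subset[OF K.subset G(2)])
  have cK: "card K \<noteq> 0" using fK K.one_closed by (metis card_eq_0_iff empty_iff)
  define \<Phi> where "\<Phi> f = t (1 / of_nat (card K)) (\<Sum>y\<in>carrier G. \<beta> y (f y))" for f
  have "\<Phi> \<in> linear_maps (fun_scale (rscale R)) (tensor_space G K R (carrier G)) t UNIV"
  proof -
    have "\<Phi> (f + g) = \<Phi> f + \<Phi> g"
      if "f \<in> tensor_space G K R (carrier G)" "g \<in> tensor_space G K R (carrier G)" for f g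
      unfolding \<Phi>_def using val[OF that(1)] val[OF that(2)]
      by (simp add: add sum.distrib U.scale_right_distrib)
    moreover have "\<Phi> (fun_scale (rscale R) c f) = t c (\<Phi> f)"
      if "f \<in> tensor_space G K R (carrier G)" for f c
      unfolding \<Phi>_def using val[OF that]
      by (simp add: scl fun_scale_def U.scale_sum_right mult.commute)
    ultimately show ?thesis by (simp add: linear_maps_def)
  qed
  moreover have "\<Phi> (pure_tensor G K R x w) = \<beta> x w" if x: "x \<in> carrier G" and w: "w \<in> rspace R" for x w
  proof -
    have "(\<Sum>y\<in>carrier G. \<beta> y (pure_tensor G K R x w y)) =
          (\<Sum>y\<in>{y \<in> carrier G. inv\<^bsub>G\<^esub> y \<otimes>\<^bsub>G\<^esub> x \<in> K}. \<beta> x w)"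
      unfolding sum.inter_filter[OF G(2)]
    proof (rule sum.cong[OF refl])
      fix y assume y: "y \<in> carrier G"
      have "\<beta> y (ract R (inv\<^bsub>G\<^esub> y \<otimes>\<^bsub>G\<^esub> x) w) = \<beta> x w" if "inv\<^bsub>G\<^esub> y \<otimes>\<^bsub>G\<^esub> x \<in> K"
        using bal[OF y that w] x y by (simp add: m_assoc[symmetric])
      then show "\<beta> y (pure_tensor G K R x w y) = (if inv\<^bsub>G\<^esub> y \<otimes>\<^bsub>G\<^esub> x \<in> K then \<beta> x w else 0)"
        using y z by (simp add: pure_tensor_def)
    qed
    also have "\<dots> = t (of_nat (card {y \<in> carrier G. inv\<^bsub>G\<^esub> y \<otimes>\<^bsub>G\<^esub> x \<in> K})) (\<beta> x w)"
      by (simp add: U.sum_constant_scale)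
    also have "card {y \<in> carrier G. inv\<^bsub>G\<^esub> y \<otimes>\<^bsub>G\<^esub> x \<in> K} = card K"
    proof (rule bij_betw_same_card[of "\<lambda>y. inv\<^bsub>G\<^esub> y \<otimes>\<^bsub>G\<^esub> x"],
           rule bij_betw_byWitness[where f' = "\<lambda>k. x \<otimes>\<^bsub>G\<^esub> inv\<^bsub>G\<^esub> k"])
      show "\<forall>a\<in>{y \<in> carrier G. inv\<^bsub>G\<^esub> y \<otimes>\<^bsub>G\<^esub> x \<in> K}. x \<otimes>\<^bsub>G\<^esub> inv\<^bsub>G\<^esub> (inv\<^bsub>G\<^esub> a \<otimes>\<^bsub>G\<^esub> x) = a"
        using x by (simp add: inv_mult_group m_assoc[symmetric])
      show "\<forall>a'\<in>K. inv\<^bsub>G\<^esub> (x \<otimes>\<^bsub>G\<^esub> inv\<^bsub>G\<^esub> a') \<otimes>\<^bsub>G\<^esub> x = a'"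
        using x by (simp add: inv_mult_group m_assoc)
      show "(\<lambda>k. x \<otimes>\<^bsub>G\<^esub> inv\<^bsub>G\<^esub> k) ` K \<subseteq> {y \<in> carrier G. inv\<^bsub>G\<^esub> y \<otimes>\<^bsub>G\<^esub> x \<in> K}"
        using x by (auto simp: inv_mult_group m_assoc)
    qed auto
    finally show ?thesis using cK by (simp add: \<Phi>_def)
  qed
  ultimately show ?thesis by blast
qed

text \<open>Lemma \<open>Ind_act_pure_tensor\<close> gives the action on the generators \<open>x \<otimes> w\<close>.\<close>

definition Ind ::
  "('g, 'b) monoid_scheme \<Rightarrow> 'g set \<Rightarrow> ('g, 'w::ab_group_add) rep \<Rightarrow> ('g, 'g \<Rightarrow> 'w) rep"
where
  "Ind G A R = \<lparr>
     rspace = tensor_space G (stabilizer_of G A) R (set_inv\<^bsub>G\<^esub> A),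
     rscale = fun_scale (rscale R),
     ract = (\<lambda>g f y. if y \<in> set_inv\<^bsub>G\<^esub> A then f (inv\<^bsub>G\<^esub> g \<otimes>\<^bsub>G\<^esub> y) else 0)\<rparr>"

lemma Ind_act_pure_tensor:
  assumes G: "group G" and A: "A \<subseteq> carrier G" and g: "g \<in> carrier G" and x: "x \<in> set_inv\<^bsub>G\<^esub> A"
  shows "ract (Ind G A R) g (pure_tensor G (stabilizer_of G A) R x w) =
    (if g \<otimes>\<^bsub>G\<^esub> x \<in> set_inv\<^bsub>G\<^esub> A then pure_tensor G (stabilizer_of G A) R (g \<otimes>\<^bsub>G\<^esub> x) w else 0)"
proof -
  interpret group G by (rule G)
  let ?K = "stabilizer_of G A" and ?B = "set_inv\<^bsub>G\<^esub> A"
  have B: "y \<in> ?B \<longleftrightarrow> inv\<^bsub>G\<^esub> y \<in> A" if "y \<in> carrier G" for y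
    using A that by (force simp: SET_INV_def)
  have xG: "x \<in> carrier G" using x A by (auto simp: SET_INV_def)
  have BG: "?B \<subseteq> carrier G" using A by (auto simp: SET_INV_def)
  have stable: "z \<otimes>\<^bsub>G\<^esub> k \<in> ?B \<longleftrightarrow> z \<in> ?B" if z: "z \<in> carrier G" and k: "k \<in> ?K" for z k
  proof -
    have kG: "k \<in> carrier G" and kA: "k <#\<^bsub>G\<^esub> A = A" using k by (auto simp: stabilizer_of_def)
    have "inv\<^bsub>G\<^esub> k \<otimes>\<^bsub>G\<^esub> inv\<^bsub>G\<^esub> z \<in> A \<longleftrightarrow> inv\<^bsub>G\<^esub> z \<in> A"
    proof
      assume "inv\<^bsub>G\<^esub> k \<otimes>\<^bsub>G\<^esub> inv\<^bsub>G\<^esub> z \<in> A"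
      then have "k \<otimes>\<^bsub>G\<^esub> (inv\<^bsub>G\<^esub> k \<otimes>\<^bsub>G\<^esub> inv\<^bsub>G\<^esub> z) \<in> k <#\<^bsub>G\<^esub> A" by (auto simp: l_coset_def)
      then show "inv\<^bsub>G\<^esub> z \<in> A" using kA kG z by (simp add: m_assoc[symmetric])
    next
      assume "inv\<^bsub>G\<^esub> z \<in> A"
      then obtain a where a: "a \<in> A" "inv\<^bsub>G\<^esub> z = k \<otimes>\<^bsub>G\<^esub> a" using kA by (auto simp: l_coset_def)
      then have "inv\<^bsub>G\<^esub> k \<otimes>\<^bsub>G\<^esub> inv\<^bsub>G\<^esub> z = a" using kG A by (auto simp: m_assoc[symmetric])
      then show "inv\<^bsub>G\<^esub> k \<otimes>\<^bsub>G\<^esub> inv\<^bsub>G\<^esub> z \<in> A" using a by simp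
    qed
    then show ?thesis using B kG z by (simp add: inv_mult_group)
  qed
  have "(if y \<in> ?B then pure_tensor G ?K R x w (inv\<^bsub>G\<^esub> g \<otimes>\<^bsub>G\<^esub> y) else 0) =
        (if g \<otimes>\<^bsub>G\<^esub> x \<in> ?B then pure_tensor G ?K R (g \<otimes>\<^bsub>G\<^esub> x) w y else 0)" for y
  proof (cases "y \<in> carrier G")
    case y: True
    have e: "inv\<^bsub>G\<^esub> (inv\<^bsub>G\<^esub> g \<otimes>\<^bsub>G\<^esub> y) \<otimes>\<^bsub>G\<^esub> x = inv\<^bsub>G\<^esub> y \<otimes>\<^bsub>G\<^esub> (g \<otimes>\<^bsub>G\<^esub> x)"
      using xG y g by (simp add: inv_mult_group m_assoc)
    have "g \<otimes>\<^bsub>G\<^esub> x \<in> ?B \<longleftrightarrow> y \<in> ?B" if "inv\<^bsub>G\<^esub> y \<otimes>\<^bsub>G\<^esub> (g \<otimes>\<^bsub>G\<^esub> x) \<in> ?K"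
      using stable[OF y that] y g xG by (simp add: m_assoc[symmetric])
    then show ?thesis using y g by (auto simp: pure_tensor_def e)
  qed (use BG in \<open>auto simp: pure_tensor_def\<close>)
  then show ?thesis by (auto simp: Ind_def fun_eq_iff)
qed


section \<open>Partitions, standard tableaux and Specht modules\<close>

definition partitions :: "nat \<Rightarrow> nat list set" where
  "partitions m = {\<nu>. sorted_wrt (\<ge>) \<nu> \<and> 0 \<notin> set \<nu> \<and> sum_list \<nu> = m}"

definition diagram :: "nat list \<Rightarrow> (nat \<times> nat) set" where
  "diagram \<nu> = {(i, j). i < length \<nu> \<and> j < \<nu> ! i}"

definition tableaux :: "nat list \<Rightarrow> (nat \<times> nat \<Rightarrow> nat) set" where
  "tableaux \<nu> = {T \<in> extensional (diagram \<nu>). bij_betw T (diagram \<nu>) {1..sum_list \<nu>}}"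

definition standard_tableaux :: "nat list \<Rightarrow> (nat \<times> nat \<Rightarrow> nat) set" where
  "standard_tableaux \<nu> = {T \<in> tableaux \<nu>.
     (\<forall>i j j'. (i, j) \<in> diagram \<nu> \<and> (i, j') \<in> diagram \<nu> \<and> j < j' \<longrightarrow> T (i, j) < T (i, j')) \<and>
     (\<forall>i i' j. (i, j) \<in> diagram \<nu> \<and> (i', j) \<in> diagram \<nu> \<and> i < i' \<longrightarrow> T (i, j) < T (i', j))}"

definition num_SYT :: "nat list \<Rightarrow> nat" where
  "num_SYT \<nu> = card (standard_tableaux \<nu>)"

text \<open>A tabloid (a row-equivalence class of tableaux) is encoded as the list of its row sets.\<close>

definition tabloid :: "nat list \<Rightarrow> (nat \<times> nat \<Rightarrow> nat) \<Rightarrow> nat set list" where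
  "tabloid \<nu> T = map (\<lambda>i. T ` {c \<in> diagram \<nu>. fst c = i}) [0..<length \<nu>]"

definition column_stabilizer :: "nat list \<Rightarrow> (nat \<times> nat \<Rightarrow> nat) \<Rightarrow> (nat \<Rightarrow> nat) set" where
  "column_stabilizer \<nu> T = {q. q permutes {1..sum_list \<nu>} \<and>
     (\<forall>j. q ` T ` {c \<in> diagram \<nu>. snd c = j} = T ` {c \<in> diagram \<nu>. snd c = j})}"

definition polytabloid :: "nat list \<Rightarrow> (nat \<times> nat \<Rightarrow> nat) \<Rightarrow> nat set list \<Rightarrow> complex" where
  "polytabloid \<nu> T =
     (\<lambda>t. \<Sum>q\<in>column_stabilizer \<nu> T. if t = tabloid \<nu> (q \<circ> T) then of_int (sign q) else 0)"

text \<open>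
  The irreducible representation of the symmetric group indexed by \<open>\<nu>\<close>: the Specht module, inside
  the space of formal complex combinations of tabloids. The action is the linear extension of
  the action of permutations on tabloids.
\<close>

definition Specht :: "nat list \<Rightarrow> (nat \<Rightarrow> nat, nat set list \<Rightarrow> complex) rep" where
  "Specht \<nu> = \<lparr>
     rspace = module.span (fun_scale (*)) (polytabloid \<nu> ` tableaux \<nu>),
     rscale = fun_scale (*),
     ract = (\<lambda>\<sigma> f t. f (map ((`) (inv\<^bsub>sym_group (sum_list \<nu>)\<^esub> \<sigma>)) t))\<rparr>"


section \<open>The representations \<open>V\<^bsub>(\<lambda>,\<mu>)\<^esub>\<close>\<close>

text \<open>
  External tensor product of representations on spaces of functions, \<open>v \<otimes> w\<close> being the function
  \<open>(x, y) \<mapsto> v x * w y\<close>; see lemma \<open>outer_tensor_act\<close> for the action.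
\<close>

definition outer_tensor ::
  "('g, 'x \<Rightarrow> complex) rep \<Rightarrow> ('h, 'y \<Rightarrow> complex) rep \<Rightarrow> ('g \<times> 'h, 'x \<times> 'y \<Rightarrow> complex) rep"
where
  "outer_tensor R S = \<lparr>
     rspace = module.span (fun_scale (*)) {\<lambda>(x, y). v x * w y | v w. v \<in> rspace R \<and> w \<in> rspace S},
     rscale = fun_scale (*),
     ract = (\<lambda>(g, h) F (x, y). ract R g (\<lambda>x'. ract S h (\<lambda>y'. F (x', y')) y) x)\<rparr>"

lemma outer_tensor_act:
  assumes "acts_on G R" "rscale R = fun_scale (*)" "g \<in> carrier G" "v \<in> rspace R"
    and "acts_on H S" "rscale S = fun_scale (*)" "h \<in> carrier H" "w \<in> rspace S"
  shows "ract (outer_tensor R S) (g, h) (\<lambda>(x, y). v x * w y) =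
           (\<lambda>(x, y). ract R g v x * ract S h w y)"
proof -
  have R: "ract R g (fun_scale (*) c v) = fun_scale (*) c (ract R g v)" for c
    using assms by (simp add: acts_on_def linear_maps_def)
  have S: "ract S h (fun_scale (*) c w) = fun_scale (*) c (ract S h w)" for c
    using assms by (simp add: acts_on_def linear_maps_def)
  have 1: "ract S h (\<lambda>y'. v x' * w y') = (\<lambda>y. v x' * ract S h w y)" for x'
    using S[of "v x'"] by (simp add: fun_scale_def)
  have 2: "ract R g (\<lambda>x'. v x' * c) = (\<lambda>x. ract R g v x * c)" for c
    using R[of c] by (simp add: fun_scale_def mult.commute)
  show ?thesis
    by (simp add: outer_tensor_def 1 2 split_def)
qed

definition pullback :: "('g \<Rightarrow> 'h) \<Rightarrow> ('h, 'v) rep \<Rightarrow> ('g, 'v) rep" where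
  "pullback \<phi> R = \<lparr>rspace = rspace R, rscale = rscale R, ract = (\<lambda>g. ract R (\<phi> g))\<rparr>"

definition sym_point_stabilizer :: "nat \<Rightarrow> (nat \<Rightarrow> nat) set" where
  "sym_point_stabilizer n = {\<sigma> \<in> carrier (sym_group n). \<sigma> 1 = 1}"

definition sym_coset_union :: "nat \<Rightarrow> nat \<Rightarrow> (nat \<Rightarrow> nat) set" where
  "sym_coset_union n k = {\<sigma> \<in> carrier (sym_group n). \<sigma> 1 \<in> {1..k}}"

lemma stabilizer_of_sym_coset_union:
  assumes k: "k \<in> {1..n}"
  shows "stabilizer_of (sym_group n) (sym_coset_union n k) =
    {\<sigma> \<in> carrier (sym_group n). \<sigma> ` {1..k} = {1..k}}"
proof -
  have ev: "(\<lambda>\<tau>. \<tau> 1) ` sym_coset_union n k = {1..k}"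
  proof (intro equalityI subsetI)
    fix i assume "i \<in> {1..k}"
    moreover from this have "transpose 1 i permutes {1..n}"
      using k by (intro permutes_swap_id) auto
    ultimately show "i \<in> (\<lambda>\<tau>. \<tau> 1) ` sym_coset_union n k"
      by (intro image_eqI[of _ _ "transpose 1 i"]) (auto simp: sym_coset_union_def sym_group_def)
  qed (auto simp: sym_coset_union_def)
  have "\<sigma> <#\<^bsub>sym_group n\<^esub> sym_coset_union n k = sym_coset_union n k \<longleftrightarrow> \<sigma> ` {1..k} = {1..k}"
    if \<sigma>: "\<sigma> permutes {1..n}" for \<sigma>
  proof
    have c: "\<sigma> <#\<^bsub>sym_group n\<^esub> sym_coset_union n k = (\<circ>) \<sigma> ` sym_coset_union n k"
      by (auto simp: l_coset_def sym_group_def)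
    {
      assume "\<sigma> <#\<^bsub>sym_group n\<^esub> sym_coset_union n k = sym_coset_union n k"
      then have "(\<lambda>\<tau>. \<tau> 1) ` (\<circ>) \<sigma> ` sym_coset_union n k = {1..k}"
        using c ev by simp
      then have "\<sigma> ` (\<lambda>\<tau>. \<tau> 1) ` sym_coset_union n k = {1..k}"
        by (simp add: image_image)
      then show "\<sigma> ` {1..k} = {1..k}" by (simp only: ev)
    next
      assume im: "\<sigma> ` {1..k} = {1..k}"
      show "\<sigma> <#\<^bsub>sym_group n\<^esub> sym_coset_union n k = sym_coset_union n k"
        unfolding c
      proof (intro equalityI subsetI)
        fix \<tau> assume "\<tau> \<in> (\<circ>) \<sigma> ` sym_coset_union n k"
        then show "\<tau> \<in> sym_coset_union n k"
          using im \<sigma> permutes_compose[OF _ \<sigma>] by (auto simp: sym_coset_union_def sym_group_def)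
      next
        fix \<tau> assume \<tau>: "\<tau> \<in> sym_coset_union n k"
        then have "\<tau> 1 \<in> \<sigma> ` {1..k}"
          unfolding im by (simp add: sym_coset_union_def)
        then obtain i where i: "i \<in> {1..k}" "\<tau> 1 = \<sigma> i"
          by blast
        have "inv_into UNIV \<sigma> \<circ> \<tau> \<in> sym_coset_union n k"
          using \<tau> i permutes_inv[OF \<sigma>] permutes_compose permutes_inverses(2)[OF \<sigma>]
          by (auto simp: sym_coset_union_def sym_group_def)
        moreover have "\<tau> = \<sigma> \<circ> (inv_into UNIV \<sigma> \<circ> \<tau>)"
          using permutes_inverses(1)[OF \<sigma>] by (simp add: fun_eq_iff)
        ultimately show "\<tau> \<in> (\<circ>) \<sigma> ` sym_coset_union n k" by blast
      qed
    }
  qed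
  then show ?thesis by (auto simp: stabilizer_of_def sym_group_def)
qed

text \<open>
  The identification of the stabilizer of \<open>{1..k}\<close> with a product of two symmetric groups:
  restrict to \<open>{1..k}\<close> and to \<open>{k+1..n}\<close>, the latter relabelled as \<open>{1..n-k}\<close>.
\<close>

definition sym_split :: "nat \<Rightarrow> nat \<Rightarrow> (nat \<Rightarrow> nat) \<Rightarrow> (nat \<Rightarrow> nat) \<times> (nat \<Rightarrow> nat)" where
  "sym_split n k \<sigma> =
     ((\<lambda>i. if i \<in> {1..k} then \<sigma> i else i), (\<lambda>i. if i \<in> {1..n - k} then \<sigma> (k + i) - k else i))"

definition V_pair ::
  "nat \<Rightarrow> nat \<Rightarrow> nat list \<Rightarrow> nat list \<Rightarrow>
   (nat \<Rightarrow> nat, (nat \<Rightarrow> nat) \<Rightarrow> nat set list \<times> nat set list \<Rightarrow> complex) rep"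
where
  "V_pair n k \<nu> \<mu> =
     Ind (sym_group n) (sym_coset_union n k)
       (pullback (sym_split n k) (outer_tensor (Specht \<nu>) (Specht \<mu>)))"

end

theory Submission
  imports Defs
begin

text \<open>
  The groupoid algebra is computed in coordinates: an arrow between two \<open>k\<close>-subsets of \<open>[n]\<close> containing
  \<open>1\<close> is a pair of indices of such subsets together with an element of \<open>S\<^sub>k \<times> S\<^bsub>n-k\<^esub>\<close>.

  An \<open>H\<close>-global partial representation is the same as a representation of the finite monoid of pairs
  \<open>(A, g)\<close> with \<open>1, g(1) \<in> A\<close> and product \<open>(A, g)(B, h) = (A \<union> gB, gh)\<close>. Its cardinality is
  \<open>\<Sum>\<^sub>k C(n-1, k-1)\<^sup>2 k! (n-k)!\<close>, and \<open>m! = \<Sum>\<^sub>\<nu> (f\<^sup>\<nu>)\<^sup>2\<close> because a Young diagram with \<open>m\<close> cells has as covers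
  one more than it has cocovers. On the induced representation of \<open>(\<lambda>, \<mu>)\<close>, the element
  \<open>\<Sum> sgn(q) sgn(q') ([k], q q')\<close>, summed over the column stabilizers of two tableaux, has rank one; it is zero
  on the induced representations of all other pairs that do not come later in a suitable order. By James'
  argument for Specht modules this gives irreducibility and inequivalence, and then linear independence of
  the matrix coefficients, so that the squares of the dimensions add up to at most the cardinality of the
  monoid. The standard polytabloids show that the dimensions are at least \<open>C(n-1, k-1) f\<^sup>\<lambda> f\<^sup>\<mu>\<close>, whose squares
  add up to that cardinality. Hence equality holds throughout and the matrix coefficients span all functions
  on the monoid, so there is no further irreducible representation.
\<close>

section \<open>Standard Young tableaux and order ideals\<close>

text \<open>The count does double duty. That the standard polytabloids span would normally be shown
  with straightening relations; here only their independence is proved, and spanning follows once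
  the two bounds for the sum of the squared dimensions meet. The monoid takes the place of the
  groupoid algebra in the classification because its elements are honest products of operators
  \<pi>(g) and idempotents e_i, whereas the units of the groupoid correspond to alternating
  combinations of such products. The algebra isomorphism and the classification are therefore proved
  independently of each other. Elements of the monoid need not be invertible, so averaging and
  orthogonality of characters are not at hand. What replaces them is triangularity: the set
  component [k] of the separating element annihilates the induced representations with smaller k, so
  k is compared first, and for equal k James' comparison of shapes excludes one direction. This
  suffices for a density theorem.\<close>

definition order_ideal :: "(nat \<times> nat) set \<Rightarrow> bool" where
  "order_ideal D \<longleftrightarrow> finite D \<and> (\<forall>i j i' j'. (i, j) \<in> D \<longrightarrow> i' \<le> i \<longrightarrow> j' \<le> j \<longrightarrow> (i', j') \<in> D)"

definition ideals :: "nat \<Rightarrow> (nat \<times> nat) set set" where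
  "ideals m = {D. order_ideal D \<and> card D = m}"

definition covers :: "(nat \<times> nat) set \<Rightarrow> (nat \<times> nat) set set" where
  "covers D = {F. order_ideal F \<and> D \<subseteq> F \<and> card F = Suc (card D)}"

text \<open>\<open>Suc\<close> stands on the smaller side: with a truncated
  \<open>card D - 1\<close> the empty diagram would be a cocover of itself.\<close>

definition cocovers :: "(nat \<times> nat) set \<Rightarrow> (nat \<times> nat) set set" where
  "cocovers D = {G. order_ideal G \<and> G \<subseteq> D \<and> Suc (card G) = card D}"

definition row_len :: "(nat \<times> nat) set \<Rightarrow> nat \<Rightarrow> nat" where
  "row_len D i = card {j. (i, j) \<in> D}"

text \<open>A single weak inequality along the product order encodes standardness, since injectivity
  turns it into strict increase along rows and columns. In this form it passes to subdiagrams
  without case distinctions.\<close>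

definition syt :: "(nat \<times> nat) set \<Rightarrow> (nat \<times> nat \<Rightarrow> nat) set" where
  "syt D = {T \<in> extensional D. bij_betw T D {1..card D} \<and>
     (\<forall>i j i' j'. (i, j) \<in> D \<longrightarrow> (i', j') \<in> D \<longrightarrow> i \<le> i' \<longrightarrow> j \<le> j' \<longrightarrow> T (i, j) \<le> T (i', j'))}"

lemma order_idealD: "order_ideal D \<Longrightarrow> (i, j) \<in> D \<Longrightarrow> i' \<le> i \<Longrightarrow> j' \<le> j \<Longrightarrow> (i', j') \<in> D"
  unfolding order_ideal_def by blast

lemma order_ideal_finite: "order_ideal D \<Longrightarrow> finite D"
  unfolding order_ideal_def by blast

lemma nat_initial_segment:
  fixes A :: "nat set"
  assumes "finite A" "\<And>x y. x \<in> A \<Longrightarrow> y \<le> x \<Longrightarrow> y \<in> A"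
  shows "A = {..<card A}"
proof -
  have "x < card A" if "x \<in> A" for x
  proof -
    have "{..x} \<subseteq> A" using assms(2) that by auto
    from card_mono[OF assms(1) this] show ?thesis by simp
  qed
  then have "A \<subseteq> {..<card A}" by auto
  then show ?thesis by (intro card_subset_eq) auto
qed

lemma row_len_iff:
  assumes "order_ideal D"
  shows "(i, j) \<in> D \<longleftrightarrow> j < row_len D i"
proof -
  have "finite {j. (i, j) \<in> D}"
    by (rule finite_subset[of _ "snd ` D"]) (use order_ideal_finite[OF assms] in \<open>force+\<close>)
  then have "{j. (i, j) \<in> D} = {..<row_len D i}"
    unfolding row_len_def by (rule nat_initial_segment) (use order_idealD[OF assms] in auto)
  then show ?thesis by blast
qed

lemma row_len_antimono:
  assumes "order_ideal D" "i \<le> i'"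
  shows "row_len D i' \<le> row_len D i"
proof (rule leI, rule notI)
  assume "row_len D i < row_len D i'"
  then have "(i', row_len D i) \<in> D" using row_len_iff[OF assms(1)] by simp
  then have "(i, row_len D i) \<in> D" by (rule order_idealD[OF assms(1) _ assms(2) order_refl])
  then show False using row_len_iff[OF assms(1)] by simp
qed

lemma finite_ideals: "finite (ideals m)"
proof (rule finite_subset)
  show "ideals m \<subseteq> Pow ({..<m} \<times> {..<m})"
  proof (clarsimp simp: ideals_def)
    fix D i j assume D: "order_ideal D" and ij: "(i, j) \<in> D"
    have "(\<lambda>a. (a, 0)) ` {..i} \<subseteq> D" "(\<lambda>a. (0, a)) ` {..j} \<subseteq> D"
      using order_idealD[OF D ij] by auto
    from card_mono[OF order_ideal_finite[OF D] this(1)] card_mono[OF order_ideal_finite[OF D] this(2)]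
    show "i < card D \<and> j < card D" by (simp add: card_image inj_on_def)
  qed
qed simp

section \<open>Addable and removable cells of a Young diagram\<close>

lemma finite_covers: "finite (covers D)"
  by (rule finite_subset[OF _ finite_ideals[of "Suc (card D)"]]) (auto simp: covers_def ideals_def)

lemma finite_cocovers: "finite (cocovers D)"
  by (rule finite_subset[OF _ finite_ideals[of "card D - 1"]]) (auto simp: cocovers_def ideals_def)

text \<open>The only cell that can be added in row i is the one just behind its end, and
  down-closure then asks that the row above be strictly longer. Row 0 has no row above, hence the
  extra disjunct.\<close>

lemma covers_eq:
  assumes D: "order_ideal D"
  shows "covers D = (\<lambda>i. insert (i, row_len D i) D) ` {i. i = 0 \<or> row_len D i < row_len D (i - 1)}"
proof (intro equalityI subsetI)
  fix F assume F: "F \<in> covers D"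
  then have oF: "order_ideal F" and sub: "D \<subseteq> F" and cF: "card F = Suc (card D)"
    by (auto simp: covers_def)
  have "card (F - D) = 1"
    using card_Diff_subset[OF order_ideal_finite[OF D] sub] cF by simp
  then obtain i j where c: "F - D = {(i, j)}" by (metis card_1_singletonE surj_pair)
  then have Feq: "F = insert (i, j) D" and nin: "(i, j) \<notin> D" using sub by auto
  have "(i, j') \<in> D" if "j' < j" for j'
    using order_idealD[OF oF, of i j i j'] Feq that by auto
  then have j: "j = row_len D i"
    using nin row_len_iff[OF D] by (metis linorder_neqE_nat order.irrefl)
  have "(i - 1, j) \<in> D" if "i \<noteq> 0"
    using order_idealD[OF oF, of i j "i - 1" j] Feq that by auto
  then show "F \<in> (\<lambda>i. insert (i, row_len D i) D) ` {i. i = 0 \<or> row_len D i < row_len D (i - 1)}"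
    using Feq j row_len_iff[OF D] by auto
next
  fix F assume "F \<in> (\<lambda>i. insert (i, row_len D i) D) ` {i. i = 0 \<or> row_len D i < row_len D (i - 1)}"
  then obtain i where i: "i = 0 \<or> row_len D i < row_len D (i - 1)" and F: "F = insert (i, row_len D i) D"
    by auto
  have nin: "(i, row_len D i) \<notin> D" using row_len_iff[OF D] by simp
  have "order_ideal F"
    unfolding order_ideal_def
  proof (intro conjI allI impI)
    show "finite F" using F order_ideal_finite[OF D] by simp
    fix a b a' b' assume *: "(a, b) \<in> F" "a' \<le> a" "b' \<le> b"
    show "(a', b') \<in> F"
    proof (cases "(a, b) \<in> D")
      case True
      then show ?thesis using order_idealD[OF D] * F by auto
    next
      case False
      then have ab: "a = i" "b = row_len D i" using * F by auto
      show ?thesis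
      proof (cases "a' = i")
        case True
        then show ?thesis using ab * F row_len_iff[OF D, of i b'] by auto
      next
        case False
        then have "a' \<le> i - 1" "i \<noteq> 0" using * ab by auto
        then have "row_len D i < row_len D a'"
          using i row_len_antimono[OF D, of a' "i - 1"] by auto
        then show ?thesis using * ab F row_len_iff[OF D] by auto
      qed
    qed
  qed
  then show "F \<in> covers D"
    using F nin order_ideal_finite[OF D] by (auto simp: covers_def)
qed

text \<open>A removable cell ends its row and has no cell below it; as row lengths decrease weakly,
  this says that the next row is strictly shorter.\<close>

lemma cocovers_eq:
  assumes D: "order_ideal D"
  shows "cocovers D = (\<lambda>i. D - {(i, row_len D i - 1)}) ` {i. row_len D (Suc i) < row_len D i}"
proof (intro equalityI subsetI)
  fix G assume G: "G \<in> cocovers D"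
  then have oG: "order_ideal G" and sub: "G \<subseteq> D" and cG: "Suc (card G) = card D"
    by (auto simp: cocovers_def)
  have "card (D - G) = 1"
    using card_Diff_subset[OF order_ideal_finite[OF oG] sub] cG by simp
  then obtain i j where c: "D - G = {(i, j)}" by (metis card_1_singletonE surj_pair)
  then have Geq: "G = D - {(i, j)}" and ij: "(i, j) \<in> D" using sub by auto
  have "(i, Suc j) \<notin> D"
  proof
    assume "(i, Suc j) \<in> D"
    then have "(i, Suc j) \<in> G" using Geq by auto
    from order_idealD[OF oG this, of i j] Geq show False by auto
  qed
  then have j: "row_len D i = Suc j"
    using ij row_len_iff[OF D] by (metis Suc_lessI)
  have "(Suc i, j) \<notin> D"
  proof
    assume "(Suc i, j) \<in> D"
    then have "(Suc i, j) \<in> G" using Geq by auto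
    from order_idealD[OF oG this, of i j] Geq show False by auto
  qed
  then show "G \<in> (\<lambda>i. D - {(i, row_len D i - 1)}) ` {i. row_len D (Suc i) < row_len D i}"
    using Geq j row_len_iff[OF D] by auto
next
  fix G assume "G \<in> (\<lambda>i. D - {(i, row_len D i - 1)}) ` {i. row_len D (Suc i) < row_len D i}"
  then obtain i where i: "row_len D (Suc i) < row_len D i" and G: "G = D - {(i, row_len D i - 1)}"
    by auto
  have in_D: "(i, row_len D i - 1) \<in> D" using row_len_iff[OF D] i by simp
  have "order_ideal G"
    unfolding order_ideal_def
  proof (intro conjI allI impI)
    show "finite G" using G order_ideal_finite[OF D] by simp
    fix a b a' b' assume *: "(a, b) \<in> G" "a' \<le> a" "b' \<le> b"
    have "\<not> (a' = i \<and> b' = row_len D i - 1)"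
    proof
      assume e: "a' = i \<and> b' = row_len D i - 1"
      have b: "b < row_len D a" using * G row_len_iff[OF D] by auto
      show False
      proof (cases "a = i")
        case True
        then show False using e b * G by auto
      next
        case False
        then have "row_len D a \<le> row_len D (Suc i)"
          using row_len_antimono[OF D, of "Suc i" a] e * by auto
        then show False using b i e * by auto
      qed
    qed
    then show "(a', b') \<in> G" using * G order_idealD[OF D] by auto
  qed
  then show "G \<in> cocovers D"
    using G in_D card_Suc_Diff1[OF order_ideal_finite[OF D] in_D] by (simp add: cocovers_def Diff_subset)
qed

text \<open>A descent between rows i and i+1 makes the end of row i removable and the place behind
  row i+1 addable. So the addable rows are row 0 and the successors of the removable ones.\<close>

lemma card_covers:
  assumes D: "order_ideal D"
  shows "card (covers D) = Suc (card (cocovers D))"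
proof -
  have inj1: "inj_on (\<lambda>i. insert (i, row_len D i) D) Z" for Z
  proof (rule inj_onI)
    fix a b assume e: "insert (a, row_len D a) D = insert (b, row_len D b) D"
    have "(a, row_len D a) \<notin> D" using row_len_iff[OF D] by simp
    moreover have "(a, row_len D a) \<in> insert (b, row_len D b) D" unfolding e[symmetric] by simp
    ultimately show "a = b" by auto
  qed
  have inj2: "inj_on (\<lambda>i. D - {(i, row_len D i - 1)}) {i. row_len D (Suc i) < row_len D i}"
  proof (rule inj_onI)
    fix a b assume a: "a \<in> {i. row_len D (Suc i) < row_len D i}"
      and e: "D - {(a, row_len D a - 1)} = D - {(b, row_len D b - 1)}"
    have 1: "(a, row_len D a - 1) \<in> D" using a row_len_iff[OF D] by auto
    have "(a, row_len D a - 1) \<notin> D - {(b, row_len D b - 1)}" unfolding e[symmetric] by simp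
    then show "a = b" using 1 by auto
  qed
  have fin: "finite {i. row_len D (Suc i) < row_len D i}"
  proof (rule finite_subset)
    show "{i. row_len D (Suc i) < row_len D i} \<subseteq> fst ` D"
    proof
      fix i assume "i \<in> {i. row_len D (Suc i) < row_len D i}"
      then have "(i, 0) \<in> D" using row_len_iff[OF D] by auto
      then show "i \<in> fst ` D" by force
    qed
  qed (use order_ideal_finite[OF D] in simp)
  have "{i. i = 0 \<or> row_len D i < row_len D (i - 1)} = insert 0 (Suc ` {i. row_len D (Suc i) < row_len D i})"
  proof (intro equalityI subsetI)
    fix i assume i: "i \<in> {i. i = 0 \<or> row_len D i < row_len D (i - 1)}"
    show "i \<in> insert 0 (Suc ` {i. row_len D (Suc i) < row_len D i})"
      using i by (cases i) auto
  qed auto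
  then have "card {i. i = 0 \<or> row_len D i < row_len D (i - 1)} = Suc (card {i. row_len D (Suc i) < row_len D i})"
    using fin by (simp add: card_image)
  then show ?thesis
    unfolding covers_eq[OF D] cocovers_eq[OF D] card_image[OF inj1] card_image[OF inj2] .
qed

section \<open>Counting standard tableaux by going up and down in Young's lattice\<close>

lemma finite_syt: "finite D \<Longrightarrow> finite (syt D)"
proof -
  assume "finite D"
  then have "finite (D \<rightarrow>\<^sub>E {1..card D})" by (intro finite_PiE) auto
  moreover have "syt D \<subseteq> D \<rightarrow>\<^sub>E {1..card D}"
    by (auto simp: syt_def PiE_def bij_betw_def)
  ultimately show ?thesis by (rule finite_subset[rotated])
qed

text \<open>The largest entry of a standard tableau sits in a removable cell, and deleting that cell
  is reversible.\<close>

lemma card_syt_rec: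
  assumes D: "order_ideal D" and ne: "D \<noteq> {}"
  shows "card (syt D) = (\<Sum>G\<in>cocovers D. card (syt G))"
proof -
  have fD: "finite D" by (rule order_ideal_finite[OF D])
  obtain m where m: "card D = Suc m" using fD ne by (metis card_0_eq not0_implies_Suc)
  let ?P = "Sigma (cocovers D) syt"
  let ?f = "\<lambda>T. ({c \<in> D. T c \<le> m}, restrict T {c \<in> D. T c \<le> m})"
  \<comment> \<open>Inverse of the deletion: the one cell missing from \<open>G\<close> receives
    \<open>Suc m\<close>, and outside \<open>D\<close> the value stays \<open>undefined\<close>
    because tableaux are extensional.\<close>
  let ?g = "\<lambda>(G, U) c. if c \<in> G then U c else if c \<in> D then Suc m else undefined"
  have "bij_betw ?f (syt D) ?P"
  proof (rule bij_betw_byWitness[where f' = ?g])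
    show "\<forall>T\<in>syt D. ?g (?f T) = T"
    proof
      fix T assume T: "T \<in> syt D"
      have "T c \<le> Suc m" if "c \<in> D" for c
        using T that by (auto simp: syt_def bij_betw_def m)
      then show "?g (?f T) = T"
        using T by (auto simp: syt_def fun_eq_iff extensional_def not_le intro: le_antisym)
    qed
    show "\<forall>P\<in>?P. ?f (?g P) = P"
    proof
      fix P assume "P \<in> ?P"
      then obtain G U where P: "P = (G, U)" and G: "G \<in> cocovers D" and U: "U \<in> syt G" by blast
      have cG: "card G = m" "G \<subseteq> D" using G m by (auto simp: cocovers_def)
      have "U c \<le> m" if "c \<in> G" for c using U that by (auto simp: syt_def bij_betw_def cG)
      then have e: "{c \<in> D. ?g (G, U) c \<le> m} = G" using cG(2) by auto
      have "restrict (?g (G, U)) G = U" using U by (auto simp: syt_def fun_eq_iff extensional_def)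
      then show "?f (?g P) = P" using e P by simp
    qed
    show "?f ` syt D \<subseteq> ?P"
    proof (rule image_subsetI)
      fix T assume T: "T \<in> syt D"
      let ?G = "{c \<in> D. T c \<le> m}"
      have bij: "bij_betw T D {1..Suc m}"
        and mono: "\<And>i j i' j'. (i, j) \<in> D \<Longrightarrow> (i', j') \<in> D \<Longrightarrow> i \<le> i' \<Longrightarrow> j \<le> j' \<Longrightarrow> T (i, j) \<le> T (i', j')"
        using T by (auto simp: syt_def m)
      have im: "T ` ?G = {1..m}"
      proof (intro equalityI subsetI)
        fix x assume "x \<in> {1..m}"
        then have "x \<in> T ` D" using bij by (auto simp: bij_betw_def)
        then show "x \<in> T ` ?G" using \<open>x \<in> {1..m}\<close> by auto
      qed (use bij in \<open>auto simp: bij_betw_def\<close>)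
      have bG: "bij_betw T ?G {1..m}"
        unfolding bij_betw_def im using bij by (auto simp: bij_betw_def inj_on_def)
      have cG: "card ?G = m" using bij_betw_same_card[OF bG] by simp
      have oG: "order_ideal ?G"
        unfolding order_ideal_def
      proof (intro conjI allI impI)
        fix i j i' j' assume *: "(i, j) \<in> ?G" "i' \<le> i" "j' \<le> j"
        then have "(i', j') \<in> D" using order_idealD[OF D] by auto
        moreover have "T (i', j') \<le> T (i, j)" using mono[of i' j' i j] * calculation by auto
        ultimately show "(i', j') \<in> ?G" using * by auto
      qed (use fD in simp)
      have "?G \<in> cocovers D" using oG cG m by (auto simp: cocovers_def)
      moreover have "bij_betw (restrict T ?G) ?G {1..m}"
        using bG by (rule bij_betw_cong[THEN iffD1, rotated]) simp
      then have "restrict T ?G \<in> syt ?G"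
        using mono by (auto simp: syt_def cG)
      ultimately show "?f T \<in> ?P" by blast
    qed
    show "?g ` ?P \<subseteq> syt D"
    proof (rule image_subsetI)
      fix P assume "P \<in> ?P"
      then obtain G U where P: "P = (G, U)" and G: "G \<in> cocovers D" and U: "U \<in> syt G" by blast
      have cG: "card G = m" "G \<subseteq> D" "order_ideal G" using G m by (auto simp: cocovers_def)
      have bij: "bij_betw U G {1..m}"
        and mono: "\<And>i j i' j'. (i, j) \<in> G \<Longrightarrow> (i', j') \<in> G \<Longrightarrow> i \<le> i' \<Longrightarrow> j \<le> j' \<Longrightarrow> U (i, j) \<le> U (i', j')"
        using U by (auto simp: syt_def cG)
      have "card (D - G) = 1"
        using card_Diff_subset[OF order_ideal_finite[OF cG(3)] cG(2)] cG(1) m by simp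
      then obtain c where c: "D - G = {c}" by (metis card_1_singletonE)
      have De: "D = insert c G" "c \<notin> G" using c cG(2) by auto
      let ?T = "?g (G, U)"
      have "bij_betw ?T G {1..m}" using bij by (rule bij_betw_cong[THEN iffD1, rotated]) simp
      moreover have "?T c = Suc m" using De by simp
      ultimately have "bij_betw ?T (insert c G) (insert (Suc m) {1..m})"
        using De(2) by (auto simp: bij_betw_def)
      moreover have "insert (Suc m) {1..m} = {1..card D}" using m by auto
      ultimately have 1: "bij_betw ?T D {1..card D}" unfolding De(1)[symmetric] by simp
      have Ule: "U d \<le> m" if "d \<in> G" for d using bij that by (auto simp: bij_betw_def)
      \<comment> \<open>A first cell outside \<open>G\<close> with a second cell inside it cannot
        occur, as \<open>G\<close> is down-closed; and if the second cell is the new one, it carries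
        the largest entry.\<close>
      have 2: "?T (i, j) \<le> ?T (i', j')" if "(i, j) \<in> D" "(i', j') \<in> D" "i \<le> i'" "j \<le> j'" for i j i' j'
        using that mono[of i j i' j'] Ule[of "(i, j)"] order_idealD[OF cG(3), of i' j' i j]
        by (auto simp: le_Suc_eq)
      have 3: "?T \<in> extensional D" using cG(2) by (auto simp: extensional_def)
      have "?T \<in> syt D" unfolding syt_def using 1 2 3 by blast
      then show "?g P \<in> syt D" using P by simp
    qed
  qed
  then have "card (syt D) = card ?P" by (rule bij_betw_same_card)
  also have "\<dots> = (\<Sum>G\<in>cocovers D. card (syt G))"
    using finite_cocovers by (intro card_SigmaI ballI finite_syt) (auto simp: cocovers_def order_ideal_def)
  finally show ?thesis .
qed

lemma order_ideal_Un: "order_ideal D \<Longrightarrow> order_ideal E \<Longrightarrow> order_ideal (D \<union> E)"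
  and order_ideal_Int: "order_ideal D \<Longrightarrow> order_ideal E \<Longrightarrow> order_ideal (D \<inter> E)"
  unfolding order_ideal_def by blast+

lemma covers_cocovers_iff:
  assumes "order_ideal D"
  shows "F \<in> covers D \<longleftrightarrow> order_ideal F \<and> D \<in> cocovers F"
  unfolding covers_def cocovers_def mem_Collect_eq eq_commute[of "Suc (card D)" "card F"] using assms by blast

text \<open>This is the commutation relation DU - UD = 1 of Young's lattice applied to the tableau
  counts. Paths that go up from D and then down to some E other than D correspond to paths that go
  down and then up, through the union and the intersection of D and E; the numbers of paths
  returning to D differ by one, by \<open>card_covers\<close>.\<close>

lemma sum_covers:
  assumes "order_ideal D"
  shows "(\<Sum>F\<in>covers D. card (syt F)) = Suc (card D) * card (syt D)"
  using assms
proof (induction "card D" arbitrary: D rule: less_induct)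
  case less
  note D = less.prems
  let ?f = "\<lambda>D. card (syt D)"
  have fD: "finite D" by (rule order_ideal_finite[OF D])
  let ?A = "Sigma (covers D) (\<lambda>F. cocovers F - {D})"
  let ?B = "Sigma (cocovers D) (\<lambda>G. covers G - {D})"
  have eqcard: "card (D \<union> E) + card (D \<inter> E) = card D + card E" if "order_ideal E" for E
    using card_Un_Int[OF fD order_ideal_finite[OF that]] by simp
  have proper: "D \<union> E \<noteq> D" "D \<inter> E \<noteq> D" "card (D \<inter> E) < card D" if "order_ideal E" "E \<noteq> D" "card E = card D" for E
  proof -
    show "D \<union> E \<noteq> D" using card_subset_eq[OF fD, of E] that by auto
    show ne: "D \<inter> E \<noteq> D" using card_subset_eq[OF order_ideal_finite[OF that(1)], of D] that by auto
    show "card (D \<inter> E) < card D" using ne by (intro psubset_card_mono fD) auto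
  qed
  have un: "D \<union> E = F" if "F \<in> covers D" "E \<in> cocovers F" "E \<noteq> D" for E F
  proof (rule card_subset_eq)
    have E: "order_ideal E" "card E = card D" "E \<subseteq> F" "D \<subseteq> F" "card F = Suc (card D)" "finite F"
      using that by (auto simp: covers_def cocovers_def order_ideal_def)
    then show "finite F" "D \<union> E \<subseteq> F" by auto
    have "card D < card (D \<union> E)"
      using proper[OF E(1) that(3) E(2)] by (intro psubset_card_mono) (use fD order_ideal_finite[OF E(1)] in auto)
    then show "card (D \<union> E) = card F"
      using card_mono[OF E(6), of "D \<union> E"] E by auto
  qed
  have int: "D \<inter> E = G" if "G \<in> cocovers D" "E \<in> covers G" "E \<noteq> D" for E G
  proof (rule card_subset_eq[symmetric])
    have E: "order_ideal E" "card E = card D" "G \<subseteq> E" "G \<subseteq> D" "card D = Suc (card G)"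
      using that by (auto simp: covers_def cocovers_def order_ideal_def)
    then show "finite (D \<inter> E)" "G \<subseteq> D \<inter> E" using fD by auto
    show "card G = card (D \<inter> E)"
      using proper[OF E(1) that(3) E(2)] card_mono[OF \<open>finite (D \<inter> E)\<close> \<open>G \<subseteq> D \<inter> E\<close>] E by auto
  qed
  have "(\<Sum>F\<in>covers D. ?f F) = (\<Sum>F\<in>covers D. \<Sum>E\<in>cocovers F. ?f E)"
  proof (rule sum.cong[OF refl])
    fix F assume "F \<in> covers D"
    then have "order_ideal F" "F \<noteq> {}" by (auto simp: covers_def)
    then show "?f F = (\<Sum>E\<in>cocovers F. ?f E)" by (rule card_syt_rec)
  qed
  also have "\<dots> = (\<Sum>F\<in>covers D. ?f D + (\<Sum>E\<in>cocovers F - {D}. ?f E))"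
    by (intro sum.cong[OF refl] sum.remove finite_cocovers) (simp add: covers_cocovers_iff[OF D])
  also have "\<dots> = Suc (card (cocovers D)) * ?f D + (\<Sum>(F, E)\<in>?A. ?f E)"
    by (simp add: sum.distrib card_covers[OF D] sum.Sigma finite_covers finite_cocovers)
  also have "(\<Sum>(F, E)\<in>?A. ?f E) = (\<Sum>(G, E)\<in>?B. ?f E)"
  proof (rule sum.reindex_bij_witness[where i = "\<lambda>(G, E). (D \<union> E, E)" and j = "\<lambda>(F, E). (D \<inter> E, E)"])
    fix a assume a: "a \<in> ?A"
    obtain F E where a': "a = (F, E)" by (cases a)
    have FE: "F \<in> covers D" "E \<in> cocovers F" "E \<noteq> D" using a a' by auto
    have E: "order_ideal E" "card E = card D" "card F = Suc (card D)"
      using FE by (auto simp: covers_def cocovers_def)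
    show "(\<lambda>(G, E). (D \<union> E, E)) ((\<lambda>(F, E). (D \<inter> E, E)) a) = a"
      using un[OF FE] a' by simp
    have "Suc (card (D \<inter> E)) = card D" using eqcard[OF E(1)] un[OF FE] E by auto
    then show "(\<lambda>(F, E). (D \<inter> E, E)) a \<in> ?B"
      using a' FE E D order_ideal_Int[OF D E(1)] by (auto simp: covers_def cocovers_def)
    show "(case (\<lambda>(F, E). (D \<inter> E, E)) a of (G, E) \<Rightarrow> ?f E) = (case a of (F, E) \<Rightarrow> ?f E)"
      using a' by simp
  next
    fix b assume b: "b \<in> ?B"
    obtain G E where b': "b = (G, E)" by (cases b)
    have GE: "G \<in> cocovers D" "E \<in> covers G" "E \<noteq> D" using b b' by auto
    have E: "order_ideal E" "card E = card D" "card D = Suc (card G)"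
      using GE by (auto simp: covers_def cocovers_def)
    show "(\<lambda>(F, E). (D \<inter> E, E)) ((\<lambda>(G, E). (D \<union> E, E)) b) = b"
      using int[OF GE] b' by simp
    have "card (D \<union> E) = Suc (card D)" using eqcard[OF E(1)] int[OF GE] E by auto
    then show "(\<lambda>(G, E). (D \<union> E, E)) b \<in> ?A"
      using b' GE E D order_ideal_Un[OF D E(1)] by (auto simp: covers_def cocovers_def)
  qed
  \<comment> \<open>One return path to D is split off; the other \<open>card (cocovers D)\<close>
    copies of \<open>?f D\<close> restore the terms E = D in the sums over \<open>covers G\<close>,
    to which the induction hypothesis applies.\<close>
  also have "Suc (card (cocovers D)) * ?f D + (\<Sum>(G, E)\<in>?B. ?f E) =
      ?f D + (\<Sum>G\<in>cocovers D. ?f D + (\<Sum>E\<in>covers G - {D}. ?f E))"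
    by (simp add: sum.distrib sum.Sigma finite_covers finite_cocovers)
  also have "(\<Sum>G\<in>cocovers D. ?f D + (\<Sum>E\<in>covers G - {D}. ?f E)) = (\<Sum>G\<in>cocovers D. \<Sum>E\<in>covers G. ?f E)"
  proof (rule sum.cong[OF refl])
    fix G assume "G \<in> cocovers D"
    then have "D \<in> covers G" using D by (auto simp: covers_def cocovers_def)
    then show "?f D + (\<Sum>E\<in>covers G - {D}. ?f E) = (\<Sum>E\<in>covers G. ?f E)"
      by (rule sum.remove[OF finite_covers, symmetric])
  qed
  also have "\<dots> = (\<Sum>G\<in>cocovers D. card D * ?f G)"
  proof (rule sum.cong[OF refl])
    fix G assume "G \<in> cocovers D"
    then have "order_ideal G" "Suc (card G) = card D" by (auto simp: cocovers_def)
    then show "(\<Sum>E\<in>covers G. ?f E) = card D * ?f G" using less.hyps[of G] by simp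
  qed
  also have "\<dots> = card D * ?f D"
    by (cases "D = {}") (simp_all add: card_syt_rec[OF D] sum_distrib_left)
  finally show ?case by simp
qed

text \<open>One of the two factors is expanded by removing a cell. Exchanging the sums over pairs of
  neighbouring diagrams turns removal into addition, where \<open>sum_covers\<close> supplies the
  factor m + 1.\<close>

lemma sum_syt_squares: "(\<Sum>D\<in>ideals m. card (syt D) ^ 2) = fact m"
proof (induction m)
  case 0
  have "ideals 0 = {{}}" by (auto simp: ideals_def order_ideal_def)
  moreover have "syt {} = {\<lambda>_. undefined}" by (auto simp: syt_def bij_betw_def extensional_def)
  ultimately show ?case by simp
next
  case (Suc m)
  have "(\<Sum>D\<in>ideals (Suc m). card (syt D) ^ 2) = (\<Sum>D\<in>ideals (Suc m). \<Sum>G\<in>cocovers D. card (syt D) * card (syt G))"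
  proof (rule sum.cong[OF refl])
    fix D assume "D \<in> ideals (Suc m)"
    then have "order_ideal D" "D \<noteq> {}" by (auto simp: ideals_def)
    then have "card (syt D) = (\<Sum>G\<in>cocovers D. card (syt G))" by (rule card_syt_rec)
    then show "card (syt D) ^ 2 = (\<Sum>G\<in>cocovers D. card (syt D) * card (syt G))"
      by (simp add: power2_eq_square sum_distrib_left)
  qed
  also have "\<dots> = (\<Sum>G\<in>ideals m. \<Sum>D\<in>covers G. card (syt D) * card (syt G))"
    unfolding sum.Sigma[OF finite_ideals ballI[OF finite_cocovers]] sum.Sigma[OF finite_ideals ballI[OF finite_covers]]
    by (rule sum.reindex_bij_witness[where i = "\<lambda>(G, D). (D, G)" and j = "\<lambda>(D, G). (G, D)"])
       (auto simp: ideals_def covers_def cocovers_def)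
  also have "\<dots> = (\<Sum>G\<in>ideals m. Suc m * card (syt G) ^ 2)"
  proof (rule sum.cong[OF refl])
    fix G assume "G \<in> ideals m"
    then have "order_ideal G" "card G = m" by (auto simp: ideals_def)
    then show "(\<Sum>D\<in>covers G. card (syt D) * card (syt G)) = Suc m * card (syt G) ^ 2"
      using sum_covers[of G] by (simp add: sum_distrib_right[symmetric] power2_eq_square algebra_simps)
  qed
  also have "\<dots> = Suc m * (\<Sum>G\<in>ideals m. card (syt G) ^ 2)" by (rule sum_distrib_left[symmetric])
  finally show ?case using Suc by simp
qed

section \<open>Partitions as order ideals\<close>

lemma diagram_Sigma: "diagram \<nu> = Sigma {..<length \<nu>} (\<lambda>i. {..<\<nu> ! i})"
  by (auto simp: diagram_def)

lemma finite_diagram: "finite (diagram \<nu>)"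
  by (simp add: diagram_Sigma)

lemma card_diagram: "card (diagram \<nu>) = sum_list \<nu>"
  by (simp add: diagram_Sigma sum_list_sum_nth lessThan_atLeast0)

lemma partitions_nth_mono: "\<nu> \<in> partitions m \<Longrightarrow> i \<le> i' \<Longrightarrow> i' < length \<nu> \<Longrightarrow> \<nu> ! i' \<le> \<nu> ! i"
  by (cases "i = i'") (auto simp: partitions_def sorted_wrt_iff_nth_less)

lemma partitions_nth_pos: "\<nu> \<in> partitions m \<Longrightarrow> i < length \<nu> \<Longrightarrow> 0 < \<nu> ! i"
  unfolding partitions_def by (metis (mono_tags, lifting) gr0I mem_Collect_eq nth_mem)

lemma order_ideal_diagram:
  assumes "\<nu> \<in> partitions m"
  shows "order_ideal (diagram \<nu>)"
proof -
  have "(i', j') \<in> diagram \<nu>" if "(i, j) \<in> diagram \<nu>" "i' \<le> i" "j' \<le> j" for i j i' j'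
    using that partitions_nth_mono[OF assms, of i' i] by (auto simp: diagram_def)
  then show ?thesis by (auto simp: order_ideal_def finite_diagram)
qed

text \<open>Partitions have no zero parts, so even the length of the list can be read off from the
  row lengths: it counts the nonzero ones.\<close>

lemma partitions_eqI:
  assumes "\<nu> \<in> partitions m" "\<mu> \<in> partitions m'" "\<And>i. row_len (diagram \<nu>) i = row_len (diagram \<mu>) i"
  shows "\<nu> = \<mu>"
proof -
  have r: "row_len (diagram \<kappa>) i = (if i < length \<kappa> then \<kappa> ! i else 0)" for \<kappa> i
    by (simp add: row_len_def diagram_def)
  have pos: "i < length \<kappa> \<longleftrightarrow> row_len (diagram \<kappa>) i \<noteq> 0" if "\<kappa> \<in> partitions k" for \<kappa> k i
    using partitions_nth_pos[OF that, of i] by (simp add: r)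
  have lt: "i < length \<nu> \<longleftrightarrow> i < length \<mu>" for i
    using pos[OF assms(1)] pos[OF assms(2)] assms(3) by simp
  then have len: "length \<nu> = length \<mu>" by (meson linorder_neqE_nat less_irrefl)
  show ?thesis
  proof (rule nth_equalityI[OF len])
    fix i assume "i < length \<nu>"
    then show "\<nu> ! i = \<mu> ! i" using assms(3)[of i] len by (simp add: r)
  qed
qed

lemma bij_betw_diagram: "bij_betw diagram (partitions m) (ideals m)"
  unfolding bij_betw_def
proof (intro conjI equalityI subsetI)
  show "inj_on diagram (partitions m)"
    by (rule inj_onI) (auto intro: partitions_eqI)
  fix D assume "D \<in> diagram ` partitions m"
  then show "D \<in> ideals m"
    by (auto simp: ideals_def order_ideal_diagram card_diagram) (simp add: partitions_def)
next
  fix D assume "D \<in> ideals m"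
  then have D: "order_ideal D" and cD: "card D = m" by (auto simp: ideals_def)
  \<comment> \<open>The height of the first column is the number of nonempty rows.\<close>
  define L where "L = card {i. (i, 0) \<in> D}"
  have "finite {i. (i, 0) \<in> D}"
    by (rule finite_subset[of _ "fst ` D"]) (use order_ideal_finite[OF D] in \<open>force+\<close>)
  then have seg: "{i. (i, 0) \<in> D} = {..<L}"
    unfolding L_def by (rule nat_initial_segment) (use order_idealD[OF D] in auto)
  have L: "0 < row_len D i \<longleftrightarrow> i < L" for i
  proof -
    have "i \<in> {i. (i, 0) \<in> D} \<longleftrightarrow> i \<in> {..<L}" by (simp only: seg)
    then show ?thesis using row_len_iff[OF D, of i 0] by simp
  qed
  define \<nu> where "\<nu> = map (row_len D) [0..<L]"
  have d: "diagram \<nu> = D"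
  proof (rule Set.set_eqI)
    fix c :: "nat \<times> nat"
    obtain i j where c: "c = (i, j)" by (cases c)
    have "i < L" if "j < row_len D i" using that L[of i] by auto
    then show "c \<in> diagram \<nu> \<longleftrightarrow> c \<in> D"
      unfolding c row_len_iff[OF D] by (auto simp: diagram_def \<nu>_def)
  qed
  have "sorted_wrt (\<ge>) \<nu>"
    by (auto simp: sorted_wrt_iff_nth_less \<nu>_def intro!: row_len_antimono[OF D])
  moreover have "row_len D i \<noteq> 0" if "i < L" for i using L[of i] that by simp
  then have "0 \<notin> set \<nu>" by (force simp: \<nu>_def)
  moreover have "sum_list \<nu> = m" using card_diagram[of \<nu>] d cD by simp
  ultimately show "D \<in> diagram ` partitions m" using d by (auto simp: partitions_def)
qed

lemma finite_partitions: "finite (partitions m)"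
  using bij_betw_finite[OF bij_betw_diagram] finite_ideals by blast

lemma standard_tableaux_eq_syt:
  assumes "\<nu> \<in> partitions m"
  shows "standard_tableaux \<nu> = syt (diagram \<nu>)"
proof (intro equalityI subsetI)
  note D = order_ideal_diagram[OF assms]
  fix T assume T: "T \<in> standard_tableaux \<nu>"
  have row: "T (i, j) < T (i, j')" if "(i, j) \<in> diagram \<nu>" "(i, j') \<in> diagram \<nu>" "j < j'" for i j j'
    using T that by (simp add: standard_tableaux_def)
  have col: "T (i, j) < T (i', j)" if "(i, j) \<in> diagram \<nu>" "(i', j) \<in> diagram \<nu>" "i < i'" for i i' j
    using T that by (simp add: standard_tableaux_def)
  have "T (i, j) \<le> T (i', j')" if "(i, j) \<in> diagram \<nu>" "(i', j') \<in> diagram \<nu>" "i \<le> i'" "j \<le> j'" for i j i' j'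
  proof -
    \<comment> \<open>The corner of the path that goes first along the row and then down the
      column.\<close>
    have m: "(i, j') \<in> diagram \<nu>" using order_idealD[OF D that(2)] that by auto
    have "T (i, j) \<le> T (i, j')" using row[OF that(1) m] that by (cases "j = j'") auto
    also have "\<dots> \<le> T (i', j')" using col[OF m that(2)] that by (cases "i = i'") auto
    finally show ?thesis .
  qed
  then show "T \<in> syt (diagram \<nu>)"
    using T by (auto simp: standard_tableaux_def tableaux_def syt_def card_diagram)
next
  fix T assume T: "T \<in> syt (diagram \<nu>)"
  have inj: "inj_on T (diagram \<nu>)" using T by (auto simp: syt_def bij_betw_def)
  have mono: "T (i, j) \<le> T (i', j')" if "(i, j) \<in> diagram \<nu>" "(i', j') \<in> diagram \<nu>" "i \<le> i'" "j \<le> j'" for i j i' j'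
    using T that by (simp add: syt_def)
  have "T (i, j) < T (i', j')" if "(i, j) \<in> diagram \<nu>" "(i', j') \<in> diagram \<nu>" "i \<le> i'" "j \<le> j'" "(i, j) \<noteq> (i', j')" for i j i' j'
  proof (rule le_neq_implies_less[OF mono])
    show "T (i, j) \<noteq> T (i', j')" using inj_onD[OF inj, of "(i, j)" "(i', j')"] that by blast
  qed (use that in auto)
  then show "T \<in> standard_tableaux \<nu>"
    using T by (simp add: standard_tableaux_def tableaux_def syt_def card_diagram)
qed

theorem sum_num_SYT_squares: "(\<Sum>\<nu>\<in>partitions m. num_SYT \<nu> ^ 2) = fact m"
proof -
  have "(\<Sum>\<nu>\<in>partitions m. num_SYT \<nu> ^ 2) = (\<Sum>\<nu>\<in>partitions m. card (syt (diagram \<nu>)) ^ 2)"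
    by (intro sum.cong refl) (simp add: num_SYT_def standard_tableaux_eq_syt)
  also have "\<dots> = (\<Sum>D\<in>ideals m. card (syt D) ^ 2)"
    by (rule sum.reindex_bij_betw[OF bij_betw_diagram])
  finally show ?thesis by (simp add: sum_syt_squares)
qed

section \<open>Polytabloids\<close>

text \<open>A tableau without the requirement of being extensional, so that composition with
  permutations of the entries stays inside the notion (\<open>filling_comp\<close>).\<close>

definition filling :: "nat list \<Rightarrow> (nat \<times> nat \<Rightarrow> nat) \<Rightarrow> bool" where
  "filling \<nu> T \<longleftrightarrow> bij_betw T (diagram \<nu>) {1..sum_list \<nu>}"

definition row_of :: "nat list \<Rightarrow> (nat \<times> nat \<Rightarrow> nat) \<Rightarrow> nat \<Rightarrow> nat" where
  "row_of \<nu> T x = fst (inv_into (diagram \<nu>) T x)"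

definition col_of :: "nat list \<Rightarrow> (nat \<times> nat \<Rightarrow> nat) \<Rightarrow> nat \<Rightarrow> nat" where
  "col_of \<nu> T x = snd (inv_into (diagram \<nu>) T x)"

definition tabloids :: "nat list \<Rightarrow> nat set list set" where
  "tabloids \<nu> = tabloid \<nu> ` tableaux \<nu>"

text \<open>The classical statistic n(\<nu>), the sum of i times the i-th part with rows numbered
  from 0. It is a numerical stand-in for the dominance order.\<close>

definition nrank :: "nat list \<Rightarrow> nat" where
  "nrank \<nu> = (\<Sum>c\<in>diagram \<nu>. fst c)"

lemma tableaux_filling: "T \<in> tableaux \<nu> \<Longrightarrow> filling \<nu> T"
  by (simp add: tableaux_def filling_def)

lemma standard_filling: "T \<in> standard_tableaux \<nu> \<Longrightarrow> filling \<nu> T"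
  by (simp add: standard_tableaux_def tableaux_filling)

lemma filling_inv:
  assumes "filling \<nu> T" "c \<in> diagram \<nu>"
  shows "inv_into (diagram \<nu>) T (T c) = c"
proof -
  have "inj_on T (diagram \<nu>)" using assms(1) unfolding filling_def bij_betw_def by (rule conjunct1)
  then show ?thesis using assms(2) by (rule inv_into_f_f)
qed

lemma filling_cell:
  assumes "filling \<nu> T" "x \<in> {1..sum_list \<nu>}"
  shows "\<exists>c. c \<in> diagram \<nu> \<and> x = T c \<and> row_of \<nu> T x = fst c \<and> col_of \<nu> T x = snd c"
proof -
  have "T ` diagram \<nu> = {1..sum_list \<nu>}" using assms(1) unfolding filling_def bij_betw_def by (rule conjunct2)
  then have "x \<in> T ` diagram \<nu>" using assms(2) by (simp only:)
  then obtain c where c: "x = T c" "c \<in> diagram \<nu>" by (rule imageE)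
  have "row_of \<nu> T x = fst c \<and> col_of \<nu> T x = snd c"
    unfolding row_of_def col_of_def c(1) filling_inv[OF assms(1) c(2)] by (rule conjI[OF refl refl])
  with c show ?thesis by blast
qed

lemma filling_range: "filling \<nu> T \<Longrightarrow> c \<in> diagram \<nu> \<Longrightarrow> T c \<in> {1..sum_list \<nu>}"
  unfolding filling_def using bij_betwE by blast

lemma row_of_cell: "filling \<nu> T \<Longrightarrow> c \<in> diagram \<nu> \<Longrightarrow> row_of \<nu> T (T c) = fst c"
  by (simp add: row_of_def filling_inv)

lemma col_of_cell: "filling \<nu> T \<Longrightarrow> c \<in> diagram \<nu> \<Longrightarrow> col_of \<nu> T (T c) = snd c"
  by (simp add: col_of_def filling_inv)

lemma filling_eq_row_col:
  assumes "filling \<nu> T" "x \<in> {1..sum_list \<nu>}" "y \<in> {1..sum_list \<nu>}"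
    "row_of \<nu> T x = row_of \<nu> T y" "col_of \<nu> T x = col_of \<nu> T y"
  shows "x = y"
proof -
  obtain c where c: "c \<in> diagram \<nu>" "x = T c" "row_of \<nu> T x = fst c" "col_of \<nu> T x = snd c"
    using filling_cell[OF assms(1,2)] by blast
  obtain d where d: "d \<in> diagram \<nu>" "y = T d" "row_of \<nu> T y = fst d" "col_of \<nu> T y = snd d"
    using filling_cell[OF assms(1,3)] by blast
  have "c = d" using assms(4,5) c d by (simp add: prod_eq_iff)
  then show ?thesis using c d by simp
qed

lemma row_set: 
  assumes "filling \<nu> T"
  shows "T ` {c \<in> diagram \<nu>. fst c = i} = {x \<in> {1..sum_list \<nu>}. row_of \<nu> T x = i}"
proof (intro equalityI subsetI)
  fix x assume "x \<in> T ` {c \<in> diagram \<nu>. fst c = i}"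
  then show "x \<in> {x \<in> {1..sum_list \<nu>}. row_of \<nu> T x = i}"
    using filling_range[OF assms] row_of_cell[OF assms] by blast
next
  fix x assume "x \<in> {x \<in> {1..sum_list \<nu>}. row_of \<nu> T x = i}"
  then have x: "x \<in> {1..sum_list \<nu>}" "row_of \<nu> T x = i" by blast+
  obtain c where c: "c \<in> diagram \<nu>" "x = T c" "row_of \<nu> T x = fst c"
    using filling_cell[OF assms x(1)] by blast
  have "c \<in> {c \<in> diagram \<nu>. fst c = i}" using x(2) c(1,3) by simp
  then show "x \<in> T ` {c \<in> diagram \<nu>. fst c = i}"
    unfolding c(2) by (rule imageI)
qed

lemma col_set: 
  assumes "filling \<nu> T"
  shows "T ` {c \<in> diagram \<nu>. snd c = i} = {x \<in> {1..sum_list \<nu>}. col_of \<nu> T x = i}"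
proof (intro equalityI subsetI)
  fix x assume "x \<in> T ` {c \<in> diagram \<nu>. snd c = i}"
  then show "x \<in> {x \<in> {1..sum_list \<nu>}. col_of \<nu> T x = i}"
    using filling_range[OF assms] col_of_cell[OF assms] by blast
next
  fix x assume "x \<in> {x \<in> {1..sum_list \<nu>}. col_of \<nu> T x = i}"
  then have x: "x \<in> {1..sum_list \<nu>}" "col_of \<nu> T x = i" by blast+
  obtain c where c: "c \<in> diagram \<nu>" "x = T c" "col_of \<nu> T x = snd c"
    using filling_cell[OF assms x(1)] by blast
  have "c \<in> {c \<in> diagram \<nu>. snd c = i}" using x(2) c(1,3) by simp
  then show "x \<in> T ` {c \<in> diagram \<nu>. snd c = i}"
    unfolding c(2) by (rule imageI)
qed

text \<open>The sets in a tabloid are the fibres of \<open>row_of\<close>, so a tabloid carries the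
  same information as this function on the entries.\<close>

lemma tabloid_eq_iff:
  assumes "filling \<nu> T" "filling \<nu> S"
  shows "tabloid \<nu> T = tabloid \<nu> S \<longleftrightarrow> (\<forall>x\<in>{1..sum_list \<nu>}. row_of \<nu> T x = row_of \<nu> S x)"
proof
  assume e: "tabloid \<nu> T = tabloid \<nu> S"
  show "\<forall>x\<in>{1..sum_list \<nu>}. row_of \<nu> T x = row_of \<nu> S x"
  proof
    fix x assume x: "x \<in> {1..sum_list \<nu>}"
    obtain c where c: "c \<in> diagram \<nu>" "x = T c" "row_of \<nu> T x = fst c"
      using filling_cell[OF assms(1) x] by blast
    then have l: "fst c < length \<nu>" by (auto simp: diagram_def)
    have "tabloid \<nu> T ! fst c = tabloid \<nu> S ! fst c" by (simp only: e)
    then have "{y \<in> {1..sum_list \<nu>}. row_of \<nu> T y = fst c} = {y \<in> {1..sum_list \<nu>}. row_of \<nu> S y = fst c}"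
      using l by (simp add: tabloid_def row_set[OF assms(1)] row_set[OF assms(2)])
    then have "x \<in> {y \<in> {1..sum_list \<nu>}. row_of \<nu> S y = fst c}" using x c(3) by blast
    then show "row_of \<nu> T x = row_of \<nu> S x" using c(3) by simp
  qed
next
  assume "\<forall>x\<in>{1..sum_list \<nu>}. row_of \<nu> T x = row_of \<nu> S x"
  then have "{x \<in> {1..sum_list \<nu>}. row_of \<nu> T x = i} = {x \<in> {1..sum_list \<nu>}. row_of \<nu> S x = i}" for i
    by (intro Collect_cong conj_cong refl) simp
  then show "tabloid \<nu> T = tabloid \<nu> S"
    by (simp add: tabloid_def row_set[OF assms(1)] row_set[OF assms(2)])
qed

lemma tabloid_comp: "tabloid \<nu> (p \<circ> T) = map ((`) p) (tabloid \<nu> T)"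
  by (simp add: tabloid_def image_comp comp_def)

lemma filling_comp: "p permutes {1..sum_list \<nu>} \<Longrightarrow> filling \<nu> T \<Longrightarrow> filling \<nu> (p \<circ> T)"
  unfolding filling_def using bij_betw_trans permutes_imp_bij by blast

lemma filling_restrict: "filling \<nu> T \<Longrightarrow> restrict T (diagram \<nu>) \<in> tableaux \<nu>"
  unfolding filling_def tableaux_def mem_Collect_eq
  using bij_betw_cong[of "diagram \<nu>" "restrict T (diagram \<nu>)" T "{1..sum_list \<nu>}"] by simp

lemma tabloid_cong: "(\<And>c. c \<in> diagram \<nu> \<Longrightarrow> T c = S c) \<Longrightarrow> tabloid \<nu> T = tabloid \<nu> S"
  unfolding tabloid_def by (intro map_cong refl image_cong) auto

lemma polytabloid_cong:
  assumes "\<And>c. c \<in> diagram \<nu> \<Longrightarrow> T c = S c"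
  shows "polytabloid \<nu> T = polytabloid \<nu> S"
proof -
  have "T ` {c \<in> diagram \<nu>. snd c = j} = S ` {c \<in> diagram \<nu>. snd c = j}" for j
    by (intro image_cong refl) (use assms in auto)
  then have "column_stabilizer \<nu> T = column_stabilizer \<nu> S"
    by (simp add: column_stabilizer_def)
  moreover have "tabloid \<nu> (q \<circ> T) = tabloid \<nu> (q \<circ> S)" for q
    by (rule tabloid_cong) (use assms in simp)
  ultimately show ?thesis unfolding polytabloid_def by simp
qed

lemma tabloid_in_tabloids: 
  assumes "filling \<nu> T"
  shows "tabloid \<nu> T \<in> tabloids \<nu>"
proof -
  have "tabloid \<nu> T = tabloid \<nu> (restrict T (diagram \<nu>))" by (rule tabloid_cong) simp
  then show ?thesis using filling_restrict[OF assms] by (auto simp: tabloids_def)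
qed

lemma tabloidsE:
  assumes "t \<in> tabloids \<nu>"
  obtains T where "filling \<nu> T" "t = tabloid \<nu> T"
  using assms tableaux_filling unfolding tabloids_def by blast

lemma finite_tableaux: "finite (tableaux \<nu>)"
proof (rule finite_subset)
  show "tableaux \<nu> \<subseteq> diagram \<nu> \<rightarrow>\<^sub>E {1..sum_list \<nu>}"
    unfolding tableaux_def PiE_def using bij_betwE by blast
qed (intro finite_PiE finite_diagram, simp)

lemma finite_tabloids: "finite (tabloids \<nu>)"
  by (simp add: tabloids_def finite_tableaux)

lemma map_image_inv:
  assumes "p permutes A"
  shows "map ((`) p) (map ((`) (inv' p)) t) = t" "map ((`) (inv' p)) (map ((`) p) t) = t"
  using permutes_inverses[OF assms] by (simp_all add: image_comp comp_def map_idI)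

lemma map_image_inv_eq_iff:
  assumes "p permutes A"
  shows "map ((`) (inv' p)) t = s \<longleftrightarrow> t = map ((`) p) s"
proof
  assume "map ((`) (inv' p)) t = s"
  then show "t = map ((`) p) s" using map_image_inv(1)[OF assms, of t] by (simp only:)
next
  assume "t = map ((`) p) s"
  then show "map ((`) (inv' p)) t = s" using map_image_inv(2)[OF assms, of s] by (simp only:)
qed

text \<open>Trades stability of the column sets for a condition on single entries. In the converse
  direction, an injective map of a finite column into itself is onto.\<close>

lemma column_stabilizer_iff:
  assumes "filling \<nu> T"
  shows "q \<in> column_stabilizer \<nu> T \<longleftrightarrow>
    q permutes {1..sum_list \<nu>} \<and> (\<forall>x\<in>{1..sum_list \<nu>}. col_of \<nu> T (q x) = col_of \<nu> T x)"
proof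
  assume q: "q \<in> column_stabilizer \<nu> T"
  have "col_of \<nu> T (q x) = col_of \<nu> T x" if "x \<in> {1..sum_list \<nu>}" for x
  proof -
    have "q ` {y \<in> {1..sum_list \<nu>}. col_of \<nu> T y = col_of \<nu> T x} = {y \<in> {1..sum_list \<nu>}. col_of \<nu> T y = col_of \<nu> T x}"
      using q by (simp add: column_stabilizer_def col_set[OF assms])
    then have "q x \<in> {y \<in> {1..sum_list \<nu>}. col_of \<nu> T y = col_of \<nu> T x}" using that by blast
    then show ?thesis by simp
  qed
  then show "q permutes {1..sum_list \<nu>} \<and> (\<forall>x\<in>{1..sum_list \<nu>}. col_of \<nu> T (q x) = col_of \<nu> T x)"
    using q by (simp add: column_stabilizer_def)
next
  assume q: "q permutes {1..sum_list \<nu>} \<and> (\<forall>x\<in>{1..sum_list \<nu>}. col_of \<nu> T (q x) = col_of \<nu> T x)"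
  have "q ` {x \<in> {1..sum_list \<nu>}. col_of \<nu> T x = j} = {x \<in> {1..sum_list \<nu>}. col_of \<nu> T x = j}" for j
  proof (rule card_subset_eq)
    show "q ` {x \<in> {1..sum_list \<nu>}. col_of \<nu> T x = j} \<subseteq> {x \<in> {1..sum_list \<nu>}. col_of \<nu> T x = j}"
      using q permutes_in_image[of q "{1..sum_list \<nu>}"] by blast
    show "card (q ` {x \<in> {1..sum_list \<nu>}. col_of \<nu> T x = j}) = card {x \<in> {1..sum_list \<nu>}. col_of \<nu> T x = j}"
      by (rule card_image) (use q permutes_inj inj_on_subset in blast)
  qed simp
  then show "q \<in> column_stabilizer \<nu> T"
    using q by (simp add: column_stabilizer_def col_set[OF assms])
qed

lemma column_stabilizer_permutes: "q \<in> column_stabilizer \<nu> T \<Longrightarrow> q permutes {1..sum_list \<nu>}"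
  by (simp add: column_stabilizer_def)

lemma column_stabilizer_permutation: "q \<in> column_stabilizer \<nu> T \<Longrightarrow> permutation q"
  using column_stabilizer_permutes permutation_permutes by blast

lemma finite_column_stabilizer: "finite (column_stabilizer \<nu> T)"
  by (rule finite_subset[OF _ finite_permutations[of "{1..sum_list \<nu>}"]]) (auto simp: column_stabilizer_def)

lemma column_stabilizer_comp:
  assumes T: "filling \<nu> T" and "q \<in> column_stabilizer \<nu> T" "r \<in> column_stabilizer \<nu> T"
  shows "q \<circ> r \<in> column_stabilizer \<nu> T"
proof -
  have q: "q permutes {1..sum_list \<nu>}" "\<And>x. x \<in> {1..sum_list \<nu>} \<Longrightarrow> col_of \<nu> T (q x) = col_of \<nu> T x"
    and r: "r permutes {1..sum_list \<nu>}" "\<And>x. x \<in> {1..sum_list \<nu>} \<Longrightarrow> col_of \<nu> T (r x) = col_of \<nu> T x"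
    using assms unfolding column_stabilizer_iff[OF T] by blast+
  have "col_of \<nu> T ((q \<circ> r) x) = col_of \<nu> T x" if "x \<in> {1..sum_list \<nu>}" for x
    using q(2)[of "r x"] r(2)[OF that] permutes_in_image[OF r(1)] that by simp
  then show ?thesis
    unfolding column_stabilizer_iff[OF T] using permutes_compose[OF r(1) q(1)] by blast
qed

lemma column_stabilizer_inv:
  assumes T: "filling \<nu> T" and "q \<in> column_stabilizer \<nu> T"
  shows "inv' q \<in> column_stabilizer \<nu> T"
proof -
  have q: "q permutes {1..sum_list \<nu>}" "\<And>x. x \<in> {1..sum_list \<nu>} \<Longrightarrow> col_of \<nu> T (q x) = col_of \<nu> T x"
    using assms unfolding column_stabilizer_iff[OF T] by blast+
  have "col_of \<nu> T (inv' q x) = col_of \<nu> T x" if "x \<in> {1..sum_list \<nu>}" for x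
    using q(2)[of "inv' q x"] permutes_in_image[OF permutes_inv[OF q(1)]] that permutes_inverses(1)[OF q(1)] by simp
  then show ?thesis
    unfolding column_stabilizer_iff[OF T] using permutes_inv[OF q(1)] by blast
qed

lemma column_stabilizer_id: "filling \<nu> T \<Longrightarrow> id \<in> column_stabilizer \<nu> T"
  by (simp add: column_stabilizer_iff permutes_id)

lemma sum_column_stabilizer_right:
  assumes T: "filling \<nu> T" and r: "r \<in> column_stabilizer \<nu> T"
  shows "(\<Sum>q\<in>column_stabilizer \<nu> T. F (q \<circ> r)) = (\<Sum>q\<in>column_stabilizer \<nu> T. F q)"
proof (rule sum.reindex_bij_witness[where i = "\<lambda>q. q \<circ> inv' r" and j = "\<lambda>q. q \<circ> r"])
  note rp = column_stabilizer_permutes[OF r]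
  fix q assume q: "q \<in> column_stabilizer \<nu> T"
  show "(q \<circ> r) \<circ> inv' r = q" "(q \<circ> inv' r) \<circ> r = q"
    using permutes_inv_o[OF rp] by (simp_all add: comp_assoc)
  show "q \<circ> r \<in> column_stabilizer \<nu> T" "q \<circ> inv' r \<in> column_stabilizer \<nu> T"
    using column_stabilizer_comp[OF T q] r column_stabilizer_inv[OF T r] by blast+
qed simp

text \<open>The coefficient at \<open>t\<close> of the signed column sum of \<open>T\<close> applied
  to the tabloid \<open>s\<close>. The shape of \<open>s\<close> is left open, since the sum is also
  applied to tabloids of other shapes.\<close>

definition column_antisym :: "nat list \<Rightarrow> (nat \<times> nat \<Rightarrow> nat) \<Rightarrow> nat set list \<Rightarrow> nat set list \<Rightarrow> complex" where
  "column_antisym \<nu> T s t =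
     (\<Sum>q\<in>column_stabilizer \<nu> T. if t = map ((`) q) s then of_int (sign q) else 0)"

lemma polytabloid_eq_column_antisym: "polytabloid \<nu> T = column_antisym \<nu> T (tabloid \<nu> T)"
  by (simp add: polytabloid_def column_antisym_def tabloid_comp fun_eq_iff)

lemma sign_comp_of_int:
  "permutation q \<Longrightarrow> permutation r \<Longrightarrow> (of_int (sign (q \<circ> r)) :: complex) = of_int (sign q) * of_int (sign r)"
  by (simp add: sign_compose)

lemma sign_square: "(of_int (sign q) :: complex) * of_int (sign q) = 1"
  by (simp add: sign_def)

text \<open>Right translation by r permutes the column stabilizer, so the signed sum absorbs r up to
  its sign.\<close>

lemma column_antisym_shift:
  assumes T: "filling \<nu> T" and r: "r \<in> column_stabilizer \<nu> T"
  shows "column_antisym \<nu> T (map ((`) r) s) t = of_int (sign r) * column_antisym \<nu> T s t"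
proof -
  have "column_antisym \<nu> T s t =
     (\<Sum>q\<in>column_stabilizer \<nu> T. if t = map ((`) (q \<circ> r)) s then of_int (sign (q \<circ> r)) else 0)"
    unfolding column_antisym_def
    by (rule sum_column_stabilizer_right[OF T r, of "\<lambda>q. if t = map ((`) q) s then of_int (sign q) else 0", symmetric])
  also have "\<dots> = (\<Sum>q\<in>column_stabilizer \<nu> T. of_int (sign r) * (if t = map ((`) q) (map ((`) r) s) then of_int (sign q) else 0))"
  proof (rule sum.cong[OF refl])
    fix q assume q: "q \<in> column_stabilizer \<nu> T"
    have "map ((`) (q \<circ> r)) s = map ((`) q) (map ((`) r) s)" by (simp add: image_comp comp_def)
    then show "(if t = map ((`) (q \<circ> r)) s then of_int (sign (q \<circ> r)) else 0) =
        of_int (sign r) * ((if t = map ((`) q) (map ((`) r) s) then of_int (sign q) else 0) :: complex)"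
      using sign_comp_of_int[OF column_stabilizer_permutation[OF q] column_stabilizer_permutation[OF r]]
      by (simp del: map_map)
  qed
  also have "\<dots> = of_int (sign r) * column_antisym \<nu> T (map ((`) r) s) t"
    by (simp only: column_antisym_def sum_distrib_left)
  finally show ?thesis by (simp add: mult.assoc[symmetric] sign_square)
qed

lemma order_ideal_col:
  assumes "order_ideal D"
  shows "(i, j) \<in> D \<longleftrightarrow> i < card {i. (i, j) \<in> D}"
proof -
  have "finite {i. (i, j) \<in> D}"
    by (rule finite_subset[of _ "fst ` D"]) (use order_ideal_finite[OF assms] in \<open>force+\<close>)
  then have "{i. (i, j) \<in> D} = {..<card {i. (i, j) \<in> D}}"
    by (rule nat_initial_segment) (use order_idealD[OF assms] in auto)
  then show ?thesis by blast
qed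

lemma sum_row_of:
  assumes "filling \<nu> T"
  shows "(\<Sum>x\<in>{1..sum_list \<nu>}. row_of \<nu> T x) = nrank \<nu>"
proof -
  have "(\<Sum>c\<in>diagram \<nu>. row_of \<nu> T (T c)) = (\<Sum>x\<in>{1..sum_list \<nu>}. row_of \<nu> T x)"
    using assms unfolding filling_def by (rule sum.reindex_bij_betw)
  then show ?thesis using row_of_cell[OF assms] by (simp add: nrank_def)
qed

lemma row_len_filling:
  assumes "filling \<nu> T"
  shows "row_len (diagram \<nu>) i = card {x \<in> {1..sum_list \<nu>}. row_of \<nu> T x = i}"
proof -
  have "card (T ` {c \<in> diagram \<nu>. fst c = i}) = card {c \<in> diagram \<nu>. fst c = i}"
    by (rule card_image) (use assms in \<open>auto simp: filling_def bij_betw_def intro: inj_on_subset\<close>)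
  moreover have "{c \<in> diagram \<nu>. fst c = i} = Pair i ` {j. (i, j) \<in> diagram \<nu>}" by force
  then have "card {c \<in> diagram \<nu>. fst c = i} = row_len (diagram \<nu>) i"
    by (simp add: row_len_def card_image inj_on_def)
  ultimately show ?thesis unfolding row_set[OF assms] by (rule trans[OF sym sym, rotated])
qed

text \<open>
  Sorting every column of \<open>T\<close> by the rows that its entries occupy in \<open>S\<close> moves no entry below its
  row in \<open>S\<close>. Comparing the sums of the row indices replaces the usual argument with the dominance order.
\<close>

lemma column_antisym_nonzero:
  assumes \<nu>: "\<nu> \<in> partitions m" and \<mu>: "\<mu> \<in> partitions m"
    and T: "filling \<nu> T" and S: "filling \<mu> S" and nz: "column_antisym \<nu> T (tabloid \<mu> S) t \<noteq> 0"
  shows "nrank \<nu> < nrank \<mu> \<or> \<nu> = \<mu> \<and> (\<exists>q\<in>column_stabilizer \<nu> T. tabloid \<mu> S = tabloid \<nu> (q \<circ> T))"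
proof -
  let ?X = "{1..m}" and ?D = "diagram \<nu>"
  have s: "sum_list \<nu> = m" "sum_list \<mu> = m" using \<nu> \<mu> by (simp_all add: partitions_def)
  let ?row = "row_of \<mu> S" and ?col = "col_of \<nu> T"
  \<comment> \<open>Two entries sharing a column of \<open>T\<close> and a row of \<open>S\<close>
    would kill the sum: their transposition fixes the tabloid of \<open>S\<close> but contributes
    the sign -1.\<close>
  have diff: "?row x \<noteq> ?row y" if xy: "x \<in> ?X" "y \<in> ?X" "x \<noteq> y" "?col x = ?col y" for x y
  proof
    assume r: "?row x = ?row y"
    let ?t = "transpose x y"
    have tp: "?t permutes ?X" using xy by (simp add: permutes_swap_id)
    have tC: "?t \<in> column_stabilizer \<nu> T"
      unfolding column_stabilizer_iff[OF T] s using tp xy by (auto simp: transpose_def)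
    have "row_of \<mu> (?t \<circ> S) z = ?row z" if z: "z \<in> ?X" for z
    proof -
      have zt: "?t z \<in> {1..sum_list \<mu>}" using permutes_in_image[OF tp] z s by simp
      obtain c where c: "c \<in> diagram \<mu>" "?t z = S c" "?row (?t z) = fst c"
        using filling_cell[OF S zt] by blast
      have "(?t \<circ> S) c = z" using c(2)[symmetric] by simp
      then have "row_of \<mu> (?t \<circ> S) z = fst c"
        using row_of_cell[OF filling_comp[OF _ S] c(1), of ?t] tp s by simp
      also have "\<dots> = ?row z" using c(3) r by (auto simp: transpose_def split: if_splits)
      finally show ?thesis .
    qed
    then have "tabloid \<mu> (?t \<circ> S) = tabloid \<mu> S"
      using tabloid_eq_iff[OF filling_comp[OF _ S] S, of ?t] tp s by simp
    then have "column_antisym \<nu> T (tabloid \<mu> S) t = of_int (sign ?t) * column_antisym \<nu> T (tabloid \<mu> S) t"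
      using column_antisym_shift[OF T tC, of "tabloid \<mu> S" t] by (simp add: tabloid_comp)
    then show False using nz xy by (simp add: sign_swap_id)
  qed
  \<comment> \<open>\<open>A x\<close> collects the entries above x once its column is sorted by
    \<open>?row\<close>; its cardinality is the new row index of x. As \<open>?row\<close> is
    injective on each column, this index is at most \<open>?row x\<close>.\<close>
  define A where "A x = {y \<in> ?X. ?col y = ?col x \<and> ?row y < ?row x}" for x
  have finA: "finite (A x)" for x by (simp add: A_def)
  have le: "card (A x) \<le> ?row x" if "x \<in> ?X" for x
  proof -
    have "inj_on ?row (A x)"
      by (rule inj_onI) (use diff in \<open>force simp: A_def\<close>)
    moreover have "?row ` A x \<subseteq> {..<?row x}" by (auto simp: A_def)
    ultimately have "card (A x) \<le> card {..<?row x}" by (intro card_inj_on_le) auto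
    then show ?thesis by simp
  qed
  define \<phi> where "\<phi> x = (card (A x), ?col x)" for x
  have oD: "order_ideal ?D" by (rule order_ideal_diagram[OF \<nu>])
  have in_D: "\<phi> x \<in> ?D" if x: "x \<in> ?X" for x
  proof -
    have "A x \<subset> {y \<in> ?X. ?col y = ?col x}" using x by (auto simp: A_def)
    then have "card (A x) < card {y \<in> ?X. ?col y = ?col x}" by (intro psubset_card_mono) auto
    also have "{y \<in> ?X. ?col y = ?col x} = T ` {c \<in> ?D. snd c = ?col x}"
      using col_set[OF T] s by simp
    also have "card \<dots> = card {c \<in> ?D. snd c = ?col x}"
      by (rule card_image) (use T in \<open>auto simp: filling_def bij_betw_def intro: inj_on_subset\<close>)
    also have "{c \<in> ?D. snd c = ?col x} = (\<lambda>i. (i, ?col x)) ` {i. (i, ?col x) \<in> ?D}" by force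
    also have "card \<dots> = card {i. (i, ?col x) \<in> ?D}" by (simp add: card_image inj_on_def)
    finally show ?thesis unfolding \<phi>_def by (rule order_ideal_col[OF oD, THEN iffD2])
  qed
  have strict: "card (A x) < card (A y)" if "x \<in> ?X" "y \<in> ?X" "?col x = ?col y" "?row x < ?row y" for x y
  proof (intro psubset_card_mono finA psubsetI)
    show "A x \<subseteq> A y"
    proof
      fix z assume "z \<in> A x"
      then show "z \<in> A y" using that(3,4) unfolding A_def by simp
    qed
    have "x \<in> A y" "x \<notin> A x" using that unfolding A_def by simp_all
    then show "A x \<noteq> A y" by blast
  qed
  have inj: "inj_on \<phi> ?X"
  proof (rule inj_onI, rule ccontr)
    fix x y assume xy: "x \<in> ?X" "y \<in> ?X" "\<phi> x = \<phi> y" "x \<noteq> y"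
    have c: "?col x = ?col y" "card (A x) = card (A y)" using xy by (simp_all add: \<phi>_def)
    have "?row x \<noteq> ?row y" using diff xy c by blast
    then consider "?row x < ?row y" | "?row y < ?row x" by linarith
    then show False using strict[of x y] strict[of y x] xy c by cases auto
  qed
  have bij: "bij_betw \<phi> ?X ?D"
    unfolding bij_betw_def
  proof (intro conjI inj card_subset_eq finite_diagram)
    show "\<phi> ` ?X \<subseteq> ?D" using in_D by blast
    show "card (\<phi> ` ?X) = card ?D" unfolding card_image[OF inj] card_diagram s by simp
  qed
  have sumA: "(\<Sum>x\<in>?X. card (A x)) = nrank \<nu>"
    using sum.reindex_bij_betw[OF bij, of fst] by (simp add: nrank_def \<phi>_def)
  have sumR: "(\<Sum>x\<in>?X. ?row x) = nrank \<mu>" using sum_row_of[OF S] s by simp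
  have "nrank \<nu> \<le> nrank \<mu>" unfolding sumA[symmetric] sumR[symmetric] by (rule sum_mono) (rule le)
  show ?thesis
  proof (cases "nrank \<nu> = nrank \<mu>")
    case False
    then show ?thesis using \<open>nrank \<nu> \<le> nrank \<mu>\<close> by simp
  next
    case True
    \<comment> \<open>Termwise inequalities with equal sums are equalities, so sorting puts every
      entry into the row that it has in \<open>S\<close>.\<close>
    have eq: "card (A x) = ?row x" if "x \<in> ?X" for x
      by (rule sum_mono_inv[of "\<lambda>x. card (A x)" ?X ?row]) (use True sumA sumR le that in auto)
    define T' where "T' = inv_into ?X \<phi>"
    have T': "filling \<nu> T'"
      unfolding filling_def T'_def s using bij_betw_inv_into[OF bij] .
    have T'\<phi>: "T' (\<phi> x) = x" if "x \<in> ?X" for x using bij_betw_inv_into_left[OF bij that] by (simp add: T'_def)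
    have rT': "row_of \<nu> T' x = ?row x" if "x \<in> ?X" for x
      using row_of_cell[OF T' in_D[OF that]] T'\<phi>[OF that] eq[OF that] by (simp add: \<phi>_def)
    have \<nu>\<mu>: "\<nu> = \<mu>"
    proof (rule partitions_eqI[OF \<nu> \<mu>])
      fix i
      have "{x \<in> ?X. row_of \<nu> T' x = i} = {x \<in> ?X. ?row x = i}"
        by (intro Collect_cong conj_cong refl) (simp only: rT')
      then show "row_len (diagram \<nu>) i = row_len (diagram \<mu>) i"
        unfolding row_len_filling[OF T'] row_len_filling[OF S] s by (simp only:)
    qed
    \<comment> \<open>The permutation taking \<open>T\<close> to its sorted version
      \<open>T'\<close>; it moves entries only within their columns.\<close>
    define q where "q x = (if x \<in> ?X then T' (inv_into ?D T x) else x)" for x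
    have bT: "bij_betw T ?D ?X" "bij_betw T' ?D ?X" using T T' by (simp_all add: filling_def s)
    have "bij_betw (T' \<circ> inv_into ?D T) ?X ?X"
      by (rule bij_betw_trans[OF bij_betw_inv_into[OF bT(1)] bT(2)])
    then have "bij_betw q ?X ?X" by (rule bij_betw_cong[THEN iffD1, rotated]) (simp add: q_def)
    then have qp: "q permutes ?X" by (rule bij_imp_permutes) (unfold q_def, erule if_not_P)
    have qT: "(q \<circ> T) c = T' c" if "c \<in> ?D" for c
      using filling_range[OF T that] filling_inv[OF T that] s by (simp add: q_def)
    have "?col (q x) = ?col x" if x: "x \<in> ?X" for x
    proof -
      obtain c where c: "c \<in> ?D" "x = T c" "?col x = snd c"
        using filling_cell[OF T, of x] x unfolding s by blast
      have qx: "q x = T' c" using qT[OF c(1)] c(2) by simp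
      have "\<phi> (T' c) = c" using bij_betw_inv_into_right[OF bij c(1)] by (simp add: T'_def)
      then show ?thesis using c(3) by (simp add: qx \<phi>_def prod_eq_iff)
    qed
    then have qC: "q \<in> column_stabilizer \<nu> T" unfolding column_stabilizer_iff[OF T] s using qp by blast
    have "tabloid \<nu> (q \<circ> T) = tabloid \<nu> T'" by (rule tabloid_cong) (rule qT)
    also have "\<dots> = tabloid \<nu> S"
      using tabloid_eq_iff[OF T'] S rT' \<nu>\<mu> s by simp
    finally show ?thesis using qC \<nu>\<mu> by metis
  qed
qed

lemma row_of_comp:
  assumes "filling \<nu> T" "q permutes {1..sum_list \<nu>}" "x \<in> {1..sum_list \<nu>}"
  shows "row_of \<nu> (q \<circ> T) (q x) = row_of \<nu> T x"
proof -
  obtain c where c: "c \<in> diagram \<nu>" "x = T c" "row_of \<nu> T x = fst c"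
    using filling_cell[OF assms(1,3)] by blast
  then show ?thesis using row_of_cell[OF filling_comp[OF assms(2,1)] c(1)] by simp
qed

text \<open>If q x = r y, then x and y share a column of \<open>T\<close>, and equality of the
  tabloids puts them into the same row; hence x = y. So the tabloids occurring in a polytabloid are
  distinct and nothing cancels.\<close>

lemma column_stabilizer_tabloid_inj:
  assumes T: "filling \<nu> T" and q: "q \<in> column_stabilizer \<nu> T" and r: "r \<in> column_stabilizer \<nu> T"
    and e: "tabloid \<nu> (q \<circ> T) = tabloid \<nu> (r \<circ> T)"
  shows "q = r"
proof -
  let ?X = "{1..sum_list \<nu>}"
  note qp = column_stabilizer_permutes[OF q] and rp = column_stabilizer_permutes[OF r]
  have qc: "col_of \<nu> T (q x) = col_of \<nu> T x" and rc: "col_of \<nu> T (r x) = col_of \<nu> T x" if "x \<in> ?X" for x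
    using q r that unfolding column_stabilizer_iff[OF T] by blast+
  have row: "row_of \<nu> (q \<circ> T) x = row_of \<nu> (r \<circ> T) x" if "x \<in> ?X" for x
    using e that tabloid_eq_iff[OF filling_comp[OF qp T] filling_comp[OF rp T]] by blast
  have "q x = r x" if x: "x \<in> ?X" for x
  proof -
    define y where "y = inv' r (q x)"
    have y: "y \<in> ?X" "r y = q x"
      using permutes_in_image[OF qp] permutes_in_image[OF permutes_inv[OF rp]] x permutes_inverses(1)[OF rp]
      by (simp_all add: y_def)
    have qx: "q x \<in> ?X" using permutes_in_image[OF qp] x by simp
    have "row_of \<nu> T x = row_of \<nu> T y"
      using row[OF qx] row_of_comp[OF T qp x] row_of_comp[OF T rp y(1)] y(2) by simp
    moreover have "col_of \<nu> T x = col_of \<nu> T y" using qc[OF x] rc[OF y(1)] y(2) by simp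
    ultimately have "x = y" by (rule filling_eq_row_col[OF T x y(1)])
    then show ?thesis using y by simp
  qed
  then show ?thesis using permutes_not_in[OF qp] permutes_not_in[OF rp] by (metis ext)
qed

lemma polytabloid_value:
  assumes T: "filling \<nu> T" and q: "q \<in> column_stabilizer \<nu> T"
  shows "polytabloid \<nu> T (tabloid \<nu> (q \<circ> T)) = of_int (sign q)"
proof -
  have "polytabloid \<nu> T (tabloid \<nu> (q \<circ> T)) = (\<Sum>r\<in>column_stabilizer \<nu> T. if r = q then of_int (sign q) else 0)"
    unfolding polytabloid_def
    by (intro sum.cong refl) (use column_stabilizer_tabloid_inj[OF T q] in auto)
  then show ?thesis using q by (simp add: finite_column_stabilizer)
qed

lemma polytabloid_support:
  assumes "polytabloid \<nu> T t \<noteq> 0"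
  obtains q where "q \<in> column_stabilizer \<nu> T" "t = tabloid \<nu> (q \<circ> T)"
proof (rule ccontr)
  assume "\<not> thesis"
  then have "polytabloid \<nu> T t = 0"
    unfolding polytabloid_def using that by (intro sum.neutral ballI) auto
  then show False using assms by simp
qed

lemma polytabloid_in_tabloids:
  assumes "filling \<nu> T" "polytabloid \<nu> T t \<noteq> 0"
  shows "t \<in> tabloids \<nu>"
  using assms(2)
  by (rule polytabloid_support) (use tabloid_in_tabloids filling_comp column_stabilizer_permutes assms(1) in metis)

lemma cnj_polytabloid: "cnj (polytabloid \<nu> T t) = polytabloid \<nu> T t"
  unfolding polytabloid_def cnj_sum by (intro sum.cong refl) simp

text \<open>James' lemma: on tabloids of its own shape the signed column sum produces only multiples
  of the polytabloid. The multiplier is again a coefficient of the polytabloid, so the matrix is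
  symmetric of rank one.\<close>

lemma column_antisym_eq_polytabloid:
  assumes \<nu>: "\<nu> \<in> partitions m" and T: "filling \<nu> T" and s: "s \<in> tabloids \<nu>"
  shows "column_antisym \<nu> T s t = polytabloid \<nu> T s * polytabloid \<nu> T t"
proof (cases "\<exists>q\<in>column_stabilizer \<nu> T. s = tabloid \<nu> (q \<circ> T)")
  case True
  then obtain q where q: "q \<in> column_stabilizer \<nu> T" "s = tabloid \<nu> (q \<circ> T)" by blast
  show ?thesis
    unfolding q(2) polytabloid_value[OF T q(1)]
    by (simp add: tabloid_comp column_antisym_shift[OF T q(1)] polytabloid_eq_column_antisym)
next
  case False
  have "column_antisym \<nu> T s t = 0"
  proof (rule ccontr)
    assume nz: "column_antisym \<nu> T s t \<noteq> 0"
    obtain S where "filling \<nu> S" "s = tabloid \<nu> S" using s by (rule tabloidsE)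
    with nz column_antisym_nonzero[OF \<nu> \<nu> T] False show False by auto
  qed
  moreover have "polytabloid \<nu> T s = 0"
    using False polytabloid_support[of \<nu> T s] by blast
  ultimately show ?thesis by simp
qed

text \<open>Passes from the action on functions, which moves the argument by the inverse, to a
  matrix with entries \<open>column_antisym\<close>; \<open>Z\<close> is a finite set containing the
  support.\<close>

lemma column_antisym_apply:
  assumes T: "filling \<nu> T" and f: "\<And>t. t \<notin> Z \<Longrightarrow> f t = 0" and Z: "finite Z"
  shows "(\<Sum>q\<in>column_stabilizer \<nu> T. of_int (sign q) * f (map ((`) (inv' q)) t)) =
    (\<Sum>s\<in>Z. f s * column_antisym \<nu> T s t)"
proof -
  have "of_int (sign q) * f (map ((`) (inv' q)) t) =
      (\<Sum>s\<in>Z. f s * (if t = map ((`) q) s then of_int (sign q) else 0))" if "q \<in> column_stabilizer \<nu> T" for q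
  proof -
    note qp = column_stabilizer_permutes[OF that]
    have "(\<Sum>s\<in>Z. f s * (if t = map ((`) q) s then of_int (sign q) else 0)) =
        (\<Sum>s\<in>Z. if s = map ((`) (inv' q)) t then f s * of_int (sign q) else 0)"
      by (intro sum.cong refl) (auto simp: map_image_inv_eq_iff[OF qp, symmetric])
    then show ?thesis using f[of "map ((`) (inv' q)) t"] Z by simp
  qed
  then have "(\<Sum>q\<in>column_stabilizer \<nu> T. of_int (sign q) * f (map ((`) (inv' q)) t)) =
      (\<Sum>q\<in>column_stabilizer \<nu> T. \<Sum>s\<in>Z. f s * (if t = map ((`) q) s then of_int (sign q) else 0))"
    by (intro sum.cong refl)
  also have "\<dots> = (\<Sum>s\<in>Z. f s * column_antisym \<nu> T s t)"
    by (subst sum.swap) (simp only: column_antisym_def sum_distrib_left)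
  finally show ?thesis .
qed

text \<open>The column stabilizers of \<open>T\<close> and \<open>p \<circ> T\<close> are conjugate
  under p, and conjugation preserves signs.\<close>

lemma polytabloid_perm:
  assumes T: "filling \<nu> T" and p: "p permutes {1..sum_list \<nu>}"
  shows "polytabloid \<nu> (p \<circ> T) t = polytabloid \<nu> T (map ((`) (inv' p)) t)"
proof -
  let ?X = "{1..sum_list \<nu>}"
  note pT = filling_comp[OF p T]
  have col: "col_of \<nu> (p \<circ> T) (p x) = col_of \<nu> T x" if x: "x \<in> ?X" for x
  proof -
    obtain c where c: "c \<in> diagram \<nu>" "x = T c" "col_of \<nu> T x = snd c"
      using filling_cell[OF T x] by blast
    then show ?thesis using col_of_cell[OF pT c(1)] by simp
  qed
  have conj: "p \<circ> q \<circ> inv' p \<in> column_stabilizer \<nu> (p \<circ> T)" if "q \<in> column_stabilizer \<nu> T" for q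
    unfolding column_stabilizer_iff[OF pT]
  proof (intro conjI ballI)
    note qp = column_stabilizer_permutes[OF that]
    show "p \<circ> q \<circ> inv' p permutes ?X"
      by (intro permutes_compose permutes_inv p qp)
    fix x assume x: "x \<in> ?X"
    let ?y = "inv' p x"
    have y: "?y \<in> ?X" "p ?y = x"
      using permutes_in_image[OF permutes_inv[OF p]] x permutes_inverses(1)[OF p] by simp_all
    have qy: "q ?y \<in> ?X" using permutes_in_image[OF qp] y by simp
    have "col_of \<nu> (p \<circ> T) ((p \<circ> q \<circ> inv' p) x) = col_of \<nu> T (q ?y)" using col[OF qy] by simp
    also have "\<dots> = col_of \<nu> T ?y" using that y(1) unfolding column_stabilizer_iff[OF T] by blast
    also have "\<dots> = col_of \<nu> (p \<circ> T) x" using col[OF y(1)] y(2) by simp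
    finally show "col_of \<nu> (p \<circ> T) ((p \<circ> q \<circ> inv' p) x) = col_of \<nu> (p \<circ> T) x" .
  qed
  have conj': "inv' p \<circ> q \<circ> p \<in> column_stabilizer \<nu> T" if q: "q \<in> column_stabilizer \<nu> (p \<circ> T)" for q
    unfolding column_stabilizer_iff[OF T]
  proof (intro conjI ballI)
    note qp = column_stabilizer_permutes[OF that]
    show "inv' p \<circ> q \<circ> p permutes ?X"
      by (intro permutes_compose permutes_inv p qp)
    fix x assume x: "x \<in> ?X"
    have px: "p x \<in> ?X" using permutes_in_image[OF p] x by simp
    have qpx: "q (p x) \<in> ?X" using permutes_in_image[OF qp] px by simp
    have i: "inv' p (q (p x)) \<in> ?X" using permutes_in_image[OF permutes_inv[OF p]] qpx by simp
    have "col_of \<nu> T ((inv' p \<circ> q \<circ> p) x) = col_of \<nu> (p \<circ> T) (q (p x))"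
      using col[OF i] permutes_inverses(1)[OF p] by simp
    also have "\<dots> = col_of \<nu> (p \<circ> T) (p x)" using q px unfolding column_stabilizer_iff[OF pT] by blast
    also have "\<dots> = col_of \<nu> T x" by (rule col[OF x])
    finally show "col_of \<nu> T ((inv' p \<circ> q \<circ> p) x) = col_of \<nu> T x" .
  qed
  have pp: "permutation p" using p permutation_permutes by blast
  have o: "p \<circ> inv' p = id" "inv' p \<circ> p = id" using permutes_inv_o[OF p] by auto
  have o': "p (inv' p x) = x" "inv' p (p x) = x" for x using permutes_inverses[OF p] by auto
  show ?thesis
    unfolding polytabloid_def
  proof (rule sum.reindex_bij_witness[where i = "\<lambda>q. p \<circ> q \<circ> inv' p" and j = "\<lambda>q. inv' p \<circ> q \<circ> p"])
    fix q assume q: "q \<in> column_stabilizer \<nu> (p \<circ> T)"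
    show "p \<circ> (inv' p \<circ> q \<circ> p) \<circ> inv' p = q" by (simp add: fun_eq_iff o')
    show "inv' p \<circ> q \<circ> p \<in> column_stabilizer \<nu> T" by (rule conj'[OF q])
    have qq: "permutation q" by (rule column_stabilizer_permutation[OF q])
    have sg: "sign (inv' p \<circ> q \<circ> p) = sign q"
      by (simp add: sign_compose permutation_compose permutation_inverse pp qq sign_inverse)
    have "map ((`) (inv' p)) t = tabloid \<nu> (inv' p \<circ> q \<circ> p \<circ> T) \<longleftrightarrow> t = tabloid \<nu> (q \<circ> (p \<circ> T))"
      unfolding map_image_inv_eq_iff[OF p] tabloid_comp[symmetric] comp_assoc[symmetric] o by simp
    then show "(if map ((`) (inv' p)) t = tabloid \<nu> (inv' p \<circ> q \<circ> p \<circ> T) then of_int (sign (inv' p \<circ> q \<circ> p)) else 0) =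
        ((if t = tabloid \<nu> (q \<circ> (p \<circ> T)) then of_int (sign q) else 0) :: complex)"
      by (simp add: sg)
  next
    fix q assume q: "q \<in> column_stabilizer \<nu> T"
    show "inv' p \<circ> (p \<circ> q \<circ> inv' p) \<circ> p = q" by (simp add: fun_eq_iff o')
    show "p \<circ> q \<circ> inv' p \<in> column_stabilizer \<nu> (p \<circ> T)" by (rule conj[OF q])
  qed
qed

text \<open>Suppose x, the largest entry whose row changes, moved down its column. The entry of
  \<open>T\<close> in the cell that x reaches is larger by standardness, so it keeps its row, and it
  keeps its column as well; but then it shares a cell with x.\<close>

lemma standard_column_perm_row:
  assumes T: "T \<in> standard_tableaux \<nu>" and q: "q \<in> column_stabilizer \<nu> T"
    and x: "x \<in> {1..sum_list \<nu>}" and neq: "row_of \<nu> (q \<circ> T) x \<noteq> row_of \<nu> T x"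
    and above: "\<And>y. y \<in> {1..sum_list \<nu>} \<Longrightarrow> x < y \<Longrightarrow> row_of \<nu> (q \<circ> T) y = row_of \<nu> T y"
  shows "row_of \<nu> (q \<circ> T) x < row_of \<nu> T x"
proof (rule ccontr)
  let ?X = "{1..sum_list \<nu>}"
  note F = standard_filling[OF T] and qp = column_stabilizer_permutes[OF q]
  assume "\<not> row_of \<nu> (q \<circ> T) x < row_of \<nu> T x"
  then have gt: "row_of \<nu> T x < row_of \<nu> (q \<circ> T) x" using neq by simp
  note qT = filling_comp[OF qp F]
  have colq: "col_of \<nu> (q \<circ> T) y = col_of \<nu> T y" if y: "y \<in> ?X" for y
  proof -
    obtain c where c: "c \<in> diagram \<nu>" "y = (q \<circ> T) c" "col_of \<nu> (q \<circ> T) y = snd c"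
      using filling_cell[OF qT y] by blast
    have "col_of \<nu> T (q (T c)) = col_of \<nu> T (T c)"
      using q filling_range[OF F c(1)] unfolding column_stabilizer_iff[OF F] by blast
    then show ?thesis using c col_of_cell[OF F c(1)] by simp
  qed
  obtain d where d: "d \<in> diagram \<nu>" "x = T d" "row_of \<nu> T x = fst d" "col_of \<nu> T x = snd d"
    using filling_cell[OF F x] by blast
  obtain c where c: "c \<in> diagram \<nu>" "x = (q \<circ> T) c" "row_of \<nu> (q \<circ> T) x = fst c" "col_of \<nu> (q \<circ> T) x = snd c"
    using filling_cell[OF qT x] by blast
  have cd: "snd c = snd d" "fst d < fst c" using c d colq[OF x] gt by simp_all
  have "T (fst d, snd d) < T (fst c, snd d)"
  proof -
    have "(fst d, snd d) \<in> diagram \<nu>" using d(1) by simp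
    moreover have "(fst c, snd d) \<in> diagram \<nu>" using c(1) unfolding cd(1)[symmetric] by simp
    ultimately show ?thesis using T cd(2) unfolding standard_tableaux_def by blast
  qed
  then have xz: "x < T c" using d(2) cd(1) by (metis prod.collapse)
  have z: "T c \<in> ?X" by (rule filling_range[OF F c(1)])
  have "row_of \<nu> (q \<circ> T) (T c) = row_of \<nu> (q \<circ> T) x"
    using above[OF z xz] row_of_cell[OF F c(1)] c(3) by simp
  moreover have "col_of \<nu> (q \<circ> T) (T c) = col_of \<nu> (q \<circ> T) x"
    using colq[OF z] col_of_cell[OF F c(1)] c(4) by simp
  ultimately have "T c = x" by (rule filling_eq_row_col[OF qT z x])
  then show False using xz by simp
qed

text \<open>Rows of a standard tableau increase, so the column of an entry is the number of smaller
  entries in its row.\<close>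

lemma standard_tableaux_tabloid_inj:
  assumes S: "S \<in> standard_tableaux \<nu>" and T: "T \<in> standard_tableaux \<nu>" and e: "tabloid \<nu> S = tabloid \<nu> T"
  shows "S = T"
proof -
  note FS = standard_filling[OF S] and FT = standard_filling[OF T]
  have row: "row_of \<nu> S x = row_of \<nu> T x" if "x \<in> {1..sum_list \<nu>}" for x
    using e that tabloid_eq_iff[OF FS FT] by blast
  have col: "snd c = card {y \<in> {1..sum_list \<nu>}. row_of \<nu> U y = fst c \<and> y < U c}"
    if U: "U \<in> standard_tableaux \<nu>" and c: "c \<in> diagram \<nu>" for U c
  proof -
    note FU = standard_filling[OF U]
    obtain i j where ij: "c = (i, j)" by fastforce
    have less: "U (i, j') < U (i, j)" if "j' < j" for j'
      using U c that unfolding standard_tableaux_def ij by (auto simp: diagram_def)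
    have notless: "j' < j" if "(i, j') \<in> diagram \<nu>" "U (i, j') < U (i, j)" for j'
    proof (rule ccontr)
      assume "\<not> j' < j"
      then have "j = j' \<or> j < j'" by auto
      then have "U (i, j) \<le> U (i, j')" using U c that(1) unfolding standard_tableaux_def ij by force
      then show False using that(2) by simp
    qed
    have mem: "(i, j') \<in> diagram \<nu>" if "j' < j" for j' using c that by (auto simp: ij diagram_def)
    have "{y \<in> {1..sum_list \<nu>}. row_of \<nu> U y = i \<and> y < U c} = (\<lambda>j'. U (i, j')) ` {..<j}"
    proof (intro equalityI subsetI)
      fix y assume "y \<in> {y \<in> {1..sum_list \<nu>}. row_of \<nu> U y = i \<and> y < U c}"
      then have y: "y \<in> {1..sum_list \<nu>}" "row_of \<nu> U y = i" "y < U c" by blast+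
      obtain d where d: "d \<in> diagram \<nu>" "y = U d" "row_of \<nu> U y = fst d"
        using filling_cell[OF FU y(1)] by blast
      then have "y = U (i, snd d)" "(i, snd d) \<in> diagram \<nu>" using y(2) by (metis prod.collapse)+
      then show "y \<in> (\<lambda>j'. U (i, j')) ` {..<j}" using notless y(3) ij by blast
    next
      fix y assume "y \<in> (\<lambda>j'. U (i, j')) ` {..<j}"
      then obtain j' where j': "j' < j" "y = U (i, j')" by blast
      then show "y \<in> {y \<in> {1..sum_list \<nu>}. row_of \<nu> U y = i \<and> y < U c}"
        using filling_range[OF FU mem[OF j'(1)]] row_of_cell[OF FU mem[OF j'(1)]] less[OF j'(1)] ij by simp
    qed
    moreover have "inj_on (\<lambda>j'. U (i, j')) {..<j}"
    proof (rule inj_onI)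
      fix a b assume ab: "a \<in> {..<j}" "b \<in> {..<j}" "U (i, a) = U (i, b)"
      have "(i, a) = inv_into (diagram \<nu>) U (U (i, a))" using filling_inv[OF FU mem[of a]] ab(1) by simp
      also have "\<dots> = inv_into (diagram \<nu>) U (U (i, b))" by (simp only: ab(3))
      also have "\<dots> = (i, b)" using filling_inv[OF FU mem[of b]] ab(2) by simp
      finally show "a = b" by (simp only: prod.inject)
    qed
    ultimately show ?thesis by (simp add: ij card_image)
  qed
  have "S c = T c" if c: "c \<in> diagram \<nu>" for c
  proof -
    have "S c \<in> {1..sum_list \<nu>}" by (rule filling_range[OF FS c])
    then obtain d where d: "d \<in> diagram \<nu>" "S c = T d" "row_of \<nu> T (S c) = fst d"
      using filling_cell[OF FT] by blast
    have f: "fst d = fst c" using d(3) row[OF \<open>S c \<in> _\<close>] row_of_cell[OF FS c] by simp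
    have "{y \<in> {1..sum_list \<nu>}. row_of \<nu> S y = fst c \<and> y < S c} = {y \<in> {1..sum_list \<nu>}. row_of \<nu> T y = fst d \<and> y < T d}"
      using row by (auto simp: f d(2))
    then have "snd c = snd d" using col[OF S c] col[OF T d(1)] by simp
    then have "c = d" using f by (simp add: prod_eq_iff)
    then show ?thesis using d(2) by (simp only:)
  qed
  moreover have "S \<in> extensional (diagram \<nu>)" "T \<in> extensional (diagram \<nu>)"
    using S T by (simp_all add: standard_tableaux_def tableaux_def)
  ultimately show ?thesis by (intro extensionalityI) auto
qed

lemma finite_standard_tableaux: "finite (standard_tableaux \<nu>)"
  by (rule finite_subset[OF _ finite_tableaux[of \<nu>]]) (auto simp: standard_tableaux_def)

text \<open>Triangularity: compare tabloids at the largest entry whose rows differ. By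
  \<open>standard_column_perm_row\<close>, any standard tableau whose tabloid occurs in the
  polytabloid of another one precedes that other one.\<close>

lemma standard_polytabloids_independent:
  assumes zero: "\<And>t. (\<Sum>T\<in>standard_tableaux \<nu>. a T * polytabloid \<nu> T t) = 0"
    and T0: "T0 \<in> standard_tableaux \<nu>"
  shows "a T0 = 0"
proof (rule ccontr)
  assume "a T0 \<noteq> 0"
  let ?X = "{1..sum_list \<nu>}"
  let ?A = "{T \<in> standard_tableaux \<nu>. a T \<noteq> 0}"
  define R where "R S T \<longleftrightarrow> (\<exists>x\<in>?X. row_of \<nu> S x < row_of \<nu> T x \<and> (\<forall>y\<in>?X. x < y \<longrightarrow> row_of \<nu> S y = row_of \<nu> T y))" for S T
  have trans: "transp_on ?A R"
  proof (rule transp_onI)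
    fix S T U assume "R S T" "R T U"
    then obtain x y where x: "x \<in> ?X" "row_of \<nu> S x < row_of \<nu> T x" "\<And>z. z \<in> ?X \<Longrightarrow> x < z \<Longrightarrow> row_of \<nu> S z = row_of \<nu> T z"
      and y: "y \<in> ?X" "row_of \<nu> T y < row_of \<nu> U y" "\<And>z. z \<in> ?X \<Longrightarrow> y < z \<Longrightarrow> row_of \<nu> T z = row_of \<nu> U z"
      unfolding R_def by blast
    consider "x < y" | "x = y" | "y < x" by linarith
    then show "R S U"
    proof cases
      case 1
      then show ?thesis unfolding R_def using x(3)[OF y(1)] y x(3) by (intro bexI[of _ y]) auto
    next
      case 2
      then show ?thesis unfolding R_def using x y by (intro bexI[of _ y]) auto
    next
      case 3
      then show ?thesis unfolding R_def using y(3)[OF x(1)] x y(3) by (intro bexI[of _ x]) auto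
    qed
  qed
  have asym: "asymp_on ?A R"
  proof (rule asymp_onI, rule notI)
    fix S T assume "R S T" "R T S"
    then obtain x y where x: "x \<in> ?X" "row_of \<nu> S x < row_of \<nu> T x" "\<And>z. z \<in> ?X \<Longrightarrow> x < z \<Longrightarrow> row_of \<nu> S z = row_of \<nu> T z"
      and y: "y \<in> ?X" "row_of \<nu> T y < row_of \<nu> S y" "\<And>z. z \<in> ?X \<Longrightarrow> y < z \<Longrightarrow> row_of \<nu> T z = row_of \<nu> S z"
      unfolding R_def by blast
    consider "x < y" | "x = y" | "y < x" by linarith
    then show False using x(2) x(3)[OF y(1)] y(2) y(3)[OF x(1)] by cases auto
  qed
  have "finite ?A" "?A \<noteq> {}" using finite_standard_tableaux T0 \<open>a T0 \<noteq> 0\<close> by auto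
  \<comment> \<open>Maximal among the tableaux with nonzero coefficient: its tabloid occurs in no
    other polytabloid of the sum, so its coefficient is isolated.\<close>
  then obtain T where T: "T \<in> ?A" and max: "\<And>S. S \<in> ?A \<Longrightarrow> S \<noteq> T \<Longrightarrow> \<not> R T S"
    using Finite_Set.bex_max_element[OF _ asym trans] by blast
  have "a S * polytabloid \<nu> S (tabloid \<nu> T) = 0" if S: "S \<in> standard_tableaux \<nu>" "S \<noteq> T" for S
  proof (rule ccontr)
    assume nz: "a S * polytabloid \<nu> S (tabloid \<nu> T) \<noteq> 0"
    then have SA: "S \<in> ?A" using S by simp
    from nz have "polytabloid \<nu> S (tabloid \<nu> T) \<noteq> 0" by simp
    then obtain q where q: "q \<in> column_stabilizer \<nu> S" "tabloid \<nu> T = tabloid \<nu> (q \<circ> S)"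
      by (rule polytabloid_support)
    note FT = standard_filling[of T \<nu>] and FS = standard_filling[OF S(1)]
    note FqS = filling_comp[OF column_stabilizer_permutes[OF q(1)] FS]
    have row: "row_of \<nu> T x = row_of \<nu> (q \<circ> S) x" if "x \<in> ?X" for x
      using q(2) that tabloid_eq_iff[OF _ FqS] FT T by blast
    let ?N = "{x \<in> ?X. row_of \<nu> (q \<circ> S) x \<noteq> row_of \<nu> S x}"
    have "?N \<noteq> {}"
    proof
      assume "?N = {}"
      then have "tabloid \<nu> T = tabloid \<nu> S" unfolding q(2) using tabloid_eq_iff[OF FqS FS] by blast
      then show False using standard_tableaux_tabloid_inj[of T \<nu> S] T S by blast
    qed
    define x where "x = Max ?N"
    have "x \<in> ?N" unfolding x_def using \<open>?N \<noteq> {}\<close> by (intro Max_in) simp_all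
    then have x: "x \<in> ?X" "row_of \<nu> (q \<circ> S) x \<noteq> row_of \<nu> S x" by blast+
    have above: "row_of \<nu> (q \<circ> S) y = row_of \<nu> S y" if "y \<in> ?X" "x < y" for y
    proof (rule ccontr)
      assume "row_of \<nu> (q \<circ> S) y \<noteq> row_of \<nu> S y"
      then have "y \<in> ?N" using that(1) by blast
      then have "y \<le> x" unfolding x_def by (intro Max_ge) simp_all
      then show False using that(2) by simp
    qed
    have "row_of \<nu> (q \<circ> S) x < row_of \<nu> S x"
      by (rule standard_column_perm_row[OF S(1) q(1) x above])
    then have "R T S" unfolding R_def
    proof (intro bexI[of _ x] conjI ballI impI)
      fix y assume "y \<in> ?X" "x < y"
      then show "row_of \<nu> T y = row_of \<nu> S y" using row[of y] above[of y] by simp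
    qed (use row[OF x(1)] x(1) in simp_all)
    then show False using max[OF SA S(2)] by blast
  qed
  then have "(\<Sum>S\<in>standard_tableaux \<nu>. a S * polytabloid \<nu> S (tabloid \<nu> T)) = a T * polytabloid \<nu> T (tabloid \<nu> T)"
    using T by (subst sum.remove[OF finite_standard_tableaux, of T]) (simp_all add: sum.neutral)
  also have "polytabloid \<nu> T (tabloid \<nu> T) = 1"
    using polytabloid_value[OF standard_filling column_stabilizer_id[OF standard_filling], of T \<nu>] T by simp
  finally show False using zero T by simp
qed

section \<open>Representations of finite monoids\<close>

text \<open>Duality in coordinates: a function space that annihilates no nonzero vector restricts to
  all functions on \<open>B\<close>, hence contains a dual basis. The induction is Gaussian
  elimination at the point \<open>b0\<close>.\<close>

lemma dual_functions:
  fixes F :: "('b \<Rightarrow> complex) set"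
  assumes "finite B"
    and "\<And>f g. f \<in> F \<Longrightarrow> g \<in> F \<Longrightarrow> (\<lambda>b. f b + g b) \<in> F"
    and "\<And>a f. f \<in> F \<Longrightarrow> (\<lambda>b. a * f b) \<in> F"
    and "\<And>x. (\<And>f. f \<in> F \<Longrightarrow> (\<Sum>b\<in>B. x b * f b) = 0) \<Longrightarrow> (\<forall>b\<in>B. x b = 0)"
  shows "\<forall>b\<in>B. \<exists>f\<in>F. f b = 1 \<and> (\<forall>b'\<in>B - {b}. f b' = 0)"
  using assms
proof (induction B arbitrary: F rule: finite_induct)
  case empty
  then show ?case by simp
next
  case (insert b0 B)
  note add = insert.prems(1) and scl = insert.prems(2) and sep = insert.prems(3)
  have "\<exists>w\<in>F. w b0 \<noteq> 0"
  proof (rule ccontr)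
    assume "\<not> (\<exists>w\<in>F. w b0 \<noteq> 0)"
    then have z: "f b0 = 0" if "f \<in> F" for f using that by blast
    have "(\<Sum>b\<in>insert b0 B. (if b = b0 then 1 else 0) * f b) = 0" if "f \<in> F" for f
      using insert.hyps z[OF that] by (simp add: sum.neutral)
    from sep[of "\<lambda>b. if b = b0 then 1 else 0", OF this] show False by simp
  qed
  then obtain w where w: "w \<in> F" "w b0 \<noteq> 0" by blast
  define F0 where "F0 = {f \<in> F. f b0 = 0}"
  \<comment> \<open>Subtracting a multiple of the pivot \<open>w\<close> moves f into the functions
    vanishing at \<open>b0\<close>.\<close>
  have red: "(\<lambda>b. f b + (- f b0 / w b0) * w b) \<in> F0" if "f \<in> F" for f
    unfolding F0_def mem_Collect_eq by (rule conjI[OF add[OF that scl[OF w(1)]]]) (simp add: w(2))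
  have IH: "\<forall>b\<in>B. \<exists>f\<in>F0. f b = 1 \<and> (\<forall>b'\<in>B - {b}. f b' = 0)"
  proof (rule insert.IH)
    fix x :: "'b \<Rightarrow> complex"
    assume x: "\<And>f. f \<in> F0 \<Longrightarrow> (\<Sum>b\<in>B. x b * f b) = 0"
    \<comment> \<open>The value at \<open>b0\<close> is chosen so that the extended vector is
      orthogonal to the pivot \<open>w\<close> as well.\<close>
    define y where "y b = (if b = b0 then - (\<Sum>b\<in>B. x b * w b) / w b0 else x b)" for b
    have yB: "(\<Sum>b\<in>B. y b * f b) = (\<Sum>b\<in>B. x b * f b)" for f
      by (rule sum.cong) (use insert.hyps in \<open>auto simp: y_def\<close>)
    have "(\<Sum>b\<in>insert b0 B. y b * f b) = 0" if f: "f \<in> F" for f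
    proof -
      have "0 = (\<Sum>b\<in>B. x b * (f b + (- f b0 / w b0) * w b))" using x[OF red[OF f]] by simp
      also have "\<dots> = (\<Sum>b\<in>B. x b * f b) + (- f b0 / w b0) * (\<Sum>b\<in>B. x b * w b)"
        unfolding sum_distrib_left sum.distrib[symmetric]
        by (intro sum.cong refl) (simp only: ring_distribs mult_ac)
      finally show ?thesis using insert.hyps by (simp add: yB) (simp add: y_def field_simps)
    qed
    from sep[of y, OF this] have "\<forall>b\<in>B. y b = 0" by blast
    then show "\<forall>b\<in>B. x b = 0" using insert.hyps by (auto simp: y_def split: if_splits)
  qed (use add scl in \<open>auto simp: F0_def\<close>)
  then obtain g where g: "\<And>b. b \<in> B \<Longrightarrow> g b \<in> F0 \<and> g b b = 1 \<and> (\<forall>b'\<in>B - {b}. g b b' = 0)" by metis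
  show ?case
  proof
    fix b assume "b \<in> insert b0 B"
    then consider "b = b0" | "b \<in> B" by blast
    then show "\<exists>f\<in>F. f b = 1 \<and> (\<forall>b'\<in>insert b0 B - {b}. f b' = 0)"
    proof cases
      case 2
      then show ?thesis using g[OF 2] insert.hyps by (intro bexI[of _ "g b"]) (auto simp: F0_def)
    next
      case 1
      define f where "f = (\<lambda>b'. (1 / w b0) * w b')"
      have fF: "f \<in> F" "f b0 = 1" using scl[OF w(1), of "1 / w b0"] w(2) by (simp_all add: f_def)
      \<comment> \<open>The normalized pivot is cleared at the points of \<open>B\<close> one after
        another; the functions \<open>g c\<close> vanish at \<open>b0\<close>, so the value 1 there
        survives.\<close>
      have "\<exists>h\<in>F. h b0 = 1 \<and> (\<forall>b'\<in>C. h b' = 0) \<and> (\<forall>b'\<in>B - C. h b' = f b')" if "finite C" "C \<subseteq> B" for C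
        using that
      proof (induction C rule: finite_induct)
        case empty
        then show ?case using fF by blast
      next
        case (insert c C)
        then obtain h where h: "h \<in> F" "h b0 = 1" "\<forall>b'\<in>C. h b' = 0" "\<forall>b'\<in>B - C. h b' = f b'" by blast
        have cB: "c \<in> B" using insert.prems by simp
        note gc = g[OF cB]
        have gF: "g c \<in> F" "g c b0 = 0" using gc by (simp_all add: F0_def)
        have "(\<lambda>b. h b + (- h c) * g c b) \<in> F" by (rule add[OF h(1) scl[OF gF(1)]])
        then show ?case
        proof (rule bexI[rotated], intro conjI ballI)
          show "h b0 + (- h c) * g c b0 = 1" using h(2) gF(2) by simp
          fix b'
          { assume b': "b' \<in> insert c C"
            show "h b' + (- h c) * g c b' = 0"
            proof (cases "b' = c")
              case True
              then show ?thesis using gc by simp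
            next
              case False
              then have "b' \<in> C" "b' \<in> B - {c}" using b' insert.prems by blast+
              then show ?thesis using gc h(3) by simp
            qed }
          { assume b': "b' \<in> B - insert c C"
            then have "b' \<in> B - {c}" "b' \<in> B - C" by blast+
            then show "h b' + (- h c) * g c b' = f b'" using gc h(4) by simp }
        qed
      qed
      from this[OF insert.hyps(1) order_refl] show ?thesis using 1 by blast
    qed
  qed
qed

lemma vector_space_complex: "vector_space ((*) :: complex \<Rightarrow> complex \<Rightarrow> complex)"
  by unfold_locales (simp_all add: algebra_simps)

text \<open>The dimension counts also need that the family has no repetitions; a repetition v i = v
  j is excluded by the relation with coefficients 1 and -1.\<close>

lemma (in vector_space) independent_family:
  assumes fin: "finite A" and ind: "\<And>a. (\<Sum>i\<in>A. scale (a i) (v i)) = 0 \<Longrightarrow> \<forall>i\<in>A. a i = 0"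
  shows "inj_on v A \<and> independent (v ` A)"
proof
  show inj: "inj_on v A"
  proof (rule inj_onI, rule ccontr)
    fix i j assume ij: "i \<in> A" "j \<in> A" "v i = v j" "i \<noteq> j"
    let ?a = "\<lambda>k. (if k = i then 1 else 0) + (if k = j then - 1 else 0) :: 'a"
    have "(\<Sum>k\<in>A. scale (?a k) (v k)) = (\<Sum>k\<in>A. if k = i then v k else 0) + (\<Sum>k\<in>A. if k = j then - v k else 0)"
      unfolding sum.distrib[symmetric] by (rule sum.cong[OF refl]) (auto simp: scale_left_distrib)
    also have "\<dots> = 0" using fin ij by simp
    finally have "?a i = 0" using ind[of ?a] ij(1) by blast
    then show False using ij(4) by simp
  qed
  show "independent (v ` A)"
  proof (rule independent_if_scalars_zero)
    show "finite (v ` A)" using fin by simp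
    fix f x assume z: "(\<Sum>x\<in>v ` A. scale (f x) x) = 0" and x: "x \<in> v ` A"
    have "(\<Sum>i\<in>A. scale (f (v i)) (v i)) = 0" using z by (simp add: sum.reindex[OF inj])
    from ind[OF this] x show "f x = 0" by blast
  qed
qed

lemma sum_fun_scale_apply:
  "(\<Sum>q\<in>T. fun_scale (*) (a q) (g q)) s = (\<Sum>q\<in>T. a q * g q s :: complex)"
  by (induction T rule: infinite_finite_induct) (simp_all add: fun_scale_def)

locale monoid_rep = vector_space sc
  for sc :: "complex \<Rightarrow> 'v::ab_group_add \<Rightarrow> 'v" +
  fixes S :: "'s set" and mul :: "'s \<Rightarrow> 's \<Rightarrow> 's" and e :: 's and V :: "'v set" and act :: "'s \<Rightarrow> 'v \<Rightarrow> 'v"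
  assumes finite_S: "finite S" and mul_closed: "s \<in> S \<Longrightarrow> t \<in> S \<Longrightarrow> mul s t \<in> S" and e_in: "e \<in> S"
    and sub: "subspace V"
    and act_in: "s \<in> S \<Longrightarrow> v \<in> V \<Longrightarrow> act s v \<in> V"
    and act_add: "s \<in> S \<Longrightarrow> v \<in> V \<Longrightarrow> w \<in> V \<Longrightarrow> act s (v + w) = act s v + act s w"
    and act_scale: "s \<in> S \<Longrightarrow> v \<in> V \<Longrightarrow> act s (sc a v) = sc a (act s v)"
    and act_mul: "s \<in> S \<Longrightarrow> t \<in> S \<Longrightarrow> v \<in> V \<Longrightarrow> act (mul s t) v = act s (act t v)"
    and act_e: "v \<in> V \<Longrightarrow> act e v = v"
begin

text \<open>Elements of the monoid algebra are represented by coefficient functions, of which only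
  the values on \<open>S\<close> matter; \<open>conv\<close> is their product.\<close>

definition lact :: "('s \<Rightarrow> complex) \<Rightarrow> 'v \<Rightarrow> 'v" where
  "lact c v = (\<Sum>s\<in>S. sc (c s) (act s v))"

definition conv :: "('s \<Rightarrow> complex) \<Rightarrow> ('s \<Rightarrow> complex) \<Rightarrow> 's \<Rightarrow> complex" where
  "conv c d u = (\<Sum>(s, t)\<in>{(s, t) \<in> S \<times> S. mul s t = u}. c s * d t)"

definition irreducible :: bool where
  "irreducible \<longleftrightarrow> V \<noteq> {0} \<and> (\<forall>U. subspace U \<longrightarrow> U \<subseteq> V \<longrightarrow> (\<forall>s\<in>S. act s ` U \<subseteq> U) \<longrightarrow> U = {0} \<or> U = V)"

lemma zero_in: "0 \<in> V"
  by (rule subspace_0[OF sub])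

lemma lact_in: "v \<in> V \<Longrightarrow> lact c v \<in> V"
  unfolding lact_def by (intro subspace_sum[OF sub] subspace_scale[OF sub] act_in)

lemma lact_add: "v \<in> V \<Longrightarrow> w \<in> V \<Longrightarrow> lact c (v + w) = lact c v + lact c w"
  unfolding lact_def sum.distrib[symmetric]
  by (intro sum.cong refl) (simp add: act_add scale_right_distrib)

lemma lact_scale: "v \<in> V \<Longrightarrow> lact c (sc a v) = sc a (lact c v)"
  unfolding lact_def scale_sum_right by (intro sum.cong refl) (simp add: act_scale mult.commute)

lemma lact_zero: "lact c 0 = 0"
  using lact_scale[OF zero_in, of c 0] by simp

lemma lact_sum: "(\<And>i. i \<in> A \<Longrightarrow> v i \<in> V) \<Longrightarrow> lact c (\<Sum>i\<in>A. v i) = (\<Sum>i\<in>A. lact c (v i))"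
proof (induction A rule: infinite_finite_induct)
  case (insert x A)
  then show ?case by (simp add: lact_add subspace_sum[OF sub])
qed (simp_all add: lact_zero)

lemma lact_cong: "(\<And>s. s \<in> S \<Longrightarrow> c s = d s) \<Longrightarrow> lact c v = lact d v"
  unfolding lact_def by simp

lemma lact_plus_coeff: "lact (\<lambda>s. c s + d s) v = lact c v + lact d v"
  unfolding lact_def by (simp add: scale_left_distrib sum.distrib)

lemma lact_scale_coeff: "lact (\<lambda>s. a * c s) v = sc a (lact c v)"
  unfolding lact_def by (simp add: scale_sum_right)

lemma lact_sum_coeff: "lact (\<lambda>s. \<Sum>i\<in>A. c i s) v = (\<Sum>i\<in>A. lact (c i) v)"
  unfolding lact_def by (simp add: scale_sum_left sum.swap[of _ S])

lemma lact_single: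
  assumes "t \<in> S"
  shows "lact (\<lambda>s. if s = t then 1 else 0) v = act t v"
proof -
  have "lact (\<lambda>s. if s = t then 1 else 0) v = (\<Sum>s\<in>S. if s = t then act s v else 0)"
    unfolding lact_def by (intro sum.cong refl) simp
  then show ?thesis using assms finite_S by simp
qed

lemma act_sum:
  assumes s: "s \<in> S" and v: "\<And>i. i \<in> A \<Longrightarrow> v i \<in> V"
  shows "act s (\<Sum>i\<in>A. v i) = (\<Sum>i\<in>A. act s (v i))"
  using lact_sum[of A v "\<lambda>t. if t = s then 1 else 0", OF v] lact_single[OF s] by simp

lemma lact_conv:
  assumes v: "v \<in> V"
  shows "lact (conv c d) v = lact c (lact d v)"
proof -
  have "lact (conv c d) v = (\<Sum>u\<in>S. \<Sum>p\<in>{p \<in> S \<times> S. mul (fst p) (snd p) = u}. sc (c (fst p) * d (snd p)) (act (mul (fst p) (snd p)) v))"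
    unfolding lact_def conv_def scale_sum_left
    by (intro sum.cong refl) (auto simp: case_prod_beta)
  \<comment> \<open>The pairs were grouped by their product; closure under \<open>mul\<close>
    ensures that every pair belongs to a group.\<close>
  also have "\<dots> = (\<Sum>p\<in>S \<times> S. sc (c (fst p) * d (snd p)) (act (mul (fst p) (snd p)) v))"
    by (rule sum.group) (use finite_S mul_closed in auto)
  also have "\<dots> = (\<Sum>s\<in>S. \<Sum>t\<in>S. sc (c s * d t) (act (mul s t) v))"
    by (simp add: sum.cartesian_product case_prod_beta)
  also have "\<dots> = (\<Sum>s\<in>S. sc (c s) (act s (lact d v)))"
  proof (rule sum.cong[OF refl])
    fix s assume s: "s \<in> S"
    have "act s (lact d v) = (\<Sum>t\<in>S. sc (d t) (act (mul s t) v))"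
      unfolding lact_def using s v
      by (subst act_sum) (auto simp: act_scale act_in act_mul subspace_scale[OF sub] intro!: sum.cong)
    then show "(\<Sum>t\<in>S. sc (c s * d t) (act (mul s t) v)) = sc (c s) (act s (lact d v))"
      by (simp add: scale_sum_right)
  qed
  finally show ?thesis unfolding lact_def .
qed

lemma act_lact:
  assumes "s \<in> S" "v \<in> V"
  shows "act s (lact c v) = lact (conv (\<lambda>t. if t = s then 1 else 0) c) v"
  using lact_conv[OF assms(2)] lact_single[OF assms(1)] by simp

lemma irreducibleD:
  "irreducible \<Longrightarrow> subspace U \<Longrightarrow> U \<subseteq> V \<Longrightarrow> (\<And>s. s \<in> S \<Longrightarrow> act s ` U \<subseteq> U) \<Longrightarrow> U = {0} \<or> U = V"
  unfolding irreducible_def by blast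

text \<open>The images of \<open>v0\<close> under the monoid algebra form an invariant subspace, and
  the unit puts \<open>v0\<close> into it.\<close>

lemma cyclic:
  assumes irr: irreducible and v0: "v0 \<in> V" "v0 \<noteq> 0" and v: "v \<in> V"
  shows "\<exists>c. lact c v0 = v"
proof -
  let ?U = "range (\<lambda>c. lact c v0)"
  have "?U = {0} \<or> ?U = V"
  proof (rule irreducibleD[OF irr])
    have "x + y \<in> ?U" if "x \<in> ?U" "y \<in> ?U" for x y
      using that lact_plus_coeff[symmetric] by force
    moreover have "sc a x \<in> ?U" if "x \<in> ?U" for a x
      using that lact_scale_coeff[symmetric] by force
    moreover have "0 \<in> ?U" using lact_scale_coeff[of 0 "\<lambda>_. 0" v0] by (metis rangeI scale_zero_left)
    ultimately show "subspace ?U" unfolding subspace_def by blast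
    show "?U \<subseteq> V" using lact_in[OF v0(1)] by blast
    fix s assume "s \<in> S"
    then show "act s ` ?U \<subseteq> ?U" using act_lact[OF _ v0(1)] by blast
  qed
  moreover have "v0 \<in> ?U" using lact_single[OF e_in] act_e[OF v0(1)] by (metis rangeI)
  ultimately have "?U = V" using v0(2) by blast
  then show ?thesis using v by blast
qed

text \<open>Burnside's theorem started from a single operator of rank one: left factors move its
  image vector \<open>v0\<close> anywhere, and right factors turn the functional \<phi> into every
  functional, in particular into the one dual to \<open>b\<close>.\<close>

lemma matrix_unit:
  assumes irr: irreducible and B: "finite B" "independent B" "span B = V" "b \<in> B"
    and v: "v \<in> V" and v0: "v0 \<in> V" "v0 \<noteq> 0"
    and rank_one: "\<And>v. v \<in> V \<Longrightarrow> lact c v = sc (\<phi> v) v0" and nz: "\<phi> v0 \<noteq> 0"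
  shows "\<exists>a d. lact (conv a (conv c d)) b = v \<and> (\<forall>b'\<in>B - {b}. lact (conv a (conv c d)) b' = 0)"
proof -
  have BV: "b' \<in> V" if "b' \<in> B" for b' using span_base[OF that] B(3) by blast
  have \<phi>_add: "\<phi> (x + y) = \<phi> x + \<phi> y" if "x \<in> V" "y \<in> V" for x y
  proof -
    have "sc (\<phi> (x + y)) v0 = sc (\<phi> x + \<phi> y) v0"
      using rank_one[of x] rank_one[of y] rank_one[of "x + y"] that subspace_add[OF sub] lact_add[of x y c]
      by (simp add: scale_left_distrib)
    then show ?thesis using v0(2) by simp
  qed
  have \<phi>_scale: "\<phi> (sc a x) = a * \<phi> x" if "x \<in> V" for a x
  proof -
    have "sc (\<phi> (sc a x)) v0 = lact c (sc a x)" using rank_one[OF subspace_scale[OF sub that]] by simp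
    also have "\<dots> = sc a (sc (\<phi> x) v0)" using lact_scale[OF that] rank_one[OF that] by (simp only:)
    also have "\<dots> = sc (a * \<phi> x) v0" by simp
    finally have "sc (\<phi> (sc a x)) v0 = sc (a * \<phi> x) v0" .
    then show ?thesis using v0(2) by simp
  qed
  have \<phi>_0: "\<phi> 0 = 0" using \<phi>_scale[OF zero_in, of 0] by simp
  have \<phi>_sum: "\<phi> (\<Sum>i\<in>A. f i) = (\<Sum>i\<in>A. \<phi> (f i))" if "\<And>i. i \<in> A \<Longrightarrow> f i \<in> V" for A and f :: "'v \<Rightarrow> 'v"
    using that
  proof (induction A rule: infinite_finite_induct)
    case (insert x A)
    then show ?case by (simp add: \<phi>_add subspace_sum[OF sub])
  qed (simp_all add: \<phi>_0)
  \<comment> \<open>The common kernel of the functionals \<phi> after \<open>lact d\<close> is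
    invariant and misses \<open>v0\<close>, so irreducibility makes it zero.\<close>
  let ?U = "{w \<in> V. \<forall>d. \<phi> (lact d w) = 0}"
  have "?U = {0} \<or> ?U = V"
  proof (rule irreducibleD[OF irr])
    show "subspace ?U"
      unfolding subspace_def
      using zero_in subspace_add[OF sub] subspace_scale[OF sub]
      by (simp add: lact_zero \<phi>_0 lact_add lact_scale \<phi>_add \<phi>_scale lact_in)
    fix s assume s: "s \<in> S"
    show "act s ` ?U \<subseteq> ?U"
    proof clarify
      fix w assume w: "w \<in> V" "\<forall>d. \<phi> (lact d w) = 0"
      have "lact d (act s w) = lact (conv d (\<lambda>t. if t = s then 1 else 0)) w" for d
        using lact_conv[OF w(1)] lact_single[OF s] by simp
      then show "act s w \<in> V \<and> (\<forall>d. \<phi> (lact d (act s w)) = 0)" using w act_in[OF s] by simp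
    qed
  qed blast
  moreover have "v0 \<notin> ?U"
  proof
    assume "v0 \<in> ?U"
    then have "\<phi> (lact (\<lambda>s. if s = e then 1 else 0) v0) = 0" by blast
    then show False using nz unfolding lact_single[OF e_in] act_e[OF v0(1)] by simp
  qed
  ultimately have U0: "?U = {0}" using v0(1) by blast
  \<comment> \<open>Additivity of \<phi> is available on \<open>V\<close> only; cutting the
    functions off outside \<open>B\<close> makes their range closed under sums and
    multiples.\<close>
  have "\<forall>b\<in>B. \<exists>f\<in>range (\<lambda>d b. \<phi> (lact d b) * (if b \<in> B then 1 else 0)). f b = 1 \<and> (\<forall>b'\<in>B - {b}. f b' = 0)"
  proof (rule dual_functions[OF B(1)])
    fix f g assume "f \<in> range (\<lambda>d b. \<phi> (lact d b) * (if b \<in> B then 1 else 0))" "g \<in> range (\<lambda>d b. \<phi> (lact d b) * (if b \<in> B then 1 else 0))"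
    then obtain d d' where "f = (\<lambda>b. \<phi> (lact d b) * (if b \<in> B then 1 else 0))" "g = (\<lambda>b. \<phi> (lact d' b) * (if b \<in> B then 1 else 0))" by blast
    then have "(\<lambda>b. f b + g b) = (\<lambda>b. \<phi> (lact (\<lambda>s. d s + d' s) b) * (if b \<in> B then 1 else 0))"
      by (auto simp: fun_eq_iff lact_plus_coeff \<phi>_add lact_in BV)
    then show "(\<lambda>b. f b + g b) \<in> range (\<lambda>d b. \<phi> (lact d b) * (if b \<in> B then 1 else 0))" by simp
  next
    fix a f assume "f \<in> range (\<lambda>d b. \<phi> (lact d b) * (if b \<in> B then 1 else 0))"
    then obtain d where "f = (\<lambda>b. \<phi> (lact d b) * (if b \<in> B then 1 else 0))" by blast
    then have "(\<lambda>b. a * f b) = (\<lambda>b. \<phi> (lact (\<lambda>s. a * d s) b) * (if b \<in> B then 1 else 0))"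
      by (auto simp: fun_eq_iff lact_scale_coeff \<phi>_scale lact_in BV)
    then show "(\<lambda>b. a * f b) \<in> range (\<lambda>d b. \<phi> (lact d b) * (if b \<in> B then 1 else 0))" by simp
  next
    fix x :: "'v \<Rightarrow> complex"
    assume x: "\<And>f. f \<in> range (\<lambda>d b. \<phi> (lact d b) * (if b \<in> B then 1 else 0)) \<Longrightarrow> (\<Sum>b\<in>B. x b * f b) = 0"
    let ?w = "\<Sum>b\<in>B. sc (x b) b"
    have wV: "?w \<in> V" by (intro subspace_sum[OF sub] subspace_scale[OF sub] BV)
    have "\<phi> (lact d ?w) = 0" for d
    proof -
      have "lact d ?w = (\<Sum>b\<in>B. sc (x b) (lact d b))"
        using BV by (subst lact_sum) (auto simp: lact_scale subspace_scale[OF sub] intro!: sum.cong)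
      also have "\<phi> \<dots> = (\<Sum>b\<in>B. x b * \<phi> (lact d b))"
        using BV by (subst \<phi>_sum) (auto simp: \<phi>_scale lact_in subspace_scale[OF sub] intro!: sum.cong)
      also have "\<dots> = (\<Sum>b\<in>B. x b * (\<phi> (lact d b) * (if b \<in> B then 1 else 0)))"
        by (intro sum.cong refl) simp
      also have "\<dots> = 0" by (rule x) blast
      finally show ?thesis .
    qed
    then have "?w = 0" using U0 wV by blast
    then show "\<forall>b\<in>B. x b = 0" using independentD[OF B(2,1) order_refl] by blast
  qed
  then obtain d where d: "\<phi> (lact d b) = 1" "\<And>b'. b' \<in> B - {b} \<Longrightarrow> \<phi> (lact d b') = 0"
    using B(4) by fastforce
  obtain a where a: "lact a v0 = v" using cyclic[OF irr v0 v] by blast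
  have "lact (conv a (conv c d)) b' = sc (\<phi> (lact d b')) v" if "b' \<in> B" for b'
    using BV[OF that] a by (simp add: lact_conv rank_one lact_in lact_scale v0(1))
  then have "lact (conv a (conv c d)) b = v \<and> (\<forall>b'\<in>B - {b}. lact (conv a (conv c d)) b' = 0)"
    using d B(4) by simp
  then show ?thesis by blast
qed

end

text \<open>The assumption \<open>separating\<close> is a triangular form of orthogonality: some
  algebra element has rank one on \<open>V i\<close> and vanishes on all other members of at most
  the same rank, while nothing is said about members of larger rank. The condition
  \<open>\<phi> v0 \<noteq> 0\<close> makes the rank-one operator non-nilpotent.\<close>

locale monoid_rep_family =
  fixes sc :: "complex \<Rightarrow> 'v::ab_group_add \<Rightarrow> 'v" and S :: "'s set" and mul e
    and A :: "'i set" and V :: "'i \<Rightarrow> 'v set" and act :: "'i \<Rightarrow> 's \<Rightarrow> 'v \<Rightarrow> 'v" and rank :: "'i \<Rightarrow> nat"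
    and B :: "'i \<Rightarrow> 'v set"
  assumes finite_A: "finite A"
    and rep: "i \<in> A \<Longrightarrow> monoid_rep sc S mul e (V i) (act i)"
    and irr: "i \<in> A \<Longrightarrow> monoid_rep.irreducible sc S (V i) (act i)"
    and basis: "i \<in> A \<Longrightarrow> finite (B i)" "i \<in> A \<Longrightarrow> \<not> module.dependent sc (B i)" "i \<in> A \<Longrightarrow> module.span sc (B i) = V i"
    and separating: "i \<in> A \<Longrightarrow> \<exists>c v0 \<phi>. v0 \<in> V i \<and> v0 \<noteq> 0 \<and> \<phi> v0 \<noteq> 0 \<and>
        (\<forall>v\<in>V i. monoid_rep.lact sc S (act i) c v = sc (\<phi> v) v0) \<and>
        (\<forall>j\<in>A. j \<noteq> i \<longrightarrow> rank j \<le> rank i \<longrightarrow> (\<forall>v\<in>V j. monoid_rep.lact sc S (act j) c v = 0))"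
begin

abbreviation "la i \<equiv> monoid_rep.lact sc S (act i)"

lemma basis_in: "i \<in> A \<Longrightarrow> b \<in> B i \<Longrightarrow> b \<in> V i"
proof -
  assume i: "i \<in> A" and b: "b \<in> B i"
  interpret monoid_rep sc S mul e "V i" "act i" by (rule rep[OF i])
  show ?thesis using span_base[OF b] basis(3)[OF i] by blast
qed

text \<open>Multiplying the separating element on both sides produces all matrix units of
  \<open>V i\<close> and keeps it zero wherever it was zero.\<close>

lemma triangular_unit:
  assumes i: "i \<in> A" and b: "b \<in> B i" and v: "v \<in> V i"
  shows "\<exists>c. la i c b = v \<and> (\<forall>b'\<in>B i - {b}. la i c b' = 0) \<and>
      (\<forall>j\<in>A. j \<noteq> i \<longrightarrow> rank j \<le> rank i \<longrightarrow> (\<forall>w\<in>V j. la j c w = 0))"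
proof -
  interpret R: monoid_rep sc S mul e "V i" "act i" by (rule rep[OF i])
  obtain c v0 \<phi> where c: "v0 \<in> V i" "v0 \<noteq> 0" "\<phi> v0 \<noteq> 0" "\<And>v. v \<in> V i \<Longrightarrow> la i c v = sc (\<phi> v) v0"
    and van: "\<And>j v. j \<in> A \<Longrightarrow> j \<noteq> i \<Longrightarrow> rank j \<le> rank i \<Longrightarrow> v \<in> V j \<Longrightarrow> la j c v = 0"
    using separating[OF i] by blast
  obtain a d where ad: "la i (R.conv a (R.conv c d)) b = v" "\<forall>b'\<in>B i - {b}. la i (R.conv a (R.conv c d)) b' = 0"
    using R.matrix_unit[OF irr[OF i] basis[OF i] b v c(1,2,4,3)] by blast
  have "la j (R.conv a (R.conv c d)) w = 0" if j: "j \<in> A" "j \<noteq> i" "rank j \<le> rank i" "w \<in> V j" for j w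
  proof -
    interpret Q: monoid_rep sc S mul e "V j" "act j" by (rule rep[OF j(1)])
    show ?thesis using j by (simp add: Q.lact_conv Q.lact_in van Q.lact_zero)
  qed
  then show ?thesis using ad by blast
qed

text \<open>A density theorem for the whole family. Members are added in order of increasing rank,
  so that the matrix units correcting the newest member do not disturb the earlier ones.\<close>

lemma joint_surjective:
  assumes "\<And>i b. i \<in> A \<Longrightarrow> b \<in> B i \<Longrightarrow> \<tau> i b \<in> V i"
  shows "\<exists>c. \<forall>i\<in>A. \<forall>b\<in>B i. la i c b = \<tau> i b"
proof -
  have "J \<subseteq> A \<longrightarrow> (\<exists>c. \<forall>i\<in>J. \<forall>b\<in>B i. la i c b = \<tau> i b)" if "finite J" for J
    using that
  proof (induction J rule: finite_ranking_induct[where f = rank])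
    case empty
    then show ?case by simp
  next
    case (insert x J)
    show ?case
    proof (cases "x \<in> J \<or> \<not> insert x J \<subseteq> A")
      case True
      then show ?thesis using insert.IH by (auto simp: insert_absorb)
    next
      case False
      then have x: "x \<in> A" "x \<notin> J" and J: "J \<subseteq> A" by blast+
      interpret R: monoid_rep sc S mul e "V x" "act x" by (rule rep[OF x(1)])
      obtain c0 where c0: "\<And>i b. i \<in> J \<Longrightarrow> b \<in> B i \<Longrightarrow> la i c0 b = \<tau> i b" using insert.IH J by blast
      \<comment> \<open>For each basis vector, a unit that supplies the defect left there by
        \<open>c0\<close> and contributes nothing at the other basis vectors.\<close>
      have "\<forall>b\<in>B x. \<exists>c. la x c b = \<tau> x b - la x c0 b \<and> (\<forall>b'\<in>B x - {b}. la x c b' = 0) \<and>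
          (\<forall>j\<in>A. j \<noteq> x \<longrightarrow> rank j \<le> rank x \<longrightarrow> (\<forall>w\<in>V j. la j c w = 0))"
        by (intro ballI triangular_unit x(1) R.subspace_diff[OF R.sub] assms R.lact_in basis_in)
      from bchoice[OF this] obtain C where C: "\<And>b. b \<in> B x \<Longrightarrow> la x (C b) b = \<tau> x b - la x c0 b"
        "\<And>b b'. b \<in> B x \<Longrightarrow> b' \<in> B x - {b} \<Longrightarrow> la x (C b) b' = 0"
        "\<And>b j w. b \<in> B x \<Longrightarrow> j \<in> A \<Longrightarrow> j \<noteq> x \<Longrightarrow> rank j \<le> rank x \<Longrightarrow> w \<in> V j \<Longrightarrow> la j (C b) w = 0"
        by blast
      let ?c = "\<lambda>s. c0 s + (\<Sum>b\<in>B x. C b s)"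
      have "la x ?c b = \<tau> x b" if b: "b \<in> B x" for b
      proof -
        have "(\<Sum>b'\<in>B x. la x (C b') b) = la x (C b) b + (\<Sum>b'\<in>B x - {b}. la x (C b') b)"
          by (rule sum.remove[OF basis(1)[OF x(1)] b])
        also have "(\<Sum>b'\<in>B x - {b}. la x (C b') b) = 0"
          by (intro sum.neutral ballI C(2)) (use b in blast)+
        finally show ?thesis unfolding R.lact_plus_coeff R.lact_sum_coeff using C(1)[OF b] by simp
      qed
      moreover have "la j ?c b = \<tau> j b" if j: "j \<in> J" "b \<in> B j" for j b
      proof -
        have jA: "j \<in> A" "j \<noteq> x" using j x J by blast+
        interpret Q: monoid_rep sc S mul e "V j" "act j" by (rule rep[OF jA(1)])
        have "(\<Sum>b'\<in>B x. la j (C b') b) = 0"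
          by (intro sum.neutral ballI C(3) jA insert.hyps(2) j(1) basis_in j(2))
        then show ?thesis unfolding Q.lact_plus_coeff Q.lact_sum_coeff using c0[OF j] by simp
      qed
      ultimately have "\<forall>i\<in>insert x J. \<forall>b\<in>B i. la i ?c b = \<tau> i b" by blast
      then show ?thesis by blast
    qed
  qed
  from this[OF finite_A] show ?thesis by blast
qed

section \<open>Matrix units and the bound for the sum of squared dimensions\<close>

definition units :: "('i \<times> 'v \<times> 'v) set" where
  "units = (SIGMA i:A. B i \<times> B i)"

text \<open>Elements acting as the elementary matrix from \<open>b\<close> to \<open>b'\<close> on
  the member \<open>i\<close> and as zero on the others. They are cut off outside \<open>S\<close>,
  so that they can be counted inside the space of functions supported on \<open>S\<close>.\<close>

definition unit_coeff :: "'i \<times> 'v \<times> 'v \<Rightarrow> 's \<Rightarrow> complex" where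
  "unit_coeff = (SOME E. \<forall>(i, b, b')\<in>units. (\<forall>s. s \<notin> S \<longrightarrow> E (i, b, b') s = 0) \<and>
     (\<forall>j\<in>A. \<forall>b1\<in>B j. la j (E (i, b, b')) b1 = (if j = i \<and> b1 = b then b' else 0)))"

lemma finite_units: "finite units"
  unfolding units_def using finite_A basis(1) by blast

lemma unit_coeff:
  assumes "(i, b, b') \<in> units"
  shows "s \<notin> S \<Longrightarrow> unit_coeff (i, b, b') s = 0"
    and "j \<in> A \<Longrightarrow> b1 \<in> B j \<Longrightarrow> la j (unit_coeff (i, b, b')) b1 = (if j = i \<and> b1 = b then b' else 0)"
proof -
  let ?P = "\<lambda>q E. (\<forall>s. s \<notin> S \<longrightarrow> E s = 0) \<and>
     (\<forall>j\<in>A. \<forall>b1\<in>B j. la j E b1 = (if j = fst q \<and> b1 = fst (snd q) then snd (snd q) else 0))"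
  have "\<forall>q\<in>units. \<exists>E. ?P q E"
  proof
    fix q assume q: "q \<in> units"
    obtain i b b' where qe: "q = (i, b, b')" by (rule prod_cases3)
    have i: "i \<in> A" "b \<in> B i" "b' \<in> B i" using q by (simp_all add: units_def qe)
    have "(if j = i \<and> b1 = b then b' else 0) \<in> V j" if "j \<in> A" for j b1
      using monoid_rep.zero_in[OF rep[OF that]] basis_in[OF i(1,3)] by simp
    then obtain c where c: "\<And>j b1. j \<in> A \<Longrightarrow> b1 \<in> B j \<Longrightarrow> la j c b1 = (if j = i \<and> b1 = b then b' else 0)"
      using joint_surjective[of "\<lambda>j b1. if j = i \<and> b1 = b then b' else 0"] by blast
    have "la j (\<lambda>s. if s \<in> S then c s else 0) b1 = la j c b1" if "j \<in> A" for j b1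
      by (rule monoid_rep.lact_cong[OF rep[OF that]]) simp
    then have "?P q (\<lambda>s. if s \<in> S then c s else 0)" using c by (simp add: qe)
    then show "\<exists>E. ?P q E" by (rule exI[of "?P q" "\<lambda>s. if s \<in> S then c s else 0"])
  qed
  from bchoice[OF this] obtain E where "\<forall>q\<in>units. ?P q (E q)" by blast
  then have "\<exists>E. \<forall>(i, b, b')\<in>units. (\<forall>s. s \<notin> S \<longrightarrow> E (i, b, b') s = 0) \<and>
     (\<forall>j\<in>A. \<forall>b1\<in>B j. la j (E (i, b, b')) b1 = (if j = i \<and> b1 = b then b' else 0))"
    by (intro exI[of _ E]) fastforce
  from someI_ex[OF this, folded unit_coeff_def] assms
  have "(\<forall>s. s \<notin> S \<longrightarrow> unit_coeff (i, b, b') s = 0) \<and>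
     (\<forall>j\<in>A. \<forall>b1\<in>B j. la j (unit_coeff (i, b, b')) b1 = (if j = i \<and> b1 = b then b' else 0))" by blast
  then show "s \<notin> S \<Longrightarrow> unit_coeff (i, b, b') s = 0"
    and "j \<in> A \<Longrightarrow> b1 \<in> B j \<Longrightarrow> la j (unit_coeff (i, b, b')) b1 = (if j = i \<and> b1 = b then b' else 0)"
    by blast+
qed

lemma la_units:
  assumes j: "j \<in> A" "b \<in> B j"
  shows "la j (\<lambda>s. \<Sum>q\<in>units. a q * unit_coeff q s) b = (\<Sum>b'\<in>B j. sc (a (j, b, b')) b')"
proof -
  interpret R: monoid_rep sc S mul e "V j" "act j" by (rule rep[OF j(1)])
  have "la j (\<lambda>s. \<Sum>q\<in>units. a q * unit_coeff q s) b = (\<Sum>q\<in>units. sc (a q) (la j (unit_coeff q) b))"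
    unfolding R.lact_sum_coeff R.lact_scale_coeff ..
  also have "\<dots> = (\<Sum>q\<in>(\<lambda>b'. (j, b, b')) ` B j. sc (a q) (la j (unit_coeff q) b))"
  proof (rule sum.mono_neutral_right[OF finite_units])
    show "(\<lambda>b'. (j, b, b')) ` B j \<subseteq> units" using j by (auto simp: units_def)
    show "\<forall>q\<in>units - (\<lambda>b'. (j, b, b')) ` B j. sc (a q) (la j (unit_coeff q) b) = 0"
    proof
      fix q assume q: "q \<in> units - (\<lambda>b'. (j, b, b')) ` B j"
      obtain i b1 b2 where qe: "q = (i, b1, b2)" by (rule prod_cases3)
      have "\<not> (j = i \<and> b = b1)" using q by (auto simp: qe units_def)
      then have "la j (unit_coeff q) b = 0" using unit_coeff(2)[of i b1 b2, OF _ j] q by (auto simp: qe)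
      then show "sc (a q) (la j (unit_coeff q) b) = 0" by simp
    qed
  qed
  also have "\<dots> = (\<Sum>b'\<in>B j. sc (a (j, b, b')) (la j (unit_coeff (j, b, b')) b))"
    by (subst sum.reindex) (auto simp: inj_on_def)
  also have "\<dots> = (\<Sum>b'\<in>B j. sc (a (j, b, b')) b')"
    by (intro sum.cong refl) (use unit_coeff(2) j in \<open>simp add: units_def\<close>)
  finally show ?thesis .
qed

text \<open>Letting the combination act on a basis vector b displays the coefficients with source b
  as coordinates with respect to a basis.\<close>

lemma units_independent:
  assumes "\<And>j b. j \<in> A \<Longrightarrow> b \<in> B j \<Longrightarrow> la j (\<lambda>s. \<Sum>q\<in>units. a q * unit_coeff q s) b = 0"
  shows "\<forall>q\<in>units. a q = 0"
proof
  fix q assume q: "q \<in> units"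
  obtain i b b' where qe: "q = (i, b, b')" by (rule prod_cases3)
  have i: "i \<in> A" "b \<in> B i" "b' \<in> B i" using q by (simp_all add: units_def qe)
  interpret R: monoid_rep sc S mul e "V i" "act i" by (rule rep[OF i(1)])
  have "(\<Sum>b'\<in>B i. sc (a (i, b, b')) b') = 0" using assms[OF i(1,2)] la_units[OF i(1,2)] by simp
  from R.independentD[OF basis(2,1)[OF i(1)] order_refl this i(3)] show "a q = 0" by (simp add: qe)
qed

lemma unit_family:
  "inj_on unit_coeff units \<and> \<not> module.dependent (fun_scale (*)) (unit_coeff ` units)"
proof -
  interpret F: vector_space "fun_scale (*) :: complex \<Rightarrow> ('s \<Rightarrow> complex) \<Rightarrow> 's \<Rightarrow> complex"
    by (rule vector_space_fun_scale[OF vector_space_complex])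
  show ?thesis
  proof (rule F.independent_family[OF finite_units])
    fix a assume z: "(\<Sum>q\<in>units. fun_scale (*) (a q) (unit_coeff q)) = 0"
    have "(\<Sum>q\<in>units. a q * unit_coeff q s) = 0" for s
      unfolding sum_fun_scale_apply[symmetric] z by simp
    then have "la j (\<lambda>s. \<Sum>q\<in>units. a q * unit_coeff q s) b = 0" if "j \<in> A" for j b
    proof -
      interpret R: monoid_rep sc S mul e "V j" "act j" by (rule rep[OF that])
      assume "\<And>s. (\<Sum>q\<in>units. a q * unit_coeff q s) = 0"
      then show ?thesis by (simp add: R.lact_def)
    qed
    then show "\<forall>q\<in>units. a q = 0" by (rule units_independent)
  qed
qed

lemma function_in_span_singles:
  assumes "finite S" "\<And>s. s \<notin> S \<Longrightarrow> c s = 0"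
  shows "c \<in> module.span (fun_scale (*)) ((\<lambda>t s. if s = t then 1 else 0) ` S :: ('s \<Rightarrow> complex) set)"
proof -
  interpret F: vector_space "fun_scale (*) :: complex \<Rightarrow> ('s \<Rightarrow> complex) \<Rightarrow> 's \<Rightarrow> complex"
    by (rule vector_space_fun_scale[OF vector_space_complex])
  have ev: "(\<Sum>t\<in>T. fun_scale (*) (c t) (\<lambda>s. if s = t then 1 else 0)) s = (\<Sum>t\<in>T. if s = t then c t else 0)" for s T
    unfolding sum_fun_scale_apply by (intro sum.cong refl) simp
  have "c = (\<Sum>t\<in>S. fun_scale (*) (c t) (\<lambda>s. if s = t then 1 else 0))"
    unfolding fun_eq_iff ev using assms by simp
  also have "\<dots> \<in> F.span ((\<lambda>t s. if s = t then 1 else 0) ` S)"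
    by (intro F.span_sum F.span_scale F.span_base imageI)
  finally show ?thesis .
qed

lemma card_units: "card units = (\<Sum>i\<in>A. card (B i) ^ 2)"
  unfolding units_def using finite_A basis(1) by (simp add: card_SigmaI card_cartesian_product power2_eq_square)

text \<open>The matrix units are independent elements of a space spanned by \<open>card S\<close>
  point masses.\<close>

lemma sum_dim_squares_le:
  assumes "finite S"
  shows "(\<Sum>i\<in>A. card (B i) ^ 2) \<le> card S"
proof -
  interpret F: vector_space "fun_scale (*) :: complex \<Rightarrow> ('s \<Rightarrow> complex) \<Rightarrow> 's \<Rightarrow> complex"
    by (rule vector_space_fun_scale[OF vector_space_complex])
  let ?D = "(\<lambda>t s. if s = t then 1 else 0) ` S :: ('s \<Rightarrow> complex) set"
  have "unit_coeff ` units \<subseteq> F.span ?D"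
    using function_in_span_singles[OF assms] unit_coeff(1) by force
  then have "card (unit_coeff ` units) \<le> card ?D"
    using F.independent_span_bound[of ?D "unit_coeff ` units"] unit_family assms by blast
  also have "\<dots> \<le> card S" by (rule card_image_le[OF assms])
  finally show ?thesis using unit_family by (simp add: card_image card_units)
qed

text \<open>Once the squared dimensions fill \<open>card S\<close>, adjoining a further independent
  function would exceed the bound.\<close>

lemma units_span:
  assumes "finite S" "(\<Sum>i\<in>A. card (B i) ^ 2) = card S" and c: "\<And>s. s \<notin> S \<Longrightarrow> c s = 0"
  shows "\<exists>a. c = (\<lambda>s. \<Sum>q\<in>units. a q * unit_coeff q s)"
proof -
  interpret F: vector_space "fun_scale (*) :: complex \<Rightarrow> ('s \<Rightarrow> complex) \<Rightarrow> 's \<Rightarrow> complex"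
    by (rule vector_space_fun_scale[OF vector_space_complex])
  let ?D = "(\<lambda>t s. if s = t then 1 else 0) ` S :: ('s \<Rightarrow> complex) set" and ?U = "unit_coeff ` units"
  note ind = unit_family[THEN conjunct2] and inj = unit_family[THEN conjunct1]
  have sub: "?U \<subseteq> F.span ?D"
    using function_in_span_singles[OF assms(1)] unit_coeff(1) by force
  have "c \<in> F.span ?U"
  proof (rule ccontr)
    assume n: "c \<notin> F.span ?U"
    then have ind': "\<not> F.dependent (insert c ?U)" using ind by (rule F.independent_insertI)
    have "c \<in> F.span ?D" by (rule function_in_span_singles[OF assms(1) c])
    then have "insert c ?U \<subseteq> F.span ?D" using sub by (rule insert_subsetI)
    from F.independent_span_bound[OF finite_imageI[OF assms(1)] ind' this]
    have "card (insert c ?U) \<le> card ?D" by (rule conjunct2)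
    also have "\<dots> \<le> card S" by (rule card_image_le[OF assms(1)])
    also have "\<dots> = card ?U" using assms(2) by (simp add: card_image[OF inj] card_units)
    finally have "card (insert c ?U) \<le> card ?U" .
    moreover have "c \<notin> ?U" using n F.span_base by blast
    ultimately show False using finite_units by simp
  qed
  then obtain u where u: "c = (\<Sum>x\<in>?U. fun_scale (*) (u x) x)"
    using F.span_finite[of ?U] finite_units by auto
  have "c = (\<lambda>s. \<Sum>q\<in>units. u (unit_coeff q) * unit_coeff q s)"
    unfolding u sum.reindex[OF inj] o_def fun_eq_iff sum_fun_scale_apply by simp
  then show ?thesis by (intro exI[of _ "\<lambda>q. u (unit_coeff q)"])
qed

text \<open>Under equality the monoid algebra acts faithfully on the family: a difference acting as
  zero is a combination of units, and its coefficients vanish.\<close>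

lemma coeff_unique:
  assumes fin: "finite S" and cnt: "(\<Sum>i\<in>A. card (B i) ^ 2) = card S"
    and c: "\<And>s. s \<notin> S \<Longrightarrow> c s = 0" and d: "\<And>s. s \<notin> S \<Longrightarrow> d s = 0"
    and eq: "\<And>j b. j \<in> A \<Longrightarrow> b \<in> B j \<Longrightarrow> la j c b = la j d b"
  shows "c = d"
proof -
  obtain a where a: "(\<lambda>s. c s + (- 1) * d s) = (\<lambda>s. \<Sum>q\<in>units. a q * unit_coeff q s)"
    using units_span[OF fin cnt, of "\<lambda>s. c s + (- 1) * d s"] c d by auto
  have "\<forall>q\<in>units. a q = 0"
  proof (rule units_independent)
    fix j b assume j: "j \<in> A" "b \<in> B j"
    interpret R: monoid_rep sc S mul e "V j" "act j" by (rule rep[OF j(1)])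
    show "la j (\<lambda>s. \<Sum>q\<in>units. a q * unit_coeff q s) b = 0"
      unfolding a[symmetric] R.lact_plus_coeff R.lact_scale_coeff eq[OF j] by simp
  qed
  then have "c s + (- 1) * d s = 0" for s
    using fun_cong[OF a, of s] by simp
  then show ?thesis by (simp add: fun_eq_iff)
qed

text \<open>The unit of the monoid is a combination of matrix units, so one of them acts
  nontrivially on the given irreducible \<open>W\<close>. The matrix units with the same source span
  a left ideal isomorphic to \<open>V i\<close>, and applying this ideal to a vector of
  \<open>W\<close> gives a nonzero intertwiner.\<close>

theorem complete:
  assumes cnt: "(\<Sum>i\<in>A. card (B i) ^ 2) = card S"
    and R: "monoid_rep sr S mul e W rho" and irrR: "monoid_rep.irreducible sr S W rho"
  shows "\<exists>i\<in>A. \<exists>f \<in> linear_maps sc (V i) sr W. bij_betw f (V i) W \<and> (\<forall>s\<in>S. \<forall>v\<in>V i. f (act i s v) = rho s (f v))"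
proof -
  interpret R: monoid_rep sr S mul e W rho by (rule R)
  note fin = R.finite_S
  obtain w where w: "w \<in> W" "w \<noteq> 0" using irrR R.zero_in unfolding R.irreducible_def by blast
  have "\<exists>q\<in>units. R.lact (unit_coeff q) w \<noteq> 0"
  proof (rule ccontr)
    assume "\<not> ?thesis"
    then have z: "R.lact (unit_coeff q) w = 0" if "q \<in> units" for q using that by blast
    have "\<And>s. s \<notin> S \<Longrightarrow> (if s = e then 1 else 0 :: complex) = 0" using R.e_in by auto
    then obtain a where a: "(\<lambda>s. if s = e then 1 else 0) = (\<lambda>s. \<Sum>q\<in>units. a q * unit_coeff q s)"
      using units_span[OF fin cnt, of "\<lambda>s. if s = e then 1 else 0"] by blast
    have "w = R.lact (\<lambda>s. if s = e then 1 else 0) w" using R.lact_single[OF R.e_in] R.act_e[OF w(1)] by simp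
    also have "\<dots> = (\<Sum>q\<in>units. sr (a q) (R.lact (unit_coeff q) w))"
      unfolding a R.lact_sum_coeff R.lact_scale_coeff ..
    also have "\<dots> = 0" using z by (intro sum.neutral) simp
    finally show False using w(2) by simp
  qed
  then obtain i b b0 where q: "(i, b, b0) \<in> units" and nz: "R.lact (unit_coeff (i, b, b0)) w \<noteq> 0"
    by (metis prod_cases3)
  have i: "i \<in> A" "b \<in> B i" "b0 \<in> B i" using q by (simp_all add: units_def)
  interpret Q: monoid_rep sc S mul e "V i" "act i" by (rule rep[OF i(1)])
  \<comment> \<open>The element c sends the fixed basis vector \<open>b\<close> of member
    \<open>i\<close> to v and kills every other basis vector of the family. As v varies, such
    elements form the left ideal modelled on \<open>V i\<close>.\<close>
  define good where "good v c \<longleftrightarrow> (\<forall>s. s \<notin> S \<longrightarrow> c s = 0) \<and>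
      (\<forall>j\<in>A. \<forall>b1\<in>B j. la j c b1 = (if j = i \<and> b1 = b then v else 0))" for v c
  have ex: "\<exists>c. good v c" if v: "v \<in> V i" for v
  proof -
    have "(if j = i \<and> b1 = b then v else 0) \<in> V j" if "j \<in> A" for j b1
      using monoid_rep.zero_in[OF rep[OF that]] v by simp
    then obtain c where c: "\<And>j b1. j \<in> A \<Longrightarrow> b1 \<in> B j \<Longrightarrow> la j c b1 = (if j = i \<and> b1 = b then v else 0)"
      using joint_surjective[of "\<lambda>j b1. if j = i \<and> b1 = b then v else 0"] by blast
    have "la j (\<lambda>s. if s \<in> S then c s else 0) b1 = la j c b1" if "j \<in> A" for j b1
      by (rule monoid_rep.lact_cong[OF rep[OF that]]) simp
    then have "good v (\<lambda>s. if s \<in> S then c s else 0)" using c by (simp add: good_def)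
    then show ?thesis by blast
  qed
  define C where "C v = (SOME c. good v c)" for v
  have C: "good v (C v)" if "v \<in> V i" for v unfolding C_def by (rule someI_ex[OF ex[OF that]])
  \<comment> \<open>Faithfulness makes the choice canonical. Linearity and equivariance of
    \<open>f\<close> thereby reduce to checking that a given element is good.\<close>
  have C_eq: "C v = c" if "v \<in> V i" "good v c" for v c
    by (rule coeff_unique[OF fin cnt]) (use C[OF that(1)] that(2) in \<open>simp_all add: good_def\<close>)
  define f where "f v = R.lact (C v) w" for v
  have f_in: "f v \<in> W" for v unfolding f_def by (rule R.lact_in[OF w(1)])
  have f_add: "f (x + y) = f x + f y" if xy: "x \<in> V i" "y \<in> V i" for x y
  proof -
    have "good (x + y) (\<lambda>s. C x s + C y s)"
      unfolding good_def
    proof (intro conjI allI impI ballI)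
      fix s assume "s \<notin> S"
      then show "C x s + C y s = 0" using C[OF xy(1)] C[OF xy(2)] by (simp add: good_def)
    next
      fix j b1 assume j: "j \<in> A" "b1 \<in> B j"
      interpret P: monoid_rep sc S mul e "V j" "act j" by (rule rep[OF j(1)])
      show "la j (\<lambda>s. C x s + C y s) b1 = (if j = i \<and> b1 = b then x + y else 0)"
        unfolding P.lact_plus_coeff using C[OF xy(1)] C[OF xy(2)] j by (simp add: good_def)
    qed
    from C_eq[OF Q.subspace_add[OF Q.sub xy] this] show ?thesis
      unfolding f_def by (simp add: R.lact_plus_coeff)
  qed
  have f_scale: "f (sc a x) = sr a (f x)" if x: "x \<in> V i" for a x
  proof -
    have "good (sc a x) (\<lambda>s. a * C x s)"
      unfolding good_def
    proof (intro conjI allI impI ballI)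
      fix s assume "s \<notin> S"
      then show "a * C x s = 0" using C[OF x] by (simp add: good_def)
    next
      fix j b1 assume j: "j \<in> A" "b1 \<in> B j"
      interpret P: monoid_rep sc S mul e "V j" "act j" by (rule rep[OF j(1)])
      show "la j (\<lambda>s. a * C x s) b1 = (if j = i \<and> b1 = b then sc a x else 0)"
        unfolding P.lact_scale_coeff using C[OF x] j by (simp add: good_def)
    qed
    from C_eq[OF Q.subspace_scale[OF Q.sub x] this] show ?thesis
      unfolding f_def by (simp add: R.lact_scale_coeff)
  qed
  have f_act: "f (act i s x) = rho s (f x)" if s: "s \<in> S" and x: "x \<in> V i" for s x
  proof -
    let ?d = "R.conv (\<lambda>t. if t = s then 1 else 0) (C x)"
    have "good (act i s x) ?d"
      unfolding good_def
    proof (intro conjI allI impI ballI)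
      fix u assume "u \<notin> S"
      then have emp: "{(s, t) \<in> S \<times> S. mul s t = u} = {}" using R.mul_closed by blast
      show "?d u = 0" unfolding R.conv_def emp by simp
    next
      fix j b1 assume j: "j \<in> A" "b1 \<in> B j"
      interpret P: monoid_rep sc S mul e "V j" "act j" by (rule rep[OF j(1)])
      have "la j ?d b1 = act j s (la j (C x) b1)"
        using P.act_lact[OF s basis_in[OF j], of "C x"] by simp
      also have "\<dots> = (if j = i \<and> b1 = b then act i s x else 0)"
        using C[OF x] j P.act_scale[OF s P.zero_in, of 0] by (simp add: good_def)
      finally show "la j ?d b1 = (if j = i \<and> b1 = b then act i s x else 0)" .
    qed
    from C_eq[OF Q.act_in[OF s x] this] show ?thesis
      unfolding f_def using R.act_lact[OF s w(1)] by simp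
  qed
  have f_0: "f 0 = 0" using f_scale[OF Q.zero_in, of 0] by simp
  have "good b0 (unit_coeff (i, b, b0))" unfolding good_def using unit_coeff[OF q] by blast
  from C_eq[OF basis_in[OF i(1,3)] this] have fb0: "f b0 \<noteq> 0" using nz by (simp add: f_def)
  have b0V: "b0 \<in> V i" by (rule basis_in[OF i(1,3)])
  \<comment> \<open>Schur's lemma: kernel and image of \<open>f\<close> are invariant, and
    \<open>f b0\<close> is nonzero.\<close>
  let ?K = "{v \<in> V i. f v = 0}"
  have "?K = {0} \<or> ?K = V i"
  proof (rule Q.irreducibleD[OF irr[OF i(1)]])
    show "Q.subspace ?K"
      unfolding Q.subspace_def
      using Q.zero_in Q.subspace_add[OF Q.sub] Q.subspace_scale[OF Q.sub] by (simp add: f_0 f_add f_scale)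
    fix s assume s: "s \<in> S"
    show "act i s ` ?K \<subseteq> ?K"
      using f_act[OF s] Q.act_in[OF s] R.act_scale[OF s R.zero_in, of 0] by auto
  qed blast
  then have K: "?K = {0}" using fb0 b0V by blast
  have inj: "inj_on f (V i)"
  proof (rule inj_onI)
    fix x y assume xy: "x \<in> V i" "y \<in> V i" "f x = f y"
    have "f (x + sc (- 1) y) = 0"
      using xy by (simp add: f_add f_scale Q.subspace_scale[OF Q.sub] del: Q.scale_minus_left)
    moreover have "x + sc (- 1) y \<in> V i"
      by (intro Q.subspace_add[OF Q.sub] Q.subspace_scale[OF Q.sub] xy)
    ultimately have "x + sc (- 1) y = 0" using K by blast
    then show "x = y" by simp
  qed
  have "f ` V i = {0} \<or> f ` V i = W"
  proof (rule R.irreducibleD[OF irrR])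
    have "0 \<in> f ` V i" using f_0 Q.zero_in by (metis imageI)
    moreover have "x + y \<in> f ` V i" if "x \<in> f ` V i" "y \<in> f ` V i" for x y
      using that f_add[symmetric] Q.subspace_add[OF Q.sub] by force
    moreover have "sr a x \<in> f ` V i" if "x \<in> f ` V i" for a x
      using that f_scale[symmetric] Q.subspace_scale[OF Q.sub] by force
    ultimately show "R.subspace (f ` V i)" unfolding R.subspace_def by blast
    show "f ` V i \<subseteq> W" using f_in by blast
    fix s assume s: "s \<in> S"
    show "rho s ` f ` V i \<subseteq> f ` V i" using f_act[OF s, symmetric] Q.act_in[OF s] by force
  qed
  then have "f ` V i = W" using fb0 b0V by blast
  then have "bij_betw f (V i) W" using inj by (simp add: bij_betw_def)
  moreover have "f \<in> linear_maps sc (V i) sr W" using f_in f_add f_scale by (simp add: linear_maps_def)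
  ultimately show ?thesis using f_act i(1) by blast
qed

end

section \<open>Partial representations as representations of a monoid\<close>

text \<open>Extending by zero puts every value into the space, so that operator identities such as
  \<open>regular\<close> and \<open>P_P\<close> hold for arbitrary v.\<close>

definition pact :: "('g, 'v::ab_group_add) rep \<Rightarrow> 'g \<Rightarrow> 'v \<Rightarrow> 'v" where
  "pact R g v = (if v \<in> rspace R then ract R g v else 0)"

text \<open>
  If \<open>\<pi>\<close> is global on the stabilizer of \<open>1\<close>, then \<open>\<pi>(g) \<pi>(g\<^sup>-\<^sup>1)\<close> depends only on \<open>i = g(1)\<close>; call it
  \<open>e\<^sub>i\<close>. Any such \<open>g\<close> may serve to define it, so the transposition of \<open>1\<close> and \<open>i\<close> does.
\<close>

definition idem :: "(nat \<Rightarrow> nat, 'v::ab_group_add) rep \<Rightarrow> nat \<Rightarrow> 'v \<Rightarrow> 'v" where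
  "idem R i v = pact R (transpose 1 i) (pact R (transpose 1 i) v)"

text \<open>The product of the e_i over \<open>A\<close>; folding over a set makes sense because
  these idempotents commute (\<open>idem_fun\<close>).\<close>

definition idems :: "(nat \<Rightarrow> nat, 'v::ab_group_add) rep \<Rightarrow> nat set \<Rightarrow> 'v \<Rightarrow> 'v" where
  "idems R A v = Finite_Set.fold (idem R) v A"

definition sact :: "(nat \<Rightarrow> nat, 'v::ab_group_add) rep \<Rightarrow> nat set \<times> (nat \<Rightarrow> nat) \<Rightarrow> 'v \<Rightarrow> 'v" where
  "sact R = (\<lambda>(A, g) v. idems R A (pact R g v))"

text \<open>The pair \<open>(A, g)\<close> stands for the operator \<open>(\<Prod>\<^bsub>i\<in>A\<^esub> e\<^sub>i) \<pi>(g)\<close>.\<close>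

definition exel_monoid :: "nat \<Rightarrow> (nat set \<times> (nat \<Rightarrow> nat)) set" where
  "exel_monoid n = {(A, g). A \<subseteq> {1..n} \<and> 1 \<in> A \<and> g permutes {1..n} \<and> g 1 \<in> A}"

text \<open>The law comes from moving idempotents to the left: \<pi>(g) e_i = e_(g i) \<pi>(g), and
  \<pi>(g) \<pi>(h) is e_(g 1) \<pi>(g h), where g(1) already lies in g B because 1 is in B.\<close>

definition exel_mult :: "nat set \<times> (nat \<Rightarrow> nat) \<Rightarrow> nat set \<times> (nat \<Rightarrow> nat) \<Rightarrow> nat set \<times> (nat \<Rightarrow> nat)" where
  "exel_mult = (\<lambda>(A, g) (B, h). (A \<union> g ` B, g \<circ> h))"

definition exel_one :: "nat set \<times> (nat \<Rightarrow> nat)" where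
  "exel_one = ({1}, id)"

locale sym_partial_rep =
  fixes n :: nat and R :: "(nat \<Rightarrow> nat, 'v::ab_group_add) rep"
  assumes n: "1 \<le> n"
    and gp: "global_partial_representation (sym_group n) (sym_point_stabilizer n) R"
begin

abbreviation "V \<equiv> rspace R"
abbreviation "P \<equiv> pact R"

lemma acts: "acts_on (sym_group n) R"
  using gp by (simp add: global_partial_representation_def partial_representation_def)

sublocale vector_space "rscale R"
  using acts by (simp add: acts_on_def fin_dim_space_def)

lemma sub: "subspace V"
  using acts by (auto simp: acts_on_def fin_dim_space_def)

lemma lin: "g permutes {1..n} \<Longrightarrow> ract R g \<in> linear_maps (rscale R) V (rscale R) V"
  using acts by (simp add: acts_on_def sym_group_carrier)

lemma zero_in: "0 \<in> V"
  by (rule subspace_0[OF sub])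

lemma P_in: "g permutes {1..n} \<Longrightarrow> P g v \<in> V"
  using lin[of g] zero_in unfolding pact_def linear_maps_def by (simp add: Pi_iff)

lemma P_add: "g permutes {1..n} \<Longrightarrow> v \<in> V \<Longrightarrow> w \<in> V \<Longrightarrow> P g (v + w) = P g v + P g w"
  using lin subspace_add[OF sub] by (simp add: pact_def linear_maps_def)

lemma P_scale: "g permutes {1..n} \<Longrightarrow> v \<in> V \<Longrightarrow> P g (rscale R a v) = rscale R a (P g v)"
  using lin subspace_scale[OF sub] by (simp add: pact_def linear_maps_def)

lemma P_outside: "v \<notin> V \<Longrightarrow> P g v = 0"
  by (simp add: pact_def)

lemma P_zero: "g permutes {1..n} \<Longrightarrow> P g 0 = 0"
  using P_scale[OF _ zero_in, of g 0] by simp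

lemma P_id: "v \<in> V \<Longrightarrow> P id v = v"
  using gp by (simp add: pact_def global_partial_representation_def partial_representation_def sym_group_one)

lemma inv_sym: "g permutes {1..n} \<Longrightarrow> inv\<^bsub>sym_group n\<^esub> g = inv' g"
  by (simp add: sym_group_carrier)

lemma axiom1:
  assumes g: "g permutes {1..n}" and h: "h permutes {1..n}"
  shows "P (inv' g) (P (g \<circ> h) v) = P (inv' g) (P g (P h v))"
proof (cases "v \<in> V")
  case True
  have "ract R (inv' g) (ract R (g \<circ> h) v) = ract R (inv' g) (ract R g (ract R h v))"
    using gp g h True inv_sym[OF g]
    by (simp add: global_partial_representation_def partial_representation_def sym_group_carrier sym_group_mult)
  moreover have "ract R (g \<circ> h) v \<in> V" "ract R h v \<in> V" "ract R g (ract R h v) \<in> V"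
    using lin[OF permutes_compose[OF h g]] lin[OF h] lin[OF g] True unfolding linear_maps_def by blast+
  ultimately show ?thesis using True by (simp add: pact_def)
next
  case False
  then show ?thesis using g h by (simp add: P_outside P_zero permutes_inv)
qed

lemma axiom2:
  assumes g: "g permutes {1..n}" and h: "h permutes {1..n}"
  shows "P (g \<circ> h) (P (inv' h) v) = P g (P h (P (inv' h) v))"
proof (cases "v \<in> V")
  case True
  have "ract R (g \<circ> h) (ract R (inv' h) v) = ract R g (ract R h (ract R (inv' h) v))"
    using gp g h True inv_sym[OF h]
    by (simp add: global_partial_representation_def partial_representation_def sym_group_carrier sym_group_mult)
  moreover have "ract R (inv' h) v \<in> V"
    using lin[OF permutes_inv[OF h]] True unfolding linear_maps_def by blast
  moreover from this have "ract R h (ract R (inv' h) v) \<in> V"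
    using lin[OF h] unfolding linear_maps_def by blast
  ultimately show ?thesis using True by (simp add: pact_def)
next
  case False
  then show ?thesis using g h by (simp add: P_outside P_zero permutes_inv permutes_compose)
qed

lemma stab_mult:
  assumes "g permutes {1..n}" "g 1 = 1" "h permutes {1..n}" "h 1 = 1"
  shows "P (g \<circ> h) v = P g (P h v)"
proof (cases "v \<in> V")
  case True
  have "ract R (g \<circ> h) v = ract R g (ract R h v)"
    using gp assms True
    by (simp add: global_partial_representation_def Defs.representation_def sym_point_stabilizer_def sym_group_carrier sym_group_mult)
  moreover have "ract R h v \<in> V" using lin[OF assms(3)] True unfolding linear_maps_def by blast
  ultimately show ?thesis using True by (simp add: pact_def)
next
  case False
  then show ?thesis using assms by (simp add: P_outside P_zero)
qed

lemma inv_fix: "g permutes {1..n} \<Longrightarrow> g 1 = 1 \<Longrightarrow> inv' g 1 = 1"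
  using permutes_inverses(2) by metis

lemma stab_inv:
  assumes "h permutes {1..n}" "h 1 = 1" "v \<in> V"
  shows "P (inv' h) (P h v) = v" "P h (P (inv' h) v) = v"
proof -
  note i = permutes_inv[OF assms(1)] inv_fix[OF assms(1,2)]
  show "P (inv' h) (P h v) = v"
    using stab_mult[OF i assms(1,2), of v] permutes_inv_o(2)[OF assms(1)] P_id[OF assms(3)] by simp
  show "P h (P (inv' h) v) = v"
    using stab_mult[OF assms(1,2) i, of v] permutes_inv_o(1)[OF assms(1)] P_id[OF assms(3)] by simp
qed

text \<open>Operators of elements fixing 1 are invertible, so the second axiom, applied to \<pi>(h)
  v, loses its last factor.\<close>

lemma mult_stab_right:
  assumes g: "g permutes {1..n}" and h: "h permutes {1..n}" "h 1 = 1"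
  shows "P (g \<circ> h) v = P g (P h v)"
proof (cases "v \<in> V")
  case True
  have "P (g \<circ> h) (P (inv' h) (P h v)) = P g (P h (P (inv' h) (P h v)))" by (rule axiom2[OF g h(1)])
  then show ?thesis unfolding stab_inv(1)[OF h True] .
next
  case False
  then show ?thesis using g h by (simp add: P_outside P_zero)
qed

lemma mult_stab_left:
  assumes h: "h permutes {1..n}" "h 1 = 1" and g: "g permutes {1..n}"
  shows "P (h \<circ> g) v = P h (P g v)"
proof -
  have "P (inv' h) (P (h \<circ> g) v) = P (inv' h) (P h (P g v))" by (rule axiom1[OF h(1) g])
  then have "P h (P (inv' h) (P (h \<circ> g) v)) = P h (P g v)"
    unfolding stab_inv(1)[OF h P_in[OF g]] by (simp only:)
  then show ?thesis unfolding stab_inv(2)[OF h P_in[OF permutes_compose[OF g h(1)]]] .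
qed

text \<open>The first axiom for the pair (g^-1, g), whose product is the identity.\<close>

lemma regular:
  assumes g: "g permutes {1..n}"
  shows "P g (P (inv' g) (P g v)) = P g v"
proof (cases "v \<in> V")
  case True
  have "P (inv' (inv' g)) (P (inv' g \<circ> g) v) = P (inv' (inv' g)) (P (inv' g) (P g v))"
    by (rule axiom1[OF permutes_inv[OF g] g])
  then show ?thesis unfolding permutes_inv_inv[OF g] permutes_inv_o(2)[OF g] P_id[OF True] by (rule sym)
next
  case False
  then show ?thesis using g by (simp add: P_outside P_zero permutes_inv)
qed

text \<open>Factor g as the transposition of 1 and g(1) after an element h fixing 1. The operators
  of h and its inverse meet in the middle and cancel, leaving only the transposition.\<close>

lemma range_idem_eq:
  assumes g: "g permutes {1..n}"
  shows "P g (P (inv' g) v) = idem R (g 1) v"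
proof -
  let ?t = "transpose 1 (g 1)"
  have "g 1 \<in> {1..n}" using permutes_in_image[OF g] n by simp
  then have t: "?t permutes {1..n}" using n by (intro permutes_swap_id) auto
  let ?h = "?t \<circ> g"
  have h: "?h permutes {1..n}" "?h 1 = 1" using permutes_compose[OF g t] by simp_all
  have "?t \<circ> ?h = g" by (simp add: fun_eq_iff)
  moreover have "inv' ?h \<circ> ?t = inv' g"
    using permutes_inv_o(2)[OF t]
    by (simp add: o_inv_distrib permutes_bij[OF g] permutes_bij[OF t] comp_assoc)
  ultimately have "P g (P (inv' g) v) = P (?t \<circ> ?h) (P (inv' ?h \<circ> ?t) v)" by simp
  also have "\<dots> = P ?t (P ?h (P (inv' ?h) (P ?t v)))"
    unfolding mult_stab_right[OF t h] mult_stab_left[OF permutes_inv[OF h(1)] inv_fix[OF h] t] ..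
  also have "\<dots> = idem R (g 1) v" unfolding stab_inv(2)[OF h P_in[OF t]] idem_def ..
  finally show ?thesis .
qed

lemma idem_P: "g permutes {1..n} \<Longrightarrow> idem R (g 1) (P g v) = P g v"
  unfolding range_idem_eq[symmetric] by (rule regular)

text \<open>The first axiom, multiplied by \<pi>(g) from the left, relates \<pi>(g) \<pi>(g^-1)
  \<pi>(g h) to \<pi>(g) \<pi>(g^-1) \<pi>(g) \<pi>(h), and regularity shortens the latter.\<close>

lemma P_P:
  assumes g: "g permutes {1..n}" and h: "h permutes {1..n}"
  shows "P g (P h v) = idem R (g 1) (P (g \<circ> h) v)"
  unfolding range_idem_eq[OF g, symmetric] axiom1[OF g h] regular[OF g] ..

lemma swap_perm: "i \<in> {1..n} \<Longrightarrow> transpose 1 i permutes {1..n}"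
  using n by (intro permutes_swap_id) auto

text \<open>With t the transposition of 1 and i, the second axiom merges \<pi>(g) \<pi>(t) in front
  of \<pi>(t), and \<open>P_P\<close> for the pair (g t, t) produces the idempotent at g(t(1)) =
  g(i).\<close>

lemma P_idem:
  assumes g: "g permutes {1..n}" and i: "i \<in> {1..n}"
  shows "P g (idem R i v) = idem R (g i) (P g v)"
proof -
  let ?t = "transpose 1 i"
  note t = swap_perm[OF i]
  have it: "inv' ?t = ?t" by (simp add: inv_transpose_eq)
  have "P g (idem R i v) = P (g \<circ> ?t) (P ?t v)"
    unfolding idem_def using axiom2[OF g t, of v] by (simp add: it)
  also have "\<dots> = idem R ((g \<circ> ?t) 1) (P (g \<circ> ?t \<circ> ?t) v)" by (rule P_P[OF permutes_compose[OF t g] t])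
  also have "\<dots> = idem R (g i) (P g v)" by (simp add: comp_assoc)
  finally show ?thesis .
qed

lemma idem_in: "i \<in> {1..n} \<Longrightarrow> idem R i v \<in> V"
  unfolding idem_def by (rule P_in[OF swap_perm])

text \<open>Each e_i is \<pi>(t) \<pi>(t) for a transposition t, and carrying e_j past both factors
  applies t twice to its index, which restores it.\<close>

lemma idem_commute:
  assumes i: "i \<in> {1..n}" and j: "j \<in> {1..n}"
  shows "idem R i (idem R j v) = idem R j (idem R i v)"
proof -
  let ?t = "transpose 1 i"
  note t = swap_perm[OF i]
  have tj: "?t j \<in> {1..n}" using permutes_in_image[OF t] j by blast
  have "idem R i (idem R j v) = P ?t (P ?t (idem R j v))" by (simp add: idem_def)
  also have "\<dots> = idem R (?t (?t j)) (P ?t (P ?t v))" unfolding P_idem[OF t j] P_idem[OF t tj] ..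
  also have "\<dots> = idem R j (idem R i v)" by (simp add: idem_def)
  finally show ?thesis .
qed

lemma idem_idem:
  assumes i: "i \<in> {1..n}"
  shows "idem R i (idem R i v) = idem R i v"
  using idem_P[OF swap_perm[OF i], of "P (transpose 1 i) v"] unfolding idem_def[of R i v] by simp

lemma idem_one: "v \<in> V \<Longrightarrow> idem R 1 v = v"
  by (simp add: idem_def P_id)

lemma idem_fun: "comp_fun_idem_on {1..n} (idem R)"
  by unfold_locales (simp_all add: fun_eq_iff idem_commute idem_idem del: atLeastAtMost_iff)

lemma idems_empty: "idems R {} v = v"
  by (simp add: idems_def)

lemma idems_insert: "insert i A \<subseteq> {1..n} \<Longrightarrow> idems R (insert i A) v = idem R i (idems R A v)"
  unfolding idems_def
proof (rule comp_fun_idem_on.fold_insert_idem[OF idem_fun])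
  assume ins: "insert i A \<subseteq> {1..n}"
  show "finite A" by (rule finite_subset[of _ "{1..n}"]) (use ins in simp_all)
qed

lemma idems_Un:
  assumes "A \<subseteq> {1..n}" "B \<subseteq> {1..n}"
  shows "idems R (A \<union> B) v = idems R A (idems R B v)"
proof -
  have "finite A" by (rule finite_subset[OF assms(1)]) simp
  then show ?thesis using assms
    by (induction A rule: finite_induct) (simp_all add: idems_empty idems_insert)
qed

lemma idems_in:
  assumes "A \<subseteq> {1..n}" "v \<in> V"
  shows "idems R A v \<in> V"
proof -
  have "finite A" by (rule finite_subset[OF assms(1)]) simp
  then show ?thesis using assms
    by (induction A rule: finite_induct) (simp_all add: idems_empty idems_insert idem_in)
qed

lemma idem_add: "i \<in> {1..n} \<Longrightarrow> v \<in> V \<Longrightarrow> w \<in> V \<Longrightarrow> idem R i (v + w) = idem R i v + idem R i w"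
  unfolding idem_def by (simp add: P_add P_in swap_perm del: One_nat_def atLeastAtMost_iff)

lemma idem_scale: "i \<in> {1..n} \<Longrightarrow> v \<in> V \<Longrightarrow> idem R i (rscale R a v) = rscale R a (idem R i v)"
  unfolding idem_def by (simp add: P_scale P_in swap_perm del: One_nat_def atLeastAtMost_iff)

lemma idems_add:
  assumes "A \<subseteq> {1..n}" "v \<in> V" "w \<in> V"
  shows "idems R A (v + w) = idems R A v + idems R A w"
proof -
  have "finite A" by (rule finite_subset[OF assms(1)]) simp
  then show ?thesis using assms
    by (induction A rule: finite_induct) (simp_all add: idems_empty idems_insert idem_add idems_in)
qed

lemma idems_scale:
  assumes "A \<subseteq> {1..n}" "v \<in> V"
  shows "idems R A (rscale R a v) = rscale R a (idems R A v)"
proof -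
  have "finite A" by (rule finite_subset[OF assms(1)]) simp
  then show ?thesis using assms
    by (induction A rule: finite_induct) (simp_all add: idems_empty idems_insert idem_scale idems_in)
qed

lemma P_idems:
  assumes "A \<subseteq> {1..n}" "g permutes {1..n}"
  shows "P g (idems R A v) = idems R (g ` A) (P g v)"
proof -
  have "finite A" by (rule finite_subset[OF assms(1)]) simp
  then show ?thesis using assms(1)
  proof (induction A rule: finite_induct)
    case empty
    then show ?case by (simp add: idems_empty)
  next
    case (insert i A)
    have "insert (g i) (g ` A) \<subseteq> {1..n}" using insert.prems permutes_in_image[OF assms(2)] by blast
    then show ?case using insert assms(2) by (simp add: idems_insert P_idem)
  qed
qed

section \<open>The action of the monoid\<close>

lemma exel_mult_closed: "s \<in> exel_monoid n \<Longrightarrow> t \<in> exel_monoid n \<Longrightarrow> exel_mult s t \<in> exel_monoid n"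
proof -
  assume st: "s \<in> exel_monoid n" "t \<in> exel_monoid n"
  obtain A g B h where e: "s = (A, g)" "t = (B, h)" by fastforce
  have A: "A \<subseteq> {1..n}" "1 \<in> A" "g permutes {1..n}" and B: "B \<subseteq> {1..n}" "h 1 \<in> B" "h permutes {1..n}"
    using st by (simp_all add: exel_monoid_def e)
  have "g ` B \<subseteq> {1..n}" using B(1) permutes_in_image[OF A(3)] by blast
  then show ?thesis using A B permutes_compose[OF B(3) A(3)]
    by (simp add: exel_monoid_def exel_mult_def e)
qed

lemma finite_exel_monoid: "finite (exel_monoid n)"
  by (rule finite_subset[of _ "Pow {1..n} \<times> {g. g permutes {1..n}}"])
     (auto simp: exel_monoid_def finite_permutations)

lemma sact_mult:
  assumes s: "s \<in> exel_monoid n" and t: "t \<in> exel_monoid n"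
  shows "sact R (exel_mult s t) v = sact R s (sact R t v)"
proof -
  obtain A g B h where e: "s = (A, g)" "t = (B, h)" by fastforce
  have A: "A \<subseteq> {1..n}" "1 \<in> A" "g permutes {1..n}" and B: "B \<subseteq> {1..n}" "1 \<in> B" "h 1 \<in> B" "h permutes {1..n}"
    using s t by (simp_all add: exel_monoid_def e)
  have gB: "g ` B \<subseteq> {1..n}" using B(1) permutes_in_image[OF A(3)] by blast
  have g1: "insert (g 1) (g ` B) = g ` B" using B(2) by blast
  have "sact R s (sact R t v) = idems R A (idems R (g ` B) (P g (P h v)))"
    by (simp add: sact_def e P_idems[OF B(1) A(3)])
  also have "\<dots> = idems R (A \<union> g ` B) (P g (P h v))" by (rule idems_Un[OF A(1) gB, symmetric])
  \<comment> \<open>Merging \<pi>(g) \<pi>(h) costs the idempotent at g(1), which the set absorbs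
    since 1 is in \<open>B\<close>.\<close>
  also have "\<dots> = idems R (A \<union> g ` B) (idems R {g 1} (P (g \<circ> h) v))"
    unfolding P_P[OF A(3) B(4)] using gB B(2) by (subst idems_insert) (auto simp: idems_empty)
  also have "\<dots> = idems R (A \<union> g ` B \<union> {g 1}) (P (g \<circ> h) v)"
    by (rule idems_Un[symmetric]) (use A(1) gB B(2) in auto)
  also have "A \<union> g ` B \<union> {g 1} = A \<union> g ` B" using g1 by blast
  finally show ?thesis by (simp add: sact_def e exel_mult_def comp_def)
qed

text \<open>Group elements sit in the monoid with the least admissible set: e_1 is the identity, and
  \<pi>(g) absorbs the idempotent at g(1).\<close>

lemma sact_group:
  assumes g: "g permutes {1..n}" and v: "v \<in> V"
  shows "sact R ({1, g 1}, g) v = ract R g v"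
proof -
  have g1: "g 1 \<in> {1..n}" using permutes_in_image[OF g] n by simp
  have "sact R ({1, g 1}, g) v = idem R 1 (idem R (g 1) (P g v))"
    using n g1 by (simp add: sact_def idems_insert idems_empty)
  also have "\<dots> = P g v" unfolding idem_P[OF g] by (rule idem_one[OF P_in[OF g]])
  finally show ?thesis using v by (simp add: pact_def)
qed

lemma group_in_exel: "g permutes {1..n} \<Longrightarrow> ({1, g 1}, g) \<in> exel_monoid n"
  using n permutes_in_image[of g "{1..n}" 1] by (simp add: exel_monoid_def)

lemma monoid_rep: "monoid_rep (rscale R) (exel_monoid n) exel_mult exel_one V (sact R)"
proof (intro monoid_rep.intro monoid_rep_axioms.intro)
  show "vector_space (rscale R)" by unfold_locales
  show "exel_one \<in> exel_monoid n" using n by (simp add: exel_one_def exel_monoid_def permutes_id)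
  fix s assume s: "s \<in> exel_monoid n"
  obtain A g where e: "s = (A, g)" by fastforce
  have A: "A \<subseteq> {1..n}" "g permutes {1..n}" using s by (simp_all add: exel_monoid_def e)
  fix v assume v: "v \<in> V"
  show "sact R s v \<in> V" by (simp add: sact_def e idems_in[OF A(1) P_in[OF A(2)]])
  show "sact R s (rscale R a v) = rscale R a (sact R s v)" for a
    by (simp add: sact_def e P_scale[OF A(2) v] idems_scale[OF A(1) P_in[OF A(2)]])
  fix w assume w: "w \<in> V"
  show "sact R s (v + w) = sact R s v + sact R s w"
    by (simp add: sact_def e P_add[OF A(2) v w] idems_add[OF A(1) P_in[OF A(2)] P_in[OF A(2)]])
next
  fix v assume v: "v \<in> V"
  show "sact R exel_one v = v"
    using n v by (simp add: sact_def exel_one_def idems_insert idems_empty P_id idem_one del: One_nat_def)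
qed (simp_all add: finite_exel_monoid exel_mult_closed sub sact_mult)

text \<open>Monoid operators are products of operators of group elements, and these are themselves
  monoid operators by \<open>sact_group\<close>.\<close>

lemma invariant_iff:
  assumes U: "subspace U" "U \<subseteq> V"
  shows "(\<forall>g\<in>carrier (sym_group n). ract R g ` U \<subseteq> U) \<longleftrightarrow> (\<forall>s\<in>exel_monoid n. sact R s ` U \<subseteq> U)"
proof
  assume inv: "\<forall>g\<in>carrier (sym_group n). ract R g ` U \<subseteq> U"
  have P: "P g u \<in> U" if "g permutes {1..n}" "u \<in> U" for g u
  proof -
    have "ract R g u \<in> U" using inv that sym_group_carrier by blast
    then show ?thesis using that(2) U(2) by (auto simp: pact_def)
  qed
  have idem: "idem R i u \<in> U" if "i \<in> {1..n}" "u \<in> U" for i u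
    unfolding idem_def by (intro P swap_perm that)
  have idems: "idems R A u \<in> U" if "A \<subseteq> {1..n}" "u \<in> U" for A u
  proof -
    have "finite A" by (rule finite_subset[OF that(1)]) simp
    then show ?thesis using that
      by (induction A rule: finite_induct) (simp_all add: idems_empty idems_insert idem)
  qed
  show "\<forall>s\<in>exel_monoid n. sact R s ` U \<subseteq> U"
  proof (intro ballI image_subsetI)
    fix s u assume s: "s \<in> exel_monoid n" and u: "u \<in> U"
    obtain A g where e: "s = (A, g)" by fastforce
    have A: "A \<subseteq> {1..n}" "g permutes {1..n}" using s by (simp_all add: exel_monoid_def e)
    show "sact R s u \<in> U" by (simp add: sact_def e idems[OF A(1) P[OF A(2) u]])
  qed
next
  assume inv: "\<forall>s\<in>exel_monoid n. sact R s ` U \<subseteq> U"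
  show "\<forall>g\<in>carrier (sym_group n). ract R g ` U \<subseteq> U"
  proof (intro ballI image_subsetI)
    fix g u assume "g \<in> carrier (sym_group n)" and u: "u \<in> U"
    then have g: "g permutes {1..n}" by (simp add: sym_group_carrier)
    have "sact R ({1, g 1}, g) u \<in> U" using inv group_in_exel[OF g] u by blast
    then show "ract R g u \<in> U" using sact_group[OF g] u U(2) by auto
  qed
qed

lemma irreducible_iff:
  "monoid_rep.irreducible (rscale R) (exel_monoid n) V (sact R) \<longleftrightarrow> rep_irreducible (sym_group n) R"
  unfolding monoid_rep.irreducible_def[OF monoid_rep] rep_irreducible_def
  using invariant_iff by blast

end

lemma equivariant_sact:
  assumes R: "sym_partial_rep n R" and Q: "sym_partial_rep n Q"
    and f: "\<And>v. v \<in> rspace R \<Longrightarrow> f v \<in> rspace Q"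
    and eq: "\<And>g v. g permutes {1..n} \<Longrightarrow> v \<in> rspace R \<Longrightarrow> f (ract R g v) = ract Q g (f v)"
    and s: "s \<in> exel_monoid n" and v: "v \<in> rspace R"
  shows "f (sact R s v) = sact Q s (f v)"
proof -
  interpret R: sym_partial_rep n R by (rule R)
  interpret Q: sym_partial_rep n Q by (rule Q)
  obtain A g where e: "s = (A, g)" by fastforce
  have A: "A \<subseteq> {1..n}" "g permutes {1..n}" using s by (simp_all add: exel_monoid_def e)
  have P: "f (pact R g v) = pact Q g (f v)" if "g permutes {1..n}" "v \<in> rspace R" for g v
    using eq[OF that] f that by (simp add: pact_def)
  have idem: "f (idem R i v) = idem Q i (f v)" if "i \<in> {1..n}" "v \<in> rspace R" for i v
    unfolding idem_def using P R.P_in R.swap_perm[OF that(1)] that(2) by simp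
  have idems: "f (idems R A v) = idems Q A (f v)" if "A \<subseteq> {1..n}" "v \<in> rspace R" for A v
  proof -
    have "finite A" by (rule finite_subset[OF that(1)]) simp
    then show ?thesis using that
      by (induction A rule: finite_induct)
         (simp_all add: R.idems_empty R.idems_insert Q.idems_empty Q.idems_insert idem R.idems_in)
  qed
  show ?thesis by (simp add: sact_def e idems[OF A(1) R.P_in[OF A(2)]] P[OF A(2) v])
qed

section \<open>The order of the monoid\<close>

lemma card_permutations_image_of_1:
  assumes "1 \<le> n" "i \<in> {1..n}"
  shows "card {g. g permutes {1..n} \<and> g 1 = i} = fact (n - 1)"
proof -
  let ?t = "transpose 1 i"
  have t: "?t permutes {1..n}" using assms by (intro permutes_swap_id) auto
  have "bij_betw (\<lambda>g. ?t \<circ> g) {g. g permutes {1..n} - {1}} {g. g permutes {1..n} \<and> g 1 = i}"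
  proof (rule bij_betw_byWitness[where f' = "\<lambda>g. ?t \<circ> g"])
    show "\<forall>a\<in>{g. g permutes {1..n} - {1}}. ?t \<circ> (?t \<circ> a) = a" by (simp add: fun_eq_iff)
    show "\<forall>a\<in>{g. g permutes {1..n} \<and> g 1 = i}. ?t \<circ> (?t \<circ> a) = a" by (simp add: fun_eq_iff)
    show "(\<lambda>g. ?t \<circ> g) ` {g. g permutes {1..n} - {1}} \<subseteq> {g. g permutes {1..n} \<and> g 1 = i}"
    proof (rule image_subsetI)
      fix g assume "g \<in> {g. g permutes {1..n} - {1}}"
      then have g: "g permutes {1..n} - {1}" by simp
      have "g permutes {1..n}" by (rule permutes_subset[OF g]) blast
      moreover have "g 1 = 1" by (rule permutes_not_in[OF g]) blast
      ultimately show "?t \<circ> g \<in> {g. g permutes {1..n} \<and> g 1 = i}" using permutes_compose[OF _ t] by simp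
    qed
    show "(\<lambda>g. ?t \<circ> g) ` {g. g permutes {1..n} \<and> g 1 = i} \<subseteq> {g. g permutes {1..n} - {1}}"
    proof (rule image_subsetI)
      fix g assume "g \<in> {g. g permutes {1..n} \<and> g 1 = i}"
      then have tg: "?t \<circ> g permutes {1..n}" "(?t \<circ> g) 1 = 1" using permutes_compose[OF _ t] by simp_all
      have "?t \<circ> g permutes {1..n} - {1}"
      proof (rule permutes_superset[OF tg(1)])
        fix x assume "x \<in> {1..n} - ({1..n} - {1})"
        then have "x = 1" by blast
        then show "(?t \<circ> g) x = x" using tg(2) by (simp only:)
      qed
      then show "?t \<circ> g \<in> {g. g permutes {1..n} - {1}}" by simp
    qed
  qed
  then have "card {g. g permutes {1..n} \<and> g 1 = i} = card {g. g permutes {1..n} - {1}}"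
    by (rule bij_betw_same_card[symmetric])
  also have "\<dots> = fact (n - 1)"
    by (rule card_permutations) (use assms in auto)
  finally show ?thesis .
qed

lemma card_subsets_containing_1:
  assumes "1 \<le> n" "1 \<le> k"
  shows "card {A. A \<subseteq> {1..n} \<and> 1 \<in> A \<and> card A = k} = (n - 1) choose (k - 1)"
proof -
  have "bij_betw (insert 1) {A. A \<subseteq> {2..n} \<and> card A = k - 1} {A. A \<subseteq> {1..n} \<and> 1 \<in> A \<and> card A = k}"
  proof (rule bij_betw_byWitness[where f' = "\<lambda>A. A - {1}"])
    show "insert 1 ` {A. A \<subseteq> {2..n} \<and> card A = k - 1} \<subseteq> {A. A \<subseteq> {1..n} \<and> 1 \<in> A \<and> card A = k}"
    proof (rule image_subsetI)
      fix A assume "A \<in> {A. A \<subseteq> {2..n} \<and> card A = k - 1}"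
      then have A: "A \<subseteq> {2..n}" "card A = k - 1" by blast+
      have "finite A" by (rule finite_subset[OF A(1)]) simp
      moreover have "1 \<notin> A" using A(1) by auto
      ultimately have "card (insert 1 A) = k" using A(2) assms by simp
      moreover have "insert 1 A \<subseteq> {1..n}" using A(1) assms by auto
      ultimately show "insert 1 A \<in> {A. A \<subseteq> {1..n} \<and> 1 \<in> A \<and> card A = k}" by blast
    qed
    show "(\<lambda>A. A - {1}) ` {A. A \<subseteq> {1..n} \<and> 1 \<in> A \<and> card A = k} \<subseteq> {A. A \<subseteq> {2..n} \<and> card A = k - 1}"
    proof (rule image_subsetI)
      fix A assume "A \<in> {A. A \<subseteq> {1..n} \<and> 1 \<in> A \<and> card A = k}"
      then have A: "A \<subseteq> {1..n}" "1 \<in> A" "card A = k" by blast+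
      have "x \<in> {2..n}" if "x \<in> A - {1}" for x
      proof -
        have "x \<in> {1..n}" "x \<noteq> 1" using A(1) that by blast+
        then show ?thesis by simp
      qed
      then show "A - {1} \<in> {A. A \<subseteq> {2..n} \<and> card A = k - 1}" using A by (simp add: subset_iff)
    qed
  qed auto
  then have "card {A. A \<subseteq> {1..n} \<and> 1 \<in> A \<and> card A = k} = card {A. A \<subseteq> {2..n} \<and> card A = k - 1}"
    by (rule bij_betw_same_card[symmetric])
  also have "\<dots> = (n - 1) choose (k - 1)" using n_subsets[of "{2..n}" "k - 1"] by simp
  finally show ?thesis .
qed

lemma card_exel_monoid:
  assumes n: "1 \<le> n"
  shows "card (exel_monoid n) = (\<Sum>k\<in>{1..n}. ((n - 1) choose (k - 1))\<^sup>2 * fact k * fact (n - k))"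
proof -
  let ?A = "{A. A \<subseteq> {1..n} \<and> 1 \<in> A}"
  have fA: "finite ?A" by simp
  have "exel_monoid n = (SIGMA A:?A. {g. g permutes {1..n} \<and> g 1 \<in> A})" by (auto simp: exel_monoid_def)
  then have "card (exel_monoid n) = (\<Sum>A\<in>?A. card {g. g permutes {1..n} \<and> g 1 \<in> A})"
    using fA by (simp add: card_SigmaI finite_permutations)
  also have "\<dots> = (\<Sum>A\<in>?A. card A * fact (n - 1))"
  proof (rule sum.cong[OF refl])
    fix A assume "A \<in> ?A"
    then have A: "A \<subseteq> {1..n}" by blast
    have "{g. g permutes {1..n} \<and> g 1 \<in> A} = (\<Union>i\<in>A. {g. g permutes {1..n} \<and> g 1 = i})" by blast
    then have "card {g. g permutes {1..n} \<and> g 1 \<in> A} = card (\<Union>i\<in>A. {g. g permutes {1..n} \<and> g 1 = i})"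
      by (simp only:)
    also have "\<dots> = (\<Sum>i\<in>A. card {g. g permutes {1..n} \<and> g 1 = i})"
      by (rule card_UN_disjoint) (use finite_subset[OF A] in \<open>auto simp: finite_permutations\<close>)
    also have "\<dots> = (\<Sum>i\<in>A. fact (n - 1))"
      by (intro sum.cong refl card_permutations_image_of_1 n) (use A in blast)
    finally show "card {g. g permutes {1..n} \<and> g 1 \<in> A} = card A * fact (n - 1)" by simp
  qed
  also have "\<dots> = (\<Sum>k\<in>{1..n}. \<Sum>A\<in>{A \<in> ?A. card A = k}. card A * fact (n - 1))"
  proof (rule sum.group[symmetric, OF fA])
    show "card ` ?A \<subseteq> {1..n}"
    proof (rule image_subsetI)
      fix A assume "A \<in> ?A"
      then have A: "A \<subseteq> {1..n}" "1 \<in> A" by blast+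
      have "finite A" by (rule finite_subset[OF A(1)]) simp
      then have "0 < card A" using A(2) card_gt_0_iff by blast
      moreover have "card A \<le> n" using card_mono[OF _ A(1)] by simp
      ultimately show "card A \<in> {1..n}" by simp
    qed
  qed simp
  also have "\<dots> = (\<Sum>k\<in>{1..n}. ((n - 1) choose (k - 1))\<^sup>2 * fact k * fact (n - k))"
  proof (rule sum.cong[OF refl])
    fix k assume k: "k \<in> {1..n}"
    have "(\<Sum>A\<in>{A \<in> ?A. card A = k}. card A * fact (n - 1)) = (\<Sum>A\<in>{A. A \<subseteq> {1..n} \<and> 1 \<in> A \<and> card A = k}. k * fact (n - 1))"
      by (intro sum.cong) auto
    also have "\<dots> = ((n - 1) choose (k - 1)) * (k * fact (n - 1))"
      using card_subsets_containing_1[OF n, of k] k by simp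
    \<comment> \<open>There are k (n-1)! admissible permutations for each k-subset; writing (n-1)!
      as C(n-1,k-1) (k-1)! (n-k)! exposes the second binomial factor.\<close>
    also have "\<dots> = ((n - 1) choose (k - 1))\<^sup>2 * fact k * fact (n - k)"
    proof -
      have "fact (k - 1) * fact (n - 1 - (k - 1)) * ((n - 1) choose (k - 1)) = (fact (n - 1) :: nat)"
        by (rule binomial_fact_lemma) (use k in \<open>simp add: diff_le_mono\<close>)
      moreover have "n - 1 - (k - 1) = n - k" using k by simp
      ultimately have f: "fact (n - 1) = fact (k - 1) * fact (n - k) * ((n - 1) choose (k - 1))" by simp
      have k': "fact k = k * fact (k - 1)" using k by (cases k) simp_all
      show ?thesis unfolding f k' by (simp only: power2_eq_square mult_ac)
    qed
    finally show "(\<Sum>A\<in>{A \<in> ?A. card A = k}. card A * fact (n - 1)) = ((n - 1) choose (k - 1))\<^sup>2 * fact k * fact (n - k)" .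
  qed
  finally show ?thesis .
qed

section \<open>Block stabilizers\<close>

lemma exists_permutation_image:
  fixes n k :: nat
  assumes kn: "k \<le> n" and A: "A \<subseteq> {1..n}" "card A = k"
  shows "\<exists>x. x permutes {1..n} \<and> x ` {1..k} = A"
proof -
  have fA: "finite A" by (rule finite_subset[OF A(1)]) simp
  obtain f where f: "bij_betw f {1..k} A" using finite_same_card_bij[of "{1..k}" A] fA A(2) by auto
  have "card ({1..n} - {1..k}) = card ({1..n} - A)"
    using card_Diff_subset[OF fA A(1)] card_Diff_subset[of "{1..k}" "{1..n}"] A(2) kn by auto
  then obtain g where g: "bij_betw g ({1..n} - {1..k}) ({1..n} - A)"
    using finite_same_card_bij[of "{1..n} - {1..k}" "{1..n} - A"] by auto
  define x where "x i = (if i \<in> {1..k} then f i else if i \<in> {1..n} then g i else i)" for i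
  have 1: "bij_betw x {1..k} A" using f by (rule bij_betw_cong[THEN iffD1, rotated]) (simp add: x_def)
  have 2: "bij_betw x ({1..n} - {1..k}) ({1..n} - A)" using g by (rule bij_betw_cong[THEN iffD1, rotated]) (auto simp: x_def)
  have "bij_betw x ({1..k} \<union> ({1..n} - {1..k})) (A \<union> ({1..n} - A))" by (rule bij_betw_combine[OF 1 2]) blast
  moreover have "{1..k} \<union> ({1..n} - {1..k}) = {1..n}" using kn by auto
  moreover have "A \<union> ({1..n} - A) = {1..n}" using A(1) by blast
  ultimately have "bij_betw x {1..n} {1..n}" by simp
  then have "x permutes {1..n}" by (rule bij_imp_permutes) (use kn in \<open>auto simp: x_def\<close>)
  moreover have "x ` {1..k} = A" using 1 by (simp add: bij_betw_def)
  ultimately show ?thesis by blast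
qed

definition block_stabilizer :: "nat \<Rightarrow> nat \<Rightarrow> (nat \<Rightarrow> nat) set" where
  "block_stabilizer n k = {\<sigma>. \<sigma> permutes {1..n} \<and> \<sigma> ` {1..k} = {1..k}}"

text \<open>The block sum of two permutations, inverse to \<open>sym_split\<close>.\<close>

definition sym_join :: "nat \<Rightarrow> nat \<Rightarrow> (nat \<Rightarrow> nat) \<Rightarrow> (nat \<Rightarrow> nat) \<Rightarrow> nat \<Rightarrow> nat" where
  "sym_join n k p q i = (if i \<in> {1..k} then p i else if i \<in> {k+1..n} then k + q (i - k) else i)"

abbreviation "upper_part n k \<sigma> \<equiv> fst (sym_split n k \<sigma>)"
abbreviation "lower_part n k \<sigma> \<equiv> snd (sym_split n k \<sigma>)"

lemma sym_join_low: "i \<in> {1..k} \<Longrightarrow> sym_join n k p q i = p i"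
  by (simp add: sym_join_def)

lemma sym_join_high: "i \<in> {1..n - k} \<Longrightarrow> sym_join n k p q (k + i) = k + q i"
  by (auto simp: sym_join_def)

lemma sym_join_outside: "k \<le> n \<Longrightarrow> i \<notin> {1..n} \<Longrightarrow> sym_join n k p q i = i"
  by (auto simp: sym_join_def)

lemma block_cases:
  fixes n k i :: nat
  assumes "k \<le> n"
  obtains "i \<in> {1..k}" | j where "j \<in> {1..n - k}" "i = k + j" | "i \<notin> {1..n}"
proof (cases "i \<in> {k+1..n}")
  case True
  then have "k + 1 \<le> i" "i \<le> n" by simp_all
  then have "i - k \<in> {1..n - k}" "i = k + (i - k)" by auto
  then show ?thesis using that(2) by blast
next
  case False
  then have "i \<in> {1..k} \<or> i \<notin> {1..n}" by auto
  then show ?thesis using that(1,3) by blast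
qed

lemma sym_join_comp:
  assumes "k \<le> n" "p' permutes {1..k}" "q' permutes {1..n - k}"
  shows "sym_join n k p q \<circ> sym_join n k p' q' = sym_join n k (p \<circ> p') (q \<circ> q')"
proof
  fix i
  show "(sym_join n k p q \<circ> sym_join n k p' q') i = sym_join n k (p \<circ> p') (q \<circ> q') i"
  proof (rule block_cases[OF assms(1), of i])
    assume i: "i \<in> {1..k}"
    then have "p' i \<in> {1..k}" using permutes_in_image[OF assms(2)] by blast
    then show ?thesis using i by (simp only: o_apply sym_join_low)
  next
    fix j assume j: "j \<in> {1..n - k}" "i = k + j"
    then have "q' j \<in> {1..n - k}" using permutes_in_image[OF assms(3)] by blast
    then show ?thesis using j by (simp only: o_apply sym_join_high)
  next
    assume i: "i \<notin> {1..n}"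
    show ?thesis unfolding o_apply sym_join_outside[OF assms(1) i] ..
  qed
qed

lemma sym_join_id: "k \<le> n \<Longrightarrow> sym_join n k id id = id"
  by (auto simp: sym_join_def fun_eq_iff)

lemma sym_join_permutes:
  assumes k: "k \<le> n" and p: "p permutes {1..k}" and q: "q permutes {1..n - k}"
  shows "sym_join n k p q permutes {1..n}"
proof (rule bij_imp_permutes)
  have maps: "sym_join n k p q i \<in> {1..n}" if i: "i \<in> {1..n}" and pq: "p permutes {1..k}" "q permutes {1..n - k}" for p q i
  proof (rule block_cases[OF k, of i])
    assume i: "i \<in> {1..k}"
    then have "p i \<in> {1..k}" using permutes_in_image[OF pq(1)] by blast
    then show ?thesis using k by (simp add: sym_join_low[OF i])
  next
    fix j assume j: "j \<in> {1..n - k}" "i = k + j"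
    then have "q j \<in> {1..n - k}" using permutes_in_image[OF pq(2)] by blast
    then have "q j \<le> n - k" "1 \<le> q j" by simp_all
    then show ?thesis unfolding j(2) sym_join_high[OF j(1)] using k by simp
  qed (use i in blast)
  show "bij_betw (sym_join n k p q) {1..n} {1..n}"
  proof (rule bij_betw_byWitness[where f' = "sym_join n k (inv' p) (inv' q)"])
    have "sym_join n k (inv' p) (inv' q) \<circ> sym_join n k p q = id"
      unfolding sym_join_comp[OF k p q] permutes_inv_o[OF p] permutes_inv_o[OF q] by (rule sym_join_id[OF k])
    then show "\<forall>a\<in>{1..n}. sym_join n k (inv' p) (inv' q) (sym_join n k p q a) = a" by (metis comp_apply id_apply)
    have "sym_join n k p q \<circ> sym_join n k (inv' p) (inv' q) = id"
      unfolding sym_join_comp[OF k permutes_inv[OF p] permutes_inv[OF q]] permutes_inv_o[OF p] permutes_inv_o[OF q]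
      by (rule sym_join_id[OF k])
    then show "\<forall>a\<in>{1..n}. sym_join n k p q (sym_join n k (inv' p) (inv' q) a) = a" by (metis comp_apply id_apply)
    show "sym_join n k p q ` {1..n} \<subseteq> {1..n}" using maps[OF _ p q] by blast
    show "sym_join n k (inv' p) (inv' q) ` {1..n} \<subseteq> {1..n}" using maps[OF _ permutes_inv[OF p] permutes_inv[OF q]] by blast
  qed
qed (rule sym_join_outside[OF k])

lemma sym_join_in:
  assumes k: "k \<le> n" and p: "p permutes {1..k}" and q: "q permutes {1..n - k}"
  shows "sym_join n k p q \<in> block_stabilizer n k"
proof -
  have "sym_join n k p q ` {1..k} = p ` {1..k}" by (rule image_cong[OF refl]) (rule sym_join_low)
  then show ?thesis
    using sym_join_permutes[OF assms] permutes_image[OF p] by (simp add: block_stabilizer_def)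
qed

lemma upper_part_permutes:
  assumes "\<sigma> \<in> block_stabilizer n k"
  shows "upper_part n k \<sigma> permutes {1..k}"
proof (rule bij_imp_permutes)
  have s: "\<sigma> permutes {1..n}" "\<sigma> ` {1..k} = {1..k}" using assms by (simp_all add: block_stabilizer_def)
  have "bij_betw \<sigma> {1..k} {1..k}"
    using s(2) inj_on_subset[OF permutes_inj[OF s(1)]] by (simp add: bij_betw_def)
  then show "bij_betw (upper_part n k \<sigma>) {1..k} {1..k}"
    by (rule bij_betw_cong[THEN iffD1, rotated]) (simp add: sym_split_def)
  show "upper_part n k \<sigma> x = x" if "x \<notin> {1..k}" for x
    unfolding sym_split_def fst_conv by (rule if_not_P[OF that])
qed

text \<open>A permutation preserving {1..k} also preserves the points above k, so the truncated
  subtraction in \<open>sym_split\<close> loses nothing.\<close>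

lemma block_complement:
  assumes k: "k \<le> n" and s: "\<sigma> \<in> block_stabilizer n k" and i: "i \<in> {1..n - k}"
  shows "\<sigma> (k + i) = k + lower_part n k \<sigma> i" "lower_part n k \<sigma> i \<in> {1..n - k}"
proof -
  have p: "\<sigma> permutes {1..n}" "\<sigma> ` {1..k} = {1..k}" using s by (simp_all add: block_stabilizer_def)
  have "k + i \<in> {1..n}" "k + i \<notin> {1..k}" using i k by auto
  then have "\<sigma> (k + i) \<in> {1..n}" "\<sigma> (k + i) \<notin> \<sigma> ` {1..k}"
    using permutes_in_image[OF p(1)] inj_image_mem_iff[OF permutes_inj[OF p(1)]] by blast+
  then have r: "k < \<sigma> (k + i)" "\<sigma> (k + i) \<le> n" unfolding p(2) by auto
  have v: "lower_part n k \<sigma> i = \<sigma> (k + i) - k" using i by (simp add: sym_split_def)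
  show "\<sigma> (k + i) = k + lower_part n k \<sigma> i" "lower_part n k \<sigma> i \<in> {1..n - k}" unfolding v using r by auto
qed

lemma lower_part_permutes:
  assumes k: "k \<le> n" and s: "\<sigma> \<in> block_stabilizer n k"
  shows "lower_part n k \<sigma> permutes {1..n - k}"
proof (rule bij_imp_permutes)
  have p: "\<sigma> permutes {1..n}" using s by (simp add: block_stabilizer_def)
  have inj: "inj_on (lower_part n k \<sigma>) {1..n - k}"
  proof (rule inj_onI)
    fix i j assume ij: "i \<in> {1..n - k}" "j \<in> {1..n - k}" "lower_part n k \<sigma> i = lower_part n k \<sigma> j"
    then have "\<sigma> (k + i) = \<sigma> (k + j)"
      using block_complement(1)[OF k s ij(1)] block_complement(1)[OF k s ij(2)] by simp
    then show "i = j" using injD[OF permutes_inj[OF p]] by fastforce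
  qed
  have "lower_part n k \<sigma> ` {1..n - k} \<subseteq> {1..n - k}" using block_complement(2)[OF k s] by blast
  then show "bij_betw (lower_part n k \<sigma>) {1..n - k} {1..n - k}"
    using inj by (simp add: bij_betw_def endo_inj_surj)
  show "lower_part n k \<sigma> x = x" if "x \<notin> {1..n - k}" for x
    unfolding sym_split_def snd_conv by (rule if_not_P[OF that])
qed

lemma sym_join_split:
  assumes k: "k \<le> n" and s: "\<sigma> \<in> block_stabilizer n k"
  shows "sym_join n k (upper_part n k \<sigma>) (lower_part n k \<sigma>) = \<sigma>"
proof
  fix i
  have p: "\<sigma> permutes {1..n}" using s by (simp add: block_stabilizer_def)
  show "sym_join n k (upper_part n k \<sigma>) (lower_part n k \<sigma>) i = \<sigma> i"
  proof (rule block_cases[OF k, of i])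
    assume i: "i \<in> {1..k}"
    then show ?thesis by (simp add: sym_join_low sym_split_def)
  next
    fix j assume j: "j \<in> {1..n - k}" "i = k + j"
    show ?thesis unfolding j(2) sym_join_high[OF j(1)] by (rule block_complement(1)[OF k s j(1), symmetric])
  next
    assume i: "i \<notin> {1..n}"
    show ?thesis unfolding sym_join_outside[OF k i] by (rule permutes_not_in[OF p i, symmetric])
  qed
qed

lemma sym_split_join:
  assumes k: "k \<le> n" and p: "p permutes {1..k}" and q: "q permutes {1..n - k}"
  shows "sym_split n k (sym_join n k p q) = (p, q)"
proof (rule prod_eqI)
  show "upper_part n k (sym_join n k p q) = fst (p, q)"
    using permutes_not_in[OF p] by (auto simp: sym_split_def sym_join_def fun_eq_iff)
  show "lower_part n k (sym_join n k p q) = snd (p, q)"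
  proof
    fix i
    show "lower_part n k (sym_join n k p q) i = snd (p, q) i"
    proof (cases "i \<in> {1..n - k}")
      case True
      then show ?thesis using sym_join_high[OF True] by (simp add: sym_split_def)
    next
      case False
      then show ?thesis using permutes_not_in[OF q False] unfolding sym_split_def snd_conv if_not_P[OF False] by simp
    qed
  qed
qed

lemma block_stabilizer_comp:
  "\<sigma> \<in> block_stabilizer n k \<Longrightarrow> \<tau> \<in> block_stabilizer n k \<Longrightarrow> \<sigma> \<circ> \<tau> \<in> block_stabilizer n k"
  unfolding block_stabilizer_def mem_Collect_eq image_comp[symmetric] by (simp only: permutes_compose)

lemma block_stabilizer_inv:
  assumes "\<sigma> \<in> block_stabilizer n k"
  shows "inv' \<sigma> \<in> block_stabilizer n k"
proof -
  have p: "\<sigma> permutes {1..n}" "\<sigma> ` {1..k} = {1..k}" using assms by (simp_all add: block_stabilizer_def)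
  have "inv' \<sigma> ` {1..k} = inv' \<sigma> ` \<sigma> ` {1..k}" by (simp only: p(2))
  also have "\<dots> = {1..k}" by (simp only: image_comp permutes_inv_o(2)[OF p(1)] image_id id_apply)
  finally show ?thesis using permutes_inv[OF p(1)] by (simp add: block_stabilizer_def)
qed

lemma block_stabilizer_id: "id \<in> block_stabilizer n k"
  by (simp add: block_stabilizer_def permutes_id)

lemma block_stabilizer_permutes: "\<sigma> \<in> block_stabilizer n k \<Longrightarrow> \<sigma> permutes {1..n}"
  by (simp add: block_stabilizer_def)

text \<open>Multiplicativity is transferred from \<open>sym_join\<close>, where composition is
  blockwise, through the fact that the two maps are inverse to each other.\<close>

lemma sym_split_comp:
  assumes k: "k \<le> n" and s: "\<sigma> \<in> block_stabilizer n k" and t: "\<tau> \<in> block_stabilizer n k"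
  shows "sym_split n k (\<sigma> \<circ> \<tau>) = (upper_part n k \<sigma> \<circ> upper_part n k \<tau>, lower_part n k \<sigma> \<circ> lower_part n k \<tau>)"
proof -
  note us = upper_part_permutes[OF s] and ut = upper_part_permutes[OF t]
    and ls = lower_part_permutes[OF k s] and lt = lower_part_permutes[OF k t]
  have "\<sigma> \<circ> \<tau> = sym_join n k (upper_part n k \<sigma>) (lower_part n k \<sigma>) \<circ> sym_join n k (upper_part n k \<tau>) (lower_part n k \<tau>)"
    by (simp only: sym_join_split[OF k s] sym_join_split[OF k t])
  also have "\<dots> = sym_join n k (upper_part n k \<sigma> \<circ> upper_part n k \<tau>) (lower_part n k \<sigma> \<circ> lower_part n k \<tau>)"
    by (rule sym_join_comp[OF k ut lt])
  finally show ?thesis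
    using sym_split_join[OF k permutes_compose[OF ut us] permutes_compose[OF lt ls]] by simp
qed

lemma sym_split_id: "k \<le> n \<Longrightarrow> sym_split n k id = (id, id)"
  using sym_split_join[of k n id id] by (simp add: sym_join_id permutes_id)

section \<open>The induced partial representations\<close>

text \<open>Two levels of function spaces occur: \<open>cvs\<close> serves functions on tabloids or
  pairs of tabloids, and \<open>vvs\<close> serves functions on the group with values in such
  functions.\<close>

interpretation cvs: vector_space "fun_scale (*) :: complex \<Rightarrow> ('a \<Rightarrow> complex) \<Rightarrow> 'a \<Rightarrow> complex"
  by (rule vector_space_fun_scale[OF vector_space_complex])

interpretation vvs: vector_space "fun_scale (fun_scale (*)) :: complex \<Rightarrow> ('x \<Rightarrow> 'a \<Rightarrow> complex) \<Rightarrow> 'x \<Rightarrow> 'a \<Rightarrow> complex"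
  by (rule vector_space_fun_scale[OF cvs.vector_space_axioms])

lemma zero_fun_eta [simp]: "(\<lambda>a. 0) = 0"
  by (simp add: zero_fun_def)

lemma fun_scale_apply: "fun_scale s c f x = s c (f x)"
  by (simp add: fun_scale_def)

section \<open>Tensor products of Specht modules and the action of the block stabilizer\<close>

definition tens :: "('a \<Rightarrow> complex) \<Rightarrow> ('b \<Rightarrow> complex) \<Rightarrow> 'a \<times> 'b \<Rightarrow> complex" where
  "tens v w = (\<lambda>(x, y). v x * w y)"

lemma tens_add_left: "tens (v + v') w = tens v w + tens v' w"
  and tens_add_right: "tens v (w + w') = tens v w + tens v w'"
  and tens_scale_left: "tens (fun_scale (*) a v) w = fun_scale (*) a (tens v w)"
  and tens_scale_right: "tens v (fun_scale (*) a w) = fun_scale (*) a (tens v w)"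
  and tens_zero_left: "tens 0 w = 0"
  and tens_zero_right: "tens v 0 = 0"
  by (rule ext, simp add: tens_def fun_scale_apply case_prod_beta distrib_left distrib_right mult_ac)+

definition polytabloid_pair where
  "polytabloid_pair \<nu> \<mu> T T' = tens (polytabloid \<nu> T) (polytabloid \<mu> T')"

text \<open>The tensor product of two Specht modules, given by finitely many generators on which
  span inductions can start.\<close>

definition pair_space :: "nat list \<Rightarrow> nat list \<Rightarrow> (nat set list \<times> nat set list \<Rightarrow> complex) set" where
  "pair_space \<nu> \<mu> = module.span (fun_scale (*)) {polytabloid_pair \<nu> \<mu> T T' | T T'. T \<in> tableaux \<nu> \<and> T' \<in> tableaux \<mu>}"

lemma subspace_pair_space: "cvs.subspace (pair_space \<nu> \<mu>)"
  unfolding pair_space_def by (rule cvs.subspace_span)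

text \<open>Bilinearity of \<open>tens\<close> lets two span inductions run one after the other,
  first in the left factor and then in the right one.\<close>

lemma rspace_outer_Specht: "rspace (outer_tensor (Specht \<nu>) (Specht \<mu>)) = pair_space \<nu> \<mu>"
proof
  let ?E = "{polytabloid_pair \<nu> \<mu> T T' | T T'. T \<in> tableaux \<nu> \<and> T' \<in> tableaux \<mu>}"
  let ?P = "polytabloid \<nu> ` tableaux \<nu>" and ?Q = "polytabloid \<mu> ` tableaux \<mu>"
  have o: "rspace (outer_tensor (Specht \<nu>) (Specht \<mu>)) = cvs.span {tens v w | v w. v \<in> cvs.span ?P \<and> w \<in> cvs.span ?Q}"
    by (simp add: outer_tensor_def Specht_def tens_def)
  have 1: "tens v (polytabloid \<mu> T') \<in> cvs.span ?E" if "v \<in> cvs.span ?P" "T' \<in> tableaux \<mu>" for v T'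
    using that(1)
  proof (induction rule: cvs.span_induct)
    case base
    show ?case unfolding cvs.subspace_def mem_Collect_eq tens_zero_left tens_add_left tens_scale_left
      by (simp add: cvs.span_zero cvs.span_add cvs.span_scale)
  next
    case (step x)
    then show ?case using that(2) by (auto intro!: cvs.span_base simp: polytabloid_pair_def)
  qed
  have 2: "tens v w \<in> cvs.span ?E" if "v \<in> cvs.span ?P" "w \<in> cvs.span ?Q" for v w
    using that(2)
  proof (induction rule: cvs.span_induct)
    case base
    show ?case unfolding cvs.subspace_def mem_Collect_eq tens_zero_right tens_add_right tens_scale_right
      by (simp add: cvs.span_zero cvs.span_add cvs.span_scale)
  next
    case (step x)
    then show ?case using 1[OF that(1)] by blast
  qed
  show "rspace (outer_tensor (Specht \<nu>) (Specht \<mu>)) \<subseteq> pair_space \<nu> \<mu>"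
    unfolding o pair_space_def by (rule cvs.span_minimal) (use 2 cvs.subspace_span in auto)
  have "?E \<subseteq> {tens v w | v w. v \<in> cvs.span ?P \<and> w \<in> cvs.span ?Q}"
    unfolding polytabloid_pair_def using cvs.span_base by blast
  then show "pair_space \<nu> \<mu> \<subseteq> rspace (outer_tensor (Specht \<nu>) (Specht \<mu>))"
    unfolding o pair_space_def by (rule cvs.span_mono)
qed

text \<open>The action of the stabilizer on the tensor product, transported through
  \<open>sym_split\<close> and extended to all functions on pairs of tabloids.\<close>

definition kact :: "nat \<Rightarrow> nat \<Rightarrow> (nat \<Rightarrow> nat) \<Rightarrow> (nat set list \<times> nat set list \<Rightarrow> complex) \<Rightarrow> nat set list \<times> nat set list \<Rightarrow> complex" where
  "kact n k \<sigma> F = (\<lambda>(t, t'). F (map ((`) (inv' (upper_part n k \<sigma>))) t, map ((`) (inv' (lower_part n k \<sigma>))) t'))"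

lemma kact_add: "kact n k \<sigma> (F + F') = kact n k \<sigma> F + kact n k \<sigma> F'"
  and kact_scale: "kact n k \<sigma> (fun_scale (*) a F) = fun_scale (*) a (kact n k \<sigma> F)"
  and kact_zero: "kact n k \<sigma> 0 = 0"
  by (rule ext, simp add: kact_def fun_scale_apply case_prod_beta)+

lemma kact_sum: "kact n k \<sigma> (\<Sum>i\<in>A. F i) = (\<Sum>i\<in>A. kact n k \<sigma> (F i))"
  by (induction A rule: infinite_finite_induct) (simp_all only: sum.infinite sum.empty sum.insert kact_add kact_zero not_False_eq_True)

lemma kact_comp:
  assumes k: "k \<le> n" and s: "\<sigma> \<in> block_stabilizer n k" and t: "\<tau> \<in> block_stabilizer n k"
  shows "kact n k (\<sigma> \<circ> \<tau>) F = kact n k \<sigma> (kact n k \<tau> F)"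
proof -
  note b = permutes_bij[OF upper_part_permutes[OF s]] permutes_bij[OF upper_part_permutes[OF t]]
    permutes_bij[OF lower_part_permutes[OF k s]] permutes_bij[OF lower_part_permutes[OF k t]]
  have 1: "inv' (upper_part n k (\<sigma> \<circ> \<tau>)) = inv' (upper_part n k \<tau>) \<circ> inv' (upper_part n k \<sigma>)"
    unfolding sym_split_comp[OF assms] fst_conv by (rule o_inv_distrib[OF b(1,2)])
  have 2: "inv' (lower_part n k (\<sigma> \<circ> \<tau>)) = inv' (lower_part n k \<tau>) \<circ> inv' (lower_part n k \<sigma>)"
    unfolding sym_split_comp[OF assms] snd_conv by (rule o_inv_distrib[OF b(3,4)])
  have m: "map ((`) (f \<circ> g)) t = map ((`) f) (map ((`) g) t)" for f g :: "nat \<Rightarrow> nat" and t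
    by (simp add: image_comp comp_def)
  show ?thesis unfolding kact_def 1 2 m by (simp add: fun_eq_iff del: map_map)
qed

lemma kact_id: "k \<le> n \<Longrightarrow> kact n k id F = F"
  by (simp add: kact_def sym_split_id fun_eq_iff)

lemma kact_polytabloid_pair:
  assumes k: "k \<le> n" and s: "\<sigma> \<in> block_stabilizer n k" and sz: "sum_list \<nu> = k" "sum_list \<mu> = n - k"
    and T: "filling \<nu> T" and T': "filling \<mu> T'"
  shows "kact n k \<sigma> (polytabloid_pair \<nu> \<mu> T T') = polytabloid_pair \<nu> \<mu> (upper_part n k \<sigma> \<circ> T) (lower_part n k \<sigma> \<circ> T')"
proof -
  have "upper_part n k \<sigma> permutes {1..sum_list \<nu>}" "lower_part n k \<sigma> permutes {1..sum_list \<mu>}"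
    using upper_part_permutes[OF s] lower_part_permutes[OF k s] sz by simp_all
  then show ?thesis
    by (simp add: kact_def polytabloid_pair_def tens_def fun_eq_iff polytabloid_perm[OF T] polytabloid_perm[OF T'])
qed

lemma polytabloid_pair_in:
  assumes "filling \<nu> T" "filling \<mu> T'"
  shows "polytabloid_pair \<nu> \<mu> T T' \<in> pair_space \<nu> \<mu>"
proof -
  have "polytabloid_pair \<nu> \<mu> T T' = polytabloid_pair \<nu> \<mu> (restrict T (diagram \<nu>)) (restrict T' (diagram \<mu>))"
    unfolding polytabloid_pair_def
    using polytabloid_cong[of \<nu> T "restrict T (diagram \<nu>)"] polytabloid_cong[of \<mu> T' "restrict T' (diagram \<mu>)"] by simp
  then show ?thesis unfolding pair_space_def
    using filling_restrict[OF assms(1)] filling_restrict[OF assms(2)] by (intro cvs.span_base) blast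
qed

lemma kact_in:
  assumes "k \<le> n" "\<sigma> \<in> block_stabilizer n k" "sum_list \<nu> = k" "sum_list \<mu> = n - k" "w \<in> pair_space \<nu> \<mu>"
  shows "kact n k \<sigma> w \<in> pair_space \<nu> \<mu>"
  using assms(5) unfolding pair_space_def
proof (induction rule: cvs.span_induct)
  case base
  show ?case unfolding cvs.subspace_def mem_Collect_eq kact_zero kact_add kact_scale
    by (simp add: cvs.span_zero cvs.span_add cvs.span_scale)
next
  case (step x)
  then obtain T T' where x: "x = polytabloid_pair \<nu> \<mu> T T'" "T \<in> tableaux \<nu>" "T' \<in> tableaux \<mu>" by blast
  note F = tableaux_filling[OF x(2)] tableaux_filling[OF x(3)]
  have "upper_part n k \<sigma> permutes {1..sum_list \<nu>}" "lower_part n k \<sigma> permutes {1..sum_list \<mu>}"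
    using upper_part_permutes[OF assms(2)] lower_part_permutes[OF assms(1,2)] assms(3,4) by simp_all
  then show ?case
    unfolding x(1) kact_polytabloid_pair[OF assms(1-4) F] pair_space_def[symmetric]
    by (intro polytabloid_pair_in filling_comp F)
qed

text \<open>The set A^-1 for A = A_k: the inverse of y maps 1 into {1..k}. Phrased through the image
  of {1..k}, it is visibly stable under right factors from the block stabilizer.\<close>

definition inducing :: "nat \<Rightarrow> nat \<Rightarrow> (nat \<Rightarrow> nat) set" where
  "inducing n k = {y. y permutes {1..n} \<and> 1 \<in> y ` {1..k}}"

lemma inducing_iff:
  assumes "y permutes {1..n}"
  shows "y \<in> inducing n k \<longleftrightarrow> inv' y 1 \<in> {1..k}"
proof -
  have "1 \<in> y ` {1..k} \<longleftrightarrow> y (inv' y 1) \<in> y ` {1..k}" by (simp only: permutes_inverses(1)[OF assms])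
  also have "\<dots> \<longleftrightarrow> inv' y 1 \<in> {1..k}" by (rule inj_image_mem_iff[OF permutes_inj[OF assms]])
  finally show ?thesis using assms by (simp add: inducing_def)
qed

lemma inducing_permutes: "y \<in> inducing n k \<Longrightarrow> y permutes {1..n}"
  by (simp add: inducing_def)

lemma set_inv_sym_coset_union: "set_inv\<^bsub>sym_group n\<^esub> (sym_coset_union n k) = inducing n k"
proof (rule Set.set_eqI)
  fix y
  show "y \<in> set_inv\<^bsub>sym_group n\<^esub> (sym_coset_union n k) \<longleftrightarrow> y \<in> inducing n k"
  proof
    assume "y \<in> set_inv\<^bsub>sym_group n\<^esub> (sym_coset_union n k)"
    then obtain a where a: "a permutes {1..n}" "a 1 \<in> {1..k}" "y = inv' a"
      by (auto simp: SET_INV_def sym_coset_union_def sym_group_carrier)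
    then show "y \<in> inducing n k"
      using inducing_iff[OF permutes_inv[OF a(1)]] permutes_inv_inv[OF a(1)] by simp
  next
    assume y: "y \<in> inducing n k"
    note yp = inducing_permutes[OF y]
    have "inv' y \<in> sym_coset_union n k"
      using y inducing_iff[OF yp] permutes_inv[OF yp] by (simp add: sym_coset_union_def sym_group_carrier)
    moreover have "y = inv\<^bsub>sym_group n\<^esub> (inv' y)"
      using permutes_inv[OF yp] permutes_inv_inv[OF yp] by (simp add: sym_group_carrier)
    ultimately show "y \<in> set_inv\<^bsub>sym_group n\<^esub> (sym_coset_union n k)" unfolding SET_INV_def by blast
  qed
qed

text \<open>The pure tensor x \<otimes> w in the function model, with the abstract group operations
  spelled out; \<open>pure_tensor_eq\<close> identifies the two forms.\<close>

definition pt :: "nat \<Rightarrow> nat \<Rightarrow> (nat \<Rightarrow> nat) \<Rightarrow> (nat set list \<times> nat set list \<Rightarrow> complex) \<Rightarrow>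
    (nat \<Rightarrow> nat) \<Rightarrow> nat set list \<times> nat set list \<Rightarrow> complex" where
  "pt n k x w = (\<lambda>y. if y permutes {1..n} \<and> inv' y \<circ> x \<in> block_stabilizer n k then kact n k (inv' y \<circ> x) w else 0)"

lemma pt_add: "pt n k x (w + w') = pt n k x w + pt n k x w'"
  and pt_scale: "pt n k x (fun_scale (*) a w) = fun_scale (fun_scale (*)) a (pt n k x w)"
  and pt_zero: "pt n k x 0 = 0"
proof -
  show "pt n k x (w + w') = pt n k x w + pt n k x w'" by (rule ext) (simp add: pt_def kact_add)
  show "pt n k x (fun_scale (*) a w) = fun_scale (fun_scale (*)) a (pt n k x w)"
    by (rule ext) (simp add: pt_def kact_scale fun_scale_def[of "fun_scale (*)"])
  show "pt n k x 0 = 0" by (rule ext) (simp add: pt_def kact_zero)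
qed

lemma inducing_block:
  assumes y: "y permutes {1..n}" and s: "\<sigma> \<in> block_stabilizer n k"
  shows "y \<circ> \<sigma> \<in> inducing n k \<longleftrightarrow> y \<in> inducing n k"
proof -
  have "\<sigma> ` {1..k} = {1..k}" using s by (simp add: block_stabilizer_def)
  then have "(y \<circ> \<sigma>) ` {1..k} = y ` {1..k}" by (simp only: image_comp[symmetric])
  then show ?thesis using permutes_compose[OF block_stabilizer_permutes[OF s] y] y by (simp add: inducing_def)
qed

lemma subspace_value:
  fixes U :: "('a \<Rightarrow> complex) set" and y :: 'x
  assumes U: "cvs.subspace U"
  shows "vvs.subspace {f. f y \<in> U}"
  unfolding vvs.subspace_def mem_Collect_eq
proof (intro conjI ballI allI)
  show "(0 :: 'x \<Rightarrow> 'a \<Rightarrow> complex) y \<in> U"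
    by (rule ssubst[of _ _ "\<lambda>z. z \<in> U", OF zero_fun_apply]) (rule cvs.subspace_0[OF U])
  fix f g :: "'x \<Rightarrow> 'a \<Rightarrow> complex" assume fg: "f \<in> {f. f y \<in> U}" "g \<in> {f. f y \<in> U}"
  show "(f + g) y \<in> U"
    by (rule ssubst[of _ _ "\<lambda>z. z \<in> U", OF plus_fun_apply]) (rule cvs.subspace_add[OF U], use fg in blast, use fg in blast)
next
  fix a and f :: "'x \<Rightarrow> 'a \<Rightarrow> complex" assume f: "f \<in> {f. f y \<in> U}"
  show "fun_scale (fun_scale (*)) a f y \<in> U"
    by (rule ssubst[of _ _ "\<lambda>z. z \<in> U", OF fun_scale_apply]) (rule cvs.subspace_scale[OF U], use f in blast)
qed

section \<open>The induced representation of one pair of partitions\<close>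

locale partition_pair =
  fixes n k :: nat and \<nu> \<mu> :: "nat list"
  assumes k: "k \<in> {1..n}" and \<nu>: "\<nu> \<in> partitions k" and \<mu>: "\<mu> \<in> partitions (n - k)"
begin

abbreviation "R \<equiv> V_pair n k \<nu> \<mu>"
abbreviation "V \<equiv> rspace R"
abbreviation "W \<equiv> pair_space \<nu> \<mu>"
abbreviation "K \<equiv> block_stabilizer n k"

lemma kn: "k \<le> n" and n1: "1 \<le> n"
  using k by auto

lemma sizes: "sum_list \<nu> = k" "sum_list \<mu> = n - k"
  using \<nu> \<mu> by (simp_all add: partitions_def)

lemma rscale_eq: "rscale R = fun_scale (fun_scale (*))"
  by (simp add: V_pair_def Ind_def pullback_def outer_tensor_def)

lemma stab_eq: "stabilizer_of (sym_group n) (sym_coset_union n k) = K"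
  unfolding stabilizer_of_sym_coset_union[OF k] by (simp add: block_stabilizer_def sym_group_carrier)

lemma ract_eq:
  assumes "g permutes {1..n}"
  shows "ract R g f = (\<lambda>y. if y \<in> inducing n k then f (inv' g \<circ> y) else 0)"
proof -
  have "inv\<^bsub>sym_group n\<^esub> g = inv' g" using assms by (simp add: sym_group_carrier)
  then show ?thesis unfolding V_pair_def Ind_def rep.simps set_inv_sym_coset_union sym_group_mult by (simp only:)
qed

lemma ract_outer:
  assumes "\<sigma> \<in> K"
  shows "ract (pullback (sym_split n k) (outer_tensor (Specht \<nu>) (Specht \<mu>))) \<sigma> w = kact n k \<sigma> w"
proof -
  obtain p q where pq: "sym_split n k \<sigma> = (p, q)" by fastforce
  have "p permutes {1..k}" "q permutes {1..n - k}"
    using upper_part_permutes[OF assms] lower_part_permutes[OF kn assms] pq by simp_all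
  then have i: "inv\<^bsub>sym_group (sum_list \<nu>)\<^esub> p = inv' p" "inv\<^bsub>sym_group (sum_list \<mu>)\<^esub> q = inv' q"
    by (simp_all add: sizes sym_group_carrier)
  show ?thesis
    by (simp add: pullback_def outer_tensor_def Specht_def kact_def pq i)
qed

lemma pure_tensor_eq:
  assumes x: "x permutes {1..n}"
  shows "pure_tensor (sym_group n) (stabilizer_of (sym_group n) (sym_coset_union n k))
      (pullback (sym_split n k) (outer_tensor (Specht \<nu>) (Specht \<mu>))) x w = pt n k x w"
proof
  fix y
  show "pure_tensor (sym_group n) (stabilizer_of (sym_group n) (sym_coset_union n k))
      (pullback (sym_split n k) (outer_tensor (Specht \<nu>) (Specht \<mu>))) x w y = pt n k x w y"
  proof (cases "y permutes {1..n}")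
    case True
    then have i: "inv\<^bsub>sym_group n\<^esub> y = inv' y" by (simp add: sym_group_carrier)
    show ?thesis using True unfolding pure_tensor_def pt_def stab_eq i
      by (simp add: sym_group_carrier sym_group_mult ract_outer)
  next
    case False
    then show ?thesis by (simp add: pure_tensor_def pt_def sym_group_carrier)
  qed
qed

text \<open>A finite generating set: it gives finite dimension and the generators for the span
  inductions over \<open>V\<close>.\<close>

definition gens :: "((nat \<Rightarrow> nat) \<Rightarrow> nat set list \<times> nat set list \<Rightarrow> complex) set" where
  "gens = {pt n k x (polytabloid_pair \<nu> \<mu> T T') | x T T'. x \<in> inducing n k \<and> T \<in> tableaux \<nu> \<and> T' \<in> tableaux \<mu>}"

lemma finite_gens: "finite gens"
proof -
  have "finite (inducing n k)"
    by (rule finite_subset[OF _ finite_permutations[of "{1..n}"]]) (auto simp: inducing_def)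
  then have "finite ((\<lambda>(x, T, T'). pt n k x (polytabloid_pair \<nu> \<mu> T T')) ` (inducing n k \<times> tableaux \<nu> \<times> tableaux \<mu>))"
    by (intro finite_imageI finite_cartesian_product finite_tableaux)
  then show ?thesis by (rule rev_finite_subset) (force simp: gens_def)
qed

lemma V_eq: "V = vvs.span gens"
proof
  have V: "V = vvs.span {pt n k x w | x w. x \<in> inducing n k \<and> w \<in> W}"
  proof -
    have "V = vvs.span {pure_tensor (sym_group n) (stabilizer_of (sym_group n) (sym_coset_union n k))
      (pullback (sym_split n k) (outer_tensor (Specht \<nu>) (Specht \<mu>))) x w | x w. x \<in> inducing n k \<and> w \<in> W}"
      unfolding V_pair_def Ind_def rep.simps tensor_space_def set_inv_sym_coset_union
      by (simp add: pullback_def rspace_outer_Specht) (simp add: outer_tensor_def)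
    also have "{pure_tensor (sym_group n) (stabilizer_of (sym_group n) (sym_coset_union n k))
      (pullback (sym_split n k) (outer_tensor (Specht \<nu>) (Specht \<mu>))) x w | x w. x \<in> inducing n k \<and> w \<in> W} =
      {pt n k x w | x w. x \<in> inducing n k \<and> w \<in> W}"
      by (intro Collect_cong ex_cong) (metis pure_tensor_eq[OF inducing_permutes])
    finally show ?thesis .
  qed
  have "pt n k x w \<in> vvs.span gens" if x: "x \<in> inducing n k" and w: "w \<in> W" for x w
    using w unfolding pair_space_def
  proof (induction rule: cvs.span_induct)
    case base
    show ?case unfolding cvs.subspace_def mem_Collect_eq pt_zero pt_add pt_scale
      by (simp add: vvs.span_zero vvs.span_add vvs.span_scale)
  next
    case (step v)
    then obtain T T' where "v = polytabloid_pair \<nu> \<mu> T T'" "T \<in> tableaux \<nu>" "T' \<in> tableaux \<mu>" by blast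
    then show ?case unfolding gens_def using x by (intro vvs.span_base) blast
  qed
  then show "V \<subseteq> vvs.span gens" unfolding V by (intro vvs.span_minimal vvs.subspace_span) blast
  show "vvs.span gens \<subseteq> V"
    unfolding V
  proof (rule vvs.span_mono)
    show "gens \<subseteq> {pt n k x w | x w. x \<in> inducing n k \<and> w \<in> W}"
      unfolding gens_def using polytabloid_pair_in[OF tableaux_filling tableaux_filling] by blast
  qed
qed

lemma gens_cases:
  assumes "v \<in> gens"
  obtains x w where "v = pt n k x w" "x \<in> inducing n k" "w \<in> W"
proof -
  obtain x T T' where v: "v = pt n k x (polytabloid_pair \<nu> \<mu> T T')" "x \<in> inducing n k" "T \<in> tableaux \<nu>" "T' \<in> tableaux \<mu>"
    using assms unfolding gens_def by blast
  show ?thesis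
    by (rule that[OF v(1,2) polytabloid_pair_in[OF tableaux_filling[OF v(3)] tableaux_filling[OF v(4)]]])
qed

lemma subspace_V: "vvs.subspace V"
  unfolding V_eq by (rule vvs.subspace_span)

lemma pt_in_V: "x \<in> inducing n k \<Longrightarrow> T \<in> tableaux \<nu> \<Longrightarrow> T' \<in> tableaux \<mu> \<Longrightarrow> pt n k x (polytabloid_pair \<nu> \<mu> T T') \<in> V"
  unfolding V_eq gens_def by (intro vvs.span_base) blast

lemma pt_in_V_filling:
  assumes "x \<in> inducing n k" "filling \<nu> T" "filling \<mu> T'"
  shows "pt n k x (polytabloid_pair \<nu> \<mu> T T') \<in> V"
proof -
  have "polytabloid_pair \<nu> \<mu> T T' = polytabloid_pair \<nu> \<mu> (restrict T (diagram \<nu>)) (restrict T' (diagram \<mu>))"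
    unfolding polytabloid_pair_def
    using polytabloid_cong[of \<nu> T "restrict T (diagram \<nu>)"] polytabloid_cong[of \<mu> T' "restrict T' (diagram \<mu>)"] by simp
  then show ?thesis using pt_in_V[OF assms(1) filling_restrict[OF assms(2)] filling_restrict[OF assms(3)]] by simp
qed

lemma support:
  assumes "f \<in> V" "y \<notin> inducing n k"
  shows "f y = 0"
  using assms(1) unfolding V_eq
proof (induction rule: vvs.span_induct)
  case base
  show ?case using subspace_value[OF cvs.subspace_single_0, of y] by (simp only: singleton_iff)
next
  case (step f)
  then obtain x w where f: "f = pt n k x w" "x \<in> inducing n k" by (rule gens_cases)
  have "\<not> (y permutes {1..n} \<and> inv' y \<circ> x \<in> K)"
  proof
    assume y: "y permutes {1..n} \<and> inv' y \<circ> x \<in> K"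
    have "y \<circ> (inv' y \<circ> x) = x" using permutes_inv_o(1)[of y "{1..n}"] y by (simp add: comp_assoc[symmetric])
    then show False using inducing_block[of y n "inv' y \<circ> x" k] y f(2) assms(2) by simp
  qed
  then show ?case unfolding f(1) pt_def by (rule if_not_P)
qed

lemma value_in:
  assumes "f \<in> V"
  shows "f y \<in> W"
  using assms unfolding V_eq
proof (induction rule: vvs.span_induct)
  case base
  show ?case by (rule subspace_value[OF subspace_pair_space])
next
  case (step f)
  then obtain x w where f: "f = pt n k x w" "w \<in> W" by (rule gens_cases)
  then show ?case using kact_in[OF kn _ sizes f(2)] cvs.subspace_0[OF subspace_pair_space] by (simp add: pt_def)
qed

text \<open>Together with \<open>support\<close> and \<open>value_in\<close> this gives the usual
  picture of induced functions: one value on each coset of the block stabilizer determines the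
  function.\<close>

lemma equivariant:
  assumes "f \<in> V" and y: "y permutes {1..n}" and s: "\<sigma> \<in> K"
  shows "f (y \<circ> \<sigma>) = kact n k (inv' \<sigma>) (f y)"
  using assms(1) unfolding V_eq
proof (induction rule: vvs.span_induct)
  case base
  show ?case
    unfolding vvs.subspace_def mem_Collect_eq zero_fun_apply plus_fun_apply fun_scale_apply[of "fun_scale (*)"]
      kact_zero kact_add kact_scale
    by (intro conjI ballI allI refl) (simp_all only: mem_Collect_eq)
next
  case (step f)
  then obtain x w where f: "f = pt n k x w" "x \<in> inducing n k" by (rule gens_cases)
  note sp = block_stabilizer_permutes[OF s] and si = block_stabilizer_inv[OF s]
  have e: "inv' (y \<circ> \<sigma>) \<circ> x = inv' \<sigma> \<circ> (inv' y \<circ> x)"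
    by (simp add: o_inv_distrib[OF permutes_bij[OF y] permutes_bij[OF sp]] comp_assoc)
  have "inv' \<sigma> \<circ> (inv' y \<circ> x) \<in> K \<longleftrightarrow> inv' y \<circ> x \<in> K"
  proof
    assume "inv' \<sigma> \<circ> (inv' y \<circ> x) \<in> K"
    then have "\<sigma> \<circ> (inv' \<sigma> \<circ> (inv' y \<circ> x)) \<in> K" by (rule block_stabilizer_comp[OF s])
    then show "inv' y \<circ> x \<in> K" using permutes_inv_o(1)[OF sp] by (simp add: comp_assoc[symmetric])
  qed (rule block_stabilizer_comp[OF si])
  then show ?case
    using y permutes_compose[OF sp y] unfolding f(1) pt_def e
    by (simp add: kact_comp[OF kn si] kact_zero)
qed

lemma ract_pt:
  assumes g: "g permutes {1..n}" and x: "x \<in> inducing n k"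
  shows "ract R g (pt n k x w) = (if g \<circ> x \<in> inducing n k then pt n k (g \<circ> x) w else 0)"
proof -
  have A: "sym_coset_union n k \<subseteq> carrier (sym_group n)" by (auto simp: sym_coset_union_def)
  note xp = inducing_permutes[OF x]
  show ?thesis
    using Ind_act_pure_tensor[OF sym_group_is_group A, of g x "pullback (sym_split n k) (outer_tensor (Specht \<nu>) (Specht \<mu>))" w] g x
    unfolding set_inv_sym_coset_union sym_group_mult pure_tensor_eq[OF xp] pure_tensor_eq[OF permutes_compose[OF xp g]]
    by (simp add: sym_group_carrier V_pair_def)
qed

lemma ract_add: "g permutes {1..n} \<Longrightarrow> ract R g (f + f') = ract R g f + ract R g f'"
  and ract_scale: "g permutes {1..n} \<Longrightarrow> ract R g (fun_scale (fun_scale (*)) a f) = fun_scale (fun_scale (*)) a (ract R g f)"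
  and ract_zero: "g permutes {1..n} \<Longrightarrow> ract R g 0 = 0"
  by (simp_all add: ract_eq fun_eq_iff fun_scale_def)

lemma ract_in:
  assumes "f \<in> V" and g: "g permutes {1..n}"
  shows "ract R g f \<in> V"
  using assms(1) unfolding V_eq
proof (induction rule: vvs.span_induct)
  case base
  show ?case unfolding vvs.subspace_def mem_Collect_eq ract_add[OF g] ract_scale[OF g] ract_zero[OF g]
    by (simp add: vvs.span_zero vvs.span_add vvs.span_scale)
next
  case (step f)
  then obtain x T T' where f: "f = pt n k x (polytabloid_pair \<nu> \<mu> T T')" "x \<in> inducing n k" "T \<in> tableaux \<nu>" "T' \<in> tableaux \<mu>"
    unfolding gens_def by blast
  show ?case unfolding f(1) ract_pt[OF g f(2)] V_eq[symmetric]
    using pt_in_V[OF _ f(3,4)] vvs.subspace_0[OF subspace_V] by simp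
qed

lemma acts: "acts_on (sym_group n) R"
  unfolding acts_on_def fin_dim_space_def rscale_eq linear_maps_def
  using vvs.vector_space_axioms finite_gens V_eq ract_in ract_add ract_scale
  by (auto simp: sym_group_carrier)

lemma inv_comp: "g permutes {1..n} \<Longrightarrow> h permutes {1..n} \<Longrightarrow> inv' (g \<circ> h) = inv' h \<circ> inv' g"
  by (intro o_inv_distrib permutes_bij)

lemma ract_value:
  "g permutes {1..n} \<Longrightarrow> ract R g f y = (if y \<in> inducing n k then f (inv' g \<circ> y) else 0)"
  by (simp add: ract_eq)

text \<open>The operators are translations cut off to \<open>inducing n k\<close>. In both axioms
  the two sides translate alike and differ in one cut-off, which is absorbed by the outermost
  cut-off in the first axiom and by the support of v in the second.\<close>

lemma partial: "partial_representation (sym_group n) R"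
  unfolding partial_representation_def
proof (intro conjI ballI)
  show "acts_on (sym_group n) R" by (rule acts)
  fix v assume v: "v \<in> V"
  show "ract R \<one>\<^bsub>sym_group n\<^esub> v = v"
    using support[OF v] by (simp add: sym_group_one ract_eq permutes_id fun_eq_iff)
next
  fix g h v assume "g \<in> carrier (sym_group n)" "h \<in> carrier (sym_group n)" and v: "v \<in> V"
  then have g: "g permutes {1..n}" and h: "h permutes {1..n}" by (simp_all add: sym_group_carrier)
  have ig: "inv\<^bsub>sym_group n\<^esub> g = inv' g" and ih: "inv\<^bsub>sym_group n\<^esub> h = inv' h"
    using g h by (simp_all add: sym_group_carrier)
  have ge: "g \<circ> y \<in> inducing n k \<Longrightarrow> inv' (g \<circ> h) \<circ> (g \<circ> y) = inv' h \<circ> y" for y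
    unfolding inv_comp[OF g h] using permutes_inverses(2)[OF g] by (simp add: fun_eq_iff)
  have gi: "inv' g \<circ> (g \<circ> y) = y" for y :: "nat \<Rightarrow> nat"
    using permutes_inverses(2)[OF g] by (simp add: fun_eq_iff)
  show "ract R (inv\<^bsub>sym_group n\<^esub> g) (ract R (g \<otimes>\<^bsub>sym_group n\<^esub> h) v) = ract R (inv\<^bsub>sym_group n\<^esub> g) (ract R g (ract R h v))"
  proof
    fix y
    show "ract R (inv\<^bsub>sym_group n\<^esub> g) (ract R (g \<otimes>\<^bsub>sym_group n\<^esub> h) v) y = ract R (inv\<^bsub>sym_group n\<^esub> g) (ract R g (ract R h v)) y"
      unfolding ig sym_group_mult ract_value[OF permutes_inv[OF g]] ract_value[OF g] ract_value[OF h]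
        ract_value[OF permutes_compose[OF h g]] permutes_inv_inv[OF g] gi
      using ge by simp
  qed
  have he: "inv' (inv' h) \<circ> (inv' (g \<circ> h) \<circ> y) = inv' g \<circ> y" for y
    unfolding inv_comp[OF g h] permutes_inv_inv[OF h] using permutes_inverses(1)[OF h] by (simp add: fun_eq_iff)
  have he': "inv' (inv' h) \<circ> (inv' h \<circ> y) = y" for y :: "nat \<Rightarrow> nat"
    unfolding permutes_inv_inv[OF h] using permutes_inverses(1)[OF h] by (simp add: fun_eq_iff)
  have he'': "inv' (g \<circ> h) \<circ> y = inv' h \<circ> (inv' g \<circ> y)" for y :: "nat \<Rightarrow> nat"
    by (simp add: inv_comp[OF g h] comp_assoc)
  show "ract R (g \<otimes>\<^bsub>sym_group n\<^esub> h) (ract R (inv\<^bsub>sym_group n\<^esub> h) v) = ract R g (ract R h (ract R (inv\<^bsub>sym_group n\<^esub> h) v))"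
  proof
    fix y
    show "ract R (g \<otimes>\<^bsub>sym_group n\<^esub> h) (ract R (inv\<^bsub>sym_group n\<^esub> h) v) y = ract R g (ract R h (ract R (inv\<^bsub>sym_group n\<^esub> h) v)) y"
      unfolding ih sym_group_mult ract_value[OF permutes_inv[OF h]] ract_value[OF g] ract_value[OF h]
        ract_value[OF permutes_compose[OF h g]] he he'
      unfolding he'' using support[OF v] by simp
  qed
qed

text \<open>Left factors fixing 1 preserve \<open>inducing n k\<close>, so the cut-offs of two such
  operators combine to the cut-off of their product.\<close>

lemma global: "global_partial_representation (sym_group n) (sym_point_stabilizer n) R"
  unfolding global_partial_representation_def
proof (intro conjI partial)
  show "Defs.representation (sym_group n\<lparr>carrier := sym_point_stabilizer n\<rparr>) R"
    unfolding Defs.representation_def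
  proof (intro conjI ballI)
    show "acts_on (sym_group n\<lparr>carrier := sym_point_stabilizer n\<rparr>) R"
      using acts by (auto simp: acts_on_def sym_point_stabilizer_def)
    fix v assume v: "v \<in> V"
    show "ract R \<one>\<^bsub>sym_group n\<lparr>carrier := sym_point_stabilizer n\<rparr>\<^esub> v = v"
      using support[OF v] by (simp add: sym_group_one ract_eq permutes_id fun_eq_iff)
  next
    fix g h v assume "g \<in> carrier (sym_group n\<lparr>carrier := sym_point_stabilizer n\<rparr>)"
      "h \<in> carrier (sym_group n\<lparr>carrier := sym_point_stabilizer n\<rparr>)" and v: "v \<in> V"
    then have g: "g permutes {1..n}" "g 1 = 1" and h: "h permutes {1..n}"
      by (simp_all add: sym_point_stabilizer_def sym_group_carrier)
    have ig: "inv' g 1 = 1" using g permutes_inverses(2) by metis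
    have "inv' g \<circ> y \<in> inducing n k" if "y \<in> inducing n k" for y
    proof -
      have "1 \<in> y ` {1..k}" using that by (simp add: inducing_def)
      then have "inv' g 1 \<in> inv' g ` y ` {1..k}" by (rule imageI)
      then have "1 \<in> (inv' g \<circ> y) ` {1..k}" unfolding ig image_comp .
      then show ?thesis
        using permutes_compose[OF inducing_permutes[OF that] permutes_inv[OF g(1)]] by (simp add: inducing_def)
    qed
    moreover have e: "inv' (g \<circ> h) \<circ> y = inv' h \<circ> (inv' g \<circ> y)" for y :: "nat \<Rightarrow> nat"
      by (simp add: inv_comp[OF g(1) h] comp_assoc)
    moreover have m: "g \<otimes>\<^bsub>sym_group n\<lparr>carrier := sym_point_stabilizer n\<rparr>\<^esub> h = g \<circ> h"
      by (simp add: sym_group_mult)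
    ultimately show "ract R (g \<otimes>\<^bsub>sym_group n\<lparr>carrier := sym_point_stabilizer n\<rparr>\<^esub> h) v = ract R g (ract R h v)"
      unfolding m by (intro ext) (simp add: ract_value[OF g(1)] ract_value[OF h] ract_value[OF permutes_compose[OF h g(1)]] e)
  qed
qed

end

sublocale partition_pair \<subseteq> rep: sym_partial_rep n "V_pair n k \<nu> \<mu>"
  by unfold_locales (rule n1, rule global)

context partition_pair
begin

text \<open>Translating by the transposition of 1 and i and back restores f. What remains is the
  intermediate cut-off, which asks that i lie in the image of {1..k} under y.\<close>

lemma idem_value:
  assumes i: "i \<in> {1..n}" and f: "f \<in> V"
  shows "idem R i f y = (if i \<in> y ` {1..k} then f y else 0)"
proof (cases "y \<in> inducing n k")
  case False
  have "idem R i f \<in> V" by (rule rep.idem_in[OF i])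
  then show ?thesis using support[OF _ False] f by simp
next
  case True
  let ?t = "transpose 1 i"
  note t = rep.swap_perm[OF i] and yp = inducing_permutes[OF True]
  have it: "inv' ?t = ?t" by (simp add: inv_transpose_eq)
  have "1 \<in> (?t \<circ> y) ` {1..k} \<longleftrightarrow> ?t i \<in> ?t ` y ` {1..k}" by (simp only: image_comp transpose_apply_second)
  also have "\<dots> \<longleftrightarrow> i \<in> y ` {1..k}" by (rule inj_image_mem_iff[OF permutes_inj[OF t]])
  finally have ind: "?t \<circ> y \<in> inducing n k \<longleftrightarrow> i \<in> y ` {1..k}"
    using permutes_compose[OF yp t] by (simp add: inducing_def)
  have "?t \<circ> (?t \<circ> y) = y" by (simp add: fun_eq_iff)
  then show ?thesis
    unfolding idem_def pact_def if_P[OF f] if_P[OF ract_in[OF f t]] ract_value[OF t] it ind if_P[OF True] by simp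
qed

lemma idems_value:
  assumes A: "A \<subseteq> {1..n}" and f: "f \<in> V"
  shows "idems R A f y = (if A \<subseteq> y ` {1..k} then f y else 0)"
proof -
  have "finite A" by (rule finite_subset[OF A]) simp
  then show ?thesis using A
  proof (induction A rule: finite_induct)
    case empty
    then show ?case by (simp add: rep.idems_empty)
  next
    case (insert i A)
    then have i: "i \<in> {1..n}" and A: "A \<subseteq> {1..n}" by blast+
    show ?case
      unfolding rep.idems_insert[OF insert.prems] idem_value[OF i rep.idems_in[OF A f]] insert.IH[OF A] by simp
  qed
qed

text \<open>As 1 is in A, the set condition implies membership in \<open>inducing n k\<close> and
  absorbs the cut-off of the group operator.\<close>

lemma sact_value:
  assumes s: "(A, g) \<in> exel_monoid n" and f: "f \<in> V"
  shows "sact R (A, g) f y = (if A \<subseteq> y ` {1..k} \<and> y permutes {1..n} then f (inv' g \<circ> y) else 0)"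
proof -
  have A: "A \<subseteq> {1..n}" "1 \<in> A" and g: "g permutes {1..n}" using s by (simp_all add: exel_monoid_def)
  have "sact R (A, g) f y = (if A \<subseteq> y ` {1..k} then (if y \<in> inducing n k then f (inv' g \<circ> y) else 0) else 0)"
    using f ract_in[OF f g] by (simp add: sact_def pact_def idems_value[OF A(1)] ract_value[OF g])
  also have "\<dots> = (if A \<subseteq> y ` {1..k} \<and> y permutes {1..n} then f (inv' g \<circ> y) else 0)"
    using A(2) by (auto simp: inducing_def)
  finally show ?thesis .
qed

end

section \<open>Irreducibility and dimension\<close>

lemma sum_fun_apply: "(\<Sum>i\<in>A. F i) x = (\<Sum>i\<in>A. F i x)"
  by (induction A rule: infinite_finite_induct) simp_all

lemma cvs_subspace_value_zero: "cvs.subspace {w. w p = 0}"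
  by (simp add: cvs.subspace_def fun_scale_apply)

section \<open>Signed column sums on tensor products\<close>

lemma pair_space_support:
  assumes "w \<in> pair_space \<nu> \<mu>" "t \<notin> tabloids \<nu> \<or> t' \<notin> tabloids \<mu>"
  shows "w (t, t') = 0"
  using assms(1) unfolding pair_space_def
proof (induction rule: cvs.span_induct)
  case base
  show ?case by (rule cvs_subspace_value_zero)
next
  case (step w)
  then obtain T T' where w: "w = polytabloid_pair \<nu> \<mu> T T'" "T \<in> tableaux \<nu>" "T' \<in> tableaux \<mu>" by blast
  have "polytabloid \<nu> T t = 0 \<or> polytabloid \<mu> T' t' = 0"
    using polytabloid_in_tabloids[OF tableaux_filling[OF w(2)]] polytabloid_in_tabloids[OF tableaux_filling[OF w(3)]] assms(2)
    by blast
  then show ?case by (auto simp: w(1) polytabloid_pair_def tens_def)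
qed

text \<open>Bilinear rather than Hermitian, because the coefficient produced by the signed column
  sums is linear in w. Positivity is recovered by conjugation in
  \<open>pairing_nonzero\<close>.\<close>

definition pairing where
  "pairing \<nu> \<mu> w u = (\<Sum>s\<in>tabloids \<nu>. \<Sum>s'\<in>tabloids \<mu>. w (s, s') * u (s, s') :: complex)"

definition pair_antisym where
  "pair_antisym \<nu> \<mu> T T' w = (\<lambda>(t, t'). \<Sum>q\<in>column_stabilizer \<nu> T. \<Sum>q'\<in>column_stabilizer \<mu> T'.
     (of_int (sign q) * of_int (sign q')) * w (map ((`) (inv' q)) t, map ((`) (inv' q')) t') :: complex)"

text \<open>The functions live on tabloids of shapes \<nu>2 and \<mu>2 while the column sums belong
  to \<nu> and \<mu>. Keeping the shapes apart serves both the rank-one formula and the vanishing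
  statement.\<close>

lemma pair_antisym_eq:
  assumes w: "w \<in> pair_space \<nu>2 \<mu>2" and T: "filling \<nu> T" and T': "filling \<mu> T'"
  shows "pair_antisym \<nu> \<mu> T T' w (t, t') =
    (\<Sum>s\<in>tabloids \<nu>2. \<Sum>s'\<in>tabloids \<mu>2. w (s, s') * column_antisym \<mu> T' s' t' * column_antisym \<nu> T s t)"
proof -
  have "pair_antisym \<nu> \<mu> T T' w (t, t') = (\<Sum>q\<in>column_stabilizer \<nu> T. of_int (sign q) *
      (\<Sum>q'\<in>column_stabilizer \<mu> T'. of_int (sign q') * w (map ((`) (inv' q)) t, map ((`) (inv' q')) t')))"
    by (simp add: pair_antisym_def sum_distrib_left mult.assoc)
  also have "\<dots> = (\<Sum>q\<in>column_stabilizer \<nu> T. of_int (sign q) *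
      (\<Sum>s'\<in>tabloids \<mu>2. w (map ((`) (inv' q)) t, s') * column_antisym \<mu> T' s' t'))"
    by (intro sum.cong refl arg_cong2[of _ _ _ _ "(*)"] column_antisym_apply[OF T'] finite_tabloids)
       (use pair_space_support[OF w] in blast)
  also have "\<dots> = (\<Sum>s\<in>tabloids \<nu>2. (\<Sum>s'\<in>tabloids \<mu>2. w (s, s') * column_antisym \<mu> T' s' t') * column_antisym \<nu> T s t)"
  proof (rule column_antisym_apply[OF T _ finite_tabloids])
    fix s assume "s \<notin> tabloids \<nu>2"
    then have "w (s, s') = 0" for s' using pair_space_support[OF w] by blast
    then show "(\<Sum>s'\<in>tabloids \<mu>2. w (s, s') * column_antisym \<mu> T' s' t') = 0" by simp
  qed
  finally show ?thesis by (simp add: sum_distrib_right)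
qed

lemma pair_antisym_same:
  assumes w: "w \<in> pair_space \<nu> \<mu>" and \<nu>: "\<nu> \<in> partitions m" and \<mu>: "\<mu> \<in> partitions m'"
    and T: "filling \<nu> T" and T': "filling \<mu> T'"
  shows "pair_antisym \<nu> \<mu> T T' w = fun_scale (*) (pairing \<nu> \<mu> w (polytabloid_pair \<nu> \<mu> T T')) (polytabloid_pair \<nu> \<mu> T T')"
proof
  fix p :: "nat set list \<times> nat set list"
  obtain t t' where p: "p = (t, t')" by fastforce
  have "pair_antisym \<nu> \<mu> T T' w (t, t') = (\<Sum>s\<in>tabloids \<nu>. \<Sum>s'\<in>tabloids \<mu>.
      w (s, s') * (polytabloid \<mu> T' s' * polytabloid \<mu> T' t') * (polytabloid \<nu> T s * polytabloid \<nu> T t))"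
    unfolding pair_antisym_eq[OF w T T']
    by (intro sum.cong refl) (simp only: column_antisym_eq_polytabloid[OF \<nu> T] column_antisym_eq_polytabloid[OF \<mu> T'])
  also have "\<dots> = pairing \<nu> \<mu> w (polytabloid_pair \<nu> \<mu> T T') * polytabloid_pair \<nu> \<mu> T T' (t, t')"
    unfolding pairing_def sum_distrib_right
    by (intro sum.cong refl) (simp add: polytabloid_pair_def tens_def mult_ac)
  finally show "pair_antisym \<nu> \<mu> T T' w p = fun_scale (*) (pairing \<nu> \<mu> w (polytabloid_pair \<nu> \<mu> T T')) (polytabloid_pair \<nu> \<mu> T T') p"
    by (simp add: p fun_scale_apply)
qed

text \<open>A nonzero value has a nonzero summand, and James' comparison applies to each tensor
  factor of that summand.\<close>

lemma pair_antisym_nonzero: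
  assumes w: "w \<in> pair_space \<nu>2 \<mu>2" and \<nu>: "\<nu> \<in> partitions m" "\<nu>2 \<in> partitions m" and \<mu>: "\<mu> \<in> partitions m'" "\<mu>2 \<in> partitions m'"
    and T: "filling \<nu> T" and T': "filling \<mu> T'" and nz: "pair_antisym \<nu> \<mu> T T' w \<noteq> 0"
  shows "(nrank \<nu> < nrank \<nu>2 \<or> \<nu> = \<nu>2) \<and> (nrank \<mu> < nrank \<mu>2 \<or> \<mu> = \<mu>2)"
proof -
  obtain p where "pair_antisym \<nu> \<mu> T T' w p \<noteq> 0" using nz by (metis ext zero_fun_apply)
  then obtain t t' where "pair_antisym \<nu> \<mu> T T' w (t, t') \<noteq> 0" by (cases p) simp
  then have "(\<Sum>s\<in>tabloids \<nu>2. \<Sum>s'\<in>tabloids \<mu>2. w (s, s') * column_antisym \<mu> T' s' t' * column_antisym \<nu> T s t) \<noteq> 0"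
    unfolding pair_antisym_eq[OF w T T'] .
  then obtain s where s: "s \<in> tabloids \<nu>2" "(\<Sum>s'\<in>tabloids \<mu>2. w (s, s') * column_antisym \<mu> T' s' t' * column_antisym \<nu> T s t) \<noteq> 0"
    by (rule sum.not_neutral_contains_not_neutral)
  from s(2) obtain s' where s': "s' \<in> tabloids \<mu>2" "w (s, s') * column_antisym \<mu> T' s' t' * column_antisym \<nu> T s t \<noteq> 0"
    by (rule sum.not_neutral_contains_not_neutral)
  obtain S where S: "filling \<nu>2 S" "s = tabloid \<nu>2 S" using s(1) by (rule tabloidsE)
  obtain S' where S': "filling \<mu>2 S'" "s' = tabloid \<mu>2 S'" using s'(1) by (rule tabloidsE)
  have "column_antisym \<nu> T (tabloid \<nu>2 S) t \<noteq> 0" "column_antisym \<mu> T' (tabloid \<mu>2 S') t' \<noteq> 0"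
    using s'(2) S(2) S'(2) by auto
  then show ?thesis
    using column_antisym_nonzero[OF \<nu> T S(1)] column_antisym_nonzero[OF \<mu> T' S'(1)] by blast
qed

text \<open>Conjugation is semilinear and fixes the generators, whose coefficients are
  integers.\<close>

lemma cnj_pair_space:
  assumes "w \<in> pair_space \<nu> \<mu>"
  shows "(\<lambda>p. cnj (w p)) \<in> pair_space \<nu> \<mu>"
  using assms unfolding pair_space_def
proof (induction rule: cvs.span_induct)
  case base
  let ?S = "cvs.span {polytabloid_pair \<nu> \<mu> T T' | T T'. T \<in> tableaux \<nu> \<and> T' \<in> tableaux \<mu>}"
  have c0: "(\<lambda>p. cnj ((0 :: nat set list \<times> nat set list \<Rightarrow> complex) p)) = 0" by (rule ext) simp
  have cadd: "(\<lambda>p. cnj ((v + w) p)) = (\<lambda>p. cnj (v p)) + (\<lambda>p. cnj (w p))" for v w :: "nat set list \<times> nat set list \<Rightarrow> complex"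
    by (rule ext) simp
  have cscl: "(\<lambda>p. cnj (fun_scale (*) a w p)) = fun_scale (*) (cnj a) (\<lambda>p. cnj (w p))" for a and w :: "nat set list \<times> nat set list \<Rightarrow> complex"
    by (rule ext) (simp add: fun_scale_apply)
  show ?case
    unfolding cvs.subspace_def mem_Collect_eq c0 cadd cscl
    by (intro conjI ballI allI cvs.span_zero cvs.span_add cvs.span_scale) blast+
next
  case (step w)
  then obtain T T' where w: "w = polytabloid_pair \<nu> \<mu> T T'" by blast
  have "(\<lambda>p. cnj (w p)) = w"
    by (rule ext) (simp add: w polytabloid_pair_def tens_def cnj_polytabloid case_prod_beta)
  then show ?case using cvs.span_base[OF step] by simp
qed

text \<open>If w paired to zero with all generators, it would pair to zero with its own conjugate,
  which lies in the space; but that pairing is the sum of the squared absolute values of w.\<close>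

lemma pairing_nonzero:
  assumes w: "w \<in> pair_space \<nu> \<mu>" "w \<noteq> 0"
  shows "\<exists>T\<in>tableaux \<nu>. \<exists>T'\<in>tableaux \<mu>. pairing \<nu> \<mu> w (polytabloid_pair \<nu> \<mu> T T') \<noteq> 0"
proof (rule ccontr)
  assume "\<not> ?thesis"
  then have z: "pairing \<nu> \<mu> w (polytabloid_pair \<nu> \<mu> T T') = 0" if "T \<in> tableaux \<nu>" "T' \<in> tableaux \<mu>" for T T'
    using that by blast
  have all: "pairing \<nu> \<mu> w u = 0" if "u \<in> pair_space \<nu> \<mu>" for u
    using that unfolding pair_space_def
  proof (induction rule: cvs.span_induct)
    case base
    have "pairing \<nu> \<mu> w 0 = 0" by (simp add: pairing_def)
    moreover have "pairing \<nu> \<mu> w (u + v) = pairing \<nu> \<mu> w u + pairing \<nu> \<mu> w v" for u v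
      by (simp add: pairing_def distrib_left sum.distrib)
    moreover have "pairing \<nu> \<mu> w (fun_scale (*) a u) = a * pairing \<nu> \<mu> w u" for a u
      by (simp add: pairing_def fun_scale_apply sum_distrib_left mult_ac)
    ultimately show ?case by (simp add: cvs.subspace_def)
  next
    case (step u)
    then show ?case using z by blast
  qed
  have "pairing \<nu> \<mu> w (\<lambda>p. cnj (w p)) = of_real (\<Sum>s\<in>tabloids \<nu>. \<Sum>s'\<in>tabloids \<mu>. (cmod (w (s, s')))\<^sup>2)"
    unfolding pairing_def of_real_sum
    by (intro sum.cong refl) (simp only: complex_norm_square)
  then have "complex_of_real (\<Sum>s\<in>tabloids \<nu>. \<Sum>s'\<in>tabloids \<mu>. (cmod (w (s, s')))\<^sup>2) = 0"
    using all[OF cnj_pair_space[OF w(1)]] by (simp only:)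
  then have 0: "(\<Sum>s\<in>tabloids \<nu>. \<Sum>s'\<in>tabloids \<mu>. (cmod (w (s, s')))\<^sup>2) = 0"
    by (rule of_real_eq_0_iff[THEN iffD1])
  have "w (s, s') = 0" for s s'
  proof (cases "s \<in> tabloids \<nu> \<and> s' \<in> tabloids \<mu>")
    case True
    have "(\<Sum>s'\<in>tabloids \<mu>. (cmod (w (s, s')))\<^sup>2) = 0"
      using 0 True by (subst (asm) sum_nonneg_eq_0_iff) (auto intro: sum_nonneg finite_tabloids)
    then have "(cmod (w (s, s')))\<^sup>2 = 0"
      using True by (subst (asm) sum_nonneg_eq_0_iff) (auto intro: finite_tabloids)
    then show ?thesis by simp
  next
    case False
    then show ?thesis using pair_space_support[OF w(1)] by blast
  qed
  then have "w = 0" by (intro ext) auto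
  then show False using w(2) by simp
qed

text \<open>A sum of signed point masses. On the representations with the same k the set component
  projects to the functions on a single coset, the block stabilizer itself.\<close>

definition separator :: "nat \<Rightarrow> nat \<Rightarrow> nat list \<Rightarrow> nat list \<Rightarrow> (nat \<times> nat \<Rightarrow> nat) \<Rightarrow> (nat \<times> nat \<Rightarrow> nat) \<Rightarrow>
    nat set \<times> (nat \<Rightarrow> nat) \<Rightarrow> complex" where
  "separator n k \<nu> \<mu> T T' = (\<lambda>s. \<Sum>q\<in>column_stabilizer \<nu> T. \<Sum>q'\<in>column_stabilizer \<mu> T'.
     (of_int (sign q) * of_int (sign q')) * (if s = ({1..k}, sym_join n k q q') then 1 else 0))"

section \<open>The separating elements in the induced representations\<close>

sublocale partition_pair \<subseteq> M: monoid_rep "fun_scale (fun_scale (*))" "exel_monoid n" exel_mult exel_one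
  "rspace (V_pair n k \<nu> \<mu>)" "sact (V_pair n k \<nu> \<mu>)"
  using rep.monoid_rep unfolding rscale_eq .

lemma block_in_exel:
  assumes "k \<in> {1..n}" "\<sigma> \<in> block_stabilizer n k"
  shows "({1..k}, \<sigma>) \<in> exel_monoid n"
proof -
  have "\<sigma> 1 \<in> \<sigma> ` {1..k}" using assms(1) by (intro imageI) simp
  then show ?thesis using assms by (auto simp: exel_monoid_def block_stabilizer_def)
qed

context partition_pair
begin

lemma lact_separator:
  assumes k0: "k0 \<in> {1..n}" "sum_list \<nu>0 = k0" "sum_list \<mu>0 = n - k0" and f: "f \<in> V"
  shows "M.lact (separator n k0 \<nu>0 \<mu>0 T T') f y =
    (\<Sum>q\<in>column_stabilizer \<nu>0 T. \<Sum>q'\<in>column_stabilizer \<mu>0 T'. fun_scale (*) (of_int (sign q) * of_int (sign q'))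
      (if {1..k0} \<subseteq> y ` {1..k} \<and> y permutes {1..n} then f (inv' (sym_join n k0 q q') \<circ> y) else 0))"
proof -
  have k0n: "k0 \<le> n" using k0(1) by simp
  have "M.lact (separator n k0 \<nu>0 \<mu>0 T T') f y =
    (\<Sum>q\<in>column_stabilizer \<nu>0 T. \<Sum>q'\<in>column_stabilizer \<mu>0 T'. fun_scale (fun_scale (*)) (of_int (sign q) * of_int (sign q'))
      (M.lact (\<lambda>s. if s = ({1..k0}, sym_join n k0 q q') then 1 else 0) f)) y"
    unfolding separator_def M.lact_sum_coeff M.lact_scale_coeff ..
  also have "\<dots> = (\<Sum>q\<in>column_stabilizer \<nu>0 T. \<Sum>q'\<in>column_stabilizer \<mu>0 T'. fun_scale (*) (of_int (sign q) * of_int (sign q'))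
      (M.lact (\<lambda>s. if s = ({1..k0}, sym_join n k0 q q') then 1 else 0) f y))"
    unfolding sum_fun_apply fun_scale_apply[of "fun_scale (*)"] ..
  also have "\<dots> = (\<Sum>q\<in>column_stabilizer \<nu>0 T. \<Sum>q'\<in>column_stabilizer \<mu>0 T'. fun_scale (*) (of_int (sign q) * of_int (sign q'))
      (if {1..k0} \<subseteq> y ` {1..k} \<and> y permutes {1..n} then f (inv' (sym_join n k0 q q') \<circ> y) else 0))"
  proof (intro sum.cong refl arg_cong2[of _ _ _ _ "fun_scale (*)"])
    fix q q' assume q: "q \<in> column_stabilizer \<nu>0 T" "q' \<in> column_stabilizer \<mu>0 T'"
    have "sym_join n k0 q q' \<in> block_stabilizer n k0"
      using sym_join_in[OF k0n] column_stabilizer_permutes[OF q(1)] column_stabilizer_permutes[OF q(2)] k0(2,3) by simp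
    then have s: "({1..k0}, sym_join n k0 q q') \<in> exel_monoid n" by (rule block_in_exel[OF k0(1)])
    show "M.lact (\<lambda>s. if s = ({1..k0}, sym_join n k0 q q') then 1 else 0) f y =
      (if {1..k0} \<subseteq> y ` {1..k} \<and> y permutes {1..n} then f (inv' (sym_join n k0 q q') \<circ> y) else 0)"
      unfolding M.lact_single[OF s] sact_value[OF s f] ..
  qed
  finally show ?thesis .
qed

text \<open>The image of {1..k} under y is too small to contain {1..k0}, so every value is cut
  off.\<close>

lemma lact_separator_smaller:
  assumes k0: "k0 \<in> {1..n}" "sum_list \<nu>0 = k0" "sum_list \<mu>0 = n - k0" and f: "f \<in> V" and less: "k < k0"
  shows "M.lact (separator n k0 \<nu>0 \<mu>0 T T') f = 0"
proof
  fix y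
  have "\<not> {1..k0} \<subseteq> y ` {1..k}"
  proof
    assume "{1..k0} \<subseteq> y ` {1..k}"
    then have "card {1..k0} \<le> card (y ` {1..k})" by (intro card_mono) auto
    also have "\<dots> \<le> card {1..k}" by (rule card_image_le) simp
    finally show False using less by simp
  qed
  then have c: "({1..k0} \<subseteq> y ` {1..k} \<and> y permutes {1..n}) = False" by blast
  show "M.lact (separator n k0 \<nu>0 \<mu>0 T T') f y = 0 y"
    unfolding lact_separator[OF k0 f] c if_False cvs.scale_zero_right sum.neutral_const zero_fun_apply ..
qed

lemma block_iff:
  assumes y: "y permutes {1..n}"
  shows "{1..k} \<subseteq> y ` {1..k} \<longleftrightarrow> y \<in> K"
proof
  assume s: "{1..k} \<subseteq> y ` {1..k}"
  have "card (y ` {1..k}) = card {1..k}" by (rule card_image[OF inj_on_subset[OF permutes_inj[OF y] subset_UNIV]])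
  then have "{1..k} = y ` {1..k}" by (intro card_subset_eq[OF _ s]) simp_all
  then show "y \<in> K" using y by (simp add: block_stabilizer_def)
next
  assume "y \<in> K"
  then show "{1..k} \<subseteq> y ` {1..k}" by (simp add: block_stabilizer_def)
qed

lemma inv_in_block_iff: "y permutes {1..n} \<Longrightarrow> inv' y \<in> K \<longleftrightarrow> y \<in> K"
  using block_stabilizer_inv[of y n k] block_stabilizer_inv[of "inv' y" n k] permutes_inv_inv[of y "{1..n}"] by metis

text \<open>Only y in the block stabilizer survive the cut-off, and there equivariance expresses
  every value through f at the identity. The separator therefore sees nothing else of f.\<close>

lemma lact_separator_same:
  assumes sz: "sum_list \<nu>0 = k" "sum_list \<mu>0 = n - k" and f: "f \<in> V"
  shows "M.lact (separator n k \<nu>0 \<mu>0 T T') f = pt n k id (pair_antisym \<nu>0 \<mu>0 T T' (f id))"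
proof
  fix y
  show "M.lact (separator n k \<nu>0 \<mu>0 T T') f y = pt n k id (pair_antisym \<nu>0 \<mu>0 T T' (f id)) y"
  proof (cases "{1..k} \<subseteq> y ` {1..k} \<and> y permutes {1..n}")
    case False
    then have c: "({1..k} \<subseteq> y ` {1..k} \<and> y permutes {1..n}) = False" by blast
    have "\<not> (y permutes {1..n} \<and> y \<in> K)" using False block_iff by blast
    then have "\<not> (y permutes {1..n} \<and> inv' y \<in> K)" using inv_in_block_iff by blast
    then have "\<not> (y permutes {1..n} \<and> inv' y \<circ> id \<in> K)" unfolding comp_id .
    then have "pt n k id (pair_antisym \<nu>0 \<mu>0 T T' (f id)) y = 0" unfolding pt_def by (rule if_not_P)
    then show ?thesis
      unfolding lact_separator[OF k sz f] c if_False cvs.scale_zero_right sum.neutral_const by (rule sym)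
  next
    case True
    then have y: "y \<in> K" "y permutes {1..n}" using block_iff by blast+
    have val: "f (inv' (sym_join n k q q') \<circ> y) = kact n k (inv' y) (kact n k (sym_join n k q q') (f id))"
      if q: "q \<in> column_stabilizer \<nu>0 T" "q' \<in> column_stabilizer \<mu>0 T'" for q q'
    proof -
      let ?j = "sym_join n k q q'"
      have j: "?j \<in> K"
        using sym_join_in[OF kn] column_stabilizer_permutes[OF q(1)] column_stabilizer_permutes[OF q(2)] sz by simp
      note jp = block_stabilizer_permutes[OF j]
      have m: "inv' ?j \<circ> y \<in> K" by (rule block_stabilizer_comp[OF block_stabilizer_inv[OF j] y(1)])
      have "f (id \<circ> (inv' ?j \<circ> y)) = kact n k (inv' (inv' ?j \<circ> y)) (f id)"
        by (rule equivariant[OF f permutes_id m])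
      also have "inv' (inv' ?j \<circ> y) = inv' y \<circ> ?j"
        unfolding inv_comp[OF permutes_inv[OF jp] y(2)] permutes_inv_inv[OF jp] ..
      finally show ?thesis unfolding kact_comp[OF kn block_stabilizer_inv[OF y(1)] j] id_comp .
    qed
    have "M.lact (separator n k \<nu>0 \<mu>0 T T') f y =
      (\<Sum>q\<in>column_stabilizer \<nu>0 T. \<Sum>q'\<in>column_stabilizer \<mu>0 T'. fun_scale (*) (of_int (sign q) * of_int (sign q'))
        (kact n k (inv' y) (kact n k (sym_join n k q q') (f id))))"
      unfolding lact_separator[OF k sz f] if_P[OF True]
      by (intro sum.cong refl arg_cong2[of _ _ _ _ "fun_scale (*)"] val)
    also have "\<dots> = kact n k (inv' y) (\<Sum>q\<in>column_stabilizer \<nu>0 T. \<Sum>q'\<in>column_stabilizer \<mu>0 T'.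
        fun_scale (*) (of_int (sign q) * of_int (sign q')) (kact n k (sym_join n k q q') (f id)))"
      unfolding kact_sum kact_scale ..
    also have "(\<Sum>q\<in>column_stabilizer \<nu>0 T. \<Sum>q'\<in>column_stabilizer \<mu>0 T'.
        fun_scale (*) (of_int (sign q) * of_int (sign q')) (kact n k (sym_join n k q q') (f id))) =
        pair_antisym \<nu>0 \<mu>0 T T' (f id)"
    proof
      fix p :: "nat set list \<times> nat set list"
      obtain t t' where p: "p = (t, t')" by fastforce
      have "kact n k (sym_join n k q q') (f id) (t, t') = f id (map ((`) (inv' q)) t, map ((`) (inv' q')) t')"
        if q: "q \<in> column_stabilizer \<nu>0 T" "q' \<in> column_stabilizer \<mu>0 T'" for q q'
      proof -
        have "sym_split n k (sym_join n k q q') = (q, q')"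
          using sym_split_join[OF kn] column_stabilizer_permutes[OF q(1)] column_stabilizer_permutes[OF q(2)] sz by simp
        then show ?thesis by (simp add: kact_def)
      qed
      then show "(\<Sum>q\<in>column_stabilizer \<nu>0 T. \<Sum>q'\<in>column_stabilizer \<mu>0 T'.
        fun_scale (*) (of_int (sign q) * of_int (sign q')) (kact n k (sym_join n k q q') (f id))) p =
        pair_antisym \<nu>0 \<mu>0 T T' (f id) p"
        unfolding sum_fun_apply fun_scale_apply p pair_antisym_def prod.case
        by (intro sum.cong refl arg_cong2[of _ _ _ _ "(*)"])
    qed
    also have "kact n k (inv' y) (pair_antisym \<nu>0 \<mu>0 T T' (f id)) = pt n k id (pair_antisym \<nu>0 \<mu>0 T T' (f id)) y"
      using y block_stabilizer_inv[OF y(1)] by (simp add: pt_def)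
    finally show ?thesis .
  qed
qed

lemma id_inducing: "id \<in> inducing n k"
  using k by (auto simp: inducing_def permutes_id)

lemma lact_rank_one:
  assumes f: "f \<in> V" and T: "filling \<nu> T" and T': "filling \<mu> T'"
  shows "M.lact (separator n k \<nu> \<mu> T T') f = fun_scale (fun_scale (*)) (pairing \<nu> \<mu> (f id) (polytabloid_pair \<nu> \<mu> T T'))
    (pt n k id (polytabloid_pair \<nu> \<mu> T T'))"
  unfolding lact_separator_same[OF sizes f] pair_antisym_same[OF value_in[OF f] \<nu> \<mu> T T'] pt_scale ..

lemma lact_subspace:
  assumes U: "vvs.subspace U" and inv: "\<And>s. s \<in> exel_monoid n \<Longrightarrow> sact R s ` U \<subseteq> U" and u: "u \<in> U"
  shows "M.lact c u \<in> U"
  unfolding M.lact_def by (intro vvs.subspace_sum[OF U] vvs.subspace_scale[OF U]) (use inv u in blast)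

lemma ex_tableau: "\<exists>T. T \<in> tableaux \<kappa>"
proof -
  obtain T where "bij_betw T (diagram \<kappa>) {1..sum_list \<kappa>}"
    using finite_same_card_bij[OF finite_diagram[of \<kappa>], of "{1..sum_list \<kappa>}"] by (auto simp: card_diagram)
  then show ?thesis using filling_restrict[of \<kappa> T] by (auto simp: filling_def)
qed

lemma polytabloid_self: "filling \<kappa> T \<Longrightarrow> polytabloid \<kappa> T (tabloid \<kappa> T) = 1"
  using polytabloid_value[OF _ column_stabilizer_id, of \<kappa> T] by simp

lemma pt_id_value: "pt n k id w id = w"
  using kn by (simp add: pt_def permutes_id block_stabilizer_id kact_id)

lemma pt_id_nonzero:
  assumes T: "filling \<nu> T" and T': "filling \<mu> T'"
  shows "pt n k id (polytabloid_pair \<nu> \<mu> T T') \<noteq> 0"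
proof
  assume "pt n k id (polytabloid_pair \<nu> \<mu> T T') = 0"
  then have "pt n k id (polytabloid_pair \<nu> \<mu> T T') id (tabloid \<nu> T, tabloid \<mu> T') = 0" by simp
  then show False
    unfolding pt_id_value by (simp add: polytabloid_pair_def tens_def polytabloid_self[OF T] polytabloid_self[OF T'])
qed

text \<open>By the rank-one formula a zero pairing would make the column sums kill their own
  polytabloids; but the value at the tabloids of \<open>T\<close> and \<open>T'\<close> is the
  product of the orders of the two column stabilizers, since all signs square to 1.\<close>

lemma pairing_self:
  assumes T: "filling \<nu> T" and T': "filling \<mu> T'"
  shows "pairing \<nu> \<mu> (polytabloid_pair \<nu> \<mu> T T') (polytabloid_pair \<nu> \<mu> T T') \<noteq> 0"
proof
  assume z: "pairing \<nu> \<mu> (polytabloid_pair \<nu> \<mu> T T') (polytabloid_pair \<nu> \<mu> T T') = 0"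
  have "pair_antisym \<nu> \<mu> T T' (polytabloid_pair \<nu> \<mu> T T') = 0"
    unfolding pair_antisym_same[OF polytabloid_pair_in[OF T T'] \<nu> \<mu> T T'] z by (rule cvs.scale_zero_left)
  then have 0: "pair_antisym \<nu> \<mu> T T' (polytabloid_pair \<nu> \<mu> T T') (tabloid \<nu> T, tabloid \<mu> T') = 0" by simp
  have c: "(\<Sum>q\<in>column_stabilizer \<kappa> U. of_int (sign q) * polytabloid \<kappa> U (map ((`) (inv' q)) (tabloid \<kappa> U))) =
      of_nat (card (column_stabilizer \<kappa> U))" if U: "filling \<kappa> U" for \<kappa> U
  proof -
    have "of_int (sign q) * polytabloid \<kappa> U (map ((`) (inv' q)) (tabloid \<kappa> U)) = 1" if q: "q \<in> column_stabilizer \<kappa> U" for q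
      unfolding tabloid_comp[symmetric] polytabloid_value[OF U column_stabilizer_inv[OF U q]]
        sign_inverse[OF column_stabilizer_permutation[OF q]] by (rule sign_square)
    then show ?thesis by simp
  qed
  have "pair_antisym \<nu> \<mu> T T' (polytabloid_pair \<nu> \<mu> T T') (tabloid \<nu> T, tabloid \<mu> T') =
     (\<Sum>q\<in>column_stabilizer \<nu> T. of_int (sign q) * polytabloid \<nu> T (map ((`) (inv' q)) (tabloid \<nu> T))) *
     (\<Sum>q\<in>column_stabilizer \<mu> T'. of_int (sign q) * polytabloid \<mu> T' (map ((`) (inv' q)) (tabloid \<mu> T')))"
    unfolding pair_antisym_def prod.case sum_product
    by (intro sum.cong refl) (simp add: polytabloid_pair_def tens_def)
  then have "of_nat (card (column_stabilizer \<nu> T)) * of_nat (card (column_stabilizer \<mu> T')) = (0 :: complex)"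
    using 0 c[OF T] c[OF T'] by simp
  then show False
    using column_stabilizer_id[OF T] column_stabilizer_id[OF T'] finite_column_stabilizer by (auto simp: card_eq_0_iff)
qed

lemma tableaux_transitive:
  assumes T: "filling \<kappa> T" and S: "filling \<kappa> S"
  obtains p where "p permutes {1..sum_list \<kappa>}" "\<And>c. c \<in> diagram \<kappa> \<Longrightarrow> (p \<circ> T) c = S c"
proof -
  let ?D = "diagram \<kappa>" and ?Y = "{1..sum_list \<kappa>}"
  have b: "bij_betw T ?D ?Y" "bij_betw S ?D ?Y" using assms by (simp_all add: filling_def)
  define p where "p x = (if x \<in> ?Y then S (inv_into ?D T x) else x)" for x
  have "bij_betw (S \<circ> inv_into ?D T) ?Y ?Y" by (rule bij_betw_trans[OF bij_betw_inv_into[OF b(1)] b(2)])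
  then have "bij_betw p ?Y ?Y" by (rule bij_betw_cong[THEN iffD1, rotated]) (simp add: p_def)
  then have "p permutes ?Y" by (rule bij_imp_permutes) (unfold p_def, erule if_not_P)
  moreover have "(p \<circ> T) c = S c" if "c \<in> ?D" for c
    using filling_range[OF T that] filling_inv[OF T that] by (simp add: p_def)
  ultimately show ?thesis using that by blast
qed

text \<open>James' submodule argument: a nonzero invariant subspace contains the generator at the
  identity for some pair of tableaux, and from there group elements reach all generators.\<close>

lemma irreducible: "M.irreducible"
  unfolding M.irreducible_def
proof (intro conjI allI impI)
  obtain T T' where "T \<in> tableaux \<nu>" "T' \<in> tableaux \<mu>" using ex_tableau by blast
  then show "V \<noteq> {0}"
    using pt_id_nonzero[of T T'] pt_in_V[OF id_inducing, of T T'] tableaux_filling by blast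
  fix U assume U: "vvs.subspace U" "U \<subseteq> V" "\<forall>s\<in>exel_monoid n. sact R s ` U \<subseteq> U"
  have inv: "sact R s ` U \<subseteq> U" if "s \<in> exel_monoid n" for s using U(3) that by blast
  have ract_U: "ract R g u \<in> U" if "g permutes {1..n}" "u \<in> U" for g u
  proof -
    have "sact R ({1, g 1}, g) u \<in> U"
      by (rule subsetD[OF inv[OF rep.group_in_exel[OF that(1)]] imageI[OF that(2)]])
    then show ?thesis unfolding rep.sact_group[OF that(1) subsetD[OF U(2) that(2)]] .
  qed
  show "U = {0} \<or> U = V"
  proof (rule disjCI)
    assume "U \<noteq> V"
    show "U = {0}"
    proof (rule ccontr)
      assume "U \<noteq> {0}"
      then obtain u where u: "u \<in> U" "u \<noteq> 0" using vvs.subspace_0[OF U(1)] by blast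
      then obtain y where y: "u y \<noteq> 0" by (metis ext zero_fun_apply)
      have uV: "u \<in> V" using u(1) U(2) by blast
      have yi: "y \<in> inducing n k" using support[OF uV, of y] y by blast
      note yp = inducing_permutes[OF yi]
      \<comment> \<open>Translation moves a nonzero value of u to the identity, the only place at
        which the separator looks.\<close>
      define v where "v = ract R (inv' y) u"
      have v: "v \<in> U" unfolding v_def by (rule ract_U[OF permutes_inv[OF yp] u(1)])
      have vid: "v id = u y"
        unfolding v_def ract_value[OF permutes_inv[OF yp]] if_P[OF id_inducing] permutes_inv_inv[OF yp] by simp
      have vV: "v \<in> V" using v U(2) by blast
      have "v id \<noteq> 0" unfolding vid by (rule y)
      then obtain T T' where T: "T \<in> tableaux \<nu>" "T' \<in> tableaux \<mu>"
        and nz: "pairing \<nu> \<mu> (v id) (polytabloid_pair \<nu> \<mu> T T') \<noteq> 0"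
        using pairing_nonzero[OF value_in[OF vV]] by blast
      note F = tableaux_filling[OF T(1)] tableaux_filling[OF T(2)]
      let ?c = "pairing \<nu> \<mu> (v id) (polytabloid_pair \<nu> \<mu> T T')"
      have "fun_scale (fun_scale (*)) ?c (pt n k id (polytabloid_pair \<nu> \<mu> T T')) \<in> U"
        using lact_subspace[OF U(1) inv v, of "separator n k \<nu> \<mu> T T'"] unfolding lact_rank_one[OF vV F] .
      then have "fun_scale (fun_scale (*)) (1 / ?c) (fun_scale (fun_scale (*)) ?c (pt n k id (polytabloid_pair \<nu> \<mu> T T'))) \<in> U"
        by (rule vvs.subspace_scale[OF U(1)])
      then have base: "pt n k id (polytabloid_pair \<nu> \<mu> T T') \<in> U"
        unfolding vvs.scale_scale times_divide_eq_left mult_1 divide_self[OF nz] vvs.scale_one .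
      have "gens \<subseteq> U"
      proof
        fix w assume "w \<in> gens"
        then obtain x S S' where w: "w = pt n k x (polytabloid_pair \<nu> \<mu> S S')" "x \<in> inducing n k" "S \<in> tableaux \<nu>" "S' \<in> tableaux \<mu>"
          unfolding gens_def by blast
        obtain p where p: "p permutes {1..sum_list \<nu>}" "\<And>c. c \<in> diagram \<nu> \<Longrightarrow> (p \<circ> T) c = S c"
          by (rule tableaux_transitive[OF F(1) tableaux_filling[OF w(3)]]) blast
        obtain q where q: "q permutes {1..sum_list \<mu>}" "\<And>c. c \<in> diagram \<mu> \<Longrightarrow> (q \<circ> T') c = S' c"
          by (rule tableaux_transitive[OF F(2) tableaux_filling[OF w(4)]]) blast
        \<comment> \<open>This block permutation carries the tableaux (T, T') to (S, S'). Balancing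
          it across the tensor sign turns a translate of the base generator into the given
          generator.\<close>
        let ?j = "sym_join n k p q"
        have j: "?j \<in> K" using sym_join_in[OF kn] p(1) q(1) sizes by simp
        have sp: "sym_split n k ?j = (p, q)" using sym_split_join[OF kn] p(1) q(1) sizes by simp
        have jx: "x \<circ> ?j \<in> inducing n k"
          using inducing_block[OF inducing_permutes[OF w(2)] j] w(2) by blast
        note xjp = inducing_permutes[OF jx]
        have "polytabloid \<nu> (p \<circ> T) = polytabloid \<nu> S" "polytabloid \<mu> (q \<circ> T') = polytabloid \<mu> S'"
          by (rule polytabloid_cong, erule p(2), rule polytabloid_cong, erule q(2))
        then have k': "kact n k ?j (polytabloid_pair \<nu> \<mu> T T') = polytabloid_pair \<nu> \<mu> S S'"
          unfolding kact_polytabloid_pair[OF kn j sizes F] sp fst_conv snd_conv by (simp only: polytabloid_pair_def)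
        have "ract R (x \<circ> ?j) (pt n k id (polytabloid_pair \<nu> \<mu> T T')) = pt n k (x \<circ> ?j) (polytabloid_pair \<nu> \<mu> T T')"
          using ract_pt[OF xjp id_inducing] jx by simp
        also have "\<dots> = pt n k x (polytabloid_pair \<nu> \<mu> S S')"
        proof
          fix z
          show "pt n k (x \<circ> ?j) (polytabloid_pair \<nu> \<mu> T T') z = pt n k x (polytabloid_pair \<nu> \<mu> S S') z"
          proof (cases "z permutes {1..n} \<and> inv' z \<circ> x \<in> K")
            case True
            then have "inv' z \<circ> (x \<circ> ?j) \<in> K" using block_stabilizer_comp[OF _ j, of "inv' z \<circ> x"] by (simp add: comp_assoc)
            then show ?thesis
              using True kact_comp[OF kn _ j, of "inv' z \<circ> x"] by (simp add: pt_def k' comp_assoc)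
          next
            case False
            have "\<not> (z permutes {1..n} \<and> inv' z \<circ> (x \<circ> ?j) \<in> K)"
            proof
              assume a: "z permutes {1..n} \<and> inv' z \<circ> (x \<circ> ?j) \<in> K"
              then have "(inv' z \<circ> (x \<circ> ?j)) \<circ> inv' ?j \<in> K"
                by (rule block_stabilizer_comp[OF conjunct2 block_stabilizer_inv[OF j]])
              moreover have "(inv' z \<circ> (x \<circ> ?j)) \<circ> inv' ?j = inv' z \<circ> x"
                using permutes_inv_o(1)[OF block_stabilizer_permutes[OF j]] by (simp add: comp_assoc)
              ultimately show False using a False by simp
            qed
            then show ?thesis unfolding pt_def if_not_P[OF False] by (rule if_not_P)
          qed
        qed
        finally show "w \<in> U" using ract_U[OF xjp base] w(1) by simp
      qed
      then have "V \<subseteq> U" unfolding V_eq by (rule vvs.span_minimal[OF _ U(1)])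
      then show False using \<open>U \<noteq> V\<close> U(2) by blast
    qed
  qed
qed

lemma rep_irreducible: "rep_irreducible (sym_group n) R"
  using irreducible rep.irreducible_iff unfolding rscale_eq by blast

text \<open>With the second tabloid fixed, independence in the first factor leaves relations in the
  second factor alone.\<close>

lemma polytabloid_pair_independent:
  assumes z: "\<And>p. (\<Sum>T\<in>standard_tableaux \<nu>. \<Sum>T'\<in>standard_tableaux \<mu>. a T T' * polytabloid_pair \<nu> \<mu> T T' p) = 0"
    and T: "T \<in> standard_tableaux \<nu>" and T': "T' \<in> standard_tableaux \<mu>"
  shows "a T T' = 0"
proof -
  have "(\<Sum>T'\<in>standard_tableaux \<mu>. a T T' * polytabloid \<mu> T' t') = 0" for t'
  proof (rule standard_polytabloids_independent[OF _ T])
    fix t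
    have "(\<Sum>T\<in>standard_tableaux \<nu>. (\<Sum>T'\<in>standard_tableaux \<mu>. a T T' * polytabloid \<mu> T' t') * polytabloid \<nu> T t) =
       (\<Sum>T\<in>standard_tableaux \<nu>. \<Sum>T'\<in>standard_tableaux \<mu>. a T T' * polytabloid_pair \<nu> \<mu> T T' (t, t'))"
      unfolding sum_distrib_right by (intro sum.cong refl) (simp add: polytabloid_pair_def tens_def)
    then show "(\<Sum>T\<in>standard_tableaux \<nu>. (\<Sum>T'\<in>standard_tableaux \<mu>. a T T' * polytabloid \<mu> T' t') * polytabloid \<nu> T t) = 0"
      using z by simp
  qed
  then show ?thesis by (rule standard_polytabloids_independent[OF _ T'])
qed

text \<open>One permutation is chosen for each possible image of {1..k}. Generators at different
  choices live on disjoint cosets, and on one coset the products of standard polytabloids are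
  independent. An arbitrary finite spanning set is allowed so that the bound applies to a chosen
  basis.\<close>

lemma dim_lower_bound:
  assumes B: "finite B" "V \<subseteq> vvs.span B"
  shows "((n - 1) choose (k - 1)) * num_SYT \<nu> * num_SYT \<mu> \<le> card B"
proof -
  define Q where "Q = {A. A \<subseteq> {1..n} \<and> 1 \<in> A \<and> card A = k}"
  let ?S = "standard_tableaux \<nu>" and ?S' = "standard_tableaux \<mu>"
  have "\<forall>A\<in>Q. \<exists>x. x permutes {1..n} \<and> x ` {1..k} = A" unfolding Q_def by (intro ballI exists_permutation_image[OF kn]) blast+
  from bchoice[OF this] obtain x where x0: "\<forall>A\<in>Q. x A permutes {1..n} \<and> x A ` {1..k} = A" by (rule exE)
  have x: "x A permutes {1..n}" "x A ` {1..k} = A" if "A \<in> Q" for A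
    by (rule bspec[OF x0 that, THEN conjunct1], rule bspec[OF x0 that, THEN conjunct2])
  have fQ: "finite Q" by (simp add: Q_def)
  let ?J = "Q \<times> ?S \<times> ?S'"
  have fJ: "finite ?J" by (intro finite_cartesian_product fQ finite_standard_tableaux)
  let ?v = "\<lambda>(A, T, T'). pt n k (x A) (polytabloid_pair \<nu> \<mu> T T')"
  \<comment> \<open>Evaluation at a chosen representative isolates the summand of its own
    coset.\<close>
  have val: "pt n k (x A) w (x A0) = (if A = A0 then w else 0)" if A: "A \<in> Q" "A0 \<in> Q" for A A0 w
  proof (cases "A = A0")
    case True
    then show ?thesis
      using x(1)[OF A(1)] permutes_inv_o(2)[OF x(1)[OF A(1)]] kn by (simp add: pt_def block_stabilizer_id kact_id)
  next
    case False
    have "\<not> (x A0 permutes {1..n} \<and> inv' (x A0) \<circ> x A \<in> K)"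
    proof
      assume "x A0 permutes {1..n} \<and> inv' (x A0) \<circ> x A \<in> K"
      then have "(inv' (x A0) \<circ> x A) ` {1..k} = {1..k}" by (simp add: block_stabilizer_def)
      then have "x A0 ` (inv' (x A0) \<circ> x A) ` {1..k} = x A0 ` {1..k}" by (simp only:)
      moreover have "x A0 \<circ> (inv' (x A0) \<circ> x A) = x A"
        using permutes_inv_o(1)[OF x(1)[OF A(2)]] by (simp only: comp_assoc[symmetric] id_comp)
      ultimately have "x A ` {1..k} = x A0 ` {1..k}" by (simp only: image_comp)
      then show False using False x(2)[OF A(1)] x(2)[OF A(2)] by simp
    qed
    then show ?thesis unfolding pt_def if_not_P[OF False] by (rule if_not_P)
  qed
  have fam: "inj_on ?v ?J \<and> \<not> vvs.dependent (?v ` ?J)"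
  proof (rule vvs.independent_family[OF fJ])
    fix a assume z: "(\<Sum>j\<in>?J. fun_scale (fun_scale (*)) (a j) (?v j)) = 0"
    show "\<forall>j\<in>?J. a j = 0"
    proof
      fix j assume "j \<in> ?J"
      then obtain A0 T0 T0' where j: "j = (A0, T0, T0')" "A0 \<in> Q" "T0 \<in> ?S" "T0' \<in> ?S'" by blast
      have "(\<Sum>T\<in>?S. \<Sum>T'\<in>?S'. a (A0, T, T') * polytabloid_pair \<nu> \<mu> T T' p) = 0" for p
      proof -
        have "0 = (\<Sum>j\<in>?J. fun_scale (fun_scale (*)) (a j) (?v j)) (x A0) p" unfolding z by simp
        also have "\<dots> = (\<Sum>j\<in>?J. a j * ?v j (x A0) p)" unfolding sum_fun_apply fun_scale_apply ..
        also have "\<dots> = (\<Sum>A\<in>Q. \<Sum>T\<in>?S. \<Sum>T'\<in>?S'. a (A, T, T') * pt n k (x A) (polytabloid_pair \<nu> \<mu> T T') (x A0) p)"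
          by (simp add: sum.cartesian_product case_prod_beta)
        also have "\<dots> = (\<Sum>A\<in>Q. if A = A0 then (\<Sum>T\<in>?S. \<Sum>T'\<in>?S'. a (A0, T, T') * polytabloid_pair \<nu> \<mu> T T' p) else 0)"
          by (rule sum.cong[OF refl]) (simp add: val[OF _ j(2)])
        also have "\<dots> = (\<Sum>T\<in>?S. \<Sum>T'\<in>?S'. a (A0, T, T') * polytabloid_pair \<nu> \<mu> T T' p)"
          unfolding sum.delta[OF fQ] if_P[OF j(2)] ..
        finally show ?thesis by (rule sym)
      qed
      from polytabloid_pair_independent[OF this j(3,4)] show "a j = 0" by (simp add: j(1))
    qed
  qed
  have "?v ` ?J \<subseteq> V"
  proof (rule image_subsetI)
    fix j assume "j \<in> ?J"
    then obtain A T T' where j: "j = (A, T, T')" "A \<in> Q" "T \<in> ?S" "T' \<in> ?S'" by blast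
    have "x A \<in> inducing n k" using x[OF j(2)] j(2) by (simp add: inducing_def Q_def)
    then show "?v j \<in> V" unfolding j(1) prod.case by (intro pt_in_V_filling standard_filling j)
  qed
  then have "?v ` ?J \<subseteq> vvs.span B" using B(2) by blast
  then have "card (?v ` ?J) \<le> card B"
    using vvs.independent_span_bound[OF B(1) fam[THEN conjunct2]] by blast
  moreover have "card (?v ` ?J) = card ?J" by (rule card_image[OF fam[THEN conjunct1]])
  moreover have "card ?J = ((n - 1) choose (k - 1)) * (num_SYT \<nu> * num_SYT \<mu>)"
    unfolding card_cartesian_product num_SYT_def Q_def using card_subsets_containing_1[OF n1, of k] k by simp
  ultimately show ?thesis by (simp only: mult.assoc)
qed

end

section \<open>Completeness\<close>

text \<open>An intertwiner commutes with the whole monoid algebra, but the separating element of a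
  member whose rank is at least that of the other is nonzero on the former and zero on the
  latter.\<close>

lemma (in monoid_rep_family) no_isomorphism:
  assumes ij: "i \<in> A" "j \<in> A" "i \<noteq> j"
    and f: "f \<in> linear_maps sc (V i) sc (V j)" and bij: "bij_betw f (V i) (V j)"
    and eq: "\<And>s v. s \<in> S \<Longrightarrow> v \<in> V i \<Longrightarrow> f (act i s v) = act j s (f v)"
  shows False
proof -
  interpret I: monoid_rep sc S mul e "V i" "act i" by (rule rep[OF ij(1)])
  interpret J: monoid_rep sc S mul e "V j" "act j" by (rule rep[OF ij(2)])
  have f_add: "f (x + y) = f x + f y" if "x \<in> V i" "y \<in> V i" for x y
    using f that by (simp add: linear_maps_def)
  have f_scale: "f (sc a x) = sc a (f x)" if "x \<in> V i" for a x
    using f that by (simp add: linear_maps_def)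
  have f_in: "f x \<in> V j" if "x \<in> V i" for x using bij_betwE[OF bij] that by blast
  have f_0: "f 0 = 0" using f_scale[OF I.zero_in, of 0] by simp
  have f_nz: "f x \<noteq> 0" if "x \<in> V i" "x \<noteq> 0" for x
    using inj_onD[OF bij_betw_imp_inj_on[OF bij], of x 0] that I.zero_in f_0 by auto
  have f_lact: "f (la i c v) = la j c (f v)" if v: "v \<in> V i" for c v
  proof -
    have "f (\<Sum>s\<in>T. sc (c s) (act i s v)) = (\<Sum>s\<in>T. sc (c s) (act j s (f v)))" if "finite T" "T \<subseteq> S" for T
      using that
    proof (induction T rule: finite_induct)
      case empty
      then show ?case by (simp add: f_0)
    next
      case (insert s T)
      have "(\<Sum>s\<in>T. sc (c s) (act i s v)) \<in> V i"
        using insert.prems v by (intro I.subspace_sum[OF I.sub] I.subspace_scale[OF I.sub] I.act_in) auto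
      then show ?case
        using insert v by (simp add: f_add f_scale eq I.subspace_scale[OF I.sub] I.act_in)
    qed
    from this[OF I.finite_S order_refl] show ?thesis unfolding I.lact_def J.lact_def .
  qed
  show False
  proof (cases "rank j \<le> rank i")
    case True
    obtain c v0 \<phi> where c: "v0 \<in> V i" "v0 \<noteq> 0" "\<phi> v0 \<noteq> 0" "\<And>v. v \<in> V i \<Longrightarrow> la i c v = sc (\<phi> v) v0"
      and van: "\<And>j v. j \<in> A \<Longrightarrow> j \<noteq> i \<Longrightarrow> rank j \<le> rank i \<Longrightarrow> v \<in> V j \<Longrightarrow> la j c v = 0"
      using separating[OF ij(1)] by blast
    have "f (sc (\<phi> v0) v0) = 0"
      using f_lact[OF c(1), of c] van[OF ij(2) ij(3)[symmetric] True f_in[OF c(1)]] c(4)[OF c(1)] by simp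
    then show False
      using f_nz[of "sc (\<phi> v0) v0"] c(1,2,3) I.subspace_scale[OF I.sub c(1)] by simp
  next
    case False
    obtain c v0 \<phi> where c: "v0 \<in> V j" "v0 \<noteq> 0" "\<phi> v0 \<noteq> 0" "\<And>v. v \<in> V j \<Longrightarrow> la j c v = sc (\<phi> v) v0"
      and van: "\<And>i v. i \<in> A \<Longrightarrow> i \<noteq> j \<Longrightarrow> rank i \<le> rank j \<Longrightarrow> v \<in> V i \<Longrightarrow> la i c v = 0"
      using separating[OF ij(2)] by blast
    have im: "f ` V i = V j" using bij unfolding bij_betw_def by (rule conjunct2)
    obtain u where u: "u \<in> V i" "f u = v0" using c(1) unfolding im[symmetric] by blast
    have "sc (\<phi> v0) v0 = 0"
      using f_lact[OF u(1), of c] van[OF ij(1) ij(3) _ u(1)] False c(4)[OF c(1)] u(2) f_0 by simp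
    then show False using c(2,3) by simp
  qed
qed

definition pair_index :: "nat \<Rightarrow> (nat \<times> nat list \<times> nat list) set" where
  "pair_index n = (SIGMA k:{1..n}. partitions k \<times> partitions (n - k))"

definition pair_rep where
  "pair_rep n = (\<lambda>(k, \<nu>, \<mu>). V_pair n k \<nu> \<mu>)"

text \<open>The factor of \<open>k\<close> exceeds \<open>nrank \<nu> + nrank \<mu>\<close> on all of \<open>pair_index n\<close>, so that \<open>k\<close> is compared first.\<close>

definition pair_rank :: "nat \<Rightarrow> nat \<times> nat list \<times> nat list \<Rightarrow> nat" where
  "pair_rank n = (\<lambda>(k, \<nu>, \<mu>). k * Suc (\<Sum>(k, \<nu>, \<mu>)\<in>pair_index n. nrank \<nu> + nrank \<mu>) + nrank \<nu> + nrank \<mu>)"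

text \<open>A basis is fixed by choice, since its size becomes known only at the end of the count
  (\<open>card_pair_basis\<close>).\<close>

definition pair_basis where
  "pair_basis n i = (SOME B. finite B \<and> \<not> module.dependent (fun_scale (fun_scale (*))) B \<and>
     module.span (fun_scale (fun_scale (*))) B = rspace (pair_rep n i))"

definition pair_dim :: "nat \<Rightarrow> nat \<times> nat list \<times> nat list \<Rightarrow> nat" where
  "pair_dim n = (\<lambda>(k, \<nu>, \<mu>). ((n - 1) choose (k - 1)) * num_SYT \<nu> * num_SYT \<mu>)"

lemma finite_pair_index: "finite (pair_index n)"
  unfolding pair_index_def by (intro finite_SigmaI finite_cartesian_product finite_partitions) simp

lemma pair_index_cases:
  assumes "i \<in> pair_index n"
  obtains k \<nu> \<mu> where "i = (k, \<nu>, \<mu>)" "partition_pair n k \<nu> \<mu>"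
proof -
  obtain k \<nu> \<mu> where i: "i = (k, \<nu>, \<mu>)" by (rule prod_cases3)
  have "partition_pair n k \<nu> \<mu>"
    using assms unfolding i pair_index_def by unfold_locales auto
  then show ?thesis using that i by blast
qed

lemma pair_basis:
  assumes "i \<in> pair_index n"
  shows "finite (pair_basis n i)" "\<not> module.dependent (fun_scale (fun_scale (*))) (pair_basis n i)"
    "module.span (fun_scale (fun_scale (*))) (pair_basis n i) = rspace (pair_rep n i)"
proof -
  obtain k \<nu> \<mu> where i: "i = (k, \<nu>, \<mu>)" and p: "partition_pair n k \<nu> \<mu>" by (rule pair_index_cases[OF assms])
  interpret partition_pair n k \<nu> \<mu> by (rule p)
  obtain B where B: "B \<subseteq> gens" "\<not> vvs.dependent B" "gens \<subseteq> vvs.span B"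
    by (rule vvs.maximal_independent_subset[of gens])
  have "vvs.span B = V"
    unfolding V_eq using vvs.span_mono[OF B(1)] vvs.span_minimal[OF B(3) vvs.subspace_span] by blast
  then have "finite B \<and> \<not> vvs.dependent B \<and> vvs.span B = rspace (pair_rep n i)"
    using finite_subset[OF B(1) finite_gens] B(2) by (simp add: i pair_rep_def)
  from someI[of "\<lambda>B. finite B \<and> \<not> vvs.dependent B \<and> vvs.span B = rspace (pair_rep n i)", OF this]
  show "finite (pair_basis n i)" "\<not> module.dependent (fun_scale (fun_scale (*))) (pair_basis n i)"
    "module.span (fun_scale (fun_scale (*))) (pair_basis n i) = rspace (pair_rep n i)"
    unfolding pair_basis_def by blast+
qed

lemma nrank_less:
  assumes "(k, \<nu>, \<mu>) \<in> pair_index n"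
  shows "nrank \<nu> + nrank \<mu> < Suc (\<Sum>(k, \<nu>, \<mu>)\<in>pair_index n. nrank \<nu> + nrank \<mu>)"
  using member_le_sum[OF assms, of "\<lambda>(k, \<nu>, \<mu>). nrank \<nu> + nrank \<mu>"] finite_pair_index by simp

lemma pair_rank_le:
  assumes i: "(k, \<nu>, \<mu>) \<in> pair_index n" and j: "(k', \<nu>', \<mu>') \<in> pair_index n"
    and le: "pair_rank n (k', \<nu>', \<mu>') \<le> pair_rank n (k, \<nu>, \<mu>)"
  shows "k' < k \<or> k' = k \<and> nrank \<nu>' + nrank \<mu>' \<le> nrank \<nu> + nrank \<mu>"
proof -
  define N where "N = Suc (\<Sum>(k, \<nu>, \<mu>)\<in>pair_index n. nrank \<nu> + nrank \<mu>)"
  have le': "k' * N + (nrank \<nu>' + nrank \<mu>') \<le> k * N + (nrank \<nu> + nrank \<mu>)"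
    using le by (simp add: pair_rank_def N_def add.assoc)
  have less: "nrank \<nu> + nrank \<mu> < N" using nrank_less[OF i] by (simp add: N_def)
  have "\<not> k < k'"
  proof
    assume "k < k'"
    then have "Suc k * N \<le> k' * N" by (intro mult_le_mono1) simp
    then show False using le' less by simp
  qed
  then consider "k' < k" | "k' = k" by linarith
  then show ?thesis using le' by cases simp_all
qed

lemma pair_family:
  assumes n: "1 \<le> n"
  shows "monoid_rep_family (fun_scale (fun_scale (*))) (exel_monoid n) exel_mult exel_one (pair_index n)
    (\<lambda>i. rspace (pair_rep n i)) (\<lambda>i. sact (pair_rep n i)) (pair_rank n) (pair_basis n)"
proof (rule monoid_rep_family.intro)
  show "finite (pair_index n)" by (rule finite_pair_index)
  fix i assume i: "i \<in> pair_index n"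
  show "finite (pair_basis n i)" by (rule pair_basis(1)[OF i])
  show "vvs.independent (pair_basis n i)" by (rule pair_basis(2)[OF i])
  show "vvs.span (pair_basis n i) = rspace (pair_rep n i)" by (rule pair_basis(3)[OF i])
  obtain k \<nu> \<mu> where ie: "i = (k, \<nu>, \<mu>)" and p: "partition_pair n k \<nu> \<mu>" by (rule pair_index_cases[OF i])
  interpret I: partition_pair n k \<nu> \<mu> by (rule p)
  show "monoid_rep (fun_scale (fun_scale (*))) (exel_monoid n) exel_mult exel_one (rspace (pair_rep n i)) (sact (pair_rep n i))"
    unfolding ie pair_rep_def prod.case by (rule I.M.monoid_rep_axioms)
  show "monoid_rep.irreducible (fun_scale (fun_scale (*))) (exel_monoid n) (rspace (pair_rep n i)) (sact (pair_rep n i))"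
    unfolding ie pair_rep_def prod.case by (rule I.irreducible)
  obtain T T' where T: "T \<in> tableaux \<nu>" "T' \<in> tableaux \<mu>" using I.ex_tableau by blast
  note F = tableaux_filling[OF T(1)] tableaux_filling[OF T(2)]
  let ?v = "pt n k id (polytabloid_pair \<nu> \<mu> T T')" and ?c = "separator n k \<nu> \<mu> T T'"
  have "?v \<in> rspace (pair_rep n i)"
    unfolding ie pair_rep_def prod.case by (rule I.pt_in_V[OF I.id_inducing T])
  moreover have "?v \<noteq> 0" by (rule I.pt_id_nonzero[OF F])
  moreover have "pairing \<nu> \<mu> (?v id) (polytabloid_pair \<nu> \<mu> T T') \<noteq> 0"
    unfolding I.pt_id_value by (rule I.pairing_self[OF F])
  moreover have "\<forall>f\<in>rspace (pair_rep n i). monoid_rep.lact (fun_scale (fun_scale (*))) (exel_monoid n) (sact (pair_rep n i)) ?c f =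
      fun_scale (fun_scale (*)) (pairing \<nu> \<mu> (f id) (polytabloid_pair \<nu> \<mu> T T')) ?v"
    unfolding ie pair_rep_def prod.case by (rule ballI) (rule I.lact_rank_one[OF _ F])
  moreover have "\<forall>j\<in>pair_index n. j \<noteq> i \<longrightarrow> pair_rank n j \<le> pair_rank n i \<longrightarrow>
     (\<forall>f\<in>rspace (pair_rep n j). monoid_rep.lact (fun_scale (fun_scale (*))) (exel_monoid n) (sact (pair_rep n j)) ?c f = 0)"
  proof (intro ballI impI)
    fix j f assume j: "j \<in> pair_index n" and ne: "j \<noteq> i" and le: "pair_rank n j \<le> pair_rank n i"
      and f: "f \<in> rspace (pair_rep n j)"
    obtain k' \<nu>' \<mu>' where je: "j = (k', \<nu>', \<mu>')" and p': "partition_pair n k' \<nu>' \<mu>'" by (rule pair_index_cases[OF j])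
    interpret J: partition_pair n k' \<nu>' \<mu>' by (rule p')
    have fJ: "f \<in> J.V" using f by (simp add: je pair_rep_def)
    have "J.M.lact ?c f = 0"
    \<comment> \<open>Smaller k' is killed by the set component. For equal k the sum of the two
      \<open>nrank\<close> values of j is at most that of i, which leaves no room for a strict
      increase in either factor.\<close>
    proof (cases "k' < k")
      case True
      show ?thesis by (rule J.lact_separator_smaller[OF I.k I.sizes fJ True])
    next
      case False
      then have k: "k' = k" and r: "nrank \<nu>' + nrank \<mu>' \<le> nrank \<nu> + nrank \<mu>"
        using pair_rank_le[of k \<nu> \<mu> n k' \<nu>' \<mu>'] i j le by (simp_all add: ie je)
      have "pair_antisym \<nu> \<mu> T T' (f id) = 0"
      proof (rule ccontr)
        assume "pair_antisym \<nu> \<mu> T T' (f id) \<noteq> 0"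
        then have "(nrank \<nu> < nrank \<nu>' \<or> \<nu> = \<nu>') \<and> (nrank \<mu> < nrank \<mu>' \<or> \<mu> = \<mu>')"
          using pair_antisym_nonzero[OF J.value_in[OF fJ] I.\<nu> _ I.\<mu> _ F] J.\<nu> J.\<mu> unfolding k by blast
        then have "\<nu> = \<nu>' \<and> \<mu> = \<mu>'" using r by auto
        then show False using ne k by (simp add: ie je)
      qed
      then have "pt n k' id (pair_antisym \<nu> \<mu> T T' (f id)) = 0" by (simp only: pt_zero)
      then show ?thesis using J.lact_separator_same[OF _ _ fJ, of \<nu> \<mu> T T'] I.sizes unfolding k by simp
    qed
    then show "monoid_rep.lact (fun_scale (fun_scale (*))) (exel_monoid n) (sact (pair_rep n j)) ?c f = 0"
      unfolding je pair_rep_def prod.case .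
  qed
  ultimately show "\<exists>c v0 \<phi>. v0 \<in> rspace (pair_rep n i) \<and> v0 \<noteq> 0 \<and> \<phi> v0 \<noteq> 0 \<and>
     (\<forall>v\<in>rspace (pair_rep n i). monoid_rep.lact (fun_scale (fun_scale (*))) (exel_monoid n) (sact (pair_rep n i)) c v = fun_scale (fun_scale (*)) (\<phi> v) v0) \<and>
     (\<forall>j\<in>pair_index n. j \<noteq> i \<longrightarrow> pair_rank n j \<le> pair_rank n i \<longrightarrow>
       (\<forall>v\<in>rspace (pair_rep n j). monoid_rep.lact (fun_scale (fun_scale (*))) (exel_monoid n) (sact (pair_rep n j)) c v = 0))"
    by (intro exI[of _ ?c] exI[of _ ?v] exI[of _ "\<lambda>f. pairing \<nu> \<mu> (f id) (polytabloid_pair \<nu> \<mu> T T')"] conjI)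
qed

lemma sum_pair_dim_squares:
  assumes n: "1 \<le> n"
  shows "(\<Sum>i\<in>pair_index n. pair_dim n i ^ 2) = card (exel_monoid n)"
proof -
  have "(\<Sum>i\<in>pair_index n. pair_dim n i ^ 2) =
      (\<Sum>k\<in>{1..n}. \<Sum>p\<in>partitions k \<times> partitions (n - k). pair_dim n (k, p) ^ 2)"
    unfolding pair_index_def
    by (subst sum.Sigma) (auto simp: finite_partitions intro!: sum.cong)
  also have "\<dots> = (\<Sum>k\<in>{1..n}. ((n - 1) choose (k - 1))\<^sup>2 * fact k * fact (n - k))"
  proof (rule sum.cong[OF refl])
    fix k
    have "(\<Sum>p\<in>partitions k \<times> partitions (n - k). pair_dim n (k, p) ^ 2) =
       (\<Sum>\<nu>\<in>partitions k. \<Sum>\<mu>\<in>partitions (n - k). ((n - 1) choose (k - 1))\<^sup>2 * (num_SYT \<nu> ^ 2 * num_SYT \<mu> ^ 2))"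
      unfolding sum.cartesian_product by (intro sum.cong refl) (auto simp: pair_dim_def power_mult_distrib)
    also have "\<dots> = ((n - 1) choose (k - 1))\<^sup>2 * ((\<Sum>\<nu>\<in>partitions k. num_SYT \<nu> ^ 2) * (\<Sum>\<mu>\<in>partitions (n - k). num_SYT \<mu> ^ 2))"
      unfolding sum_product by (simp only: sum_distrib_left)
    finally show "(\<Sum>p\<in>partitions k \<times> partitions (n - k). pair_dim n (k, p) ^ 2) = ((n - 1) choose (k - 1))\<^sup>2 * fact k * fact (n - k)"
      unfolding sum_num_SYT_squares by (simp add: mult.assoc)
  qed
  finally show ?thesis unfolding card_exel_monoid[OF n] .
qed

lemma pair_dim_le:
  assumes "i \<in> pair_index n"
  shows "pair_dim n i \<le> card (pair_basis n i)"
proof -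
  obtain k \<nu> \<mu> where i: "i = (k, \<nu>, \<mu>)" and p: "partition_pair n k \<nu> \<mu>" by (rule pair_index_cases[OF assms])
  interpret partition_pair n k \<nu> \<mu> by (rule p)
  have "V \<subseteq> vvs.span (pair_basis n i)" using pair_basis(3)[OF assms] by (simp add: i pair_rep_def)
  from dim_lower_bound[OF pair_basis(1)[OF assms] this] show ?thesis by (simp add: i pair_dim_def)
qed

text \<open>Independence of the matrix units bounds the sum from above and independence of the
  standard polytabloids bounds it from below; both bounds are the order of the monoid.\<close>

lemma sum_basis_squares:
  assumes n: "1 \<le> n"
  shows "(\<Sum>i\<in>pair_index n. card (pair_basis n i) ^ 2) = card (exel_monoid n)"
proof (rule antisym)
  show "(\<Sum>i\<in>pair_index n. card (pair_basis n i) ^ 2) \<le> card (exel_monoid n)"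
  proof (rule monoid_rep_family.sum_dim_squares_le[OF pair_family[OF n]])
    show "finite (exel_monoid n)"
      by (rule finite_subset[of _ "Pow {1..n} \<times> {g. g permutes {1..n}}"])
         (auto simp: exel_monoid_def finite_permutations)
  qed
  show "card (exel_monoid n) \<le> (\<Sum>i\<in>pair_index n. card (pair_basis n i) ^ 2)"
    unfolding sum_pair_dim_squares[OF n, symmetric] by (intro sum_mono power_mono pair_dim_le) simp_all
qed

text \<open>Termwise inequalities between equal sums are equalities.\<close>

lemma card_pair_basis:
  assumes n: "1 \<le> n" and i: "i \<in> pair_index n"
  shows "card (pair_basis n i) = pair_dim n i"
proof -
  have "pair_dim n i ^ 2 = card (pair_basis n i) ^ 2"
    by (rule sum_mono_inv[of "\<lambda>i. pair_dim n i ^ 2" "pair_index n" "\<lambda>i. card (pair_basis n i) ^ 2"])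
       (use sum_basis_squares[OF n] sum_pair_dim_squares[OF n] pair_dim_le finite_pair_index i in \<open>auto intro: power_mono\<close>)
  then show ?thesis by (simp add: power2_eq_iff_nonneg)
qed

lemma rdim_V_pair:
  assumes n: "1 \<le> n" and i: "i \<in> pair_index n"
  shows "rdim (pair_rep n i) = pair_dim n i"
proof -
  obtain k \<nu> \<mu> where ie: "i = (k, \<nu>, \<mu>)" and p: "partition_pair n k \<nu> \<mu>" by (rule pair_index_cases[OF i])
  interpret partition_pair n k \<nu> \<mu> by (rule p)
  have s: "rscale (pair_rep n i) = fun_scale (fun_scale (*))" using rscale_eq by (simp add: ie pair_rep_def)
  have "pair_basis n i \<subseteq> rspace (pair_rep n i)" unfolding pair_basis(3)[OF i, symmetric] by (rule vvs.span_superset)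
  from vvs.basis_card_eq_dim[OF this _ pair_basis(2)[OF i]] pair_basis(3)[OF i] card_pair_basis[OF n i]
  show ?thesis unfolding rdim_def s by simp
qed

lemma pair_rep_not_isomorphic:
  assumes n: "1 \<le> n" and i: "i \<in> pair_index n" and j: "j \<in> pair_index n"
    and iso: "rep_isomorphic (sym_group n) (pair_rep n i) (pair_rep n j)"
  shows "i = j"
proof (rule ccontr)
  assume ne: "i \<noteq> j"
  obtain k \<nu> \<mu> where ie: "i = (k, \<nu>, \<mu>)" and p: "partition_pair n k \<nu> \<mu>" by (rule pair_index_cases[OF i])
  obtain k' \<nu>' \<mu>' where je: "j = (k', \<nu>', \<mu>')" and p': "partition_pair n k' \<nu>' \<mu>'" by (rule pair_index_cases[OF j])
  interpret I: partition_pair n k \<nu> \<mu> by (rule p)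
  interpret J: partition_pair n k' \<nu>' \<mu>' by (rule p')
  have s: "rscale (pair_rep n i) = fun_scale (fun_scale (*))" "rscale (pair_rep n j) = fun_scale (fun_scale (*))"
    using I.rscale_eq J.rscale_eq by (simp_all add: ie je pair_rep_def)
  have reps: "sym_partial_rep n (pair_rep n i)" "sym_partial_rep n (pair_rep n j)"
    using I.rep.sym_partial_rep_axioms J.rep.sym_partial_rep_axioms by (simp_all add: ie je pair_rep_def)
  obtain f where f: "f \<in> linear_maps (fun_scale (fun_scale (*))) (rspace (pair_rep n i)) (fun_scale (fun_scale (*))) (rspace (pair_rep n j))"
    "bij_betw f (rspace (pair_rep n i)) (rspace (pair_rep n j))"
    "\<forall>g\<in>carrier (sym_group n). \<forall>v\<in>rspace (pair_rep n i). f (ract (pair_rep n i) g v) = ract (pair_rep n j) g (f v)"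
    using iso unfolding rep_isomorphic_def s by blast
  have "f (sact (pair_rep n i) t v) = sact (pair_rep n j) t (f v)"
    if "t \<in> exel_monoid n" "v \<in> rspace (pair_rep n i)" for t v
    by (rule equivariant_sact[OF reps _ _ that])
       (use f(3) bij_betwE[OF f(2)] sym_group_carrier in blast)+
  then show False
    by (rule monoid_rep_family.no_isomorphism[OF pair_family[OF n] i j ne f(1,2)])
qed

text \<open>\<open>complete\<close> supplies an isomorphism from the model onto the given
  representation; the opposite direction is wanted here, hence the inverse map \<open>h\<close>.
  Equivariance under the group is recovered from that under the monoid by
  \<open>sact_group\<close>.\<close>

lemma pair_rep_complete:
  assumes n: "1 \<le> n" and gp: "global_partial_representation (sym_group n) (sym_point_stabilizer n) R"
    and irr: "rep_irreducible (sym_group n) R"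
  shows "\<exists>i\<in>pair_index n. rep_isomorphic (sym_group n) R (pair_rep n i)"
proof -
  interpret R: sym_partial_rep n R by unfold_locales (rule n, rule gp)
  have irr': "monoid_rep.irreducible (rscale R) (exel_monoid n) (rspace R) (sact R)"
    using irr R.irreducible_iff by blast
  obtain i f where i: "i \<in> pair_index n"
    and f: "f \<in> linear_maps (fun_scale (fun_scale (*))) (rspace (pair_rep n i)) (rscale R) (rspace R)"
      "bij_betw f (rspace (pair_rep n i)) (rspace R)"
      "\<And>s v. s \<in> exel_monoid n \<Longrightarrow> v \<in> rspace (pair_rep n i) \<Longrightarrow> f (sact (pair_rep n i) s v) = sact R s (f v)"
    using monoid_rep_family.complete[OF pair_family[OF n] sum_basis_squares[OF n] R.monoid_rep irr'] by blast
  obtain k \<nu> \<mu> where ie: "i = (k, \<nu>, \<mu>)" and p: "partition_pair n k \<nu> \<mu>" by (rule pair_index_cases[OF i])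
  interpret I: partition_pair n k \<nu> \<mu> by (rule p)
  let ?V = "rspace (pair_rep n i)"
  have Q: "sym_partial_rep n (pair_rep n i)" and s: "rscale (pair_rep n i) = fun_scale (fun_scale (*))"
    using I.rep.sym_partial_rep_axioms I.rscale_eq by (simp_all add: ie pair_rep_def)
  interpret Q: sym_partial_rep n "pair_rep n i" by (rule Q)
  have f_add: "f (x + y) = f x + f y" if "x \<in> ?V" "y \<in> ?V" for x y
    using f(1) that by (simp add: linear_maps_def)
  have f_scale: "f (rscale (pair_rep n i) a x) = rscale R a (f x)" if "x \<in> ?V" for a x
    using f(1) that by (simp add: linear_maps_def s)
  have f_in: "f x \<in> rspace R" if "x \<in> ?V" for x using bij_betwE[OF f(2)] that by blast
  have f_act: "f (ract (pair_rep n i) g v) = ract R g (f v)" if g: "g permutes {1..n}" and v: "v \<in> ?V" for g v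
    using f(3)[OF R.group_in_exel[OF g] v] unfolding R.sact_group[OF g f_in[OF v]] Q.sact_group[OF g v] .
  have act_in: "ract (pair_rep n i) g v \<in> ?V" if "g permutes {1..n}" "v \<in> ?V" for g v
    using Q.lin[OF that(1)] that(2) by (auto simp: linear_maps_def)
  define h where "h = inv_into ?V f"
  have h_in: "h w \<in> ?V" and fh: "f (h w) = w" if "w \<in> rspace R" for w
    using bij_betwE[OF bij_betw_inv_into[OF f(2)]] bij_betw_inv_into_right[OF f(2)] that by (simp_all add: h_def)
  have hf: "h (f v) = v" if "v \<in> ?V" for v
    using bij_betw_inv_into_left[OF f(2) that] by (simp add: h_def)
  have h_eq: "h w = v" if "v \<in> ?V" "f v = w" for v w using hf[OF that(1)] that(2) by simp
  have "h \<in> linear_maps (rscale R) (rspace R) (rscale (pair_rep n i)) ?V"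
    unfolding linear_maps_def
  proof (intro CollectI conjI ballI allI)
    show "h \<in> rspace R \<rightarrow> ?V" using h_in by blast
    fix x assume x: "x \<in> rspace R"
    show "h (rscale R a x) = rscale (pair_rep n i) a (h x)" for a
      by (rule h_eq) (simp_all add: f_scale fh x h_in Q.subspace_scale[OF Q.sub])
    fix y assume y: "y \<in> rspace R"
    show "h (x + y) = h x + h y"
      by (rule h_eq) (simp_all only: f_add fh x y h_in Q.subspace_add[OF Q.sub])
  qed
  moreover have "bij_betw h (rspace R) ?V" unfolding h_def by (rule bij_betw_inv_into[OF f(2)])
  moreover have "\<forall>g\<in>carrier (sym_group n). \<forall>v\<in>rspace R. h (ract R g v) = ract (pair_rep n i) g (h v)"
  proof (intro ballI)
    fix g v assume "g \<in> carrier (sym_group n)" and v: "v \<in> rspace R"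
    then have g: "g permutes {1..n}" by (simp add: sym_group_carrier)
    show "h (ract R g v) = ract (pair_rep n i) g (h v)"
      by (rule h_eq) (simp_all only: act_in[OF g h_in[OF v]] f_act[OF g h_in[OF v]] fh[OF v])
  qed
  ultimately show ?thesis using i unfolding rep_isomorphic_def by blast
qed

section \<open>Convolution algebras\<close>

text \<open>The general form of an algebra with basis \<open>S\<close> and a partial product,
  \<open>None\<close> standing for an undefined product. The unit is a parameter, since in a
  groupoid it is a sum of several basis elements.\<close>

definition conv_alg :: "'s set \<Rightarrow> ('s \<Rightarrow> 's \<Rightarrow> 's option) \<Rightarrow> ('s \<Rightarrow> complex) \<Rightarrow> (complex, 's \<Rightarrow> complex) module" where
  "conv_alg S m u = \<lparr>
     carrier = {a. \<forall>x. x \<notin> S \<longrightarrow> a x = 0},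
     monoid.mult = (\<lambda>a b x. \<Sum>(y, z) \<in> {(y, z) \<in> S \<times> S. m y z = Some x}. a y * b z),
     one = u,
     ring.zero = (\<lambda>x. 0),
     add = (\<lambda>a b x. a x + b x),
     module.smult = (\<lambda>c a x. c * a x)\<rparr>"

lemma sum_pairs_filter:
  assumes "finite S"
  shows "(\<Sum>(y, z)\<in>{(y, z) \<in> S \<times> S. Q y z}. F y z) = (\<Sum>y\<in>S. \<Sum>z\<in>S. if Q y z then F y z else 0 :: complex)"
proof -
  have "{(y, z) \<in> S \<times> S. Q y z} = {p \<in> S \<times> S. Q (fst p) (snd p)}" by auto
  then have "(\<Sum>(y, z)\<in>{(y, z) \<in> S \<times> S. Q y z}. F y z) = (\<Sum>p\<in>{p \<in> S \<times> S. Q (fst p) (snd p)}. F (fst p) (snd p))"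
    by (simp add: case_prod_beta)
  also have "\<dots> = (\<Sum>p\<in>S \<times> S. if Q (fst p) (snd p) then F (fst p) (snd p) else 0)"
    by (rule sum.inter_filter) (use assms in simp)
  also have "\<dots> = (\<Sum>y\<in>S. \<Sum>z\<in>S. if Q y z then F y z else 0)"
    by (simp add: sum.cartesian_product case_prod_beta)
  finally show ?thesis .
qed

lemma sum_pairs_single:
  assumes "finite S" "y0 \<in> S" "z0 \<in> S" and "\<And>y z. y \<in> S \<Longrightarrow> z \<in> S \<Longrightarrow> (y, z) \<noteq> (y0, z0) \<Longrightarrow> F y z = (0 :: complex)"
  shows "(\<Sum>y\<in>S. \<Sum>z\<in>S. F y z) = F y0 z0"
proof -
  have "(\<Sum>y\<in>S. \<Sum>z\<in>S. F y z) = (\<Sum>p\<in>S \<times> S. F (fst p) (snd p))"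
    by (simp add: sum.cartesian_product case_prod_beta)
  also have "\<dots> = F (fst (y0, z0)) (snd (y0, z0)) + (\<Sum>p\<in>S \<times> S - {(y0, z0)}. F (fst p) (snd p))"
    by (rule sum.remove) (use assms(1-3) in auto)
  also have "(\<Sum>p\<in>S \<times> S - {(y0, z0)}. F (fst p) (snd p)) = 0"
  proof (rule sum.neutral, rule ballI)
    fix p assume "p \<in> S \<times> S - {(y0, z0)}"
    then show "F (fst p) (snd p) = 0" using assms(4)[of "fst p" "snd p"] by (cases p) auto
  qed
  finally show ?thesis by simp
qed

lemma sum_rotate3:
  fixes F :: "'a \<Rightarrow> 'b \<Rightarrow> 'c \<Rightarrow> 'd \<Rightarrow> complex"
  shows "(\<Sum>w\<in>A. \<Sum>x\<in>B. \<Sum>y\<in>C. \<Sum>z\<in>D. F w x y z) = (\<Sum>x\<in>B. \<Sum>y\<in>C. \<Sum>z\<in>D. \<Sum>w\<in>A. F w x y z)"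
proof -
  have "(\<Sum>w\<in>A. \<Sum>x\<in>B. \<Sum>y\<in>C. \<Sum>z\<in>D. F w x y z) = (\<Sum>x\<in>B. \<Sum>w\<in>A. \<Sum>y\<in>C. \<Sum>z\<in>D. F w x y z)" by (rule sum.swap)
  also have "\<dots> = (\<Sum>x\<in>B. \<Sum>y\<in>C. \<Sum>w\<in>A. \<Sum>z\<in>D. F w x y z)" by (intro sum.cong refl sum.swap)
  also have "\<dots> = (\<Sum>x\<in>B. \<Sum>y\<in>C. \<Sum>z\<in>D. \<Sum>w\<in>A. F w x y z)" by (intro sum.cong refl sum.swap)
  finally show ?thesis .
qed

lemma pointwise_abelian_group:
  fixes R :: "('s \<Rightarrow> complex, 'b) ring_scheme" (structure)
  assumes c: "carrier R = {a. \<forall>x. x \<notin> S \<longrightarrow> a x = 0}"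
    and add: "add R = (\<lambda>a b x. a x + b x)" and zero: "ring.zero R = (\<lambda>x. 0)"
  shows "abelian_group R"
proof (rule abelian_groupI)
  show "a \<oplus> b \<in> carrier R" if "a \<in> carrier R" "b \<in> carrier R" for a b
    using that by (simp add: c add)
  show "\<zero> \<in> carrier R" by (simp add: c zero)
  show "(a1 \<oplus> a2) \<oplus> a3 = a1 \<oplus> (a2 \<oplus> a3)" for a1 a2 a3 unfolding add by (rule ext) (rule add.assoc)
  show "a \<oplus> b = b \<oplus> a" for a b unfolding add by (rule ext) (rule add.commute)
  show "\<zero> \<oplus> a = a" for a unfolding add zero by (rule ext) (rule add_0)
  show "\<exists>b\<in>carrier R. b \<oplus> a = \<zero>" if "a \<in> carrier R" for a
    using that unfolding c add zero by (intro bexI[of _ "\<lambda>x. - a x"]) simp_all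
qed

text \<open>\<open>Option.bind\<close> expresses that the two bracketings are defined together and
  then agree. The unit laws are stated as sums, the form in which products of functions
  evaluate.\<close>

locale conv_data =
  fixes S :: "'s set" and m :: "'s \<Rightarrow> 's \<Rightarrow> 's option" and u :: "'s \<Rightarrow> complex"
  assumes fin: "finite S"
    and closed: "y \<in> S \<Longrightarrow> z \<in> S \<Longrightarrow> m y z = Some x \<Longrightarrow> x \<in> S"
    and assoc: "x \<in> S \<Longrightarrow> y \<in> S \<Longrightarrow> z \<in> S \<Longrightarrow> Option.bind (m x y) (\<lambda>w. m w z) = Option.bind (m y z) (\<lambda>w. m x w)"
    and unit_outside: "x \<notin> S \<Longrightarrow> u x = 0"
    and unit_right: "x \<in> S \<Longrightarrow> (\<Sum>y\<in>S. \<Sum>z\<in>S. if m y z = Some x then a y * u z else 0) = a x"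
    and unit_left: "x \<in> S \<Longrightarrow> (\<Sum>y\<in>S. \<Sum>z\<in>S. if m y z = Some x then u y * a z else 0) = a x"
begin

abbreviation "A \<equiv> conv_alg S m u"

lemma mult_eq: "(a \<otimes>\<^bsub>A\<^esub> b) x = (\<Sum>y\<in>S. \<Sum>z\<in>S. if m y z = Some x then a y * b z else 0)"
  by (simp only: conv_alg_def monoid.select_convs sum_pairs_filter[OF fin])

lemma carrier_eq: "a \<in> carrier A \<longleftrightarrow> (\<forall>x. x \<notin> S \<longrightarrow> a x = 0)"
  by (simp add: conv_alg_def)

lemma mult_in: "a \<otimes>\<^bsub>A\<^esub> b \<in> carrier A"
  unfolding carrier_eq
proof (intro allI impI)
  fix x assume x: "x \<notin> S"
  have "(if m y z = Some x then a y * b z else 0) = 0" if "y \<in> S" "z \<in> S" for y z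
  proof -
    have "m y z \<noteq> Some x" using closed[OF that] x by blast
    then show ?thesis by (rule if_not_P)
  qed
  then show "(a \<otimes>\<^bsub>A\<^esub> b) x = 0" unfolding mult_eq by (intro sum.neutral ballI)
qed

text \<open>At most one w is the product of y and z, so the sum over intermediate products collapses
  to a test on an option value.\<close>

lemma inner_delta:
  assumes "y \<in> S" "z \<in> S"
  shows "(\<Sum>w\<in>S. if Q w \<and> m y z = Some w then t else 0) = (if Option.bind (m y z) (\<lambda>w. if Q w then Some () else None) = Some () then t else 0 :: complex)"
proof (cases "m y z")
  case None
  then show ?thesis by simp
next
  case (Some w0)
  have "w0 \<in> S" by (rule closed[OF assms Some])
  have "(\<Sum>w\<in>S. if Q w \<and> m y z = Some w then t else 0) = (\<Sum>w\<in>S. if w = w0 then (if Q w0 then t else 0) else 0)"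
    by (intro sum.cong refl) (auto simp: Some)
  then show ?thesis using \<open>w0 \<in> S\<close> fin by (simp add: Some)
qed

lemma bind_test: "Option.bind r (\<lambda>w. if f w = Some x then Some () else None) = Some () \<longleftrightarrow> Option.bind r f = Some x"
  by (cases r) auto

text \<open>Both sides are brought to a triple sum over the factors; the intermediate product is
  summed away by \<open>inner_delta\<close>, once for each bracketing.\<close>

lemma mult_assoc: "(a \<otimes>\<^bsub>A\<^esub> b) \<otimes>\<^bsub>A\<^esub> c = a \<otimes>\<^bsub>A\<^esub> (b \<otimes>\<^bsub>A\<^esub> c)"
proof
  fix x
  have "((a \<otimes>\<^bsub>A\<^esub> b) \<otimes>\<^bsub>A\<^esub> c) x =
      (\<Sum>w\<in>S. \<Sum>z\<in>S. \<Sum>y1\<in>S. \<Sum>y2\<in>S. if m w z = Some x \<and> m y1 y2 = Some w then a y1 * b y2 * c z else 0)"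
    unfolding mult_eq[of "a \<otimes>\<^bsub>A\<^esub> b"]
  proof (intro sum.cong refl)
    fix w z
    show "(if m w z = Some x then (a \<otimes>\<^bsub>A\<^esub> b) w * c z else 0) =
        (\<Sum>y1\<in>S. \<Sum>y2\<in>S. if m w z = Some x \<and> m y1 y2 = Some w then a y1 * b y2 * c z else 0)"
      by (cases "m w z = Some x") (simp_all add: mult_eq sum_distrib_right if_distrib[of "\<lambda>t. t * c z"] cong: if_cong)
  qed
  also have "\<dots> = (\<Sum>z\<in>S. \<Sum>y1\<in>S. \<Sum>y2\<in>S. \<Sum>w\<in>S. if m w z = Some x \<and> m y1 y2 = Some w then a y1 * b y2 * c z else 0)"
    by (rule sum_rotate3)
  also have "\<dots> = (\<Sum>z\<in>S. \<Sum>y1\<in>S. \<Sum>y2\<in>S. if Option.bind (m y1 y2) (\<lambda>w. m w z) = Some x then a y1 * b y2 * c z else 0)"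
    by (intro sum.cong refl) (simp only: inner_delta bind_test)
  also have "\<dots> = (\<Sum>z\<in>S. \<Sum>y1\<in>S. \<Sum>y2\<in>S. if Option.bind (m y2 z) (\<lambda>w. m y1 w) = Some x then a y1 * b y2 * c z else 0)"
    by (intro sum.cong refl) (simp only: assoc)
  also have "\<dots> = (\<Sum>y1\<in>S. \<Sum>z\<in>S. \<Sum>y2\<in>S. if Option.bind (m y2 z) (\<lambda>w. m y1 w) = Some x then a y1 * b y2 * c z else 0)"
    by (rule sum.swap)
  also have "\<dots> = (\<Sum>y1\<in>S. \<Sum>y2\<in>S. \<Sum>z\<in>S. if Option.bind (m y2 z) (\<lambda>w. m y1 w) = Some x then a y1 * b y2 * c z else 0)"
    by (intro sum.cong refl sum.swap)
  also have "\<dots> = (\<Sum>y1\<in>S. \<Sum>y2\<in>S. \<Sum>z\<in>S. \<Sum>w\<in>S. if m y1 w = Some x \<and> m y2 z = Some w then a y1 * b y2 * c z else 0)"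
    by (intro sum.cong refl) (simp only: inner_delta bind_test)
  also have "\<dots> = (\<Sum>y1\<in>S. \<Sum>w\<in>S. \<Sum>y2\<in>S. \<Sum>z\<in>S. if m y1 w = Some x \<and> m y2 z = Some w then a y1 * b y2 * c z else 0)"
  proof (rule sum.cong[OF refl])
    fix y1
    have "(\<Sum>y2\<in>S. \<Sum>z\<in>S. \<Sum>w\<in>S. if m y1 w = Some x \<and> m y2 z = Some w then a y1 * b y2 * c z else 0) =
        (\<Sum>y2\<in>S. \<Sum>w\<in>S. \<Sum>z\<in>S. if m y1 w = Some x \<and> m y2 z = Some w then a y1 * b y2 * c z else 0)"
      by (intro sum.cong refl sum.swap)
    also have "\<dots> = (\<Sum>w\<in>S. \<Sum>y2\<in>S. \<Sum>z\<in>S. if m y1 w = Some x \<and> m y2 z = Some w then a y1 * b y2 * c z else 0)"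
      by (rule sum.swap)
    finally show "(\<Sum>y2\<in>S. \<Sum>z\<in>S. \<Sum>w\<in>S. if m y1 w = Some x \<and> m y2 z = Some w then a y1 * b y2 * c z else 0) =
        (\<Sum>w\<in>S. \<Sum>y2\<in>S. \<Sum>z\<in>S. if m y1 w = Some x \<and> m y2 z = Some w then a y1 * b y2 * c z else 0)" .
  qed
  also have "\<dots> = (a \<otimes>\<^bsub>A\<^esub> (b \<otimes>\<^bsub>A\<^esub> c)) x"
    unfolding mult_eq[of a "b \<otimes>\<^bsub>A\<^esub> c"]
  proof (intro sum.cong refl)
    fix y1 w
    show "(\<Sum>y2\<in>S. \<Sum>z\<in>S. if m y1 w = Some x \<and> m y2 z = Some w then a y1 * b y2 * c z else 0) =
        (if m y1 w = Some x then a y1 * (b \<otimes>\<^bsub>A\<^esub> c) w else 0)"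
      by (cases "m y1 w = Some x") (simp_all add: mult_eq sum_distrib_left if_distrib[of "\<lambda>t. a y1 * t"] mult.assoc cong: if_cong)
  qed
  finally show "((a \<otimes>\<^bsub>A\<^esub> b) \<otimes>\<^bsub>A\<^esub> c) x = (a \<otimes>\<^bsub>A\<^esub> (b \<otimes>\<^bsub>A\<^esub> c)) x" .
qed

lemma abelian: "abelian_group A"
  by (rule pointwise_abelian_group[of _ S]) (simp_all add: conv_alg_def)

lemma one_eq: "\<one>\<^bsub>A\<^esub> = u"
  by (simp add: conv_alg_def)

lemma is_ring: "ring A"
proof (rule ringI)
  show "abelian_group A" by (rule abelian)
  show "monoid A"
  proof (rule monoidI)
    show "\<one>\<^bsub>A\<^esub> \<in> carrier A" unfolding one_eq carrier_eq using unit_outside by blast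
    fix a b c
    show "(a \<otimes>\<^bsub>A\<^esub> b) \<otimes>\<^bsub>A\<^esub> c = a \<otimes>\<^bsub>A\<^esub> (b \<otimes>\<^bsub>A\<^esub> c)" by (rule mult_assoc)
    show "a \<otimes>\<^bsub>A\<^esub> b \<in> carrier A" by (rule mult_in)
    assume a: "a \<in> carrier A"
    show "\<one>\<^bsub>A\<^esub> \<otimes>\<^bsub>A\<^esub> a = a"
    proof
      fix x
      show "(\<one>\<^bsub>A\<^esub> \<otimes>\<^bsub>A\<^esub> a) x = a x"
      proof (cases "x \<in> S")
        case True
        then show ?thesis unfolding one_eq mult_eq by (rule unit_left)
      next
        case False
        then show ?thesis using a mult_in[of u a] unfolding one_eq carrier_eq by simp
      qed
    qed
    show "a \<otimes>\<^bsub>A\<^esub> \<one>\<^bsub>A\<^esub> = a"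
    proof
      fix x
      show "(a \<otimes>\<^bsub>A\<^esub> \<one>\<^bsub>A\<^esub>) x = a x"
      proof (cases "x \<in> S")
        case True
        then show ?thesis unfolding one_eq mult_eq by (rule unit_right)
      next
        case False
        then show ?thesis using a mult_in[of a u] unfolding one_eq carrier_eq by simp
      qed
    qed
  qed
  fix a b c
  have add: "(a \<oplus>\<^bsub>A\<^esub> b) x = a x + b x" for a b x by (simp add: conv_alg_def)
  show "(a \<oplus>\<^bsub>A\<^esub> b) \<otimes>\<^bsub>A\<^esub> c = a \<otimes>\<^bsub>A\<^esub> c \<oplus>\<^bsub>A\<^esub> b \<otimes>\<^bsub>A\<^esub> c"
    unfolding fun_eq_iff add mult_eq sum.distrib[symmetric]
    by (intro allI sum.cong refl) (simp add: distrib_right)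
  show "c \<otimes>\<^bsub>A\<^esub> (a \<oplus>\<^bsub>A\<^esub> b) = c \<otimes>\<^bsub>A\<^esub> a \<oplus>\<^bsub>A\<^esub> c \<otimes>\<^bsub>A\<^esub> b"
    unfolding fun_eq_iff add mult_eq sum.distrib[symmetric]
    by (intro allI sum.cong refl) (simp add: distrib_left)
qed

lemma complex_algebra: "complex_algebra A"
  unfolding complex_algebra_def
proof (intro conjI allI ballI)
  show "ring A" by (rule is_ring)
  show "Module.module complex_ring A"
    by (rule moduleI[OF cring_from_type_algebra abelian])
       (simp_all add: conv_alg_def ring_of_type_algebra_def distrib_left distrib_right mult.assoc)
  fix k a b
  have sm: "(k \<odot>\<^bsub>A\<^esub> a) x = k * a x" for a x by (simp add: conv_alg_def)
  show "(k \<odot>\<^bsub>A\<^esub> a) \<otimes>\<^bsub>A\<^esub> b = k \<odot>\<^bsub>A\<^esub> (a \<otimes>\<^bsub>A\<^esub> b)" "a \<otimes>\<^bsub>A\<^esub> (k \<odot>\<^bsub>A\<^esub> b) = k \<odot>\<^bsub>A\<^esub> (a \<otimes>\<^bsub>A\<^esub> b)"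
    unfolding fun_eq_iff sm mult_eq sum_distrib_left by (intro allI sum.cong refl, simp)+
qed

end

text \<open>The axioms for a product of matrix algebras over group algebras are obtained along an
  isomorphism instead of being verified layer by layer. The zero has its own assumption because
  \<open>ring_iso\<close> does not speak of it.\<close>

lemma complex_algebra_transport:
  assumes A: "complex_algebra A" and h: "h \<in> ring_iso A B" and h0: "h \<zero>\<^bsub>A\<^esub> = \<zero>\<^bsub>B\<^esub>"
    and hs: "\<And>c x. x \<in> carrier A \<Longrightarrow> h (c \<odot>\<^bsub>A\<^esub> x) = c \<odot>\<^bsub>B\<^esub> h x"
  shows "complex_algebra B"
proof -
  have rA: "ring A" and mA: "Module.module complex_ring A"
    and sA: "\<And>c x y. x \<in> carrier A \<Longrightarrow> y \<in> carrier A \<Longrightarrow> (c \<odot>\<^bsub>A\<^esub> x) \<otimes>\<^bsub>A\<^esub> y = c \<odot>\<^bsub>A\<^esub> (x \<otimes>\<^bsub>A\<^esub> y)"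
      "\<And>c x y. x \<in> carrier A \<Longrightarrow> y \<in> carrier A \<Longrightarrow> x \<otimes>\<^bsub>A\<^esub> (c \<odot>\<^bsub>A\<^esub> y) = c \<odot>\<^bsub>A\<^esub> (x \<otimes>\<^bsub>A\<^esub> y)"
    using A unfolding complex_algebra_def by blast+
  interpret A: ring A by (rule rA)
  interpret MA: Module.module complex_ring A by (rule mA)
  have "ring (B\<lparr>ring.zero := h \<zero>\<^bsub>A\<^esub>\<rparr>)" by (rule A.ring_iso_imp_img_ring[OF h])
  moreover have "B\<lparr>ring.zero := \<zero>\<^bsub>B\<^esub>\<rparr> = B" by (rule module.equality) simp_all
  ultimately have rB: "ring B" unfolding h0 by (simp only:)
  interpret B: ring B by (rule rB)
  have hm: "\<And>x y. x \<in> carrier A \<Longrightarrow> y \<in> carrier A \<Longrightarrow> h (x \<otimes>\<^bsub>A\<^esub> y) = h x \<otimes>\<^bsub>B\<^esub> h y"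
    and ha: "\<And>x y. x \<in> carrier A \<Longrightarrow> y \<in> carrier A \<Longrightarrow> h (x \<oplus>\<^bsub>A\<^esub> y) = h x \<oplus>\<^bsub>B\<^esub> h y"
    and hc: "\<And>x. x \<in> carrier A \<Longrightarrow> h x \<in> carrier B"
    using h by (auto simp: ring_iso_def ring_hom_def)
  have sur: "\<exists>a\<in>carrier A. b = h a" if "b \<in> carrier B" for b
    using h that by (auto simp: ring_iso_def bij_betw_def)
  have cr: "carrier complex_ring = UNIV" by (simp add: ring_of_type_algebra_def)
  have sc: "c \<odot>\<^bsub>A\<^esub> x \<in> carrier A" if "x \<in> carrier A" for c x
    using MA.smult_closed[of c x] that cr by simp
  have "Module.module complex_ring B"
  proof (rule moduleI[OF cring_from_type_algebra B.abelian_group_axioms])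
    fix c and x assume "x \<in> carrier B"
    then obtain a where a: "a \<in> carrier A" "x = h a" using sur by blast
    show "c \<odot>\<^bsub>B\<^esub> x \<in> carrier B" unfolding a(2) hs[OF a(1), symmetric] by (rule hc[OF sc[OF a(1)]])
  next
    fix c d x assume "x \<in> carrier B"
    then obtain a where a: "a \<in> carrier A" "x = h a" using sur by blast
    show "(c \<oplus>\<^bsub>complex_ring\<^esub> d) \<odot>\<^bsub>B\<^esub> x = c \<odot>\<^bsub>B\<^esub> x \<oplus>\<^bsub>B\<^esub> d \<odot>\<^bsub>B\<^esub> x"
      unfolding a(2) hs[OF a(1), symmetric] ha[OF sc[OF a(1)] sc[OF a(1)], symmetric]
      using MA.smult_l_distr[of c d a] a(1) cr by simp
    show "(c \<otimes>\<^bsub>complex_ring\<^esub> d) \<odot>\<^bsub>B\<^esub> x = c \<odot>\<^bsub>B\<^esub> (d \<odot>\<^bsub>B\<^esub> x)"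
      unfolding a(2) hs[OF a(1), symmetric] hs[OF sc[OF a(1)], symmetric]
      using MA.smult_assoc1[of c d a] a(1) cr by simp
  next
    fix c x y assume "x \<in> carrier B" "y \<in> carrier B"
    then obtain a b where a: "a \<in> carrier A" "x = h a" and b: "b \<in> carrier A" "y = h b" using sur by blast
    show "c \<odot>\<^bsub>B\<^esub> (x \<oplus>\<^bsub>B\<^esub> y) = c \<odot>\<^bsub>B\<^esub> x \<oplus>\<^bsub>B\<^esub> c \<odot>\<^bsub>B\<^esub> y"
      unfolding a(2) b(2) ha[OF a(1) b(1), symmetric] hs[OF a(1), symmetric] hs[OF b(1), symmetric]
        ha[OF sc[OF a(1)] sc[OF b(1)], symmetric] hs[OF A.a_closed[OF a(1) b(1)], symmetric]
      using MA.smult_r_distr[of c a b] a(1) b(1) cr by simp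
  next
    fix x assume "x \<in> carrier B"
    then obtain a where a: "a \<in> carrier A" "x = h a" using sur by blast
    show "\<one>\<^bsub>complex_ring\<^esub> \<odot>\<^bsub>B\<^esub> x = x"
      unfolding a(2) hs[OF a(1), symmetric] using MA.smult_one[OF a(1)] by simp
  qed
  moreover have "(c \<odot>\<^bsub>B\<^esub> x) \<otimes>\<^bsub>B\<^esub> y = c \<odot>\<^bsub>B\<^esub> (x \<otimes>\<^bsub>B\<^esub> y) \<and> x \<otimes>\<^bsub>B\<^esub> (c \<odot>\<^bsub>B\<^esub> y) = c \<odot>\<^bsub>B\<^esub> (x \<otimes>\<^bsub>B\<^esub> y)"
    if "x \<in> carrier B" "y \<in> carrier B" for c x y
  proof -
    obtain a b where a: "a \<in> carrier A" "x = h a" and b: "b \<in> carrier A" "y = h b" using sur \<open>x \<in> carrier B\<close> \<open>y \<in> carrier B\<close> by blast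
    show ?thesis
      unfolding a(2) b(2) hs[OF a(1), symmetric] hs[OF b(1), symmetric] hm[OF a(1) b(1), symmetric]
        hm[OF sc[OF a(1)] b(1), symmetric] hm[OF a(1) sc[OF b(1)], symmetric] hs[OF A.m_closed[OF a(1) b(1)], symmetric]
      using sA[OF a(1) b(1), of c] by simp
  qed
  ultimately show ?thesis using rB unfolding complex_algebra_def by blast
qed

lemma group_algebra_abelian: "abelian_group (group_algebra G)"
  by (rule pointwise_abelian_group[of _ "carrier G"]) (simp_all add: group_algebra_def)

lemma group_algebra_finsum:
  assumes "finite L" "\<And>l. l \<in> L \<Longrightarrow> f l \<in> carrier (group_algebra G)"
  shows "(\<Oplus>\<^bsub>group_algebra G\<^esub>l\<in>L. f l) x = (\<Sum>l\<in>L. f l x)"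
proof -
  interpret abelian_group "group_algebra G" by (rule group_algebra_abelian)
  have add: "(a \<oplus>\<^bsub>group_algebra G\<^esub> b) x = a x + b x" for a b by (simp add: group_algebra_def)
  have z: "\<zero>\<^bsub>group_algebra G\<^esub> x = 0" by (simp add: group_algebra_def)
  show ?thesis using assms
  proof (induction L rule: finite_induct)
    case empty
    then show ?case by (simp add: z)
  next
    case (insert l L)
    then have "(\<Oplus>\<^bsub>group_algebra G\<^esub>l\<in>insert l L. f l) = f l \<oplus>\<^bsub>group_algebra G\<^esub> (\<Oplus>\<^bsub>group_algebra G\<^esub>l\<in>L. f l)"
      by (intro finsum_insert) auto
    then show ?case using insert by (simp add: add)
  qed
qed

lemma group_algebra_mult_in:
  assumes "group G"
  shows "a \<otimes>\<^bsub>group_algebra G\<^esub> b \<in> carrier (group_algebra G)"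
proof -
  interpret group G by (rule assms)
  have "(a \<otimes>\<^bsub>group_algebra G\<^esub> b) x = 0" if "x \<notin> carrier G" for x
  proof -
    have emp: "{(y, z) \<in> carrier G \<times> carrier G. y \<otimes>\<^bsub>G\<^esub> z = x} = {}" using that by auto
    show ?thesis unfolding group_algebra_def monoid.select_convs emp by simp
  qed
  then show ?thesis by (simp add: group_algebra_def[of G])
qed

section \<open>The groupoid in coordinates\<close>

text \<open>Identifies subsets of {1..n} with unions of cosets of the point stabilizer, a coset
  being given by the common value of its members at 1.\<close>

definition coset_union :: "nat \<Rightarrow> nat set \<Rightarrow> (nat \<Rightarrow> nat) set" where
  "coset_union n A = {\<tau>. \<tau> permutes {1..n} \<and> \<tau> 1 \<in> A}"

lemma swap_1_permutes:
  fixes n i :: nat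
  shows "1 \<le> n \<Longrightarrow> i \<in> {1..n} \<Longrightarrow> transpose 1 i permutes {1..n}"
  by (intro permutes_swap_id) auto

lemma coset_union_image:
  fixes n :: nat
  assumes "1 \<le> n" "A \<subseteq> {1..n}"
  shows "(\<lambda>\<tau>. \<tau> 1) ` coset_union n A = A"
proof (intro equalityI subsetI)
  fix i assume i: "i \<in> A"
  have "transpose 1 i \<in> coset_union n A"
    using swap_1_permutes[OF assms(1), of i] assms(2) i by (auto simp: coset_union_def)
  then have "transpose 1 i 1 \<in> (\<lambda>\<tau>. \<tau> 1) ` coset_union n A" by (rule imageI)
  then show "i \<in> (\<lambda>\<tau>. \<tau> 1) ` coset_union n A" by simp
qed (auto simp: coset_union_def)

lemma coset_union_inj:
  assumes "1 \<le> n" "A \<subseteq> {1..n}" "B \<subseteq> {1..n}" "coset_union n A = coset_union n B"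
  shows "A = B"
  using coset_union_image[OF assms(1,2)] coset_union_image[OF assms(1,3)] assms(4) by simp

lemma l_coset_sym: "h <#\<^bsub>sym_group n\<^esub> B = (\<lambda>b. h \<circ> b) ` B"
  by (auto simp: l_coset_def sym_group_mult)

lemma l_coset_coset_union:
  assumes h: "h permutes {1..n}"
  shows "h <#\<^bsub>sym_group n\<^esub> coset_union n A = coset_union n (h ` A)"
  unfolding l_coset_sym
proof (intro equalityI subsetI)
  fix \<tau> assume "\<tau> \<in> (\<lambda>b. h \<circ> b) ` coset_union n A"
  then obtain b where b: "b permutes {1..n}" "b 1 \<in> A" "\<tau> = h \<circ> b" by (auto simp: coset_union_def)
  then show "\<tau> \<in> coset_union n (h ` A)" using permutes_compose[OF b(1) h] by (simp add: coset_union_def)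
next
  fix \<tau> assume "\<tau> \<in> coset_union n (h ` A)"
  then have t: "\<tau> permutes {1..n}" "\<tau> 1 \<in> h ` A" by (simp_all add: coset_union_def)
  then obtain a where a: "a \<in> A" "\<tau> 1 = h a" by blast
  have "(inv' h \<circ> \<tau>) 1 = a" using a(2) permutes_inverses(2)[OF h] by simp
  then have "inv' h \<circ> \<tau> \<in> coset_union n A"
    using permutes_compose[OF t(1) permutes_inv[OF h]] a(1) by (simp add: coset_union_def)
  moreover have "\<tau> = h \<circ> (inv' h \<circ> \<tau>)" using permutes_inverses(1)[OF h] by (simp add: fun_eq_iff)
  ultimately show "\<tau> \<in> (\<lambda>b. h \<circ> b) ` coset_union n A" by blast
qed

lemma point_stabilizer_coset_union: "sym_point_stabilizer n = coset_union n {1}"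
  by (auto simp: sym_point_stabilizer_def coset_union_def sym_group_carrier)

text \<open>A coset contains every permutation with its value at 1, so a union of cosets is
  recovered from the set of values that its members take at 1.\<close>

lemma coset_unions_sym:
  assumes n: "1 \<le> n"
  shows "coset_unions (sym_group n) (sym_point_stabilizer n) = coset_union n ` {A. A \<subseteq> {1..n} \<and> 1 \<in> A}"
proof -
  have lc: "lcosets\<^bsub>sym_group n\<^esub> (sym_point_stabilizer n) = {coset_union n {g 1} | g. g permutes {1..n}}"
    unfolding LCOSETS_def point_stabilizer_coset_union using l_coset_coset_union[of _ n "{1}"]
    by (auto simp: sym_group_carrier)
  show ?thesis
  proof (intro equalityI subsetI)
    fix B assume "B \<in> coset_unions (sym_group n) (sym_point_stabilizer n)"
    then obtain C where B: "B \<subseteq> carrier (sym_group n)" "sym_point_stabilizer n \<subseteq> B"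
      and C: "C \<subseteq> {coset_union n {g 1} | g. g permutes {1..n}}" "B = \<Union>C"
      unfolding coset_unions_def lc by blast
    have Bp: "\<tau> permutes {1..n}" if "\<tau> \<in> B" for \<tau> using B(1) that sym_group_carrier by blast
    have "B = coset_union n ((\<lambda>\<tau>. \<tau> 1) ` B)"
    proof (intro equalityI subsetI)
      fix \<tau> assume "\<tau> \<in> B"
      then show "\<tau> \<in> coset_union n ((\<lambda>\<tau>. \<tau> 1) ` B)" using Bp by (simp add: coset_union_def)
    next
      fix \<tau> assume "\<tau> \<in> coset_union n ((\<lambda>\<tau>. \<tau> 1) ` B)"
      then obtain \<sigma> where s: "\<tau> permutes {1..n}" "\<sigma> \<in> B" "\<tau> 1 = \<sigma> 1" by (auto simp: coset_union_def)
      obtain D where D: "D \<in> C" "\<sigma> \<in> D" using s(2) C(2) by blast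
      then obtain g :: "nat \<Rightarrow> nat" where "D = coset_union n {g 1}" using C(1) by blast
      then have "\<tau> \<in> D" using D(2) s by (simp add: coset_union_def)
      then show "\<tau> \<in> B" using D(1) C(2) by blast
    qed
    moreover have "(\<lambda>\<tau>. \<tau> 1) ` B \<subseteq> {1..n}"
    proof (rule image_subsetI)
      fix \<tau> assume "\<tau> \<in> B"
      then show "\<tau> 1 \<in> {1..n}" using permutes_in_image[OF Bp, of \<tau> 1] n by simp
    qed
    moreover have "1 \<in> (\<lambda>\<tau>. \<tau> 1) ` B"
    proof -
      have "id \<in> B" using B(2) by (auto simp: point_stabilizer_coset_union coset_union_def permutes_id)
      then have "id 1 \<in> (\<lambda>\<tau>. \<tau> 1) ` B" by (rule imageI)
      then show ?thesis by simp
    qed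
    ultimately show "B \<in> coset_union n ` {A. A \<subseteq> {1..n} \<and> 1 \<in> A}" by blast
  next
    fix B assume "B \<in> coset_union n ` {A. A \<subseteq> {1..n} \<and> 1 \<in> A}"
    then obtain A where A: "A \<subseteq> {1..n}" "1 \<in> A" "B = coset_union n A" by blast
    let ?C = "{coset_union n {g 1} | g. g permutes {1..n} \<and> g 1 \<in> A}"
    have "\<Union>?C = B" unfolding A(3) by (auto simp: coset_union_def)
    moreover have "?C \<subseteq> lcosets\<^bsub>sym_group n\<^esub> (sym_point_stabilizer n)" unfolding lc by blast
    moreover have "B \<subseteq> carrier (sym_group n)" unfolding A(3) by (auto simp: coset_union_def sym_group_carrier)
    moreover have "sym_point_stabilizer n \<subseteq> B"
      unfolding A(3) point_stabilizer_coset_union using A(2) by (auto simp: coset_union_def)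
    ultimately show "B \<in> coset_unions (sym_group n) (sym_point_stabilizer n)" unfolding coset_unions_def by blast
  qed
qed

text \<open>The inverse of g maps 1 into A exactly if 1 lies in g A. So the elements of the groupoid
  are arrows from A to g A between subsets that both contain 1.\<close>

lemma Gamma_sym:
  assumes n: "1 \<le> n"
  shows "(B, g) \<in> Gamma (sym_group n) (sym_point_stabilizer n) \<longleftrightarrow>
    g permutes {1..n} \<and> (\<exists>A. A \<subseteq> {1..n} \<and> 1 \<in> A \<and> 1 \<in> g ` A \<and> B = coset_union n A)"
proof (cases "g permutes {1..n}")
  case g: True
  have iA: "inv\<^bsub>sym_group n\<^esub> g \<in> coset_union n A \<longleftrightarrow> 1 \<in> g ` A" for A
  proof -
    have i: "inv\<^bsub>sym_group n\<^esub> g = inv' g" using g by (simp add: sym_group_carrier)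
    have "1 \<in> g ` A \<longleftrightarrow> g (inv' g 1) \<in> g ` A" by (simp only: permutes_inverses(1)[OF g])
    also have "\<dots> \<longleftrightarrow> inv' g 1 \<in> A" by (rule inj_image_mem_iff[OF permutes_inj[OF g]])
    finally show ?thesis unfolding i using permutes_inv[OF g] by (simp add: coset_union_def)
  qed
  have "(B, g) \<in> Gamma (sym_group n) (sym_point_stabilizer n) \<longleftrightarrow>
      B \<in> coset_union n ` {A. A \<subseteq> {1..n} \<and> 1 \<in> A} \<and> inv\<^bsub>sym_group n\<^esub> g \<in> B"
    using g by (simp add: Gamma_def sym_group_carrier coset_unions_sym[OF n])
  also have "\<dots> \<longleftrightarrow> (\<exists>A. A \<subseteq> {1..n} \<and> 1 \<in> A \<and> 1 \<in> g ` A \<and> B = coset_union n A)"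
  proof
    assume "B \<in> coset_union n ` {A. A \<subseteq> {1..n} \<and> 1 \<in> A} \<and> inv\<^bsub>sym_group n\<^esub> g \<in> B"
    then obtain A where A: "A \<subseteq> {1..n}" "1 \<in> A" "B = coset_union n A" "inv\<^bsub>sym_group n\<^esub> g \<in> coset_union n A" by blast
    have "1 \<in> g ` A" using A(4) unfolding iA .
    then show "\<exists>A. A \<subseteq> {1..n} \<and> 1 \<in> A \<and> 1 \<in> g ` A \<and> B = coset_union n A" using A(1-3) by blast
  next
    assume "\<exists>A. A \<subseteq> {1..n} \<and> 1 \<in> A \<and> 1 \<in> g ` A \<and> B = coset_union n A"
    then obtain A where A: "A \<subseteq> {1..n}" "1 \<in> A" "1 \<in> g ` A" "B = coset_union n A" by blast
    have "inv\<^bsub>sym_group n\<^esub> g \<in> coset_union n A" using A(3) unfolding iA .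
    then show "B \<in> coset_union n ` {A. A \<subseteq> {1..n} \<and> 1 \<in> A} \<and> inv\<^bsub>sym_group n\<^esub> g \<in> B"
      using A(1,2) unfolding A(4) by blast
  qed
  finally show ?thesis using g by simp
qed (simp add: Gamma_def sym_group_carrier)

definition block_pairs :: "nat \<Rightarrow> nat \<Rightarrow> ((nat \<Rightarrow> nat) \<times> (nat \<Rightarrow> nat)) set" where
  "block_pairs n k = {p. p permutes {1..k}} \<times> {q. q permutes {1..n - k}}"

definition pair_comp :: "(nat \<Rightarrow> nat) \<times> (nat \<Rightarrow> nat) \<Rightarrow> (nat \<Rightarrow> nat) \<times> (nat \<Rightarrow> nat) \<Rightarrow> (nat \<Rightarrow> nat) \<times> (nat \<Rightarrow> nat)" where
  "pair_comp P Q = (fst P \<circ> fst Q, snd P \<circ> snd Q)"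

lemma pair_comp_in: "P \<in> block_pairs n k \<Longrightarrow> Q \<in> block_pairs n k \<Longrightarrow> pair_comp P Q \<in> block_pairs n k"
  by (auto simp: block_pairs_def pair_comp_def permutes_compose)

lemma pair_comp_assoc: "pair_comp (pair_comp P Q) T = pair_comp P (pair_comp Q T)"
  by (simp add: pair_comp_def comp_assoc)

lemma pair_comp_id: "pair_comp P (id, id) = P" "pair_comp (id, id) P = P"
  by (simp_all add: pair_comp_def)

lemma pair_id_in: "(id, id) \<in> block_pairs n k"
  by (simp add: block_pairs_def permutes_id)

lemma block_group:
  shows "carrier (sym_group k \<times>\<times> sym_group (n - k)) = block_pairs n k"
    and "P \<otimes>\<^bsub>sym_group k \<times>\<times> sym_group (n - k)\<^esub> Q = pair_comp P Q"
    and "\<one>\<^bsub>sym_group k \<times>\<times> sym_group (n - k)\<^esub> = (id, id)"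
  by (auto simp: DirProd_def block_pairs_def pair_comp_def sym_group_def case_prod_beta)

text \<open>\<open>e k\<close> numbers the k-subsets containing 1, and \<open>s A\<close> carries
  {1..card A} onto A. The maps \<open>s\<close> trivialize each component of the groupoid: an arrow
  becomes a pair of numbers together with a loop at {1..k}.\<close>

locale block_coordinates =
  fixes n :: nat and e :: "nat \<Rightarrow> nat \<Rightarrow> nat set" and s :: "nat set \<Rightarrow> nat \<Rightarrow> nat"
  assumes n: "1 \<le> n"
    and e: "k \<in> {1..n} \<Longrightarrow> bij_betw (e k) {..<(n - 1) choose (k - 1)} {A. A \<subseteq> {1..n} \<and> 1 \<in> A \<and> card A = k}"
    and s: "A \<subseteq> {1..n} \<Longrightarrow> s A permutes {1..n}" "A \<subseteq> {1..n} \<Longrightarrow> s A ` {1..card A} = A"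
begin

abbreviation "bsize k \<equiv> (n - 1) choose (k - 1)"
abbreviation "\<Gamma> \<equiv> Gamma (sym_group n) (sym_point_stabilizer n)"

definition coords :: "(nat \<times> nat \<times> nat \<times> ((nat \<Rightarrow> nat) \<times> (nat \<Rightarrow> nat))) set" where
  "coords = {(k, i, j, P). k \<in> {1..n} \<and> i < bsize k \<and> j < bsize k \<and> P \<in> block_pairs n k}"

text \<open>The arrow from \<open>e k j\<close> to \<open>e k i\<close> that becomes \<open>P\<close> when both sets are moved to \<open>{1..k}\<close> by \<open>s\<close>.\<close>

definition arrow :: "nat \<times> nat \<times> nat \<times> ((nat \<Rightarrow> nat) \<times> (nat \<Rightarrow> nat)) \<Rightarrow> (nat \<Rightarrow> nat) set \<times> (nat \<Rightarrow> nat)" where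
  "arrow = (\<lambda>(k, i, j, P). (coset_union n (e k j), s (e k i) \<circ> sym_join n k (fst P) (snd P) \<circ> inv' (s (e k j))))"

lemma e_in:
  assumes "k \<in> {1..n}" "i < bsize k"
  shows "e k i \<subseteq> {1..n}" "1 \<in> e k i" "card (e k i) = k"
  using bij_betwE[OF e[OF assms(1)]] assms(2) by blast+

lemma e_inj: "k \<in> {1..n} \<Longrightarrow> i < bsize k \<Longrightarrow> j < bsize k \<Longrightarrow> e k i = e k j \<Longrightarrow> i = j"
  using inj_onD[OF bij_betw_imp_inj_on[OF e]] by blast

lemma arrow_data:
  assumes "(k, i, j, P) \<in> coords"
  shows "s (e k i) permutes {1..n}" "s (e k j) permutes {1..n}" "s (e k i) ` {1..k} = e k i" "s (e k j) ` {1..k} = e k j"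
    "sym_join n k (fst P) (snd P) \<in> block_stabilizer n k" "k \<le> n"
proof -
  have k: "k \<in> {1..n}" "i < bsize k" "j < bsize k" and P: "fst P permutes {1..k}" "snd P permutes {1..n - k}"
    using assms by (auto simp: coords_def block_pairs_def)
  show "k \<le> n" using k(1) by simp
  then show "sym_join n k (fst P) (snd P) \<in> block_stabilizer n k" by (rule sym_join_in[OF _ P])
  show "s (e k i) permutes {1..n}" "s (e k j) permutes {1..n}"
    by (rule s(1)[OF e_in(1)[OF k(1,2)]], rule s(1)[OF e_in(1)[OF k(1,3)]])
  show "s (e k i) ` {1..k} = e k i" "s (e k j) ` {1..k} = e k j"
    using s(2)[OF e_in(1)[OF k(1,2)]] s(2)[OF e_in(1)[OF k(1,3)]] e_in(3)[OF k(1,2)] e_in(3)[OF k(1,3)] by simp_all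
qed

lemma arrow_permutes:
  assumes "(k, i, j, P) \<in> coords"
  shows "snd (arrow (k, i, j, P)) permutes {1..n}"
proof -
  note d = arrow_data[OF assms]
  show ?thesis unfolding arrow_def prod.case snd_conv
    by (intro permutes_compose d permutes_inv block_stabilizer_permutes[OF d(5)])
qed

lemma arrow_image:
  assumes "(k, i, j, P) \<in> coords"
  shows "snd (arrow (k, i, j, P)) ` e k j = e k i"
proof -
  note d = arrow_data[OF assms]
  have 1: "inv' (s (e k j)) ` e k j = {1..k}"
  proof -
    have "inv' (s (e k j)) ` e k j = inv' (s (e k j)) ` s (e k j) ` {1..k}" by (simp only: d(4))
    then show ?thesis by (simp only: image_comp permutes_inv_o(2)[OF d(2)] image_id id_apply)
  qed
  have 2: "sym_join n k (fst P) (snd P) ` {1..k} = {1..k}" using d(5) by (simp add: block_stabilizer_def)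
  show ?thesis unfolding arrow_def prod.case snd_conv image_comp[symmetric] 1 2 by (rule d(3))
qed

lemma arrow_in:
  assumes "c \<in> coords"
  shows "arrow c \<in> \<Gamma>"
proof -
  obtain k i j P where c: "c = (k, i, j, P)" by (rule prod_cases4)
  have k: "k \<in> {1..n}" "i < bsize k" "j < bsize k" using assms by (simp_all add: c coords_def)
  have "1 \<in> snd (arrow c) ` e k j" using arrow_image[of k i j P] assms e_in(2)[OF k(1,2)] unfolding c by simp
  moreover have "snd (arrow c) permutes {1..n}" using arrow_permutes[of k i j P] assms unfolding c .
  ultimately have "(coset_union n (e k j), snd (arrow c)) \<in> \<Gamma>"
    unfolding Gamma_sym[OF n] using e_in(1,2)[OF k(1,3)] by blast
  then show ?thesis by (simp add: c arrow_def)
qed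

text \<open>The set component determines k and j, its image under the permutation determines i, and
  undoing \<open>s\<close> on both sides leaves the block permutation.\<close>

lemma arrow_inj: "inj_on arrow coords"
proof (rule inj_onI)
  fix c c' assume cc: "c \<in> coords" "c' \<in> coords" "arrow c = arrow c'"
  obtain k i j P where c: "c = (k, i, j, P)" by (rule prod_cases4)
  obtain k' i' j' P' where c': "c' = (k', i', j', P')" by (rule prod_cases4)
  have k: "k \<in> {1..n}" "i < bsize k" "j < bsize k" "P \<in> block_pairs n k" using cc by (simp_all add: c coords_def)
  have k': "k' \<in> {1..n}" "i' < bsize k'" "j' < bsize k'" "P' \<in> block_pairs n k'" using cc by (simp_all add: c' coords_def)
  have "coset_union n (e k j) = coset_union n (e k' j')" using cc(3) by (simp add: c c' arrow_def)
  then have ej: "e k j = e k' j'" by (rule coset_union_inj[OF n e_in(1)[OF k(1,3)] e_in(1)[OF k'(1,3)]])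
  then have kk: "k = k'" using e_in(3)[OF k(1,3)] e_in(3)[OF k'(1,3)] by simp
  then have jj: "j = j'" using e_inj[OF k(1,3)] k'(3) ej by simp
  have "e k i = e k' i'"
    using arrow_image[of k i j P] arrow_image[of k' i' j' P'] cc ej by (simp add: c c')
  then have ii: "i = i'" using e_inj[OF k(1,2)] k'(2) kk by simp
  note d = arrow_data[OF cc(1)[unfolded c]]
  have "s (e k i) \<circ> sym_join n k (fst P) (snd P) \<circ> inv' (s (e k j)) = s (e k i) \<circ> sym_join n k (fst P') (snd P') \<circ> inv' (s (e k j))"
    using cc(3) by (simp add: c c' arrow_def kk ii jj)
  then have "inv' (s (e k i)) \<circ> (s (e k i) \<circ> sym_join n k (fst P) (snd P) \<circ> inv' (s (e k j))) \<circ> s (e k j) =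
      inv' (s (e k i)) \<circ> (s (e k i) \<circ> sym_join n k (fst P') (snd P') \<circ> inv' (s (e k j))) \<circ> s (e k j)" by (simp only:)
  then have eq: "sym_join n k (fst P) (snd P) = sym_join n k (fst P') (snd P')"
    using permutes_inverses(2)[OF d(1)] permutes_inverses(2)[OF d(2)] by (simp add: fun_eq_iff)
  have sp: "sym_split n k (sym_join n k (fst P) (snd P)) = (fst P, snd P)"
    using k(4) by (intro sym_split_join d(6)) (auto simp: block_pairs_def)
  have sp': "sym_split n k (sym_join n k (fst P') (snd P')) = (fst P', snd P')"
    using k'(4) unfolding kk[symmetric] by (intro sym_split_join d(6)) (auto simp: block_pairs_def)
  have "(fst P, snd P) = (fst P', snd P')" unfolding sp[symmetric] sp'[symmetric] eq ..
  then have "P = P'" by (simp only: prod.collapse)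
  then show "c = c'" by (simp add: c c' kk ii jj)
qed

lemma arrow_surj:
  assumes "x \<in> \<Gamma>"
  shows "\<exists>c\<in>coords. arrow c = x"
proof -
  obtain B g where xB: "x = (B, g)" by (rule prod.exhaust)
  obtain A where A: "A \<subseteq> {1..n}" "1 \<in> A" and g: "g permutes {1..n}" "1 \<in> g ` A" and B: "B = coset_union n A"
    using assms unfolding xB Gamma_sym[OF n] by blast
  have x: "x = (coset_union n A, g)" unfolding xB B ..
  have fA: "finite A" by (rule finite_subset[OF A(1)]) simp
  define k where "k = card A"
  have "0 < card A" using A(2) fA card_gt_0_iff by blast
  moreover have "card A \<le> n" using card_mono[OF _ A(1)] by simp
  ultimately have k: "k \<in> {1..n}" by (simp add: k_def)
  have im: "e k ` {..<bsize k} = {A. A \<subseteq> {1..n} \<and> 1 \<in> A \<and> card A = k}" using e[OF k] by (simp add: bij_betw_def)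
  have "A \<in> e k ` {..<bsize k}" unfolding im using A k_def by simp
  then obtain j where j: "j < bsize k" "A = e k j" by blast
  have gA: "g ` A \<subseteq> {1..n}" using A(1) permutes_in_image[OF g(1)] by blast
  have "card (g ` A) = k" unfolding k_def by (rule card_image[OF inj_on_subset[OF permutes_inj[OF g(1)] subset_UNIV]])
  then have "g ` A \<in> e k ` {..<bsize k}" unfolding im using gA g(2) by simp
  then obtain i where i: "i < bsize k" "g ` A = e k i" by blast
  have sj: "s (e k j) permutes {1..n}" "s (e k j) ` {1..k} = e k j"
    using s[OF e_in(1)[OF k j(1)]] e_in(3)[OF k j(1)] by simp_all
  have si: "s (e k i) permutes {1..n}" "s (e k i) ` {1..k} = e k i"
    using s[OF e_in(1)[OF k i(1)]] e_in(3)[OF k i(1)] by simp_all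
  \<comment> \<open>The loop at {1..k} obtained by moving source and target back along
    \<open>s\<close>.\<close>
  define \<kappa> where "\<kappa> = inv' (s (e k i)) \<circ> g \<circ> s (e k j)"
  have kn: "k \<le> n" using k by simp
  have "\<kappa> ` {1..k} = inv' (s (e k i)) ` s (e k i) ` {1..k}"
    unfolding \<kappa>_def image_comp[symmetric] sj(2) unfolding j(2)[symmetric] i(2) unfolding si(2) ..
  also have "\<dots> = {1..k}" by (simp only: image_comp permutes_inv_o(2)[OF si(1)] image_id id_apply)
  finally have \<kappa>: "\<kappa> \<in> block_stabilizer n k"
    unfolding block_stabilizer_def \<kappa>_def using permutes_compose[OF sj(1) permutes_compose[OF g(1) permutes_inv[OF si(1)]]] by simp
  let ?P = "sym_split n k \<kappa>"
  have "?P \<in> block_pairs n k"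
    using upper_part_permutes[OF \<kappa>] lower_part_permutes[OF kn \<kappa>] by (simp add: block_pairs_def mem_Times_iff)
  then have "(k, i, j, ?P) \<in> coords" using k i j by (simp add: coords_def)
  moreover have "s (e k i) \<circ> \<kappa> \<circ> inv' (s (e k j)) = g"
    unfolding \<kappa>_def using permutes_inverses(1)[OF si(1)] permutes_inverses(1)[OF sj(1)] by (simp add: fun_eq_iff)
  then have "arrow (k, i, j, ?P) = x"
    unfolding arrow_def prod.case sym_join_split[OF kn \<kappa>] x j(2)[symmetric] by (simp only: j(2))
  ultimately show ?thesis by blast
qed

lemma arrow_bij: "bij_betw arrow coords \<Gamma>"
  unfolding bij_betw_def using arrow_inj arrow_in arrow_surj by blast

text \<open>The law of matrix units: arrows compose when the inner indices agree, and then the two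
  inner copies of \<open>s\<close> cancel.\<close>

lemma arrow_mult:
  assumes c1: "(k1, i1, l1, P1) \<in> coords" and c2: "(k2, l2, j2, P2) \<in> coords"
  shows "Gamma_mult (sym_group n) (arrow (k1, i1, l1, P1)) (arrow (k2, l2, j2, P2)) =
    (if k1 = k2 \<and> l1 = l2 then Some (arrow (k1, i1, j2, pair_comp P1 P2)) else None)"
proof -
  have k1: "k1 \<in> {1..n}" "l1 < bsize k1" and k2: "k2 \<in> {1..n}" "l2 < bsize k2"
    and P: "P1 \<in> block_pairs n k1" "P2 \<in> block_pairs n k2" using c1 c2 by (simp_all add: coords_def)
  note d1 = arrow_data[OF c1] and d2 = arrow_data[OF c2]
  let ?g = "snd (arrow (k1, i1, l1, P1))" and ?h = "snd (arrow (k2, l2, j2, P2))"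
  have a: "arrow (k1, i1, l1, P1) = (coset_union n (e k1 l1), ?g)" "arrow (k2, l2, j2, P2) = (coset_union n (e k2 j2), ?h)"
    by (simp_all add: arrow_def)
  have "?h <#\<^bsub>sym_group n\<^esub> coset_union n (e k2 j2) = coset_union n (e k2 l2)"
    unfolding l_coset_coset_union[OF arrow_permutes[OF c2]] arrow_image[OF c2] ..
  then have m: "Gamma_mult (sym_group n) (arrow (k1, i1, l1, P1)) (arrow (k2, l2, j2, P2)) =
      (if coset_union n (e k1 l1) = coset_union n (e k2 l2) then Some (coset_union n (e k2 j2), ?g \<circ> ?h) else None)"
    by (subst a(1), subst a(2)) (simp add: sym_group_mult)
  have cond: "coset_union n (e k1 l1) = coset_union n (e k2 l2) \<longleftrightarrow> k1 = k2 \<and> l1 = l2"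
  proof
    assume "coset_union n (e k1 l1) = coset_union n (e k2 l2)"
    then have el: "e k1 l1 = e k2 l2" by (rule coset_union_inj[OF n e_in(1)[OF k1] e_in(1)[OF k2]])
    then have "k1 = k2" using e_in(3)[OF k1] e_in(3)[OF k2] by simp
    then show "k1 = k2 \<and> l1 = l2" using e_inj[OF k1] k2(2) el by simp
  qed simp
  show ?thesis
  proof (cases "k1 = k2 \<and> l1 = l2")
    case True
    have "sym_join n k1 (fst P1) (snd P1) \<circ> sym_join n k1 (fst P2) (snd P2) = sym_join n k1 (fst (pair_comp P1 P2)) (snd (pair_comp P1 P2))"
      unfolding pair_comp_def fst_conv snd_conv
      by (rule sym_join_comp[OF d1(6)]) (use P(2) True in \<open>auto simp: block_pairs_def\<close>)
    then have j: "sym_join n k1 (fst P1) (snd P1) (sym_join n k2 (fst P2) (snd P2) z) = sym_join n k1 (fst (pair_comp P1 P2)) (snd (pair_comp P1 P2)) z" for z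
      using conjunct1[OF True] by (metis comp_apply)
    have i: "inv' (s (e k1 l1)) (s (e k2 l2) z) = z" for z using True permutes_inverses(2)[OF d1(2)] by simp
    have ee: "e k2 j2 = e k1 j2" using True by simp
    have "?g \<circ> ?h = s (e k1 i1) \<circ> sym_join n k1 (fst (pair_comp P1 P2)) (snd (pair_comp P1 P2)) \<circ> inv' (s (e k1 j2))"
      unfolding arrow_def prod.case snd_conv fun_eq_iff comp_apply i j ee by (intro allI refl)
    then show ?thesis unfolding m cond if_P[OF True] using True by (simp add: arrow_def)
  next
    case False
    show ?thesis unfolding m cond if_not_P[OF False] ..
  qed
qed

definition unit_fun :: "(nat \<Rightarrow> nat) set \<times> (nat \<Rightarrow> nat) \<Rightarrow> complex" where
  "unit_fun = (\<lambda>(A, g). if A \<in> coset_unions (sym_group n) (sym_point_stabilizer n) \<and> g = \<one>\<^bsub>sym_group n\<^esub> then 1 else 0)"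

lemma groupoid_algebra_eq: "groupoid_algebra (sym_group n) (sym_point_stabilizer n) = conv_alg \<Gamma> (Gamma_mult (sym_group n)) unit_fun"
  by (simp add: groupoid_algebra_def conv_alg_def unit_fun_def)

text \<open>By injectivity of the coordinates, an arrow with permutation \<open>id\<close> is the
  identity arrow of its source.\<close>

lemma unit_fun_arrow:
  assumes c: "(k, i, j, P) \<in> coords"
  shows "unit_fun (arrow (k, i, j, P)) = (if i = j \<and> P = (id, id) then 1 else 0)"
proof -
  have k: "k \<in> {1..n}" "i < bsize k" "j < bsize k" using c by (simp_all add: coords_def)
  note d = arrow_data[OF c]
  have A: "coset_union n (e k j) \<in> coset_unions (sym_group n) (sym_point_stabilizer n)"
    unfolding coset_unions_sym[OF n] using e_in[OF k(1,3)] by blast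
  have cj: "(k, j, j, (id, id)) \<in> coords" using k pair_id_in by (simp add: coords_def)
  have aj: "arrow (k, j, j, (id, id)) = (coset_union n (e k j), id)"
    by (simp add: arrow_def sym_join_id[OF d(6)] permutes_inv_o(1)[OF d(2)])
  have "snd (arrow (k, i, j, P)) = id \<longleftrightarrow> arrow (k, i, j, P) = arrow (k, j, j, (id, id))"
    unfolding aj by (simp add: arrow_def)
  also have "\<dots> \<longleftrightarrow> (k, i, j, P) = (k, j, j, (id, id))"
    using inj_on_eq_iff[OF arrow_inj c cj] .
  finally have "snd (arrow (k, i, j, P)) = id \<longleftrightarrow> i = j \<and> P = (id, id)" by simp
  moreover have "arrow (k, i, j, P) = (coset_union n (e k j), snd (arrow (k, i, j, P)))" by (simp add: arrow_def)
  then have "unit_fun (arrow (k, i, j, P)) = unit_fun (coset_union n (e k j), snd (arrow (k, i, j, P)))" by (simp only:)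
  ultimately show ?thesis unfolding unit_fun_def prod.case sym_group_one using A by simp
qed

lemma finite_\<Gamma>: "finite \<Gamma>"
proof -
  have "finite coords"
  proof (rule finite_subset)
    show "coords \<subseteq> (SIGMA k:{1..n}. {..<bsize k} \<times> {..<bsize k} \<times> block_pairs n k)" by (auto simp: coords_def)
    show "finite (SIGMA k:{1..n}. {..<bsize k} \<times> {..<bsize k} \<times> block_pairs n k)"
      unfolding block_pairs_def by (intro finite_SigmaI finite_cartesian_product finite_permutations) simp_all
  qed
  then show ?thesis using bij_betw_finite[OF arrow_bij] by simp
qed

lemma \<Gamma>_cases:
  assumes "x \<in> \<Gamma>"
  obtains k i j P where "x = arrow (k, i, j, P)" "(k, i, j, P) \<in> coords"
  using arrow_surj[OF assms] by (metis prod_cases4)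

lemma coords_iff: "(k, i, j, P) \<in> coords \<longleftrightarrow> k \<in> {1..n} \<and> i < bsize k \<and> j < bsize k \<and> P \<in> block_pairs n k"
  by (simp add: coords_def)

lemma conv: "conv_data \<Gamma> (Gamma_mult (sym_group n)) unit_fun"
proof
  show "finite \<Gamma>" by (rule finite_\<Gamma>)
  fix x assume "x \<notin> \<Gamma>"
  then show "unit_fun x = 0"
  proof (cases x)
    case (Pair B g)
    have "\<not> (B \<in> coset_unions (sym_group n) (sym_point_stabilizer n) \<and> g = id)"
    proof
      assume as: "B \<in> coset_unions (sym_group n) (sym_point_stabilizer n) \<and> g = id"
      then obtain A where A: "A \<subseteq> {1..n}" "1 \<in> A" "B = coset_union n A" unfolding coset_unions_sym[OF n] by blast
      then have "1 \<in> id ` A" by simp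
      then have "(B, id) \<in> \<Gamma>" unfolding Gamma_sym[OF n] using A permutes_id by blast
      then show False using \<open>x \<notin> \<Gamma>\<close> as unfolding Pair by simp
    qed
    then show ?thesis unfolding unit_fun_def Pair prod.case sym_group_one by (rule if_not_P)
  qed
next
  fix y z x assume y: "y \<in> \<Gamma>" and z: "z \<in> \<Gamma>" and m: "Gamma_mult (sym_group n) y z = Some x"
  obtain k1 i1 l1 P1 where y': "y = arrow (k1, i1, l1, P1)" "(k1, i1, l1, P1) \<in> coords" by (rule \<Gamma>_cases[OF y])
  obtain k2 l2 j2 P2 where z': "z = arrow (k2, l2, j2, P2)" "(k2, l2, j2, P2) \<in> coords" by (rule \<Gamma>_cases[OF z])
  have *: "k1 = k2 \<and> l1 = l2" "x = arrow (k1, i1, j2, pair_comp P1 P2)"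
    using m unfolding y'(1) z'(1) arrow_mult[OF y'(2) z'(2)] by (simp_all split: if_splits)
  have "(k1, i1, j2, pair_comp P1 P2) \<in> coords" using y'(2) z'(2) *(1) pair_comp_in by (simp add: coords_iff)
  then show "x \<in> \<Gamma>" unfolding *(2) by (rule arrow_in)
next
  fix x y z assume x: "x \<in> \<Gamma>" and y: "y \<in> \<Gamma>" and z: "z \<in> \<Gamma>"
  obtain k1 i1 l1 P1 where x': "x = arrow (k1, i1, l1, P1)" "(k1, i1, l1, P1) \<in> coords" by (rule \<Gamma>_cases[OF x])
  obtain k2 i2 l2 P2 where y': "y = arrow (k2, i2, l2, P2)" "(k2, i2, l2, P2) \<in> coords" by (rule \<Gamma>_cases[OF y])
  obtain k3 i3 l3 P3 where z': "z = arrow (k3, i3, l3, P3)" "(k3, i3, l3, P3) \<in> coords" by (rule \<Gamma>_cases[OF z])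
  show "Option.bind (Gamma_mult (sym_group n) x y) (\<lambda>w. Gamma_mult (sym_group n) w z) =
      Option.bind (Gamma_mult (sym_group n) y z) (\<lambda>w. Gamma_mult (sym_group n) x w)"
  \<comment> \<open>Whether a product is defined depends on the indices alone, so comparing them
    settles each of the four cases.\<close>
  proof (cases "k1 = k2 \<and> l1 = i2")
    case True
    have c12: "(k1, i1, l2, pair_comp P1 P2) \<in> coords" using x'(2) y'(2) True pair_comp_in by (simp add: coords_iff)
    show ?thesis
    proof (cases "k2 = k3 \<and> l2 = i3")
      case True2: True
      have c23: "(k2, i2, l3, pair_comp P2 P3) \<in> coords" using y'(2) z'(2) True2 pair_comp_in by (simp add: coords_iff)
      have t3: "k1 = k3 \<and> l2 = i3" using True True2 by simp
      show ?thesis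
        unfolding x'(1) y'(1) z'(1) arrow_mult[OF x'(2) y'(2)] arrow_mult[OF y'(2) z'(2)] if_P[OF True] if_P[OF True2]
          Option.bind.simps arrow_mult[OF c12 z'(2)] arrow_mult[OF x'(2) c23] if_P[OF t3]
        by (simp only: pair_comp_assoc)
    next
      case False
      have t3: "\<not> (k1 = k3 \<and> l2 = i3)" using True False by simp
      show ?thesis
        unfolding x'(1) y'(1) z'(1) arrow_mult[OF x'(2) y'(2)] arrow_mult[OF y'(2) z'(2)] if_P[OF True] if_not_P[OF False]
          Option.bind.simps arrow_mult[OF c12 z'(2)] if_not_P[OF t3] ..
    qed
  next
    case False
    show ?thesis
    proof (cases "k2 = k3 \<and> l2 = i3")
      case True2: True
      have c23: "(k2, i2, l3, pair_comp P2 P3) \<in> coords" using y'(2) z'(2) True2 pair_comp_in by (simp add: coords_iff)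
      show ?thesis
        unfolding x'(1) y'(1) z'(1) arrow_mult[OF x'(2) y'(2)] arrow_mult[OF y'(2) z'(2)] if_not_P[OF False] if_P[OF True2]
          Option.bind.simps arrow_mult[OF x'(2) c23] ..
    next
      case False2: False
      show ?thesis
        unfolding x'(1) y'(1) z'(1) arrow_mult[OF x'(2) y'(2)] arrow_mult[OF y'(2) z'(2)] if_not_P[OF False] if_not_P[OF False2]
          Option.bind.simps ..
    qed
  qed
next
  fix x a assume x: "x \<in> \<Gamma>"
  obtain k i j P where x': "x = arrow (k, i, j, P)" "(k, i, j, P) \<in> coords" by (rule \<Gamma>_cases[OF x])
  have cj: "(k, j, j, (id, id)) \<in> coords" and ci: "(k, i, i, (id, id)) \<in> coords"
    using x'(2) pair_id_in by (simp_all add: coords_iff)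
  show "(\<Sum>y\<in>\<Gamma>. \<Sum>z\<in>\<Gamma>. if Gamma_mult (sym_group n) y z = Some x then a y * unit_fun z else 0) = a x"
  \<comment> \<open>The only factorization of x with a unit on the right uses the identity arrow at
    the source of x.\<close>
  proof (subst sum_pairs_single[OF finite_\<Gamma> x arrow_in[OF cj]])
    fix y z assume y: "y \<in> \<Gamma>" and z: "z \<in> \<Gamma>" and ne: "(y, z) \<noteq> (x, arrow (k, j, j, (id, id)))"
    obtain k1 i1 l1 P1 where y': "y = arrow (k1, i1, l1, P1)" "(k1, i1, l1, P1) \<in> coords" by (rule \<Gamma>_cases[OF y])
    obtain k2 l2 j2 P2 where z': "z = arrow (k2, l2, j2, P2)" "(k2, l2, j2, P2) \<in> coords" by (rule \<Gamma>_cases[OF z])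
    have False if m: "Gamma_mult (sym_group n) y z = Some x" and u: "unit_fun z \<noteq> 0"
    proof -
      have u': "l2 = j2" "P2 = (id, id)" using u unfolding z'(1) unit_fun_arrow[OF z'(2)] by (simp_all split: if_splits)
      have *: "k1 = k2" "l1 = l2" "arrow (k1, i1, j2, pair_comp P1 P2) = x"
        using m unfolding y'(1) z'(1) arrow_mult[OF y'(2) z'(2)] by (simp_all split: if_splits)
      have "y = x" using * u' y'(1) by (simp add: pair_comp_id)
      moreover have "(k1, i1, l1, P1) = (k, i, j, P)"
        using inj_onD[OF arrow_inj _ y'(2) x'(2)] \<open>y = x\<close> y'(1) x'(1) by simp
      ultimately show False using ne z'(1) * u' by simp
    qed
    then show "(if Gamma_mult (sym_group n) y z = Some x then a y * unit_fun z else 0) = 0" by auto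
  next
    have "Gamma_mult (sym_group n) x (arrow (k, j, j, (id, id))) = Some x"
      unfolding x'(1) arrow_mult[OF x'(2) cj] by (simp add: pair_comp_id)
    then show "(if Gamma_mult (sym_group n) x (arrow (k, j, j, (id, id))) = Some x then a x * unit_fun (arrow (k, j, j, (id, id))) else 0) = a x"
      unfolding unit_fun_arrow[OF cj] by simp
  qed
  show "(\<Sum>y\<in>\<Gamma>. \<Sum>z\<in>\<Gamma>. if Gamma_mult (sym_group n) y z = Some x then unit_fun y * a z else 0) = a x"
  proof (subst sum_pairs_single[OF finite_\<Gamma> arrow_in[OF ci] x])
    fix y z assume y: "y \<in> \<Gamma>" and z: "z \<in> \<Gamma>" and ne: "(y, z) \<noteq> (arrow (k, i, i, (id, id)), x)"
    obtain k1 i1 l1 P1 where y': "y = arrow (k1, i1, l1, P1)" "(k1, i1, l1, P1) \<in> coords" by (rule \<Gamma>_cases[OF y])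
    obtain k2 l2 j2 P2 where z': "z = arrow (k2, l2, j2, P2)" "(k2, l2, j2, P2) \<in> coords" by (rule \<Gamma>_cases[OF z])
    have False if m: "Gamma_mult (sym_group n) y z = Some x" and u: "unit_fun y \<noteq> 0"
    proof -
      have u': "i1 = l1" "P1 = (id, id)" using u unfolding y'(1) unit_fun_arrow[OF y'(2)] by (simp_all split: if_splits)
      have *: "k1 = k2" "l1 = l2" "arrow (k1, i1, j2, pair_comp P1 P2) = x"
        using m unfolding y'(1) z'(1) arrow_mult[OF y'(2) z'(2)] by (simp_all split: if_splits)
      have "z = x" using * u' z'(1) by (simp add: pair_comp_id)
      moreover have "(k2, l2, j2, P2) = (k, i, j, P)"
        using inj_onD[OF arrow_inj _ z'(2) x'(2)] \<open>z = x\<close> z'(1) x'(1) by simp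
      ultimately show False using ne y'(1) * u' by simp
    qed
    then show "(if Gamma_mult (sym_group n) y z = Some x then unit_fun y * a z else 0) = 0" by auto
  next
    have "Gamma_mult (sym_group n) (arrow (k, i, i, (id, id))) x = Some x"
      unfolding x'(1) arrow_mult[OF ci x'(2)] by (simp add: pair_comp_id)
    then show "(if Gamma_mult (sym_group n) (arrow (k, i, i, (id, id))) x = Some x then unit_fun (arrow (k, i, i, (id, id))) * a x else 0) = a x"
      unfolding unit_fun_arrow[OF ci] by simp
  qed
qed

section \<open>The isomorphism with a product of matrix algebras\<close>

abbreviation "groupoid_alg \<equiv> groupoid_algebra (sym_group n) (sym_point_stabilizer n)"
abbreviation "block_alg k \<equiv> group_algebra (sym_group k \<times>\<times> sym_group (n - k))"
abbreviation "block_algs \<equiv> product_algebra {1..n} (\<lambda>k. matrix_algebra (bsize k) (block_alg k))"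

text \<open>The restrictions and the value 0 follow the conventions of the layers: extensional
  functions for the product and the matrices, functions vanishing off the group for the group
  algebra.\<close>

definition to_blocks :: "((nat \<Rightarrow> nat) set \<times> (nat \<Rightarrow> nat) \<Rightarrow> complex) \<Rightarrow> nat \<Rightarrow> nat \<times> nat \<Rightarrow> (nat \<Rightarrow> nat) \<times> (nat \<Rightarrow> nat) \<Rightarrow> complex" where
  "to_blocks a = (\<lambda>k\<in>{1..n}. \<lambda>(i, j)\<in>{..<bsize k} \<times> {..<bsize k}. \<lambda>P. if P \<in> block_pairs n k then a (arrow (k, i, j, P)) else 0)"

definition from_blocks :: "(nat \<Rightarrow> nat \<times> nat \<Rightarrow> (nat \<Rightarrow> nat) \<times> (nat \<Rightarrow> nat) \<Rightarrow> complex) \<Rightarrow> (nat \<Rightarrow> nat) set \<times> (nat \<Rightarrow> nat) \<Rightarrow> complex" where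
  "from_blocks M x = (if x \<in> \<Gamma> then case inv_into coords arrow x of (k, i, j, P) \<Rightarrow> M k (i, j) P else 0)"

lemma to_blocks_apply:
  assumes "k \<in> {1..n}" "i < bsize k" "j < bsize k"
  shows "to_blocks a k (i, j) = (\<lambda>P. if P \<in> block_pairs n k then a (arrow (k, i, j, P)) else 0)"
  using assms by (simp add: to_blocks_def)

lemma blocks_eqI:
  assumes "\<And>k i j. k \<in> {1..n} \<Longrightarrow> i < bsize k \<Longrightarrow> j < bsize k \<Longrightarrow> f k (i, j) = g k (i, j)"
  shows "(\<lambda>k\<in>{1..n}. restrict (f k) ({..<bsize k} \<times> {..<bsize k})) = (\<lambda>k\<in>{1..n}. restrict (g k) ({..<bsize k} \<times> {..<bsize k}))"
proof (rule restrict_ext, rule restrict_ext)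
  fix k p assume k: "k \<in> {1..n}" and p: "p \<in> {..<bsize k} \<times> {..<bsize k}"
  obtain i j where ij: "p = (i, j)" by (rule prod.exhaust)
  show "f k p = g k p" unfolding ij using assms[OF k] p unfolding ij by simp
qed

lemma block_alg_carrier: "f \<in> carrier (block_alg k) \<longleftrightarrow> (\<forall>P. P \<notin> block_pairs n k \<longrightarrow> f P = 0)"
  unfolding group_algebra_def partial_object.select_convs block_group mem_Collect_eq ..

lemma block_alg_mult:
  "(f \<otimes>\<^bsub>block_alg k\<^esub> g) P = (\<Sum>(Y, Z)\<in>{(Y, Z) \<in> block_pairs n k \<times> block_pairs n k. pair_comp Y Z = P}. f Y * g Z)"
  unfolding group_algebra_def monoid.select_convs block_group ..

text \<open>Factoring an arrow amounts to choosing an intermediate vertex l and a factorization of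
  its group component; this is matrix multiplication over the group algebra.\<close>

lemma groupoid_alg_mult_arrow:
  assumes c: "(k, i, j, P) \<in> coords"
  shows "(a \<otimes>\<^bsub>groupoid_alg\<^esub> b) (arrow (k, i, j, P)) =
    (\<Sum>l<bsize k. \<Sum>(Y, Z)\<in>{(Y, Z) \<in> block_pairs n k \<times> block_pairs n k. pair_comp Y Z = P}. a (arrow (k, i, l, Y)) * b (arrow (k, l, j, Z)))"
proof -
  let ?S = "{(Y, Z) \<in> block_pairs n k \<times> block_pairs n k. pair_comp Y Z = P}"
  let ?g = "\<lambda>(l, Y, Z). (arrow (k, i, l, Y), arrow (k, l, j, Z))"
  let ?T = "{(y, z) \<in> \<Gamma> \<times> \<Gamma>. Gamma_mult (sym_group n) y z = Some (arrow (k, i, j, P))}"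
  have kij: "k \<in> {1..n}" "i < bsize k" "j < bsize k" using c by (simp_all add: coords_iff)
  have cY: "(k, i, l, Y) \<in> coords" and cZ: "(k, l, j, Z) \<in> coords" and YZ: "pair_comp Y Z = P"
    if "(l, Y, Z) \<in> {..<bsize k} \<times> ?S" for l Y Z
    using that kij by (simp_all add: coords_iff)
  have inj: "inj_on ?g ({..<bsize k} \<times> ?S)"
  proof (rule inj_onI)
    fix p q assume p: "p \<in> {..<bsize k} \<times> ?S" and q: "q \<in> {..<bsize k} \<times> ?S" and eq: "?g p = ?g q"
    obtain l Y Z where p': "p = (l, Y, Z)" by (rule prod_cases3)
    obtain l' Y' Z' where q': "q = (l', Y', Z')" by (rule prod_cases3)
    have "arrow (k, i, l, Y) = arrow (k, i, l', Y')" "arrow (k, l, j, Z) = arrow (k, l', j, Z')"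
      using eq unfolding p' q' by simp_all
    then have "(k, i, l, Y) = (k, i, l', Y')" "(k, l, j, Z) = (k, l', j, Z')"
      using inj_onD[OF arrow_inj _ cY[OF p[unfolded p']] cY[OF q[unfolded q']]]
        inj_onD[OF arrow_inj _ cZ[OF p[unfolded p']] cZ[OF q[unfolded q']]] by simp_all
    then show "p = q" unfolding p' q' by simp
  qed
  have T: "?T = ?g ` ({..<bsize k} \<times> ?S)"
  proof (rule Set.set_eqI, rule iffI)
    fix w assume w: "w \<in> ?T"
    obtain y z where yz: "w = (y, z)" by (rule prod.exhaust)
    have y: "y \<in> \<Gamma>" and z: "z \<in> \<Gamma>" and m: "Gamma_mult (sym_group n) y z = Some (arrow (k, i, j, P))"
      using w unfolding yz by simp_all
    obtain k1 i1 l1 P1 where y': "y = arrow (k1, i1, l1, P1)" "(k1, i1, l1, P1) \<in> coords" by (rule \<Gamma>_cases[OF y])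
    obtain k2 l2 j2 P2 where z': "z = arrow (k2, l2, j2, P2)" "(k2, l2, j2, P2) \<in> coords" by (rule \<Gamma>_cases[OF z])
    have *: "k1 = k2" "l1 = l2" "arrow (k1, i1, j2, pair_comp P1 P2) = arrow (k, i, j, P)"
      using m unfolding y'(1) z'(1) arrow_mult[OF y'(2) z'(2)] by (simp_all split: if_splits)
    have "(k1, i1, j2, pair_comp P1 P2) \<in> coords" using y'(2) z'(2) *(1) pair_comp_in by (simp add: coords_iff)
    then have "(k1, i1, j2, pair_comp P1 P2) = (k, i, j, P)" by (rule inj_onD[OF arrow_inj *(3) _ c])
    then have e: "k1 = k" "i1 = i" "j2 = j" "pair_comp P1 P2 = P" "k2 = k" "l2 = l1" using * by simp_all
    have "(l1, P1, P2) \<in> {..<bsize k} \<times> ?S" using y'(2) z'(2) e by (simp add: coords_iff)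
    moreover have "w = ?g (l1, P1, P2)" unfolding yz y'(1) z'(1) prod.case e ..
    ultimately show "w \<in> ?g ` ({..<bsize k} \<times> ?S)" by (rule rev_image_eqI)
  next
    fix w assume "w \<in> ?g ` ({..<bsize k} \<times> ?S)"
    then obtain q where q: "q \<in> {..<bsize k} \<times> ?S" "w = ?g q" by (rule imageE)
    obtain l Y Z where q': "q = (l, Y, Z)" by (rule prod_cases3)
    note in' = q(1)[unfolded q']
    have "w = (arrow (k, i, l, Y), arrow (k, l, j, Z))" unfolding q(2) q' by simp
    then show "w \<in> ?T"
      using arrow_in[OF cY[OF in']] arrow_in[OF cZ[OF in']] arrow_mult[OF cY[OF in'] cZ[OF in']] YZ[OF in'] by simp
  qed
  have "(a \<otimes>\<^bsub>groupoid_alg\<^esub> b) (arrow (k, i, j, P)) = (\<Sum>(y, z)\<in>?T. a y * b z)"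
    unfolding groupoid_algebra_def monoid.select_convs ..
  also have "\<dots> = (\<Sum>(l, Y, Z)\<in>{..<bsize k} \<times> ?S. a (arrow (k, i, l, Y)) * b (arrow (k, l, j, Z)))"
    unfolding T sum.reindex[OF inj] by (intro sum.cong refl) (simp add: case_prod_beta)
  also have "\<dots> = (\<Sum>l<bsize k. \<Sum>(Y, Z)\<in>?S. a (arrow (k, i, l, Y)) * b (arrow (k, l, j, Z)))"
    by (simp only: sum.cartesian_product)
  finally show ?thesis .
qed

lemma to_blocks_mult: "to_blocks (a \<otimes>\<^bsub>groupoid_alg\<^esub> b) = to_blocks a \<otimes>\<^bsub>block_algs\<^esub> to_blocks b"
proof -
  have gr: "group (sym_group k \<times>\<times> sym_group (n - k))" for k
    by (intro DirProd_group sym_group_is_group)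
  have "to_blocks a \<otimes>\<^bsub>block_algs\<^esub> to_blocks b = (\<lambda>k\<in>{1..n}. \<lambda>(i, j)\<in>{..<bsize k} \<times> {..<bsize k}.
      \<Oplus>\<^bsub>block_alg k\<^esub>l\<in>{..<bsize k}. to_blocks a k (i, l) \<otimes>\<^bsub>block_alg k\<^esub> to_blocks b k (l, j))"
    by (simp add: product_algebra_def matrix_algebra_def)
  also have "\<dots> = to_blocks (a \<otimes>\<^bsub>groupoid_alg\<^esub> b)"
    unfolding to_blocks_def[of "a \<otimes>\<^bsub>groupoid_alg\<^esub> b"]
  proof (rule blocks_eqI, unfold prod.case, rule ext)
    fix k i j P assume k: "k \<in> {1..n}" "i < bsize k" "j < bsize k"
    have fs: "(\<Oplus>\<^bsub>block_alg k\<^esub>l\<in>{..<bsize k}. to_blocks a k (i, l) \<otimes>\<^bsub>block_alg k\<^esub> to_blocks b k (l, j)) P =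
        (\<Sum>l<bsize k. (to_blocks a k (i, l) \<otimes>\<^bsub>block_alg k\<^esub> to_blocks b k (l, j)) P)"
      by (rule group_algebra_finsum[OF finite_lessThan group_algebra_mult_in[OF gr]])
    let ?S = "{(Y, Z) \<in> block_pairs n k \<times> block_pairs n k. pair_comp Y Z = P}"
    have "(\<Sum>l<bsize k. (to_blocks a k (i, l) \<otimes>\<^bsub>block_alg k\<^esub> to_blocks b k (l, j)) P) =
        (\<Sum>l<bsize k. \<Sum>(Y, Z)\<in>?S. a (arrow (k, i, l, Y)) * b (arrow (k, l, j, Z)))"
      unfolding block_alg_mult
    proof (intro sum.cong refl)
      fix l q assume l: "l \<in> {..<bsize k}" and q: "q \<in> ?S"
      obtain Y Z where YZ: "q = (Y, Z)" by (rule prod.exhaust)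
      have "Y \<in> block_pairs n k" "Z \<in> block_pairs n k" using q unfolding YZ by simp_all
      then show "(case q of (Y, Z) \<Rightarrow> to_blocks a k (i, l) Y * to_blocks b k (l, j) Z) =
          (case q of (Y, Z) \<Rightarrow> a (arrow (k, i, l, Y)) * b (arrow (k, l, j, Z)))"
        using l k by (simp add: YZ to_blocks_apply)
    qed
    also have "\<dots> = (if P \<in> block_pairs n k then (a \<otimes>\<^bsub>groupoid_alg\<^esub> b) (arrow (k, i, j, P)) else 0)"
    proof (cases "P \<in> block_pairs n k")
      case True
      then have c: "(k, i, j, P) \<in> coords" using k by (simp add: coords_iff)
      show ?thesis unfolding if_P[OF True] groupoid_alg_mult_arrow[OF c] ..
    next
      case False
      then have emp: "?S = {}" using pair_comp_in by blast
      show ?thesis unfolding emp if_not_P[OF False] by simp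
    qed
    finally show "(\<Oplus>\<^bsub>block_alg k\<^esub>l\<in>{..<bsize k}. to_blocks a k (i, l) \<otimes>\<^bsub>block_alg k\<^esub> to_blocks b k (l, j)) P =
        (if P \<in> block_pairs n k then (a \<otimes>\<^bsub>groupoid_alg\<^esub> b) (arrow (k, i, j, P)) else 0)" unfolding fs .
  qed
  finally show ?thesis ..
qed

lemma to_blocks_add: "to_blocks (a \<oplus>\<^bsub>groupoid_alg\<^esub> b) = to_blocks a \<oplus>\<^bsub>block_algs\<^esub> to_blocks b"
proof -
  have "to_blocks a \<oplus>\<^bsub>block_algs\<^esub> to_blocks b = (\<lambda>k\<in>{1..n}. \<lambda>(i, j)\<in>{..<bsize k} \<times> {..<bsize k}.
      to_blocks a k (i, j) \<oplus>\<^bsub>block_alg k\<^esub> to_blocks b k (i, j))"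
    by (simp add: product_algebra_def matrix_algebra_def)
  also have "\<dots> = to_blocks (a \<oplus>\<^bsub>groupoid_alg\<^esub> b)"
    unfolding to_blocks_def[of "a \<oplus>\<^bsub>groupoid_alg\<^esub> b"]
    by (rule blocks_eqI) (simp add: to_blocks_apply group_algebra_def groupoid_algebra_def fun_eq_iff)
  finally show ?thesis ..
qed

lemma to_blocks_one: "to_blocks \<one>\<^bsub>groupoid_alg\<^esub> = \<one>\<^bsub>block_algs\<^esub>"
proof -
  have "\<one>\<^bsub>block_algs\<^esub> = (\<lambda>k\<in>{1..n}. \<lambda>(i, j)\<in>{..<bsize k} \<times> {..<bsize k}. if i = j then \<one>\<^bsub>block_alg k\<^esub> else \<zero>\<^bsub>block_alg k\<^esub>)"
    by (simp add: product_algebra_def matrix_algebra_def)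
  also have "\<dots> = to_blocks \<one>\<^bsub>groupoid_alg\<^esub>"
    unfolding to_blocks_def
  proof (rule blocks_eqI, unfold prod.case, rule ext)
    fix k i j P assume k: "k \<in> {1..n}" "i < bsize k" "j < bsize k"
    have o: "\<one>\<^bsub>groupoid_alg\<^esub> = unit_fun" by (simp add: groupoid_algebra_eq conv_alg_def)
    have b: "\<one>\<^bsub>block_alg k\<^esub> P = (if P = (id, id) then 1 else 0)" "\<zero>\<^bsub>block_alg k\<^esub> P = 0"
      unfolding group_algebra_def monoid.select_convs ring.select_convs block_group by (rule refl)+
    show "(if i = j then \<one>\<^bsub>block_alg k\<^esub> else \<zero>\<^bsub>block_alg k\<^esub>) P =
        (if P \<in> block_pairs n k then \<one>\<^bsub>groupoid_alg\<^esub> (arrow (k, i, j, P)) else 0)"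
    proof (cases "P \<in> block_pairs n k")
      case True
      then have c: "(k, i, j, P) \<in> coords" using k by (simp add: coords_iff)
      show ?thesis unfolding if_P[OF True] o unit_fun_arrow[OF c]
        by (cases "i = j") (simp_all only: if_True if_False b simp_thms)
    next
      case False
      then have "P \<noteq> (id, id)" using pair_id_in by blast
      then show ?thesis unfolding if_not_P[OF False] by (cases "i = j") (simp_all only: if_True if_False b simp_thms)
    qed
  qed
  finally show ?thesis ..
qed

lemma to_blocks_zero: "to_blocks \<zero>\<^bsub>groupoid_alg\<^esub> = \<zero>\<^bsub>block_algs\<^esub>"
proof -
  have "\<zero>\<^bsub>block_algs\<^esub> = (\<lambda>k\<in>{1..n}. \<lambda>(i, j)\<in>{..<bsize k} \<times> {..<bsize k}. \<zero>\<^bsub>block_alg k\<^esub>)"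
    by (simp add: product_algebra_def matrix_algebra_def)
  also have "\<dots> = to_blocks \<zero>\<^bsub>groupoid_alg\<^esub>"
    unfolding to_blocks_def by (rule blocks_eqI) (simp add: group_algebra_def groupoid_algebra_def fun_eq_iff)
  finally show ?thesis ..
qed

lemma to_blocks_smult: "to_blocks (c \<odot>\<^bsub>groupoid_alg\<^esub> a) = c \<odot>\<^bsub>block_algs\<^esub> to_blocks a"
proof -
  have "c \<odot>\<^bsub>block_algs\<^esub> to_blocks a = (\<lambda>k\<in>{1..n}. \<lambda>(i, j)\<in>{..<bsize k} \<times> {..<bsize k}. c \<odot>\<^bsub>block_alg k\<^esub> to_blocks a k (i, j))"
    by (simp add: product_algebra_def matrix_algebra_def)
  also have "\<dots> = to_blocks (c \<odot>\<^bsub>groupoid_alg\<^esub> a)"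
    unfolding to_blocks_def[of "c \<odot>\<^bsub>groupoid_alg\<^esub> a"]
    by (rule blocks_eqI) (simp add: to_blocks_apply group_algebra_def groupoid_algebra_def fun_eq_iff)
  finally show ?thesis ..
qed

lemma block_algs_carrier: "carrier block_algs = (\<Pi>\<^sub>E k\<in>{1..n}. {..<bsize k} \<times> {..<bsize k} \<rightarrow>\<^sub>E carrier (block_alg k))"
  by (simp add: product_algebra_def matrix_algebra_def)

lemma to_blocks_in: "to_blocks a \<in> carrier block_algs"
  unfolding block_algs_carrier to_blocks_def
proof (rule restrict_PiE_iff[THEN iffD2], rule ballI, rule restrict_PiE_iff[THEN iffD2], rule ballI)
  fix k :: nat and p :: "nat \<times> nat"
  obtain i j where p: "p = (i, j)" by (rule prod.exhaust)
  show "(case p of (i, j) \<Rightarrow> \<lambda>P. if P \<in> block_pairs n k then a (arrow (k, i, j, P)) else 0) \<in> carrier (block_alg k)"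
    unfolding p prod.case block_alg_carrier by simp
qed

lemma from_to_blocks:
  assumes "a \<in> carrier groupoid_alg"
  shows "from_blocks (to_blocks a) = a"
proof
  fix x
  show "from_blocks (to_blocks a) x = a x"
  proof (cases "x \<in> \<Gamma>")
    case True
    obtain k i j P where x: "x = arrow (k, i, j, P)" "(k, i, j, P) \<in> coords" by (rule \<Gamma>_cases[OF True])
    have i: "inv_into coords arrow x = (k, i, j, P)" unfolding x(1) by (rule inv_into_f_f[OF arrow_inj x(2)])
    have "k \<in> {1..n}" "i < bsize k" "j < bsize k" "P \<in> block_pairs n k" using x(2) by (simp_all add: coords_iff)
    then show ?thesis unfolding from_blocks_def if_P[OF True] i prod.case by (simp add: to_blocks_apply x(1))
  next
    case False
    have "\<forall>x. x \<notin> \<Gamma> \<longrightarrow> a x = 0" using assms unfolding groupoid_algebra_def partial_object.select_convs mem_Collect_eq .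
    then show ?thesis unfolding from_blocks_def if_not_P[OF False] using False by (simp only: simp_thms)
  qed
qed

lemma to_from_blocks:
  assumes M: "M \<in> carrier block_algs"
  shows "to_blocks (from_blocks M) = M"
proof (rule PiE_ext[OF to_blocks_in[unfolded block_algs_carrier] M[unfolded block_algs_carrier]])
  fix k assume k: "k \<in> {1..n}"
  have M': "M k \<in> {..<bsize k} \<times> {..<bsize k} \<rightarrow>\<^sub>E carrier (block_alg k)"
    by (rule PiE_mem[OF M[unfolded block_algs_carrier] k])
  show "to_blocks (from_blocks M) k = M k"
  proof (rule PiE_ext[OF PiE_mem[OF to_blocks_in[unfolded block_algs_carrier] k] M'])
    fix p assume p: "p \<in> {..<bsize k} \<times> {..<bsize k}"
    obtain i j where ij: "p = (i, j)" by (rule prod.exhaust)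
    have ij': "i < bsize k" "j < bsize k" using p unfolding ij by simp_all
    have Mp: "\<forall>P. P \<notin> block_pairs n k \<longrightarrow> M k (i, j) P = 0"
      using PiE_mem[OF M' p] unfolding ij block_alg_carrier .
    show "to_blocks (from_blocks M) k p = M k p"
      unfolding ij to_blocks_apply[OF k ij']
    proof
      fix P
      show "(if P \<in> block_pairs n k then from_blocks M (arrow (k, i, j, P)) else 0) = M k (i, j) P"
      proof (cases "P \<in> block_pairs n k")
        case True
        then have c: "(k, i, j, P) \<in> coords" using k ij' by (simp add: coords_iff)
        show ?thesis
          unfolding if_P[OF True] from_blocks_def if_P[OF arrow_in[OF c]] inv_into_f_f[OF arrow_inj c] prod.case ..
      next
        case False
        then show ?thesis unfolding if_not_P[OF False] using Mp by (simp only: simp_thms)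
      qed
    qed
  qed
qed

lemma to_blocks_iso: "to_blocks \<in> ring_iso groupoid_alg block_algs"
  unfolding ring_iso_def mem_Collect_eq
proof
  show "to_blocks \<in> ring_hom groupoid_alg block_algs"
    by (intro ring_hom_memI to_blocks_in to_blocks_mult to_blocks_add to_blocks_one)
  have "from_blocks M \<in> carrier groupoid_alg" for M
    by (simp add: groupoid_algebra_def from_blocks_def)
  then show "bij_betw to_blocks (carrier groupoid_alg) (carrier block_algs)"
    using from_to_blocks to_from_blocks to_blocks_in
    by (intro bij_betw_byWitness[where f' = from_blocks] ballI image_subsetI)
qed

lemma groupoid_algebra_isomorphic: "algebra_isomorphic groupoid_alg block_algs"
proof -
  have A: "complex_algebra groupoid_alg" unfolding groupoid_algebra_eq by (rule conv_data.complex_algebra[OF conv])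
  have "complex_algebra block_algs"
  proof (rule complex_algebra_transport)
    show "complex_algebra groupoid_alg" by (rule A)
    show "to_blocks \<in> ring_iso groupoid_alg block_algs" by (rule to_blocks_iso)
    show "to_blocks \<zero>\<^bsub>groupoid_alg\<^esub> = \<zero>\<^bsub>block_algs\<^esub>" by (rule to_blocks_zero)
  qed (rule to_blocks_smult)
  then show ?thesis unfolding algebra_isomorphic_def using A to_blocks_iso to_blocks_smult by blast
qed

end

lemma groupoid_algebra_sym_group:
  fixes n :: nat
  assumes n: "1 \<le> n"
  shows "algebra_isomorphic (groupoid_algebra (sym_group n) (sym_point_stabilizer n))
    (product_algebra {1..n} (\<lambda>k. matrix_algebra ((n - 1) choose (k - 1)) (group_algebra (sym_group k \<times>\<times> sym_group (n - k)))))"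
proof -
  have "\<exists>f. bij_betw f {..<(n - 1) choose (k - 1)} {A. A \<subseteq> {1..n} \<and> 1 \<in> A \<and> card A = k}" if "k \<in> {1..n}" for k
  proof -
    have "finite {A. A \<subseteq> {1..n} \<and> 1 \<in> A \<and> card A = k}" by (rule finite_subset[of _ "Pow {1..n}"]) auto
    then show ?thesis
      using card_subsets_containing_1[of n k] that n by (intro finite_same_card_bij) simp_all
  qed
  then obtain e where e: "\<And>k. k \<in> {1..n} \<Longrightarrow> bij_betw (e k) {..<(n - 1) choose (k - 1)} {A. A \<subseteq> {1..n} \<and> 1 \<in> A \<and> card A = k}"
    by metis
  have "\<exists>x. x permutes {1..n} \<and> x ` {1..card A} = A" if "A \<subseteq> {1..n}" for A
    using exists_permutation_image[OF _ that refl] card_mono[OF _ that] by simp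
  then obtain s where "\<And>A. A \<subseteq> {1..n} \<Longrightarrow> s A permutes {1..n} \<and> s A ` {1..card A} = A" by metis
  then interpret block_coordinates n e s using n e by unfold_locales blast+
  show ?thesis by (rule groupoid_algebra_isomorphic)
qed

theorem mainTheorem10:
  fixes n :: nat
  assumes "n \<ge> 1"
  shows
    "algebra_isomorphic
       (groupoid_algebra (sym_group n) (sym_point_stabilizer n))
       (product_algebra {1..n} (\<lambda>k.
          matrix_algebra ((n - 1) choose (k - 1)) (group_algebra (sym_group k \<times>\<times> sym_group (n - k)))))
     \<and> (\<forall>k\<in>{1..n}. \<forall>\<nu>\<in>partitions k. \<forall>\<mu>\<in>partitions (n - k).
          global_partial_representation (sym_group n) (sym_point_stabilizer n) (V_pair n k \<nu> \<mu>) \<and>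
          rep_irreducible (sym_group n) (V_pair n k \<nu> \<mu>) \<and>
          rdim (V_pair n k \<nu> \<mu>) = ((n - 1) choose (k - 1)) * num_SYT \<nu> * num_SYT \<mu>)
     \<and> (\<forall>k\<in>{1..n}. \<forall>\<nu>\<in>partitions k. \<forall>\<mu>\<in>partitions (n - k).
        \<forall>k'\<in>{1..n}. \<forall>\<nu>'\<in>partitions k'. \<forall>\<mu>'\<in>partitions (n - k').
          rep_isomorphic (sym_group n) (V_pair n k \<nu> \<mu>) (V_pair n k' \<nu>' \<mu>') \<longrightarrow>
          (k, \<nu>, \<mu>) = (k', \<nu>', \<mu>'))
     \<and> (\<forall>R :: (nat \<Rightarrow> nat, 'v::ab_group_add) rep.
          global_partial_representation (sym_group n) (sym_point_stabilizer n) R \<and>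
          rep_irreducible (sym_group n) R \<longrightarrow>
          (\<exists>k\<in>{1..n}. \<exists>\<nu>\<in>partitions k. \<exists>\<mu>\<in>partitions (n - k).
             rep_isomorphic (sym_group n) R (V_pair n k \<nu> \<mu>)))"
proof (intro conjI ballI impI allI)
  have n: "1 \<le> n" by (rule assms)
  show "algebra_isomorphic (groupoid_algebra (sym_group n) (sym_point_stabilizer n))
      (product_algebra {1..n} (\<lambda>k. matrix_algebra ((n - 1) choose (k - 1)) (group_algebra (sym_group k \<times>\<times> sym_group (n - k)))))"
    by (rule groupoid_algebra_sym_group[OF n])
  {
    fix k \<nu> \<mu> assume k: "k \<in> {1..n}" and \<nu>: "\<nu> \<in> partitions k" and \<mu>: "\<mu> \<in> partitions (n - k)"
    interpret partition_pair n k \<nu> \<mu> by unfold_locales (rule k, rule \<nu>, rule \<mu>)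
    have i: "(k, \<nu>, \<mu>) \<in> pair_index n" using k \<nu> \<mu> by (simp add: pair_index_def)
    show "global_partial_representation (sym_group n) (sym_point_stabilizer n) (V_pair n k \<nu> \<mu>)" by (rule global)
    show "rep_irreducible (sym_group n) (V_pair n k \<nu> \<mu>)" by (rule rep_irreducible)
    show "rdim (V_pair n k \<nu> \<mu>) = ((n - 1) choose (k - 1)) * num_SYT \<nu> * num_SYT \<mu>"
      using rdim_V_pair[OF n i] unfolding pair_rep_def pair_dim_def prod.case .
    fix k' \<nu>' \<mu>' assume k': "k' \<in> {1..n}" and \<nu>': "\<nu>' \<in> partitions k'" and \<mu>': "\<mu>' \<in> partitions (n - k')"
      and iso: "rep_isomorphic (sym_group n) (V_pair n k \<nu> \<mu>) (V_pair n k' \<nu>' \<mu>')"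
    have j: "(k', \<nu>', \<mu>') \<in> pair_index n" using k' \<nu>' \<mu>' by (simp add: pair_index_def)
    show "(k, \<nu>, \<mu>) = (k', \<nu>', \<mu>')"
      by (rule pair_rep_not_isomorphic[OF n i j]) (simp only: pair_rep_def prod.case iso)
  }
  fix R :: "(nat \<Rightarrow> nat, 'v) rep"
  assume "global_partial_representation (sym_group n) (sym_point_stabilizer n) R \<and> rep_irreducible (sym_group n) R"
  then obtain i where i: "i \<in> pair_index n" "rep_isomorphic (sym_group n) R (pair_rep n i)"
    using pair_rep_complete[OF n] by blast
  obtain k \<nu> \<mu> where e: "i = (k, \<nu>, \<mu>)" by (rule prod_cases3)
  show "\<exists>k\<in>{1..n}. \<exists>\<nu>\<in>partitions k. \<exists>\<mu>\<in>partitions (n - k). rep_isomorphic (sym_group n) R (V_pair n k \<nu> \<mu>)"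
    using i unfolding e pair_index_def pair_rep_def prod.case by blast
qed

end
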